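(* Let $K$ be a commutative ring, $\delta,\delta_L,\delta_R,\kappa_L,\kappa_R,\kappa_{LR}\in K$, and $m$ a positive integer. The set $B^x_m$ is a $K$-basis for the symplectic blob algebra $b^x_m(\delta,\delta_L,\delta_R,\kappa_L,\kappa_R,\kappa_{LR})$.
   Context: Take a rectangle with vertices $1,\dots,m$ (left to right) on its northern edge and $1',\dots,m'$ on its southern edge. A left-right blob pseudodiagram is a planar picture, up to isotopy, of pairwise disjoint lines inside the rectangle joining the $2m$ vertices in pairs, together with finitely many disjoint closed loops, and finitely many marked points (blobs) on lines and loops, each labelled $L$ or $R$, such that all blobs can simultaneously be deformed to the appropriate edge: there are pairwise disjoint arcs, one from each $L$-blob to the western edge and one from each $R$-blob to the eastern edge, meeting the lines and loops only at that blob. A line $\{a,b\}$ has a word in $L,R$ (written as a subscript) read along the line, from the smaller number to the larger if both ends are on the same edge, and from the northern to the southern end otherwise. $B^{x'}_m$ is the set of such pseudodiagrams with no closed loops and with each line carrying one of the words $\emptyset,L,R,LR,RL$. The algebra $b^{x'}_m(\delta,\delta_L,\delta_R,\kappa_L,\kappa_R,\kappa_{LR})$ has $K$-basis $B^{x'}_m$; the product $d_1d_2$ is computed by stacking $d_1$ above $d_2$ and reducing the resulting pseudodiagram to a scalar multiple of an element of $B^{x'}_m$ by: $LL\to\delta_L L$, $RR\to\delta_R R$, $LRL\to\kappa_{LR}L$, $RLR\to\kappa_{LR}R$ for consecutive blobs on the same line (and likewise $LL$, $RR$ on loops); an undecorated loop is replaced by the factor $\delta$, a loop with a single $L$ by $\kappa_L$,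 with a single $R$ by $\kappa_R$, and with one $L$ and one $R$ by $\kappa_{LR}$. The symplectic blob algebra $b^x_m$ is the quotient of $b^{x'}_m$ by the topological relations: whenever $d\in B^{x'}_m$ contains pairs $\{i,j\}_{LR}$ and $\{r',s'\}_{LR}$ with $i<j$, $r<s$ (two doubly decorated lines, one with both ends on the northern and one with both ends on the southern edge; such $d$ has no line joining the northern to the southern edge), one imposes $d=\kappa_{LR}\,\bar d$, where $\bar d$ is obtained from $d$ by replacing these two pairs by $\{i,r'\}_L$ and $\{j,s'\}_R$, leaving all other lines and decorations unchanged. $B^x_m$ is the subset of $B^{x'}_m$ obtained by discarding all such $d$ (i.e. all diagrams with two doubly decorated lines $\{i,j\}_{LR}$, $\{r',s'\}_{LR}$). *)

theory Defs
  imports Complex_Main "HOL-Algebra.QuotRing" "HOL-Algebra.Module"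
begin

section \<open>Left-right blob diagrams\<close>

datatype blob = BL | BR

datatype vertex = North nat | South nat

text \<open>
  A picture is recorded by its isotopy invariants: the endpoints of its lines, and the word of
  each line. The triple \<open>(a, w, b)\<close> is the line joining \<open>a\<close> and \<open>b\<close> with word \<open>w\<close> read from \<open>a\<close>
  to \<open>b\<close>. Every line is stored once, with \<open>precedes a b\<close>: the reading direction is then from the
  smaller number to the larger for ends on the same edge, and from north to south otherwise.
\<close>

type_synonym line = "vertex \<times> blob list \<times> vertex"
type_synonym diagram = "line set"

fun precedes :: "vertex \<Rightarrow> vertex \<Rightarrow> bool" where
  "precedes (North i) (North j) \<longleftrightarrow> i < j"
| "precedes (North i) (South j) \<longleftrightarrow> True"
| "precedes (South i) (North j) \<longleftrightarrow> False"
| "precedes (South i) (South j) \<longleftrightarrow> i < j"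

definition vertices :: "nat \<Rightarrow> vertex set" where
  "vertices m = North ` {1..m} \<union> South ` {1..m}"

fun line_word :: "line \<Rightarrow> blob list" where
  "line_word (a, w, b) = w"

fun line_ends :: "line \<Rightarrow> vertex set" where
  "line_ends (a, w, b) = {a, b}"

definition pairs_vertices :: "nat \<Rightarrow> diagram \<Rightarrow> bool" where
  "pairs_vertices m d \<longleftrightarrow>
     (\<forall>(a, w, b) \<in> d. a \<in> vertices m \<and> b \<in> vertices m \<and> precedes a b) \<and>
     (\<forall>v \<in> vertices m. \<exists>!l. l \<in> d \<and> v \<in> line_ends l)"

text \<open>
  The boundary of the rectangle is parametrised clockwise, starting at the north-western corner:
  the northern vertices \<open>1, \<dots>, m\<close> come first, then the eastern edge, then the southern vertices
  from \<open>m'\<close> down to \<open>1'\<close>, and finally the western edge.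
\<close>

fun position :: "nat \<Rightarrow> vertex \<Rightarrow> real" where
  "position m (North i) = real i"
| "position m (South i) = 2 * real m + 1 - real i"

fun blob_edge :: "nat \<Rightarrow> blob \<Rightarrow> real set" where
  "blob_edge m BR = {real m <..< real m + 1}"
| "blob_edge m BL = {2 * real m <..< 2 * real m + 1}"

text \<open>
  Two pairs of distinct boundary points can be joined by disjoint curves in the rectangle unless
  the pairs separate each other.
\<close>

definition crossing :: "real \<Rightarrow> real \<Rightarrow> real \<Rightarrow> real \<Rightarrow> bool" where
  "crossing x y u v \<longleftrightarrow>
     (u \<in> {min x y <..< max x y}) \<noteq> (v \<in> {min x y <..< max x y})"

text \<open>
  Disjoint arcs from the blobs to the edges turn every line into a tree: a spine with one leg for
  each of its blobs. The point \<open>\<phi> l k\<close> is where the arc from blob number \<open>k\<close> of the line \<open>l\<close>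
  ends; the ends of \<open>l\<close> and of its arcs are the leaves of the tree of \<open>l\<close>.
\<close>

definition leaves :: "nat \<Rightarrow> (line \<Rightarrow> nat \<Rightarrow> real) \<Rightarrow> line \<Rightarrow> real set" where
  "leaves m \<phi> l = position m ` line_ends l \<union> \<phi> l ` {..<length (line_word l)}"

text \<open>
  Such trees can be drawn disjointly if and only if the conditions on \<open>\<phi>\<close> below hold. The third
  one makes each single tree planar: for \<open>k < k'\<close>, the part of the tree from the first end of the
  line to the end of arc \<open>k\<close> is disjoint from the part from the end of arc \<open>k'\<close> to the last end
  of the line. (Equivalently, the arcs leaving the line on a given side arrive on the boundary in
  the order of their blobs.) The last one keeps the trees of different lines apart; in particular
  it forbids crossings of the lines themselves.
\<close>

definition deformable :: "nat \<Rightarrow> diagram \<Rightarrow> bool" where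
  "deformable m d \<longleftrightarrow>
     (\<exists>\<phi> :: line \<Rightarrow> nat \<Rightarrow> real.
        (\<forall>l \<in> d. \<forall>k < length (line_word l). \<phi> l k \<in> blob_edge m (line_word l ! k)) \<and>
        inj_on (\<lambda>(l, k). \<phi> l k) (SIGMA l:d. {..<length (line_word l)}) \<and>
        (\<forall>(a, w, b) \<in> d. \<forall>k k'. k < k' \<and> k' < length w \<longrightarrow>
           \<not> crossing (position m a) (\<phi> (a, w, b) k) (\<phi> (a, w, b) k') (position m b)) \<and>
        (\<forall>l \<in> d. \<forall>l' \<in> d. l \<noteq> l' \<longrightarrow>
           (\<forall>x \<in> leaves m \<phi> l. \<forall>y \<in> leaves m \<phi> l. \<forall>u \<in> leaves m \<phi> l'. \<forall>v \<in> leaves m \<phi> l'.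
              \<not> crossing x y u v)))"

definition loopless_pseudodiagrams :: "nat \<Rightarrow> diagram set" where
  "loopless_pseudodiagrams m = {d. pairs_vertices m d \<and> deformable m d}"

definition line_words :: "blob list set" where
  "line_words = {[], [BL], [BR], [BL, BR], [BR, BL]}"

text \<open>The set $B^{x'}_m$.\<close>

definition blob_diagrams :: "nat \<Rightarrow> diagram set" where
  "blob_diagrams m =
     {d \<in> loopless_pseudodiagrams m. \<forall>l \<in> d. line_word l \<in> line_words}"

definition identity_diagram :: "nat \<Rightarrow> diagram" where
  "identity_diagram m = (\<lambda>i. (North i, [], South i)) ` {1..m}"

text \<open>
  The diagrams to which a topological relation applies, and the diagram $\bar d$ (for which
  \<open>{i, r'}\<close> is decorated by $L$ and \<open>{j, s'}\<close> by $R$).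
\<close>

definition has_double_pair :: "diagram \<Rightarrow> nat \<Rightarrow> nat \<Rightarrow> nat \<Rightarrow> nat \<Rightarrow> bool" where
  "has_double_pair d i j r s \<longleftrightarrow>
     i < j \<and> r < s \<and> (North i, [BL, BR], North j) \<in> d \<and> (South r, [BL, BR], South s) \<in> d"

definition reconnect :: "diagram \<Rightarrow> nat \<Rightarrow> nat \<Rightarrow> nat \<Rightarrow> nat \<Rightarrow> diagram" where
  "reconnect d i j r s =
     (d - {(North i, [BL, BR], North j), (South r, [BL, BR], South s)}) \<union>
     {(North i, [BL], South r), (North j, [BR], South s)}"

text \<open>The set $B^x_m$.\<close>

definition symplectic_blob_diagrams :: "nat \<Rightarrow> diagram set" where
  "symplectic_blob_diagrams m =
     {d \<in> blob_diagrams m. \<not> (\<exists>i j r s. has_double_pair d i j r s)}"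


section \<open>Stacking\<close>

text \<open>
  When \<open>d\<^sub>1\<close> is stacked above \<open>d\<^sub>2\<close>, the southern vertices of \<open>d\<^sub>1\<close> are identified with the northern
  vertices of \<open>d\<^sub>2\<close>.
\<close>

datatype half = Upper | Lower

datatype spot = Top nat | Mid nat | Bot nat

fun upper_spot :: "vertex \<Rightarrow> spot" where
  "upper_spot (North i) = Top i"
| "upper_spot (South i) = Mid i"

fun lower_spot :: "vertex \<Rightarrow> spot" where
  "lower_spot (North i) = Mid i"
| "lower_spot (South i) = Bot i"

fun outer_spot :: "vertex \<Rightarrow> spot" where
  "outer_spot (North i) = Top i"
| "outer_spot (South i) = Bot i"

text \<open>Each line of the two diagrams, traversed in either direction.\<close>

definition segments :: "diagram \<Rightarrow> diagram \<Rightarrow> (half \<times> spot \<times> blob list \<times> spot) set" where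
  "segments d\<^sub>1 d\<^sub>2 =
     {(Upper, upper_spot a, w, upper_spot b) | a w b. (a, w, b) \<in> d\<^sub>1 \<or> (b, rev w, a) \<in> d\<^sub>1} \<union>
     {(Lower, lower_spot a, w, lower_spot b) | a w b. (a, w, b) \<in> d\<^sub>2 \<or> (b, rev w, a) \<in> d\<^sub>2}"

text \<open>
  \<open>walk d\<^sub>1 d\<^sub>2 h x w js h' y\<close>: a curve in the stacked picture from \<open>x\<close> to \<open>y\<close> with word \<open>w\<close>, whose
  first segment lies in the half \<open>h\<close> and whose last one lies in the half \<open>h'\<close>, and which passes
  through the identified vertices \<open>js\<close> in between.
\<close>

inductive walk ::
    "diagram \<Rightarrow> diagram \<Rightarrow> half \<Rightarrow> spot \<Rightarrow> blob list \<Rightarrow> nat list \<Rightarrow> half \<Rightarrow> spot \<Rightarrow> bool"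
  for d\<^sub>1 d\<^sub>2 where
  single: "(h, x, w, y) \<in> segments d\<^sub>1 d\<^sub>2 \<Longrightarrow> walk d\<^sub>1 d\<^sub>2 h x w [] h y"
| extend: "(h, x, w, Mid i) \<in> segments d\<^sub>1 d\<^sub>2 \<Longrightarrow> h' \<noteq> h \<Longrightarrow>
    walk d\<^sub>1 d\<^sub>2 h' (Mid i) w' js h'' y \<Longrightarrow> walk d\<^sub>1 d\<^sub>2 h x (w @ w') (i # js) h'' y"

definition stack_lines :: "diagram \<Rightarrow> diagram \<Rightarrow> diagram" where
  "stack_lines d\<^sub>1 d\<^sub>2 =
     {(a, w, b). precedes a b \<and>
        (\<exists>h js h'. walk d\<^sub>1 d\<^sub>2 h (outer_spot a) w js h' (outer_spot b))}"

text \<open>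
  A loop meets the identified vertices. To list each loop once, it is cut open at the smallest
  such vertex \<open>i\<close> and traversed from there through the upper diagram; the condition on \<open>js\<close> also
  makes the walk stop at its first return to \<open>i\<close>. The word of a loop is only meaningful up to
  rotation and reversal.
\<close>

definition stack_loops :: "diagram \<Rightarrow> diagram \<Rightarrow> (nat \<times> blob list) set" where
  "stack_loops d\<^sub>1 d\<^sub>2 =
     {(i, w). \<exists>js. walk d\<^sub>1 d\<^sub>2 Upper (Mid i) w js Lower (Mid i) \<and> (\<forall>j \<in> set js. i < j)}"


section \<open>Reduction of words, and the algebras\<close>

text \<open>The two-sided ideal generated by \<open>S\<close> in an algebra \<open>A\<close> over \<open>K\<close>.\<close>

definition algebra_ideal ::
    "('k, 'b) ring_scheme \<Rightarrow> ('k, 'a, 'c) module_scheme \<Rightarrow> 'a set \<Rightarrow> 'a set" where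
  "algebra_ideal K A S =
     \<Inter> {I. submodule I K A \<and> S \<subseteq> I \<and>
          (\<forall>a \<in> carrier A. \<forall>x \<in> I. a \<otimes>\<^bsub>A\<^esub> x \<in> I \<and> x \<otimes>\<^bsub>A\<^esub> a \<in> I)}"

definition quotient_algebra ::
    "('k, 'a, 'c) module_scheme \<Rightarrow> 'a set \<Rightarrow> ('k, 'a set) module" where
  "quotient_algebra A I =
     ring.extend (A Quot I) (module.fields (\<lambda>k X. \<Union>x\<in>X. I +>\<^bsub>A\<^esub> (k \<odot>\<^bsub>A\<^esub> x)))"

text \<open>The family \<open>(v s)\<^bsub>s \<in> S\<^esub>\<close> is a basis of the \<open>K\<close>-module \<open>M\<close>.\<close>

definition module_basis ::
    "('k, 'b) ring_scheme \<Rightarrow> ('k, 'a, 'c) module_scheme \<Rightarrow> 's set \<Rightarrow> ('s \<Rightarrow> 'a) \<Rightarrow> bool" where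
  "module_basis K M S v \<longleftrightarrow>
     v \<in> S \<rightarrow> carrier M \<and>
     (\<forall>x \<in> carrier M. \<exists>F c. finite F \<and> F \<subseteq> S \<and> c \<in> F \<rightarrow> carrier K \<and>
        x = (\<Oplus>\<^bsub>M\<^esub>s\<in>F. c s \<odot>\<^bsub>M\<^esub> v s)) \<and>
     (\<forall>F c. finite F \<and> F \<subseteq> S \<and> c \<in> F \<rightarrow> carrier K \<and>
        (\<Oplus>\<^bsub>M\<^esub>s\<in>F. c s \<odot>\<^bsub>M\<^esub> v s) = \<zero>\<^bsub>M\<^esub> \<longrightarrow> (\<forall>s \<in> F. c s = \<zero>\<^bsub>K\<^esub>))"

locale blob_parameters = cring K for K (structure) +
  fixes \<delta> \<delta>L \<delta>R \<kappa>L \<kappa>R \<kappa>LR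
  assumes parameters_closed [simp, intro]:
    "\<delta> \<in> carrier K" "\<delta>L \<in> carrier K" "\<delta>R \<in> carrier K"
    "\<kappa>L \<in> carrier K" "\<kappa>R \<in> carrier K" "\<kappa>LR \<in> carrier K"
begin

text \<open>\<open>word_reduces w c x\<close>: a line with word \<open>w\<close> reduces to \<open>c\<close> times the line with word \<open>x\<close>.\<close>

inductive word_reduces :: "blob list \<Rightarrow> 'a \<Rightarrow> blob list \<Rightarrow> bool" where
  reduced: "x \<in> line_words \<Longrightarrow> word_reduces x \<one> x"
| LL: "word_reduces (u @ [BL] @ v) c x \<Longrightarrow> word_reduces (u @ [BL, BL] @ v) (\<delta>L \<otimes> c) x"
| RR: "word_reduces (u @ [BR] @ v) c x \<Longrightarrow> word_reduces (u @ [BR, BR] @ v) (\<delta>R \<otimes> c) x"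
| LRL: "word_reduces (u @ [BL] @ v) c x \<Longrightarrow> word_reduces (u @ [BL, BR, BL] @ v) (\<kappa>LR \<otimes> c) x"
| RLR: "word_reduces (u @ [BR] @ v) c x \<Longrightarrow> word_reduces (u @ [BR, BL, BR] @ v) (\<kappa>LR \<otimes> c) x"

definition reduced_word :: "blob list \<Rightarrow> 'a \<times> blob list" where
  "reduced_word w = (THE (c, x). word_reduces w c x)"

text \<open>
  \<open>loop_reduces w c\<close>: a loop with cyclic word \<open>w\<close> reduces to the factor \<open>c\<close>. On a loop whose blobs
  can be deformed to the edges, the cyclic word consists of at most one run of $L$ and one run
  of $R$, so these rules suffice.
\<close>

inductive loop_reduces :: "blob list \<Rightarrow> 'a \<Rightarrow> bool" where
  undecorated: "loop_reduces [] \<delta>"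
| L: "loop_reduces [BL] \<kappa>L"
| R: "loop_reduces [BR] \<kappa>R"
| LR: "loop_reduces [BL, BR] \<kappa>LR"
| LL: "loop_reduces (BL # w) c \<Longrightarrow> loop_reduces (BL # BL # w) (\<delta>L \<otimes> c)"
| RR: "loop_reduces (BR # w) c \<Longrightarrow> loop_reduces (BR # BR # w) (\<delta>R \<otimes> c)"
| rotate: "loop_reduces (rotate1 w) c \<Longrightarrow> loop_reduces w c"

definition loop_factor :: "blob list \<Rightarrow> 'a" where
  "loop_factor w = (THE c. loop_reduces w c)"

definition product_diagram :: "diagram \<Rightarrow> diagram \<Rightarrow> diagram" where
  "product_diagram d\<^sub>1 d\<^sub>2 =
     (\<lambda>(a, w, b). (a, snd (reduced_word w), b)) ` stack_lines d\<^sub>1 d\<^sub>2"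

definition product_factor :: "diagram \<Rightarrow> diagram \<Rightarrow> 'a" where
  "product_factor d\<^sub>1 d\<^sub>2 =
     (\<Otimes>l\<in>stack_lines d\<^sub>1 d\<^sub>2. fst (reduced_word (line_word l))) \<otimes>
     (\<Otimes>l\<in>stack_loops d\<^sub>1 d\<^sub>2. loop_factor (snd l))"

definition diagram_vector :: "nat \<Rightarrow> diagram \<Rightarrow> diagram \<Rightarrow> 'a" where
  "diagram_vector m d = (\<lambda>e \<in> blob_diagrams m. if e = d then \<one> else \<zero>)"

text \<open>The algebra $b^{x'}_m$; an element is its family of coefficients with respect to $B^{x'}_m$.\<close>

definition blob_algebra :: "nat \<Rightarrow> ('a, diagram \<Rightarrow> 'a) module" where
  "blob_algebra m =
     \<lparr>carrier = blob_diagrams m \<rightarrow>\<^sub>E carrier K,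
      mult = (\<lambda>f g. \<lambda>d \<in> blob_diagrams m.
        \<Oplus>p\<in>{(d\<^sub>1, d\<^sub>2) \<in> blob_diagrams m \<times> blob_diagrams m. product_diagram d\<^sub>1 d\<^sub>2 = d}.
          f (fst p) \<otimes> g (snd p) \<otimes> product_factor (fst p) (snd p)),
      one = diagram_vector m (identity_diagram m),
      zero = (\<lambda>d \<in> blob_diagrams m. \<zero>),
      add = (\<lambda>f g. \<lambda>d \<in> blob_diagrams m. f d \<oplus> g d),
      smult = (\<lambda>k f. \<lambda>d \<in> blob_diagrams m. k \<otimes> f d)\<rparr>"

definition topological_relators :: "nat \<Rightarrow> (diagram \<Rightarrow> 'a) set" where
  "topological_relators m =
     {diagram_vector m d \<ominus>\<^bsub>blob_algebra m\<^esub>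
        (\<kappa>LR \<odot>\<^bsub>blob_algebra m\<^esub> diagram_vector m (reconnect d i j r s)) | d i j r s.
        d \<in> blob_diagrams m \<and> has_double_pair d i j r s}"

definition topological_ideal :: "nat \<Rightarrow> (diagram \<Rightarrow> 'a) set" where
  "topological_ideal m = algebra_ideal K (blob_algebra m) (topological_relators m)"

definition symplectic_blob_algebra :: "nat \<Rightarrow> ('a, (diagram \<Rightarrow> 'a) set) module" where
  "symplectic_blob_algebra m = quotient_algebra (blob_algebra m) (topological_ideal m)"

definition diagram_class :: "nat \<Rightarrow> diagram \<Rightarrow> (diagram \<Rightarrow> 'a) set" where
  "diagram_class m d = topological_ideal m +>\<^bsub>blob_algebra m\<^esub> diagram_vector m d"


subsection \<open>The reductions are well defined\<close>

fun prepend :: "blob \<Rightarrow> blob list \<Rightarrow> 'a \<times> blob list" where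
  "prepend b [] = (\<one>, [b])"
| "prepend b (c # v) =
     (if c = b then (if b = BL then \<delta>L else \<delta>R, c # v)
      else if v \<noteq> [] then (\<kappa>LR, v) else (\<one>, b # c # v))"

fun normal_form :: "blob list \<Rightarrow> 'a \<times> blob list" where
  "normal_form [] = (\<one>, [])"
| "normal_form (b # w) =
     (fst (prepend b (snd (normal_form w))) \<otimes> fst (normal_form w),
      snd (prepend b (snd (normal_form w))))"

lemma prepend_closed: "fst (prepend b v) \<in> carrier K"
  by (cases "(b, v)" rule: prepend.cases) auto

lemma normal_form_closed: "fst (normal_form w) \<in> carrier K"
  by (induction w) (auto simp: prepend_closed)

lemma normal_form_line_words: "snd (normal_form w) \<in> line_words"
proof (induction w)
  case (Cons b w)
  then show ?case
    unfolding line_words_def by (cases b) auto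
qed (simp add: line_words_def)

lemma normal_form_reduced: "x \<in> line_words \<Longrightarrow> normal_form x = (\<one>, x)"
  unfolding line_words_def by auto

lemma normal_form_rule:
  assumes "\<And>v. normal_form (p @ v) = (t \<otimes> fst (normal_form (q @ v)), snd (normal_form (q @ v)))"
    and "t \<in> carrier K"
  shows "normal_form (u @ p @ v) =
           (t \<otimes> fst (normal_form (u @ q @ v)), snd (normal_form (u @ q @ v)))"
proof (induction u)
  case Nil
  show ?case using assms(1) by simp
next
  case (Cons b u)
  then show ?case
    using assms(2) by (simp add: m_lcomm prepend_closed normal_form_closed)
qed

lemma normal_form_steps:
  "normal_form (u @ [BL, BL] @ v) =
     (\<delta>L \<otimes> fst (normal_form (u @ [BL] @ v)), snd (normal_form (u @ [BL] @ v)))"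
  "normal_form (u @ [BR, BR] @ v) =
     (\<delta>R \<otimes> fst (normal_form (u @ [BR] @ v)), snd (normal_form (u @ [BR] @ v)))"
  "normal_form (u @ [BL, BR, BL] @ v) =
     (\<kappa>LR \<otimes> fst (normal_form (u @ [BL] @ v)), snd (normal_form (u @ [BL] @ v)))"
  "normal_form (u @ [BR, BL, BR] @ v) =
     (\<kappa>LR \<otimes> fst (normal_form (u @ [BR] @ v)), snd (normal_form (u @ [BR] @ v)))"
proof -
  have words: "snd (normal_form v) = [] \<or> snd (normal_form v) = [BL] \<or> snd (normal_form v) = [BR] \<or>
      snd (normal_form v) = [BL, BR] \<or> snd (normal_form v) = [BR, BL]" for v
    using normal_form_line_words[of v] by (simp add: line_words_def)
  note simps = normal_form_closed m_ac
  show "normal_form (u @ [BL, BL] @ v) =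
     (\<delta>L \<otimes> fst (normal_form (u @ [BL] @ v)), snd (normal_form (u @ [BL] @ v)))"
  proof (rule normal_form_rule)
    show "normal_form ([BL, BL] @ v) =
        (\<delta>L \<otimes> fst (normal_form ([BL] @ v)), snd (normal_form ([BL] @ v)))" for v
      using words[of v] by (elim disjE) (simp_all add: simps)
  qed simp
  show "normal_form (u @ [BR, BR] @ v) =
     (\<delta>R \<otimes> fst (normal_form (u @ [BR] @ v)), snd (normal_form (u @ [BR] @ v)))"
  proof (rule normal_form_rule)
    show "normal_form ([BR, BR] @ v) =
        (\<delta>R \<otimes> fst (normal_form ([BR] @ v)), snd (normal_form ([BR] @ v)))" for v
      using words[of v] by (elim disjE) (simp_all add: simps)
  qed simp
  show "normal_form (u @ [BL, BR, BL] @ v) =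
     (\<kappa>LR \<otimes> fst (normal_form (u @ [BL] @ v)), snd (normal_form (u @ [BL] @ v)))"
  proof (rule normal_form_rule)
    show "normal_form ([BL, BR, BL] @ v) =
        (\<kappa>LR \<otimes> fst (normal_form ([BL] @ v)), snd (normal_form ([BL] @ v)))" for v
      using words[of v] by (elim disjE) (simp_all add: simps)
  qed simp
  show "normal_form (u @ [BR, BL, BR] @ v) =
     (\<kappa>LR \<otimes> fst (normal_form (u @ [BR] @ v)), snd (normal_form (u @ [BR] @ v)))"
  proof (rule normal_form_rule)
    show "normal_form ([BR, BL, BR] @ v) =
        (\<kappa>LR \<otimes> fst (normal_form ([BR] @ v)), snd (normal_form ([BR] @ v)))" for v
      using words[of v] by (elim disjE) (simp_all add: simps)
  qed simp
qed

lemma word_reduces_normal_form: "word_reduces w c x \<Longrightarrow> normal_form w = (c, x)"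
  by (induction rule: word_reduces.induct) (simp_all only: normal_form_reduced normal_form_steps fst_conv snd_conv)

lemma ex_word_reduces: "\<exists>c x. word_reduces w c x"
proof (induction w rule: length_induct)
  case (1 w)
  have ex: "\<exists>c x. word_reduces (b # v) c x" if "length v + 1 < length w" for b v
    using 1 that by simp
  note steps = word_reduces.LL[of "[]", simplified] word_reduces.RR[of "[]", simplified]
    word_reduces.LRL[of "[]", simplified] word_reduces.RLR[of "[]", simplified]
    word_reduces.LL[of "[b]" for b, simplified] word_reduces.RR[of "[b]" for b, simplified]
  show ?case
  proof (cases "w \<in> line_words")
    case True
    then show ?thesis using word_reduces.reduced by blast
  next
    case False
    then consider v where "w = BL # BL # v" | v where "w = BR # BR # v"
      | v where "w = BL # BR # BL # v" | v where "w = BR # BL # BR # v"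
      | v where "w = BL # BR # BR # v" | v where "w = BR # BL # BL # v"
      unfolding line_words_def
      by (cases w; cases "tl w"; cases "tl (tl w)"; cases "hd w"; cases "hd (tl w)";
          cases "hd (tl (tl w))") auto
    then show ?thesis
    proof cases
      case (1 v)
      then obtain c x where "word_reduces (BL # v) c x"
        using ex[of "v" BL] by auto
      from steps(1)[OF this] show ?thesis using 1 by blast
    next
      case (2 v)
      then obtain c x where "word_reduces (BR # v) c x"
        using ex[of "v" BR] by auto
      from steps(2)[OF this] show ?thesis using 2 by blast
    next
      case (3 v)
      then obtain c x where "word_reduces (BL # v) c x"
        using ex[of "v" BL] by auto
      from steps(3)[OF this] show ?thesis using 3 by blast
    next
      case (4 v)
      then obtain c x where "word_reduces (BR # v) c x"
        using ex[of "v" BR] by auto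
      from steps(4)[OF this] show ?thesis using 4 by blast
    next
      case (5 v)
      then obtain c x where "word_reduces (BL # BR # v) c x"
        using ex[of "BR # v" BL] by auto
      from steps(6)[OF this] show ?thesis using 5 by blast
    next
      case (6 v)
      then obtain c x where "word_reduces (BR # BL # v) c x"
        using ex[of "BL # v" BR] by auto
      from steps(5)[OF this] show ?thesis using 6 by blast
    qed
  qed
qed

theorem word_reduces_iff: "word_reduces w c x \<longleftrightarrow> normal_form w = (c, x)"
proof
  assume "normal_form w = (c, x)"
  moreover obtain c' x' where "word_reduces w c' x'"
    using ex_word_reduces by blast
  ultimately show "word_reduces w c x"
    using word_reduces_normal_form by fastforce
qed (rule word_reduces_normal_form)

corollary reduced_word_eq: "reduced_word w = normal_form w"
  unfolding reduced_word_def word_reduces_iff by (auto intro: the_equality)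

definition loop_base :: "bool \<Rightarrow> bool \<Rightarrow> 'a" where
  "loop_base l r = (if l then if r then \<kappa>LR else \<kappa>L else if r then \<kappa>R else \<delta>)"

lemma loop_reduces_eq:
  assumes "loop_reduces w c"
  shows "c = \<delta>L [^] (count_list w BL - 1) \<otimes> \<delta>R [^] (count_list w BR - 1) \<otimes>
             loop_base (BL \<in> set w) (BR \<in> set w)"
  using assms
proof (induction rule: loop_reduces.induct)
  case (LL w c)
  have "loop_base l r \<in> carrier K" for l r by (simp add: loop_base_def)
  with LL show ?case by (simp add: m_ac nat_pow_Suc2)
next
  case (RR w c)
  have "loop_base l r \<in> carrier K" for l r by (simp add: loop_base_def)
  with RR show ?case by (simp add: m_ac nat_pow_Suc2)
next
  case (rotate w c)
  have "count_list (rotate1 w) b = count_list w b" for b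
    by (cases w) auto
  with rotate show ?case by simp
qed (simp_all add: loop_base_def)

lemma ex_loop_reduces: "\<exists>c. loop_reduces (rotate n (replicate p BL @ replicate q BR)) c"
proof -
  define w where "w p q = replicate p BL @ replicate q BR" for p q
  have rot: "loop_reduces (rotate n v) c \<Longrightarrow> loop_reduces v c" for n v c
  proof (induction n arbitrary: v)
    case (Suc n)
    have "rotate (Suc n) v = rotate n (rotate1 v)"
      by (simp add: rotate1_rotate_swap)
    with Suc show ?case by (metis loop_reduces.rotate)
  qed simp
  have rot': "\<exists>c. loop_reduces (rotate n v) c" if "loop_reduces v c" for n v c
  proof -
    have "rotate (length v * n - n) (rotate n v) = v"
    proof (cases "v = []")
      case False
      then have "n \<le> length v * n" by (cases v) auto
      then show ?thesis by (simp add: rotate_rotate rotate_id)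
    qed simp
    then show ?thesis using rot that by metis
  qed
  have right: "\<exists>c. loop_reduces (replicate q BR) c" for q
  proof (induction q rule: nat_induct)
    case (Suc q)
    then show ?case by (cases q) (auto intro: loop_reduces.intros)
  qed (auto intro: loop_reduces.intros)
  have one: "\<exists>c. loop_reduces (w 1 q) c" for q
  proof (induction q rule: nat_induct)
    case (Suc q)
    show ?case
    proof (cases q)
      case 0
      then show ?thesis by (auto simp: w_def intro: loop_reduces.intros)
    next
      case (Suc r)
      obtain c where "loop_reduces (rotate 1 (w 1 q)) c"
        using \<open>\<exists>c. loop_reduces (w 1 q) c\<close> rot' by blast
      then have "loop_reduces (rotate 1 (w 1 (Suc q))) (\<delta>R \<otimes> c)"
        using Suc by (simp add: w_def loop_reduces.RR)
      then show ?thesis using rot by blast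
    qed
  qed (auto simp: w_def intro: loop_reduces.intros)
  have "\<exists>c. loop_reduces (w p q) c"
  proof (induction p rule: nat_induct)
    case 0
    then show ?case using right by (simp add: w_def)
  next
    case (Suc p)
    then show ?case
      using one by (cases p) (auto simp: w_def intro: loop_reduces.LL)
  qed
  then show ?thesis using rot' by (auto simp: w_def)
qed

theorem loop_factor_eq:
  "loop_factor (rotate n (replicate p BL @ replicate q BR)) =
     \<delta>L [^] (p - 1) \<otimes> \<delta>R [^] (q - 1) \<otimes> loop_base (p > 0) (q > 0)"
proof -
  define w where "w = rotate n (replicate p BL @ replicate q BR)"
  have *: "count_list (rotate n v) b = count_list v b" for v and b :: blob
  proof (induction n)
    case (Suc n)
    have "count_list (rotate1 u) b = count_list u b" for u
      by (cases u) auto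
    with Suc show ?case by simp
  qed simp
  have rep: "count_list (replicate k a) b = (if a = b then k else 0)" for k and a b :: blob
    by (induction k) auto
  have "\<exists>!c. loop_reduces w c"
    using ex_loop_reduces[of n p q] loop_reduces_eq unfolding w_def by metis
  then have "loop_reduces w (loop_factor w)"
    unfolding loop_factor_def by (rule theI')
  from loop_reduces_eq[OF this] show ?thesis
    by (simp add: w_def * rep)
qed

end

end

theory Submission
  imports Defs
begin

text \<open>
  The vectors of the diagrams in $B^{x'}_m$ are a basis of $b^{x'}_m$. No diagram has more than one
  pair of lines to which a topological relation applies, and reconnecting this pair leads to a
  diagram of $B^x_m$. Every diagram \<open>d\<close> is therefore congruent to \<open>untangle_factor d\<close> times
  \<open>untangle d\<close>: for \<open>d\<close> with such a pair these are \<open>\<kappa>LR\<close> and $\bar d$, for \<open>d\<close> in $B^x_m$ they are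
  \<open>\<one>\<close> and \<open>d\<close>. So the classes of the diagrams in $B^x_m$ span, and independence is the point: the
  two-sided ideal generated by the relators must not contain a nonzero combination of these diagrams.

  For each \<open>t\<close> in $B^x_m$ consider the linear functional that sends \<open>d\<close> to \<open>untangle_factor d\<close> if
  \<open>untangle d = t\<close> and to \<open>\<zero>\<close> otherwise. These functionals vanish on the relators, and on a
  combination of diagrams in $B^x_m$ they read off the coefficients. It remains to see that their
  common kernel is a two-sided ideal (\<open>coordinate_kernel_absorbs\<close>), that is, that multiplication by
  a diagram \<open>e\<close>, followed by one of these functionals, gives the same value on \<open>d\<close> and on
  \<open>untangle_factor d\<close> times \<open>untangle d\<close> (\<open>product_weight_untangle\<close>).

  This is a statement about pictures. Let \<open>d\<close> contain the two doubly decorated lines, and stack it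
  with \<open>e\<close>. Together with the arcs of its blobs, one such line separates the northern from the
  southern edge, so that \<open>d\<close> has no line from north to south. One of the two lines has both ends on
  the edge along which \<open>d\<close> and \<open>e\<close> are glued; follow the curve of the stack through it.
  \<^item> If the curve closes up, planarity forces its cyclic word to be $L^{p+1} R^{q+1}$. Reconnecting
    cuts this loop open and inserts it into the other doubly decorated line, which then has the word
    $L^{p+1} R^{q+1}$. The loop contributed $\delta_L^p \delta_R^q \kappa_{LR}$, the longer
    line contributes $\delta_L^p \delta_R^q$, and both products have the same diagram
    (\<open>loop_case_result\<close>).
  \<^item> Otherwise the curve is a line with both ends on the edge of \<open>e\<close> opposite to \<open>d\<close>, and planarity
    forces its word to be $L^{p+1} R^{q+1}$ again. Reconnecting cuts it into two lines with the words
    $L^{p+1}$ and $R^{q+1}$ that run to the other edge of the stack. The two scalars agree, and the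
    two product diagrams are again related by reconnecting (\<open>line_case_result\<close>).

  In the second case one of the two product diagrams might satisfy the conditions that define
  $B^{x'}_m$ and the other one not. That they do so together is \<open>reconnect_blob_diagram_iff\<close>: the
  arcs of a drawing of one of them serve, up to a small displacement, for the other one.

  Planarity of the stack enters through one fact about curves made of pieces of the two
  drawings: if two such curves with ends on the outer boundary are disjoint, then their ends do not
  separate each other (\<open>disjoint_curves_do_not_cross\<close>). It is proved by counting, modulo 2, how often
  one of the curves has to be crossed. Applied to arcs that reach the boundary at a blob, follow a
  line or a loop, and leave it at another blob, it says that the letters of a loop are not
  interleaved, and that a line which turns back has its letters in the order prescribed by its ends.
\<close>

section \<open>Disjoint curves in two glued rectangles\<close>

text \<open>
  The boundary is cut open at its north-western corner. Then a curve with the ends \<open>u\<close> and \<open>v\<close>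
  separates \<open>p\<close> from this corner if and only if \<open>p\<close> is between them.
\<close>

definition separates :: "real \<Rightarrow> real \<Rightarrow> real \<Rightarrow> bool" where
  "separates p u v \<longleftrightarrow> (p < u) \<noteq> (p < v)"

lemma crossing_iff_separates:
  assumes "x \<notin> {u, v}" "y \<notin> {u, v}"
  shows "crossing x y u v \<longleftrightarrow> separates x u v \<noteq> separates y u v"
  using assms unfolding crossing_def separates_def by (auto simp: min_def max_def split: if_splits)

text \<open>
  A chord is a piece of a curve in one of the two halves of a stack, known by its two ends on the
  boundary of that half; a curve of the stack is a list of chords of alternating halves.
\<close>

type_synonym chord = "half \<times> real \<times> real"

text \<open>
  Position of the glued vertex \<open>k\<close> on the boundary of the upper half, where it is southern, and on
  that of the lower half, where it is northern.
\<close>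

fun mid_pos :: "nat \<Rightarrow> half \<Rightarrow> nat \<Rightarrow> real" where
  "mid_pos m Upper k = 2 * real m + 1 - real k"
| "mid_pos m Lower k = real k"

fun glued :: "nat \<Rightarrow> chord \<Rightarrow> chord \<Rightarrow> bool" where
  "glued m (h, x, y) (h', x', y') \<longleftrightarrow>
     h' \<noteq> h \<and> (\<exists>k \<in> {1..m}. y = mid_pos m h k \<and> x' = mid_pos m h' k)"

text \<open>
  Position on the boundary of the whole stack, clockwise from the north-western corner. Each of
  its vertical edges has length two.
\<close>

fun outer_pos :: "nat \<Rightarrow> half \<Rightarrow> real \<Rightarrow> real" where
  "outer_pos m Upper p = (if p < real m + 1 then p else p + 2)"
| "outer_pos m Lower p = p + 1"

fun outer_point :: "nat \<Rightarrow> half \<Rightarrow> real \<Rightarrow> bool" where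
  "outer_point m Upper p \<longleftrightarrow> p < real m + 1 \<or> 2 * real m < p"
| "outer_point m Lower p \<longleftrightarrow> real m < p \<and> p < 2 * real m + 1"

abbreviation chord_half :: "chord \<Rightarrow> half" where "chord_half c \<equiv> fst c"
abbreviation chord_start :: "chord \<Rightarrow> real" where "chord_start c \<equiv> fst (snd c)"
abbreviation chord_end :: "chord \<Rightarrow> real" where "chord_end c \<equiv> snd (snd c)"

text \<open>
  Parity of the number of chords in the half \<open>h\<close> that separate \<open>p\<close> from the north-western corner of
  \<open>h\<close>: on which side of the curve \<open>p\<close> lies, as seen within \<open>h\<close>.
\<close>

fun hits :: "chord list \<Rightarrow> half \<Rightarrow> real \<Rightarrow> bool" where
  "hits [] h p \<longleftrightarrow> False"
| "hits ((h', u, v) # Q) h p \<longleftrightarrow> (h = h' \<and> separates p u v) \<noteq> hits Q h p"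

lemma xor_telescope:
  fixes a b p q r :: bool
  shows "(a \<longleftrightarrow> (p \<noteq> q) \<noteq> b) \<Longrightarrow> (b \<longleftrightarrow> q \<noteq> r) \<Longrightarrow> (a \<longleftrightarrow> p \<noteq> r)"
  by argo

text \<open>
  If a colouring \<open>V\<close> of the chord ends changes along a chord exactly when the chord counts for
  \<open>hits\<close>, and does not change where two chords are glued, then the parity telescopes.
\<close>

lemma hits_telescope:
  fixes V :: "half \<Rightarrow> real \<Rightarrow> bool"
  assumes "successively (glued m) Q" "Q \<noteq> []"
    and "\<And>u v. (h, u, v) \<in> set Q \<Longrightarrow> separates p u v = (V h u \<noteq> V h v)"
    and "\<And>h' u v. (h', u, v) \<in> set Q \<Longrightarrow> h' \<noteq> h \<Longrightarrow> V h' u = V h' v"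
    and "\<And>h1 x y h2 u v k. (h1, x, y) \<in> set Q \<Longrightarrow> (h2, u, v) \<in> set Q \<Longrightarrow> h2 \<noteq> h1 \<Longrightarrow>
      k \<in> {1..m} \<Longrightarrow> y = mid_pos m h1 k \<Longrightarrow> u = mid_pos m h2 k \<Longrightarrow> V h1 y = V h2 u"
  shows "hits Q h p \<longleftrightarrow>
    V (chord_half (hd Q)) (chord_start (hd Q)) \<noteq> V (chord_half (last Q)) (chord_end (last Q))"
  using assms
proof (induction Q)
  case (Cons c Q)
  obtain h' u v where c: "c = (h', u, v)" by (cases c)
  have here: "(h = h' \<and> separates p u v) = (V h' u \<noteq> V h' v)"
  proof (cases "h = h'")
    case True
    then show ?thesis using Cons.prems(3)[of u v] c by simp
  next
    case False
    then show ?thesis using Cons.prems(4)[of h' u v] c by simp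
  qed
  show ?case
  proof (cases "Q = []")
    case True
    then show ?thesis using c here by simp
  next
    case False
    then obtain h2 x y Q' where Q: "Q = (h2, x, y) # Q'" by (metis list.exhaust prod_cases3)
    obtain k where k: "h2 \<noteq> h'" "k \<in> {1..m}" "v = mid_pos m h' k" "x = mid_pos m h2 k"
      using Cons.prems(1) unfolding c Q by auto
    have "V h' v = V h2 x"
      by (rule Cons.prems(5)[of h' u v h2 x y k]) (use k in \<open>simp_all add: c Q\<close>)
    then have 1: "hits (c # Q) h p \<longleftrightarrow> (V h' u \<noteq> V h2 x) \<noteq> hits Q h p"
      using here c by simp
    have 2: "hits Q h p \<longleftrightarrow>
      V (chord_half (hd Q)) (chord_start (hd Q)) \<noteq> V (chord_half (last Q)) (chord_end (last Q))"
    proof (rule Cons.IH)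
      show "successively (glued m) Q" using Cons.prems(1) False by (simp add: successively_Cons)
      show "Q \<noteq> []" by fact
      show "separates p u v = (V h u \<noteq> V h v)" if "(h, u, v) \<in> set Q" for u v
        by (rule Cons.prems(3)) (use that in simp)
      show "V h' u = V h' v" if "(h', u, v) \<in> set Q" "h' \<noteq> h" for h' u v
        by (rule Cons.prems(4)) (use that in simp_all)
      show "V h1 y = V h2 u" if "(h1, x, y) \<in> set Q" "(h2, u, v) \<in> set Q" "h2 \<noteq> h1"
        "k \<in> {1..m}" "y = mid_pos m h1 k" "u = mid_pos m h2 k" for h1 x y h2 u v k
        by (rule Cons.prems(5)[of h1 x y h2 u v k]) (use that in simp_all)
    qed
    have 3: "chord_half (hd Q) = h2" "chord_start (hd Q) = x" "hd (c # Q) = c" "last (c # Q) = last Q"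
      "chord_half c = h'" "chord_start c = u"
      by (simp_all add: Q c)
    show ?thesis
      unfolding 3 by (rule xor_telescope[OF 1]) (rule 2[unfolded 3])
  qed
next
  case Nil
  from Nil.prems(2) show ?case by blast
qed

text \<open>
  From an outer boundary point, the side seen within one half determines the side in the stack.
  For the lower half the reference corner is the western end of the gluing line; it is on the same
  side of the curve as the north-western corner of the stack unless exactly one end of the curve lies
  on the western edge of the upper half, between these two corners.
\<close>

lemma hits_at_outer_point:
  assumes "successively (glued m) Q" "Q \<noteq> []" "outer_point m h p"
    and "outer_point m (chord_half (hd Q)) (chord_start (hd Q))"
    and "outer_point m (chord_half (last Q)) (chord_end (last Q))" and "m \<ge> 1"
  defines "west \<equiv> \<lambda>c q. c = Upper \<and> 2 * real m < q"
  shows "(hits Q h p \<noteq> (h = Lower \<and>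
      west (chord_half (hd Q)) (chord_start (hd Q)) \<noteq> west (chord_half (last Q)) (chord_end (last Q))))
    \<longleftrightarrow> separates (outer_pos m h p)
      (outer_pos m (chord_half (hd Q)) (chord_start (hd Q)))
      (outer_pos m (chord_half (last Q)) (chord_end (last Q)))"
proof (cases h)
  case Upper
  define V where "V = (\<lambda>h' u. if h' = Upper then p < u else p < real m + 1)"
  have "hits Q h p \<longleftrightarrow>
      V (chord_half (hd Q)) (chord_start (hd Q)) \<noteq> V (chord_half (last Q)) (chord_end (last Q))"
  proof (rule hits_telescope[OF assms(1,2)])
    show "V h1 y = V h2 u" if "h2 \<noteq> h1" "k \<in> {1..m}" "y = mid_pos m h1 k" "u = mid_pos m h2 k"
      for h1 y h2 u k
      using that assms(3) Upper by (cases h1; cases h2) (auto simp: V_def)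
  qed (auto simp: V_def Upper separates_def)
  moreover have "V h' u \<longleftrightarrow> outer_pos m h p < outer_pos m h' u" if "outer_point m h' u" for h' u
    using that assms(3) Upper by (cases h') (auto simp: V_def)
  ultimately show ?thesis using assms(4,5) Upper by (simp add: separates_def)
next
  case Lower
  define V where "V = (\<lambda>h' u. h' = Lower \<and> p < u)"
  have "hits Q h p \<longleftrightarrow>
      V (chord_half (hd Q)) (chord_start (hd Q)) \<noteq> V (chord_half (last Q)) (chord_end (last Q))"
  proof (rule hits_telescope[OF assms(1,2)])
    show "V h1 y = V h2 u" if "h2 \<noteq> h1" "k \<in> {1..m}" "y = mid_pos m h1 k" "u = mid_pos m h2 k"
      for h1 y h2 u k
      using that assms(3) Lower by (cases h1; cases h2) (auto simp: V_def)
  qed (auto simp: V_def Lower separates_def)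
  moreover have "(V h' u \<noteq> west h' u) \<longleftrightarrow> outer_pos m h p < outer_pos m h' u"
    if "outer_point m h' u" for h' u
    using that assms(3) Lower \<open>m \<ge> 1\<close>
    by (cases h') (auto simp: V_def west_def)
  ultimately show ?thesis using assms(4,5) Lower by (auto simp: separates_def)
qed

text \<open>
  Both halves agree about the side on which a glued vertex lies, up to the same correction for the
  different reference corners.
\<close>

lemma hits_across_middle:
  assumes "successively (glued m) Q" "Q \<noteq> []" "k \<in> {1..m}" "m \<ge> 1"
    and "outer_point m (chord_half (hd Q)) (chord_start (hd Q))"
    and "outer_point m (chord_half (last Q)) (chord_end (last Q))"
    and free: "\<And>h u v. (h, u, v) \<in> set Q \<Longrightarrow> mid_pos m h k \<notin> {u, v}"
  defines "west \<equiv> \<lambda>c q. c = Upper \<and> 2 * real m < q"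
  shows "(hits Q Upper (mid_pos m Upper k) \<noteq> hits Q Lower (mid_pos m Lower k)) \<longleftrightarrow>
    west (chord_half (hd Q)) (chord_start (hd Q)) \<noteq> west (chord_half (last Q)) (chord_end (last Q))"
proof -
  define V where "V = (\<lambda>h q. (mid_pos m h k < q) \<noteq> (h = Lower))"
  have ends: "V h q = west h q" if "outer_point m h q" for h q
    using that \<open>k \<in> {1..m}\<close> \<open>m \<ge> 1\<close> by (cases h) (auto simp: V_def west_def)
  have "(hits Q Upper (mid_pos m Upper k) \<noteq> hits Q Lower (mid_pos m Lower k)) \<longleftrightarrow>
    V (chord_half (hd Q)) (chord_start (hd Q)) \<noteq> V (chord_half (last Q)) (chord_end (last Q))"
    using assms(1,2) free
  proof (induction Q)
    case (Cons c Q)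
    obtain h u v where c: "c = (h, u, v)" by (cases c)
    have here: "hits (c # Q) Upper (mid_pos m Upper k) \<noteq> hits (c # Q) Lower (mid_pos m Lower k) \<longleftrightarrow>
      (V h u \<noteq> V h v) \<noteq> (hits Q Upper (mid_pos m Upper k) \<noteq> hits Q Lower (mid_pos m Lower k))"
      unfolding c V_def by (cases h) (auto simp: separates_def)
    show ?case
    proof (cases "Q = []")
      case True
      then show ?thesis using here c by simp
    next
      case False
      then obtain h2 x y Q' where Q: "Q = (h2, x, y) # Q'" by (metis list.exhaust prod_cases3)
      obtain k' where k': "h2 \<noteq> h" "v = mid_pos m h k'" "x = mid_pos m h2 k'"
        using Cons.prems(1) unfolding c Q by auto
      have "k' \<noteq> k" using Cons.prems(3)[of h u v] k' c by auto
      then have "V h v = V h2 x"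
        using k' by (cases h; cases h2) (auto simp: V_def)
      with here have 1: "hits (c # Q) Upper (mid_pos m Upper k) \<noteq> hits (c # Q) Lower (mid_pos m Lower k) \<longleftrightarrow>
        (V h u \<noteq> V h2 x) \<noteq> (hits Q Upper (mid_pos m Upper k) \<noteq> hits Q Lower (mid_pos m Lower k))"
        by simp
      have 2: "(hits Q Upper (mid_pos m Upper k) \<noteq> hits Q Lower (mid_pos m Lower k)) \<longleftrightarrow>
        V (chord_half (hd Q)) (chord_start (hd Q)) \<noteq> V (chord_half (last Q)) (chord_end (last Q))"
        by (rule Cons.IH) (use Cons.prems False in \<open>auto simp: successively_Cons\<close>)
      have 3: "chord_half (hd Q) = h2" "chord_start (hd Q) = x" "hd (c # Q) = c" "last (c # Q) = last Q"
        "chord_half c = h" "chord_start c = u"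
        by (simp_all add: Q c)
      show ?thesis
        unfolding 3 by (rule xor_telescope[OF 1]) (rule 2[unfolded 3])
    qed
  qed simp
  then show ?thesis using ends assms(5,6) by simp
qed

text \<open>
  A combinatorial form of the Jordan curve theorem: walking along \<open>P\<close> never changes the side of
  \<open>Q\<close>. Within a half this holds because no chord of \<open>P\<close> crosses a chord of \<open>Q\<close>, and at a glued vertex
  by \<open>hits_across_middle\<close>. At the ends of \<open>P\<close> the side is the cyclic order on the outer boundary.
\<close>

theorem disjoint_curves_do_not_cross:
  assumes "successively (glued m) P" "P \<noteq> []" "successively (glued m) Q" "Q \<noteq> []" "m \<ge> 1"
    and endsP: "outer_point m (chord_half (hd P)) (chord_start (hd P))"
      "outer_point m (chord_half (last P)) (chord_end (last P))"
    and endsQ: "outer_point m (chord_half (hd Q)) (chord_start (hd Q))"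
      "outer_point m (chord_half (last Q)) (chord_end (last Q))"
    and apart: "\<And>h x y u v. (h, x, y) \<in> set P \<Longrightarrow> (h, u, v) \<in> set Q \<Longrightarrow>
      x \<notin> {u, v} \<and> y \<notin> {u, v} \<and> \<not> crossing x y u v"
  shows "separates (outer_pos m (chord_half (hd P)) (chord_start (hd P)))
      (outer_pos m (chord_half (hd Q)) (chord_start (hd Q)))
      (outer_pos m (chord_half (last Q)) (chord_end (last Q))) \<longleftrightarrow>
    separates (outer_pos m (chord_half (last P)) (chord_end (last P)))
      (outer_pos m (chord_half (hd Q)) (chord_start (hd Q)))
      (outer_pos m (chord_half (last Q)) (chord_end (last Q)))"
proof -
  define w where "w = ((chord_half (hd Q) = Upper \<and> 2 * real m < chord_start (hd Q)) \<noteq>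
    (chord_half (last Q) = Upper \<and> 2 * real m < chord_end (last Q)))"
  \<comment> \<open>the side of \<open>Q\<close> in the whole stack: \<open>w\<close> corrects for the reference corner of the lower half\<close>
  define side where "side h p = (hits Q h p \<noteq> (h = Lower \<and> w))" for h p
  have along: "hits Q h x = hits Q h y" if "(h, x, y) \<in> set P" for h x y
  proof -
    have "\<And>u v. (h, u, v) \<in> set Q \<Longrightarrow> separates x u v = separates y u v"
      using apart[OF that] crossing_iff_separates by blast
    then show ?thesis
    proof (induction Q)
      case (Cons c Q)
      obtain h' u v where c: "c = (h', u, v)" by (cases c)
      have "h = h' \<Longrightarrow> separates x u v = separates y u v" using Cons.prems[of u v] c by simp
      moreover have "hits Q h x = hits Q h y" using Cons by simp
      ultimately show ?case unfolding c by auto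
    qed simp
  qed
  have "side (chord_half (hd P)) (chord_start (hd P)) = side (chord_half (last P)) (chord_end (last P))"
    using assms(1,2) along apart
  proof (induction P)
    case (Cons c P)
    obtain h x y where c: "c = (h, x, y)" by (cases c)
    have here: "side h x = side h y" using Cons.prems(3)[of h x y] c by (simp add: side_def)
    show ?case
    proof (cases "P = []")
      case True
      then show ?thesis using here c by simp
    next
      case False
      then obtain h2 u v P' where P: "P = (h2, u, v) # P'" by (metis list.exhaust prod_cases3)
      obtain k where k: "h2 \<noteq> h" "k \<in> {1..m}" "y = mid_pos m h k" "u = mid_pos m h2 k"
        using Cons.prems(1) unfolding c P by auto
      have "mid_pos m h' k \<notin> {u', v'}" if "(h', u', v') \<in> set Q" for h' u' v'
      proof -
        have "h' = h \<or> h' = h2" using k(1) by (metis half.exhaust)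
        then show ?thesis
          using Cons.prems(4)[of h x y u' v'] Cons.prems(4)[of h2 u v u' v'] that k(3,4)
          unfolding c P by auto
      qed
      then have "(hits Q Upper (mid_pos m Upper k) \<noteq> hits Q Lower (mid_pos m Lower k)) \<longleftrightarrow> w"
        unfolding w_def by (intro hits_across_middle assms endsQ k)
      then have "side h y = side h2 u"
        using k by (cases h; cases h2) (auto simp: side_def)
      moreover have "side (chord_half (hd P)) (chord_start (hd P)) =
        side (chord_half (last P)) (chord_end (last P))"
      proof (rule Cons.IH)
        show "successively (glued m) P" using Cons.prems(1) False by (simp add: successively_Cons)
        show "hits Q h x = hits Q h y" if "(h, x, y) \<in> set P" for h x y
          using Cons.prems(3) that by simp
        show "x \<notin> {u, v} \<and> y \<notin> {u, v} \<and> \<not> crossing x y u v"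
          if "(h, x, y) \<in> set P" "(h, u, v) \<in> set Q" for h x y u v
          using Cons.prems(4)[of h x y u v] that by simp
      qed fact
      ultimately show ?thesis using here P unfolding c by simp
    qed
  qed simp
  moreover have "side (chord_half (hd P)) (chord_start (hd P)) \<longleftrightarrow>
    separates (outer_pos m (chord_half (hd P)) (chord_start (hd P)))
      (outer_pos m (chord_half (hd Q)) (chord_start (hd Q)))
      (outer_pos m (chord_half (last Q)) (chord_end (last Q)))"
    unfolding side_def w_def by (rule hits_at_outer_point) (fact assms)+
  moreover have "side (chord_half (last P)) (chord_end (last P)) \<longleftrightarrow>
    separates (outer_pos m (chord_half (last P)) (chord_end (last P)))
      (outer_pos m (chord_half (hd Q)) (chord_start (hd Q)))
      (outer_pos m (chord_half (last Q)) (chord_end (last Q)))"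
    unfolding side_def w_def by (rule hits_at_outer_point) (fact assms)+
  ultimately show ?thesis by (simp only:)
qed

section \<open>Trails of segments\<close>

type_synonym segment = "half \<times> spot \<times> blob list \<times> spot"

abbreviation seg_half :: "segment \<Rightarrow> half" where "seg_half g \<equiv> fst g"
abbreviation seg_from :: "segment \<Rightarrow> spot" where "seg_from g \<equiv> fst (snd g)"
abbreviation seg_word :: "segment \<Rightarrow> blob list" where "seg_word g \<equiv> fst (snd (snd g))"
abbreviation seg_to :: "segment \<Rightarrow> spot" where "seg_to g \<equiv> snd (snd (snd g))"

definition turn :: "segment \<Rightarrow> segment" where
  "turn g = (seg_half g, seg_to g, rev (seg_word g), seg_from g)"

lemma turn_simps [simp]:
  "seg_half (turn g) = seg_half g" "seg_from (turn g) = seg_to g"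
  "seg_to (turn g) = seg_from g" "seg_word (turn g) = rev (seg_word g)"
  by (simp_all add: turn_def)

lemma turn_turn [simp]: "turn (turn g) = g"
  by (simp add: turn_def)

lemma turn_eq_iff: "turn g = g' \<longleftrightarrow> g = turn g'"
  by auto

text \<open>
  A curve continues through a glued vertex from one half into the other.
\<close>

definition follows :: "segment \<Rightarrow> segment \<Rightarrow> bool" where
  "follows g g' \<longleftrightarrow> seg_half g' \<noteq> seg_half g \<and> seg_to g = seg_from g' \<and> (\<exists>i. seg_to g = Mid i)"

lemma follows_turn [simp]: "follows (turn g) (turn g') \<longleftrightarrow> follows g' g"
  unfolding follows_def by (simp, metis)

lemma half_eqI: "h \<noteq> k \<Longrightarrow> h' \<noteq> k \<Longrightarrow> h = (h' :: half)"
  by (cases h; cases h'; cases k) auto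

definition trail :: "segment set \<Rightarrow> segment list \<Rightarrow> bool" where
  "trail S gs \<longleftrightarrow> gs \<noteq> [] \<and> set gs \<subseteq> S \<and> successively follows gs"

definition trail_word :: "segment list \<Rightarrow> blob list" where
  "trail_word gs = concat (map seg_word gs)"

definition backwards :: "segment list \<Rightarrow> segment list" where
  "backwards gs = rev (map turn gs)"

definition stuck :: "segment set \<Rightarrow> segment \<Rightarrow> bool" where
  "stuck S g \<longleftrightarrow> (\<forall>g' \<in> S. \<not> follows g g')"

lemma trail_word_simps [simp]:
  "trail_word [] = []" "trail_word (g # gs) = seg_word g @ trail_word gs"
  "trail_word (gs @ hs) = trail_word gs @ trail_word hs"
  by (simp_all add: trail_word_def)

lemma backwards_simps [simp]:
  "backwards [] = []" "backwards (g # gs) = backwards gs @ [turn g]"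
  "backwards (gs @ hs) = backwards hs @ backwards gs"
  "backwards (backwards gs) = gs" "backwards gs = [] \<longleftrightarrow> gs = []"
  "set (backwards gs) = turn ` set gs"
  "gs \<noteq> [] \<Longrightarrow> hd (backwards gs) = turn (last gs)"
  "gs \<noteq> [] \<Longrightarrow> last (backwards gs) = turn (hd gs)"
  by (auto simp: backwards_def rev_map comp_def hd_rev last_rev last_map hd_map)

lemma trail_word_backwards: "trail_word (backwards gs) = rev (trail_word gs)"
  by (induction gs) auto

lemma successively_backwards:
  "successively follows (backwards gs) \<longleftrightarrow> successively follows gs"
  unfolding backwards_def successively_rev successively_map follows_turn ..

lemma trail_append:
  "gs \<noteq> [] \<Longrightarrow> hs \<noteq> [] \<Longrightarrow>
    trail S (gs @ hs) \<longleftrightarrow> trail S gs \<and> trail S hs \<and> follows (last gs) (hd hs)"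
  by (auto simp: trail_def successively_append_iff)

lemma trail_Cons:
  "gs \<noteq> [] \<Longrightarrow> trail S (g # gs) \<longleftrightarrow> g \<in> S \<and> trail S gs \<and> follows g (hd gs)"
  by (auto simp: trail_def successively_Cons)

lemma trail_single [simp]: "trail S [g] \<longleftrightarrow> g \<in> S"
  by (simp add: trail_def)

lemma trail_mono: "trail S gs \<Longrightarrow> S \<subseteq> T \<Longrightarrow> trail T gs"
  by (auto simp: trail_def)

lemma trail_nth_follows:
  "trail S gs \<Longrightarrow> Suc n < length gs \<Longrightarrow> follows (gs ! n) (gs ! Suc n)"
  unfolding trail_def by (auto simp: successively_conv_nth)

text \<open>
  The segments of a stack, in both directions. At most one segment of each half starts at a given
  spot, which makes trails deterministic forwards and backwards: they are pieces of disjoint curves.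
\<close>

locale segment_system =
  fixes S :: "segment set"
  assumes turn_closed: "g \<in> S \<Longrightarrow> turn g \<in> S"
    and unique: "g \<in> S \<Longrightarrow> g' \<in> S \<Longrightarrow> seg_half g = seg_half g' \<Longrightarrow> seg_from g = seg_from g' \<Longrightarrow> g = g'"
    and proper: "g \<in> S \<Longrightarrow> seg_from g \<noteq> seg_to g"
begin

lemma turn_iff [simp]: "turn g \<in> S \<longleftrightarrow> g \<in> S"
  using turn_closed[of g] turn_closed[of "turn g"] by auto

lemma turn_neq: "g \<in> S \<Longrightarrow> turn g \<noteq> g"
  using proper[of g] turn_simps(2)[of g] by metis

lemma follows_unique:
  assumes "g1 \<in> S" "g2 \<in> S" "follows g g1" "follows g g2"
  shows "g1 = g2"
  using assms unique[of g1 g2] half_eqI[of "seg_half g1" "seg_half g" "seg_half g2"]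
  unfolding follows_def by simp

lemma follows_unique_back:
  assumes "g1 \<in> S" "g2 \<in> S" "follows g1 g" "follows g2 g"
  shows "g1 = g2"
  using follows_unique[of "turn g1" "turn g2" "turn g"] assms by (simp add: turn_eq_iff)

lemma trail_backwards: "trail S gs \<Longrightarrow> trail S (backwards gs)"
  unfolding trail_def by (auto simp: successively_backwards)

text \<open>
  A repetition could be shifted back along the trail until it involves the first segment, which
  has no predecessor.
\<close>

lemma trail_no_repeat:
  assumes tr: "trail S gs" and start: "stuck S (turn (hd gs))" and "i < j" "j < length gs"
  shows "gs ! i \<noteq> gs ! j"
  using \<open>i < j\<close> \<open>j < length gs\<close>
proof (induction i arbitrary: j)
  have in_S: "gs ! n \<in> S" if "n < length gs" for n
    using that tr by (auto simp: trail_def)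
  case 0
  show ?case
  proof
    assume eq: "gs ! 0 = gs ! j"
    have "follows (gs ! (j - 1)) (gs ! j)"
      using trail_nth_follows[OF tr, of "j - 1"] 0 by simp
    then have "follows (turn (hd gs)) (turn (gs ! (j - 1)))"
      using eq 0 by (simp add: hd_conv_nth flip: length_greater_0_conv)
    moreover have "turn (gs ! (j - 1)) \<in> S" using in_S 0 by simp
    ultimately show False using start unfolding stuck_def by blast
  qed
next
  have in_S: "gs ! n \<in> S" if "n < length gs" for n
    using that tr by (auto simp: trail_def)
  case (Suc i)
  show ?case
  proof
    assume eq: "gs ! Suc i = gs ! j"
    have "follows (gs ! (j - 1)) (gs ! j)" "follows (gs ! i) (gs ! Suc i)"
      using trail_nth_follows[OF tr, of "j - 1"] trail_nth_follows[OF tr, of i] Suc.prems by simp_all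
    then have "gs ! i = gs ! (j - 1)"
      using eq follows_unique_back[of "gs ! i" "gs ! (j - 1)" "gs ! j"] in_S[of i] in_S[of "j - 1"]
        Suc.prems by simp
    moreover have "i < j - 1" "j - 1 < length gs" using Suc.prems by linarith+
    ultimately show False using Suc.IH[of "j - 1"] by blast
  qed
qed

text \<open>
  If a trail returned along one of its own segments, then it would do so along the whole part in
  between, down to its middle. There a segment would be its own reversal or would be followed by it.
\<close>

lemma trail_no_return:
  assumes tr: "trail S gs" and "i \<le> j" "j < length gs"
  shows "gs ! i \<noteq> turn (gs ! j)"
  using \<open>i \<le> j\<close> \<open>j < length gs\<close>
proof (induction "j - i" arbitrary: i j rule: less_induct)
  have in_S: "gs ! n \<in> S" if "n < length gs" for n
    using that tr by (auto simp: trail_def)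
  case less
  consider "j = i" | "j = Suc i" | "Suc i \<le> j - 1" using less.prems by linarith
  then show ?case
  proof cases
    case 1
    then show ?thesis using turn_neq[OF in_S, of i] less.prems by auto
  next
    case 2
    then have "seg_half (gs ! j) \<noteq> seg_half (gs ! i)"
      using trail_nth_follows[OF tr, of i] less.prems by (simp add: follows_def)
    then show ?thesis by (metis turn_simps(1))
  next
    case 3
    show ?thesis
    proof
      assume eq: "gs ! i = turn (gs ! j)"
      have "follows (gs ! (j - 1)) (gs ! j)" "follows (gs ! i) (gs ! Suc i)"
        using trail_nth_follows[OF tr, of "j - 1"] trail_nth_follows[OF tr, of i] 3 less.prems by simp_all
      then have "follows (gs ! i) (turn (gs ! (j - 1)))" using eq by simp
      then have "gs ! Suc i = turn (gs ! (j - 1))"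
        using follows_unique \<open>follows (gs ! i) (gs ! Suc i)\<close> in_S 3 less.prems by simp
      moreover have "j - 1 - Suc i < j - i" "j - 1 < length gs" using 3 less.prems by linarith+
      ultimately show False using less.hyps[of "j - 1" "Suc i"] 3 less.prems by simp
    qed
  qed
qed

lemma trail_prefix:
  assumes "trail S gs" "trail S hs" "hd gs = hd hs" "n < length gs" "n < length hs"
  shows "gs ! n = hs ! n"
  using assms(4,5)
proof (induction n)
  case 0
  then show ?case using assms(1-3) by (auto simp: hd_conv_nth trail_def)
next
  case (Suc n)
  then have "gs ! n = hs ! n" by simp
  moreover have "gs ! Suc n \<in> S" "hs ! Suc n \<in> S"
    using Suc.prems assms(1,2) by (auto simp: trail_def)
  ultimately show ?case
    using trail_nth_follows[OF assms(1) Suc.prems(1)] trail_nth_follows[OF assms(2) Suc.prems(2)]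
      follows_unique[of "gs ! Suc n" "hs ! Suc n" "gs ! n"] by simp
qed

lemma trail_unique:
  assumes "trail S gs" "trail S hs" "hd gs = hd hs" "stuck S (last gs)" "stuck S (last hs)"
  shows "gs = hs"
proof -
  have le: "length hs \<le> length gs"
    if "trail S gs" "trail S hs" "hd gs = hd hs" "stuck S (last gs)" for gs hs
  proof (rule ccontr)
    assume "\<not> length hs \<le> length gs"
    then have less: "length gs < length hs" by simp
    have "gs \<noteq> []" using that by (simp add: trail_def)
    then have "last gs = hs ! (length gs - 1)"
      using trail_prefix[OF that(1-3), of "length gs - 1"] less by (simp add: last_conv_nth)
    moreover have "follows (hs ! (length gs - 1)) (hs ! length gs)"
      using trail_nth_follows[OF that(2), of "length gs - 1"] less \<open>gs \<noteq> []\<close> by simp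
    moreover have "hs ! length gs \<in> S" using that(2) less by (auto simp: trail_def)
    ultimately show False using that(4) by (auto simp: stuck_def)
  qed
  have "length gs = length hs"
    using le[of gs hs] le[of hs gs] assms by simp
  then show ?thesis
    using trail_prefix[OF assms(1-3)] by (intro nth_equalityI) auto
qed

lemma trail_unique_through:
  assumes "trail S gs" "trail S hs" "g \<in> set gs" "g \<in> set hs"
    and "stuck S (last gs)" "stuck S (turn (hd gs))" "stuck S (last hs)" "stuck S (turn (hd hs))"
  shows "gs = hs"
proof -
  obtain a b where gs: "gs = a @ g # b" using assms(3) by (auto simp: in_set_conv_decomp)
  obtain c d where hs: "hs = c @ g # d" using assms(4) by (auto simp: in_set_conv_decomp)
  have "trail S (g # b)" "trail S (g # d)"
    using assms(1,2) trail_append[of a "g # b"] trail_append[of c "g # d"] unfolding gs hs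
    by (cases "a = []"; cases "c = []"; simp)+
  then have 1: "g # b = g # d"
    by (rule trail_unique) (use assms(5,7) in \<open>auto simp: gs hs\<close>)
  have "trail S (a @ [g])" "trail S (c @ [g])"
    using assms(1,2) trail_append[of "a @ [g]" b] trail_append[of "c @ [g]" d] unfolding gs hs
    by (cases "b = []"; cases "d = []"; simp)+
  then have "trail S (backwards (a @ [g]))" "trail S (backwards (c @ [g]))"
    using trail_backwards by blast+
  then have "backwards (a @ [g]) = backwards (c @ [g])"
  proof (rule trail_unique)
    show "stuck S (last (backwards (a @ [g])))" "stuck S (last (backwards (c @ [g])))"
      using assms(6,8) by (cases a; cases c; simp add: gs hs)+
  qed simp
  then have "a @ [g] = c @ [g]" by (metis backwards_simps(4))
  with 1 show ?thesis by (simp add: gs hs)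
qed

text \<open>
  A trail without predecessor has no repetitions, so its length is bounded by the number of segments.
\<close>

lemma ex_maximal_trail:
  assumes "finite S" "g \<in> S" "stuck S (turn g)"
  obtains gs where "trail S gs" "hd gs = g" "stuck S (last gs)"
proof -
  define T where "T = {gs. trail S gs \<and> hd gs = g}"
  have bound: "length gs \<le> card S" if "gs \<in> T" for gs
  proof -
    have "distinct gs"
      unfolding distinct_conv_nth
    proof (intro allI impI)
      fix i j assume ij: "i < length gs" "j < length gs" "i \<noteq> j"
      have *: "trail S gs" "stuck S (turn (hd gs))" using that assms(3) by (simp_all add: T_def)
      from ij(3) consider "i < j" | "j < i" by linarith
      then show "gs ! i \<noteq> gs ! j"
        using trail_no_repeat[OF *, of i j] trail_no_repeat[OF *, of j i] ij by cases auto
    qed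
    then have "length gs = card (set gs)" by (simp add: distinct_card)
    also have "\<dots> \<le> card S"
      using that assms(1) by (intro card_mono) (auto simp: T_def trail_def)
    finally show ?thesis .
  qed
  have "[g] \<in> T" using assms(2) by (simp add: T_def)
  moreover have "\<forall>hs. hs \<in> T \<longrightarrow> length hs < Suc (card S)"
    using bound by (simp add: less_Suc_eq_le)
  ultimately obtain gs where gs: "gs \<in> T" "\<And>hs. hs \<in> T \<Longrightarrow> length hs \<le> length gs"
    using ex_has_greatest_nat[of "\<lambda>gs. gs \<in> T" "[g]" length "Suc (card S)"] by blast
  have "stuck S (last gs)"
  proof (rule ccontr)
    assume "\<not> stuck S (last gs)"
    then obtain g' where "g' \<in> S" "follows (last gs) g'" by (auto simp: stuck_def)
    then have "gs @ [g'] \<in> T"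
      using gs(1) trail_append[of gs "[g']" S] by (auto simp: T_def trail_def)
    from gs(2)[OF this] show False by simp
  qed
  then show ?thesis using that gs(1) by (auto simp: T_def)
qed

end

lemma walk_imp_trail:
  assumes "walk d\<^sub>1 d\<^sub>2 h x w js h' y"
  shows "\<exists>gs. trail (segments d\<^sub>1 d\<^sub>2) gs \<and> seg_half (hd gs) = h \<and> seg_from (hd gs) = x \<and>
    trail_word gs = w \<and> map seg_from (tl gs) = map Mid js \<and>
    seg_half (last gs) = h' \<and> seg_to (last gs) = y"
  using assms
proof induction
  case (single h x w y)
  then show ?case by (intro exI[of _ "[(h, x, w, y)]"]) simp
next
  case (extend h x w i h' w' js h'' y)
  then obtain gs where gs: "trail (segments d\<^sub>1 d\<^sub>2) gs" "seg_half (hd gs) = h'"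
    "seg_from (hd gs) = Mid i" "trail_word gs = w'" "map seg_from (tl gs) = map Mid js"
    "seg_half (last gs) = h''" "seg_to (last gs) = y" by blast
  have "gs \<noteq> []" using gs by (simp add: trail_def)
  then have "map seg_from gs = map Mid (i # js)" using gs(3,5) by (cases gs) auto
  then show ?case
    using gs extend.hyps \<open>gs \<noteq> []\<close>
    by (intro exI[of _ "(h, x, w, Mid i) # gs"]) (auto simp: trail_Cons follows_def)
qed

lemma trail_imp_walk:
  assumes "trail (segments d\<^sub>1 d\<^sub>2) gs"
  shows "\<exists>js. map seg_from (tl gs) = map Mid js \<and>
    walk d\<^sub>1 d\<^sub>2 (seg_half (hd gs)) (seg_from (hd gs)) (trail_word gs) js (seg_half (last gs)) (seg_to (last gs))"
  using assms
proof (induction gs)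
  case (Cons g gs)
  obtain h x w y where g: "g = (h, x, w, y)" by (cases g)
  show ?case
  proof (cases "gs = []")
    case True
    then show ?thesis using Cons.prems by (auto simp: g intro: walk.single)
  next
    case False
    then have *: "g \<in> segments d\<^sub>1 d\<^sub>2" "trail (segments d\<^sub>1 d\<^sub>2) gs" "follows g (hd gs)"
      using Cons.prems by (auto simp: trail_Cons)
    then obtain i where i: "y = Mid i" "seg_from (hd gs) = Mid i" "seg_half (hd gs) \<noteq> h"
      by (auto simp: follows_def g)
    obtain js where js: "map seg_from (tl gs) = map Mid js"
      "walk d\<^sub>1 d\<^sub>2 (seg_half (hd gs)) (seg_from (hd gs)) (trail_word gs) js (seg_half (last gs)) (seg_to (last gs))"
      using Cons.IH * by blast
    have "walk d\<^sub>1 d\<^sub>2 h x (w @ trail_word gs) (i # js) (seg_half (last gs)) (seg_to (last gs))"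
      using js(2) i * unfolding g by (intro walk.extend) auto
    moreover have "map seg_from gs = map Mid (i # js)"
      using False i js(1) by (cases gs) auto
    ultimately show ?thesis using False g by (intro exI[of _ "i # js"]) auto
  qed
qed (simp add: trail_def)

definition lines_of :: "segment set \<Rightarrow> diagram" where
  "lines_of S = {(a, w, b). precedes a b \<and>
     (\<exists>gs. trail S gs \<and> seg_from (hd gs) = outer_spot a \<and> seg_to (last gs) = outer_spot b \<and>
       trail_word gs = w)}"

text \<open>
  The representative of a loop in \<open>stack_loops\<close>: cut open at its smallest glued vertex \<open>i\<close> and
  traversed through the upper half first.
\<close>

definition loop_at :: "segment set \<Rightarrow> nat \<Rightarrow> segment list \<Rightarrow> bool" where
  "loop_at S i gs \<longleftrightarrow> trail S gs \<and> follows (last gs) (hd gs) \<and> seg_half (hd gs) = Upper \<and>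
     seg_from (hd gs) = Mid i \<and> (\<forall>g \<in> set (tl gs). \<forall>j. seg_from g = Mid j \<longrightarrow> i < j)"

definition loops_of :: "segment set \<Rightarrow> (nat \<times> blob list) set" where
  "loops_of S = {(i, w). \<exists>gs. loop_at S i gs \<and> trail_word gs = w}"

lemma stack_lines_eq: "stack_lines d\<^sub>1 d\<^sub>2 = lines_of (segments d\<^sub>1 d\<^sub>2)"
proof -
  have "(\<exists>h js h'. walk d\<^sub>1 d\<^sub>2 h x w js h' y) \<longleftrightarrow>
    (\<exists>gs. trail (segments d\<^sub>1 d\<^sub>2) gs \<and> seg_from (hd gs) = x \<and> seg_to (last gs) = y \<and> trail_word gs = w)"
    (is "?L \<longleftrightarrow> ?R") for x w y
  proof
    assume ?L
    then obtain h js h' where "walk d\<^sub>1 d\<^sub>2 h x w js h' y" by blast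
    from walk_imp_trail[OF this] show ?R by blast
  next
    assume ?R
    then obtain gs where gs: "trail (segments d\<^sub>1 d\<^sub>2) gs" "seg_from (hd gs) = x" "seg_to (last gs) = y"
      "trail_word gs = w" by blast
    from trail_imp_walk[OF gs(1)] show ?L unfolding gs by blast
  qed
  then show ?thesis unfolding stack_lines_def lines_of_def by simp
qed

lemma stack_loops_eq: "stack_loops d\<^sub>1 d\<^sub>2 = loops_of (segments d\<^sub>1 d\<^sub>2)"
proof (intro equalityI subsetI; clarify)
  fix i w assume "(i, w) \<in> stack_loops d\<^sub>1 d\<^sub>2"
  then obtain js where js: "walk d\<^sub>1 d\<^sub>2 Upper (Mid i) w js Lower (Mid i)" "\<forall>j \<in> set js. i < j"
    by (auto simp: stack_loops_def)
  obtain gs where gs: "trail (segments d\<^sub>1 d\<^sub>2) gs" "seg_half (hd gs) = Upper" "seg_from (hd gs) = Mid i"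
    "trail_word gs = w" "map seg_from (tl gs) = map Mid js"
    "seg_half (last gs) = Lower" "seg_to (last gs) = Mid i"
    using walk_imp_trail[OF js(1)] by blast
  have "i < j" if "g \<in> set (tl gs)" "seg_from g = Mid j" for g j
  proof -
    have "Mid j \<in> set (map seg_from (tl gs))" using that by force
    then show ?thesis using gs(5) js(2) by auto
  qed
  then show "(i, w) \<in> loops_of (segments d\<^sub>1 d\<^sub>2)"
    using gs by (auto simp: loops_of_def loop_at_def follows_def intro!: exI[of _ gs])
next
  fix i w assume "(i, w) \<in> loops_of (segments d\<^sub>1 d\<^sub>2)"
  then obtain gs where gs: "loop_at (segments d\<^sub>1 d\<^sub>2) i gs" "trail_word gs = w"
    by (auto simp: loops_of_def)
  have "seg_half (last gs) = Lower" "seg_to (last gs) = Mid i"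
    using gs half_eqI[of "seg_half (last gs)" Upper Lower] by (auto simp: loop_at_def follows_def)
  moreover obtain js where js: "map seg_from (tl gs) = map Mid js"
    "walk d\<^sub>1 d\<^sub>2 (seg_half (hd gs)) (seg_from (hd gs)) (trail_word gs) js (seg_half (last gs)) (seg_to (last gs))"
    using trail_imp_walk[of d\<^sub>1 d\<^sub>2 gs] gs(1) unfolding loop_at_def by blast
  moreover have "i < j" if j: "j \<in> set js" for j
  proof -
    have "Mid j \<in> set (map seg_from (tl gs))" using j js(1) by simp
    then show ?thesis using gs(1) by (auto simp: loop_at_def)
  qed
  ultimately show "(i, w) \<in> stack_loops d\<^sub>1 d\<^sub>2"
    using gs by (auto simp: stack_loops_def loop_at_def)
qed

section \<open>Drawings of the two stacked diagrams\<close>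

text \<open>
  The lines in either reading direction; this is the form in which they occur as segments.
\<close>

definition both_ways :: "diagram \<Rightarrow> diagram" where
  "both_ways d = {(a, w, b). (a, w, b) \<in> d \<or> (b, rev w, a) \<in> d}"

lemma both_ways_reverse: "(a, w, b) \<in> both_ways d \<Longrightarrow> (b, rev w, a) \<in> both_ways d"
  by (auto simp: both_ways_def)

lemma precedes_antisym: "precedes a b \<Longrightarrow> \<not> precedes b a"
  by (cases a; cases b) auto

lemma precedes_total: "a \<noteq> b \<Longrightarrow> precedes a b \<or> precedes b a"
  by (cases a; cases b) auto

context
  fixes m d assumes pv: "pairs_vertices m d"
begin

lemma line_vertices: "(a, w, b) \<in> d \<Longrightarrow> a \<in> vertices m \<and> b \<in> vertices m \<and> precedes a b"
  using pv unfolding pairs_vertices_def by blast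

lemma line_at_vertex_unique:
  assumes "l \<in> d" "l' \<in> d" "v \<in> line_ends l" "v \<in> line_ends l'"
  shows "l = l'"
proof -
  have "v \<in> vertices m" using line_vertices assms(1,3) by (cases l) auto
  then have "\<exists>!l. l \<in> d \<and> v \<in> line_ends l" using pv unfolding pairs_vertices_def by blast
  then show ?thesis using assms by blast
qed

lemma both_ways_vertices: "(a, w, b) \<in> both_ways d \<Longrightarrow> a \<in> vertices m \<and> b \<in> vertices m \<and> a \<noteq> b"
  using line_vertices[of a w b] line_vertices[of b "rev w" a] precedes_antisym
  unfolding both_ways_def by blast

lemma both_ways_unique:
  assumes "(a, w, b) \<in> both_ways d" "(a, w', b') \<in> both_ways d"
  shows "w = w' \<and> b = b'"
proof -
  obtain l where l: "l \<in> d" "l = (a, w, b) \<or> l = (b, rev w, a)"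
    using assms(1) unfolding both_ways_def by blast
  obtain l' where l': "l' \<in> d" "l' = (a, w', b') \<or> l' = (b', rev w', a)"
    using assms(2) unfolding both_ways_def by blast
  have "l = l'" by (rule line_at_vertex_unique[of l l' a]) (use l l' in auto)
  then show ?thesis using l l' both_ways_vertices[OF assms(1)] by auto
qed

lemma both_ways_ex: "v \<in> vertices m \<Longrightarrow> \<exists>w b. (v, w, b) \<in> both_ways d"
proof -
  assume "v \<in> vertices m"
  then obtain l where "l \<in> d" "v \<in> line_ends l" using pv unfolding pairs_vertices_def by blast
  then show ?thesis
    unfolding both_ways_def by (cases l) (auto, metis rev_rev_ident)
qed

lemma both_ways_same_ends:
  assumes "(a, w, b) \<in> both_ways d" "(a', w', b') \<in> both_ways d" "{a, b} \<inter> {a', b'} \<noteq> {}"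
  shows "(a', w', b') = (a, w, b) \<or> (a', w', b') = (b, rev w, a)"
proof -
  from assms(3) consider "a' = a" | "a' = b" | "b' = a" | "b' = b" by auto
  then show ?thesis
  proof cases
    case 1
    then show ?thesis using both_ways_unique[of a w b w' b'] assms by simp
  next
    case 2
    then show ?thesis
      using both_ways_unique[of b "rev w" a w' b'] both_ways_reverse[OF assms(1)] assms by auto
  next
    case 3
    then show ?thesis
      using both_ways_unique[of a w b "rev w'" a'] both_ways_reverse[OF assms(2)] assms by auto
  next
    case 4
    then show ?thesis
      using both_ways_unique[of b "rev w" a "rev w'" a'] both_ways_reverse[OF assms(1)]
        both_ways_reverse[OF assms(2)] by auto
  qed
qed

end

lemma position_inj:
  assumes "v \<in> vertices m" "v' \<in> vertices m" "position m v = position m v'"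
  shows "v = v'"
proof -
  have "position m v \<le> real m" if "v = North i" for i using that assms(1) by (auto simp: vertices_def)
  moreover have "position m v' \<le> real m" if "v' = North i" for i
    using that assms(2) by (auto simp: vertices_def)
  moreover have "position m v \<ge> real m + 1" if "v = South i" for i
    using that assms(1) by (auto simp: vertices_def)
  moreover have "position m v' \<ge> real m + 1" if "v' = South i" for i
    using that assms(2) by (auto simp: vertices_def)
  ultimately show ?thesis using assms(3) by (cases v; cases v') fastforce+
qed

lemma position_not_blob_edge: "v \<in> vertices m \<Longrightarrow> position m v \<notin> blob_edge m b"
  by (cases v; cases b) (auto simp: vertices_def)

text \<open>
  Reading a line backwards reverses the numbering of its blobs.
\<close>

definition legs_of :: "diagram \<Rightarrow> (line \<Rightarrow> nat \<Rightarrow> real) \<Rightarrow> line \<Rightarrow> nat \<Rightarrow> real" where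
  "legs_of d \<phi> = (\<lambda>(a, w, b) k. if (a, w, b) \<in> d then \<phi> (a, w, b) k
     else \<phi> (b, rev w, a) (length w - 1 - k))"

lemma both_ways_legs:
  assumes pv: "pairs_vertices m d" and "deformable m d"
  obtains \<psi> where
    "\<And>a w b k. (a, w, b) \<in> both_ways d \<Longrightarrow> k < length w \<Longrightarrow> \<psi> (a, w, b) k \<in> blob_edge m (w ! k)"
    "\<And>a w b k k'. (a, w, b) \<in> both_ways d \<Longrightarrow> k < k' \<Longrightarrow> k' < length w \<Longrightarrow>
       \<psi> (a, w, b) k \<noteq> \<psi> (a, w, b) k' \<and>
       \<not> crossing (position m a) (\<psi> (a, w, b) k) (\<psi> (a, w, b) k') (position m b)"
    "\<And>a w b a' w' b'. (a, w, b) \<in> both_ways d \<Longrightarrow> (a', w', b') \<in> both_ways d \<Longrightarrow>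
       (a', w', b') \<noteq> (a, w, b) \<Longrightarrow> (a', w', b') \<noteq> (b, rev w, a) \<Longrightarrow>
       leaves m \<psi> (a, w, b) \<inter> leaves m \<psi> (a', w', b') = {} \<and>
       (\<forall>x \<in> leaves m \<psi> (a, w, b). \<forall>y \<in> leaves m \<psi> (a, w, b).
        \<forall>u \<in> leaves m \<psi> (a', w', b'). \<forall>v \<in> leaves m \<psi> (a', w', b'). \<not> crossing x y u v)"
proof -
  obtain \<phi> where edge: "\<forall>l \<in> d. \<forall>k < length (line_word l). \<phi> l k \<in> blob_edge m (line_word l ! k)"
    and inj: "inj_on (\<lambda>(l, k). \<phi> l k) (SIGMA l:d. {..<length (line_word l)})"
    and tree: "\<forall>(a, w, b) \<in> d. \<forall>k k'. k < k' \<and> k' < length w \<longrightarrow>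
           \<not> crossing (position m a) (\<phi> (a, w, b) k) (\<phi> (a, w, b) k') (position m b)"
    and apart: "\<forall>l \<in> d. \<forall>l' \<in> d. l \<noteq> l' \<longrightarrow>
           (\<forall>x \<in> leaves m \<phi> l. \<forall>y \<in> leaves m \<phi> l. \<forall>u \<in> leaves m \<phi> l'. \<forall>v \<in> leaves m \<phi> l'.
              \<not> crossing x y u v)"
    using \<open>deformable m d\<close> unfolding deformable_def by (elim exE conjE) (rule that; assumption)
  define \<psi> where "\<psi> = legs_of d \<phi>"
  have direct: "\<psi> (a, w, b) k = \<phi> (a, w, b) k" if "(a, w, b) \<in> d" for a w b k
    using that by (simp add: \<psi>_def legs_of_def)
  have reversed: "\<psi> (a, w, b) k = \<phi> (b, rev w, a) (length w - 1 - k)"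
    if "(b, rev w, a) \<in> d" for a w b k
  proof -
    have "(a, w, b) \<notin> d"
      using that line_vertices[OF pv, of a w b] line_vertices[OF pv that] precedes_antisym by blast
    then show ?thesis by (simp add: \<psi>_def legs_of_def)
  qed
  have leaves: "\<exists>l \<in> d. l \<in> {(a, w, b), (b, rev w, a)} \<and> leaves m \<psi> (a, w, b) = leaves m \<phi> l"
    if l: "(a, w, b) \<in> both_ways d" for a w b
  proof -
    consider "(a, w, b) \<in> d" | "(b, rev w, a) \<in> d" using l unfolding both_ways_def by blast
    then show ?thesis
    proof cases
      case 1
      have "leaves m \<psi> (a, w, b) = leaves m \<phi> (a, w, b)"
        unfolding leaves_def using direct[OF 1] by simp
      then show ?thesis using 1 by blast
    next
      case 2
      have "(\<lambda>k. length w - 1 - k) ` {..<length w} = {..<length w}"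
      proof (intro equalityI subsetI)
        fix k assume "k \<in> {..<length w}"
        then have "k = length w - 1 - (length w - 1 - k)" "length w - 1 - k < length w" by auto
        then show "k \<in> (\<lambda>k. length w - 1 - k) ` {..<length w}" by blast
      qed auto
      then have "\<psi> (a, w, b) ` {..<length w} = \<phi> (b, rev w, a) ` {..<length w}"
        using reversed[OF 2] by (metis (no_types, lifting) image_cong image_image)
      then have "leaves m \<psi> (a, w, b) = leaves m \<phi> (b, rev w, a)"
        unfolding leaves_def by auto
      then show ?thesis using 2 by blast
    qed
  qed
  have inj': "\<phi> l k \<noteq> \<phi> l' k'"
    if "l \<in> d" "l' \<in> d" "k < length (line_word l)" "k' < length (line_word l')" "l \<noteq> l' \<or> k \<noteq> k'"
    for l l' k k'
    using inj_onD[OF inj, of "(l, k)" "(l', k')"] that by auto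
  show thesis
  proof (rule that[of \<psi>])
    fix a w b k assume l: "(a, w, b) \<in> both_ways d" and k: "k < length w"
    then consider "(a, w, b) \<in> d" | "(b, rev w, a) \<in> d" unfolding both_ways_def by blast
    then show "\<psi> (a, w, b) k \<in> blob_edge m (w ! k)"
    proof cases
      case 1
      then show ?thesis using edge k by (force simp: direct)
    next
      case 2
      have "\<phi> (b, rev w, a) (length w - 1 - k) \<in> blob_edge m (rev w ! (length w - 1 - k))"
        using edge 2 k by force
      moreover have "rev w ! (length w - 1 - k) = w ! k"
        using k by (simp add: rev_nth)
      ultimately show ?thesis using reversed[OF 2] by simp
    qed
  next
    fix a w b k k' assume l: "(a, w, b) \<in> both_ways d" and k: "k < k'" "k' < length w"
    then consider "(a, w, b) \<in> d" | "(b, rev w, a) \<in> d" unfolding both_ways_def by blast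
    then show "\<psi> (a, w, b) k \<noteq> \<psi> (a, w, b) k' \<and>
       \<not> crossing (position m a) (\<psi> (a, w, b) k) (\<psi> (a, w, b) k') (position m b)"
    proof cases
      case 1
      then show ?thesis using tree k inj'[of "(a, w, b)" "(a, w, b)" k k'] by (auto simp: direct)
    next
      case 2
      define n n' where "n = length w - 1 - k'" and "n' = length w - 1 - k"
      have n: "n < n'" "n' < length w" using k by (auto simp: n_def n'_def)
      have ne: "\<phi> (b, rev w, a) n \<noteq> \<phi> (b, rev w, a) n'"
        using inj'[of "(b, rev w, a)" "(b, rev w, a)" n n'] 2 n by auto
      have nc: "\<not> crossing (position m b) (\<phi> (b, rev w, a) n) (\<phi> (b, rev w, a) n') (position m a)"
        using tree 2 n by auto
      have in_edge: "\<phi> (b, rev w, a) n \<in> blob_edge m (rev w ! n)"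
        "\<phi> (b, rev w, a) n' \<in> blob_edge m (rev w ! n')"
        using edge 2 n by force+
      have V: "a \<in> vertices m" "b \<in> vertices m" "a \<noteq> b" using both_ways_vertices[OF pv l] by auto
      have D: "position m b \<notin> {\<phi> (b, rev w, a) n', position m a}"
        "\<phi> (b, rev w, a) n \<notin> {\<phi> (b, rev w, a) n', position m a}"
        "position m a \<notin> {\<phi> (b, rev w, a) n, position m b}"
        "\<phi> (b, rev w, a) n' \<notin> {\<phi> (b, rev w, a) n, position m b}"
        using ne position_inj[OF V(1,2)] V(3) position_not_blob_edge[OF V(1), of "rev w ! n"]
          position_not_blob_edge[OF V(2), of "rev w ! n'"]
          position_not_blob_edge[OF V(1), of "rev w ! n'"]
          position_not_blob_edge[OF V(2), of "rev w ! n"] in_edge by auto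
      have "\<not> crossing (position m a) (\<phi> (b, rev w, a) n') (\<phi> (b, rev w, a) n) (position m b)"
        using nc D unfolding crossing_iff_separates[OF D(1,2)] crossing_iff_separates[OF D(3,4)] separates_def
        by (auto simp: not_less_iff_gr_or_eq)
      then show ?thesis using ne reversed[OF 2] by (simp add: n_def n'_def)
    qed
  next
    fix a w b a' w' b'
    assume l: "(a, w, b) \<in> both_ways d" "(a', w', b') \<in> both_ways d"
      and ne: "(a', w', b') \<noteq> (a, w, b)" "(a', w', b') \<noteq> (b, rev w, a)"
    obtain l1 where l1: "l1 \<in> d" "l1 \<in> {(a, w, b), (b, rev w, a)}"
      "leaves m \<psi> (a, w, b) = leaves m \<phi> l1" using leaves[OF l(1)] by blast
    obtain l2 where l2: "l2 \<in> d" "l2 \<in> {(a', w', b'), (b', rev w', a')}"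
      "leaves m \<psi> (a', w', b') = leaves m \<phi> l2" using leaves[OF l(2)] by blast
    have ends: "{a, b} \<inter> {a', b'} = {}"
      using both_ways_same_ends[OF pv l] ne by blast
    then have "l1 \<noteq> l2" using l1(2) l2(2) by auto
    have "leaves m \<phi> l1 \<inter> leaves m \<phi> l2 = {}"
    proof -
      have e1: "line_ends l1 = {a, b}" and e2: "line_ends l2 = {a', b'}" using l1(2) l2(2) by auto
      have V: "{a, b} \<subseteq> vertices m" "{a', b'} \<subseteq> vertices m"
        using both_ways_vertices[OF pv] l by auto
      have in1: "\<exists>b. \<phi> l1 k \<in> blob_edge m b" if "k < length (line_word l1)" for k
        using edge l1(1) that by blast
      have in2: "\<exists>b. \<phi> l2 k \<in> blob_edge m b" if "k < length (line_word l2)" for k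
        using edge l2(1) that by blast
      have False if z: "z \<in> leaves m \<phi> l1" "z \<in> leaves m \<phi> l2" for z
      proof -
        have 1: "(\<exists>v. v \<in> {a, b} \<and> z = position m v) \<or> (\<exists>k < length (line_word l1). z = \<phi> l1 k)"
          using z(1) unfolding leaves_def e1 by blast
        have 2: "(\<exists>v. v \<in> {a', b'} \<and> z = position m v) \<or> (\<exists>k < length (line_word l2). z = \<phi> l2 k)"
          using z(2) unfolding leaves_def e2 by blast
        from 1 2 show False
        proof (elim disjE exE conjE)
          fix v v' assume *: "v \<in> {a, b}" "z = position m v" "v' \<in> {a', b'}" "z = position m v'"
          then have "v = v'" using position_inj[of v m v'] V by auto
          then show False using * ends by blast
        next
          fix v k assume *: "v \<in> {a, b}" "z = position m v" "k < length (line_word l2)" "z = \<phi> l2 k"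
          have "v \<in> vertices m" using * V by blast
          then show False using position_not_blob_edge[of v m] in2[OF *(3)] *(2,4) by auto
        next
          fix v k assume *: "v \<in> {a', b'}" "z = position m v" "k < length (line_word l1)" "z = \<phi> l1 k"
          have "v \<in> vertices m" using * V by blast
          then show False using position_not_blob_edge[of v m] in1[OF *(3)] *(2,4) by auto
        next
          fix k k' assume *: "k < length (line_word l1)" "z = \<phi> l1 k" "k' < length (line_word l2)" "z = \<phi> l2 k'"
          then show False using inj'[OF l1(1) l2(1) *(1,3)] \<open>l1 \<noteq> l2\<close> by auto
        qed
      qed
      then show ?thesis by blast
    qed
    then show "leaves m \<psi> (a, w, b) \<inter> leaves m \<psi> (a', w', b') = {} \<and>
       (\<forall>x \<in> leaves m \<psi> (a, w, b). \<forall>y \<in> leaves m \<psi> (a, w, b).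
        \<forall>u \<in> leaves m \<psi> (a', w', b'). \<forall>v \<in> leaves m \<psi> (a', w', b'). \<not> crossing x y u v)"
      using apart l1 l2 \<open>l1 \<noteq> l2\<close> by simp
  qed
qed

text \<open>
  The conditions of \<open>deformable\<close>, for the lines in either reading direction.
\<close>

definition drawn :: "nat \<Rightarrow> diagram \<Rightarrow> (line \<Rightarrow> nat \<Rightarrow> real) \<Rightarrow> bool" where
  "drawn m d \<psi> \<longleftrightarrow>
    (\<forall>a w b k. (a, w, b) \<in> both_ways d \<longrightarrow> k < length w \<longrightarrow> \<psi> (a, w, b) k \<in> blob_edge m (w ! k)) \<and>
    (\<forall>a w b k k'. (a, w, b) \<in> both_ways d \<longrightarrow> k < k' \<longrightarrow> k' < length w \<longrightarrow>
       \<psi> (a, w, b) k \<noteq> \<psi> (a, w, b) k' \<and>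
       \<not> crossing (position m a) (\<psi> (a, w, b) k) (\<psi> (a, w, b) k') (position m b)) \<and>
    (\<forall>a w b a' w' b'. (a, w, b) \<in> both_ways d \<longrightarrow> (a', w', b') \<in> both_ways d \<longrightarrow>
       (a', w', b') \<noteq> (a, w, b) \<longrightarrow> (a', w', b') \<noteq> (b, rev w, a) \<longrightarrow>
       leaves m \<psi> (a, w, b) \<inter> leaves m \<psi> (a', w', b') = {} \<and>
       (\<forall>x \<in> leaves m \<psi> (a, w, b). \<forall>y \<in> leaves m \<psi> (a, w, b).
        \<forall>u \<in> leaves m \<psi> (a', w', b'). \<forall>v \<in> leaves m \<psi> (a', w', b'). \<not> crossing x y u v))"

lemma ex_drawn:
  assumes "pairs_vertices m d" "deformable m d"
  shows "\<exists>\<psi>. drawn m d \<psi>"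
  using assms
proof (rule both_ways_legs)
  fix \<psi>
  assume 1: "\<And>a w b k. (a, w, b) \<in> both_ways d \<Longrightarrow> k < length w \<Longrightarrow> \<psi> (a, w, b) k \<in> blob_edge m (w ! k)"
    and 2: "\<And>a w b k k'. (a, w, b) \<in> both_ways d \<Longrightarrow> k < k' \<Longrightarrow> k' < length w \<Longrightarrow>
       \<psi> (a, w, b) k \<noteq> \<psi> (a, w, b) k' \<and>
       \<not> crossing (position m a) (\<psi> (a, w, b) k) (\<psi> (a, w, b) k') (position m b)"
    and 3: "\<And>a w b a' w' b'. (a, w, b) \<in> both_ways d \<Longrightarrow> (a', w', b') \<in> both_ways d \<Longrightarrow>
       (a', w', b') \<noteq> (a, w, b) \<Longrightarrow> (a', w', b') \<noteq> (b, rev w, a) \<Longrightarrow>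
       leaves m \<psi> (a, w, b) \<inter> leaves m \<psi> (a', w', b') = {} \<and>
       (\<forall>x \<in> leaves m \<psi> (a, w, b). \<forall>y \<in> leaves m \<psi> (a, w, b).
        \<forall>u \<in> leaves m \<psi> (a', w', b'). \<forall>v \<in> leaves m \<psi> (a', w', b'). \<not> crossing x y u v)"
  have "drawn m d \<psi>"
    unfolding drawn_def by (intro conjI[OF _ conjI] allI impI; (rule 1 2 3; assumption)?)
  then show ?thesis by blast
qed

lemma drawn_edge:
  "drawn m d \<psi> \<Longrightarrow> (a, w, b) \<in> both_ways d \<Longrightarrow> k < length w \<Longrightarrow> \<psi> (a, w, b) k \<in> blob_edge m (w ! k)"
  unfolding drawn_def by (drule conjunct1, drule spec[of _ a], drule spec[of _ w], drule spec[of _ b], drule spec[of _ k]) simp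

lemma drawn_tree:
  "drawn m d \<psi> \<Longrightarrow> (a, w, b) \<in> both_ways d \<Longrightarrow> k < k' \<Longrightarrow> k' < length w \<Longrightarrow>
    \<psi> (a, w, b) k \<noteq> \<psi> (a, w, b) k' \<and>
    \<not> crossing (position m a) (\<psi> (a, w, b) k) (\<psi> (a, w, b) k') (position m b)"
  unfolding drawn_def by (drule conjunct2, drule conjunct1, drule spec[of _ a], drule spec[of _ w], drule spec[of _ b], drule spec[of _ k], drule spec[of _ k']) simp

lemma drawn_apart:
  "drawn m d \<psi> \<Longrightarrow> (a, w, b) \<in> both_ways d \<Longrightarrow> (a', w', b') \<in> both_ways d \<Longrightarrow>
    (a', w', b') \<noteq> (a, w, b) \<Longrightarrow> (a', w', b') \<noteq> (b, rev w, a) \<Longrightarrow>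
    leaves m \<psi> (a, w, b) \<inter> leaves m \<psi> (a', w', b') = {} \<and>
    (\<forall>x \<in> leaves m \<psi> (a, w, b). \<forall>y \<in> leaves m \<psi> (a, w, b).
     \<forall>u \<in> leaves m \<psi> (a', w', b'). \<forall>v \<in> leaves m \<psi> (a', w', b'). \<not> crossing x y u v)"
  unfolding drawn_def by (drule conjunct2, drule conjunct2, drule spec[of _ a], drule spec[of _ w], drule spec[of _ b], drule spec[of _ a'], drule spec[of _ w'], drule spec[of _ b'],
    (drule mp, assumption)+, assumption)

fun half_spot :: "half \<Rightarrow> vertex \<Rightarrow> spot" where
  "half_spot Upper v = upper_spot v"
| "half_spot Lower v = lower_spot v"

text \<open>
  Inverse to \<open>half_spot h\<close>; the spots that do not belong to the half \<open>h\<close> get the index \<open>0\<close>, which no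
  vertex has.
\<close>

fun half_vertex :: "half \<Rightarrow> spot \<Rightarrow> vertex" where
  "half_vertex Upper (Top i) = North i"
| "half_vertex Upper (Mid i) = South i"
| "half_vertex Upper (Bot i) = South 0"
| "half_vertex Lower (Top i) = North 0"
| "half_vertex Lower (Mid i) = North i"
| "half_vertex Lower (Bot i) = South i"

lemma half_vertex_spot [simp]: "half_vertex h (half_spot h v) = v"
  by (cases h; cases v) auto

lemma half_spot_eq [simp]: "half_spot h a = half_spot h b \<longleftrightarrow> a = b"
  by (cases h; cases a; cases b) auto

fun in_half :: "half \<Rightarrow> 'a \<Rightarrow> 'a \<Rightarrow> 'a" where
  "in_half Upper x y = x"
| "in_half Lower x y = y"

lemma segments_iff:
  "(h, x, w, y) \<in> segments d\<^sub>1 d\<^sub>2 \<longleftrightarrow>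
    (\<exists>a b. x = half_spot h a \<and> y = half_spot h b \<and> (a, w, b) \<in> both_ways (in_half h d\<^sub>1 d\<^sub>2))"
proof (cases h)
  case Upper
  then show ?thesis unfolding segments_def both_ways_def by simp
next
  case Lower
  then show ?thesis unfolding segments_def both_ways_def by simp
qed

lemma segments_system:
  assumes "pairs_vertices m d\<^sub>1" "pairs_vertices m d\<^sub>2"
  shows "segment_system (segments d\<^sub>1 d\<^sub>2)"
proof
  have pv: "pairs_vertices m (in_half h d\<^sub>1 d\<^sub>2)" for h using assms by (cases h) auto
  fix g assume g: "g \<in> segments d\<^sub>1 d\<^sub>2"
  obtain h x w y where [simp]: "g = (h, x, w, y)" by (cases g)
  obtain a b where ab: "x = half_spot h a" "y = half_spot h b" "(a, w, b) \<in> both_ways (in_half h d\<^sub>1 d\<^sub>2)"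
    using g by (auto simp: segments_iff)
  show "turn g \<in> segments d\<^sub>1 d\<^sub>2"
    using both_ways_reverse[OF ab(3)] ab(1,2) unfolding turn_def by (simp add: segments_iff)
  show "seg_from g \<noteq> seg_to g"
    using ab both_ways_vertices[OF pv ab(3)] by simp
  fix g' assume g': "g' \<in> segments d\<^sub>1 d\<^sub>2" "seg_half g = seg_half g'" "seg_from g = seg_from g'"
  then obtain w' y' where [simp]: "g' = (h, x, w', y')" by (cases g') auto
  obtain a' b' where ab': "x = half_spot h a'" "y' = half_spot h b'" "(a', w', b') \<in> both_ways (in_half h d\<^sub>1 d\<^sub>2)"
    using g' by (auto simp: segments_iff)
  have "a' = a" using ab(1) ab'(1) by simp
  then have "w = w' \<and> b = b'" using both_ways_unique[OF pv ab(3)] ab'(3) by simp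
  then show "g = g'" using ab(2) ab'(2) by simp
qed

lemma finite_diagram:
  assumes "pairs_vertices m d"
  shows "finite d"
proof -
  have "inj_on fst d"
  proof (rule inj_onI)
    fix l l' assume *: "l \<in> d" "l' \<in> d" "fst l = fst l'"
    then have "fst l \<in> line_ends l" "fst l \<in> line_ends l'" by (cases l; cases l'; simp)+
    then show "l = l'" using line_at_vertex_unique[OF assms] * by blast
  qed
  moreover have "fst l \<in> vertices m" if "l \<in> d" for l
    using line_vertices[OF assms] that by (cases l) auto
  then have "fst ` d \<subseteq> vertices m" by blast
  then have "finite (fst ` d)" by (rule finite_subset) (simp add: vertices_def)
  ultimately show ?thesis by (simp add: finite_image_iff)
qed

lemma finite_segments:
  assumes "pairs_vertices m d\<^sub>1" "pairs_vertices m d\<^sub>2"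
  shows "finite (segments d\<^sub>1 d\<^sub>2)"
proof -
  have fin: "finite (both_ways d)" if "finite d" for d
  proof (rule finite_subset)
    show "both_ways d \<subseteq> d \<union> (\<lambda>(a, w, b). (b, rev w, a)) ` d"
    proof clarify
      fix a w b assume "(a, w, b) \<in> both_ways d" "(a, w, b) \<notin> (\<lambda>(a, w, b). (b, rev w, a)) ` d"
      then show "(a, w, b) \<in> d"
        using image_eqI[of "(a, w, b)" "\<lambda>(a, w, b). (b, rev w, a)" "(b, rev w, a)" d]
        by (auto simp: both_ways_def)
    qed
    show "finite (d \<union> (\<lambda>(a, w, b). (b, rev w, a)) ` d)" using that by simp
  qed
  define f :: "half \<Rightarrow> line \<Rightarrow> segment"
    where "f h = (\<lambda>(a, w, b). (h, half_spot h a, w, half_spot h b))" for h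
  have "segments d\<^sub>1 d\<^sub>2 \<subseteq> f Upper ` both_ways d\<^sub>1 \<union> f Lower ` both_ways d\<^sub>2"
  proof
    fix g assume g: "g \<in> segments d\<^sub>1 d\<^sub>2"
    obtain h x w y where "g = (h, x, w, y)" by (cases g)
    then obtain a b where "g = f h (a, w, b)" "(a, w, b) \<in> both_ways (in_half h d\<^sub>1 d\<^sub>2)"
      using g by (auto simp: segments_iff f_def)
    then show "g \<in> f Upper ` both_ways d\<^sub>1 \<union> f Lower ` both_ways d\<^sub>2"
      by (cases h) auto
  qed
  then show ?thesis
    by (rule finite_subset) (simp add: fin[OF finite_diagram[OF assms(1)]] fin[OF finite_diagram[OF assms(2)]])
qed

definition top_mark :: "segment \<Rightarrow> nat" where
  "top_mark g = Suc (length (seg_word g))"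

text \<open>
  The boundary points met by the tree of a segment, in their order along the segment: its start,
  the ends of the arcs of its blobs, its end. Blobs are numbered from \<open>0\<close> and hence shifted by one.
\<close>

definition mark :: "nat \<Rightarrow> (segment \<Rightarrow> nat \<Rightarrow> real) \<Rightarrow> segment \<Rightarrow> nat \<Rightarrow> real" where
  "mark m \<psi> g k = (if k = 0 then position m (half_vertex (seg_half g) (seg_from g))
     else if k = top_mark g then position m (half_vertex (seg_half g) (seg_to g))
     else \<psi> g (k - 1))"

text \<open>
  Both diagrams of a stack can be drawn; their arcs are here attached to the segments of the stack.
\<close>

lemma segment_marks:
  assumes "d\<^sub>1 \<in> blob_diagrams m" "d\<^sub>2 \<in> blob_diagrams m"
  defines "S \<equiv> segments d\<^sub>1 d\<^sub>2"
  obtains \<psi> where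
    "\<And>g k. g \<in> S \<Longrightarrow> k < length (seg_word g) \<Longrightarrow> mark m \<psi> g (Suc k) \<in> blob_edge m (seg_word g ! k)"
    "\<And>g a b c d. g \<in> S \<Longrightarrow> a < b \<Longrightarrow> b < c \<Longrightarrow> c < d \<Longrightarrow> d \<le> top_mark g \<Longrightarrow>
      \<not> crossing (mark m \<psi> g a) (mark m \<psi> g b) (mark m \<psi> g c) (mark m \<psi> g d)"
    "\<And>g a b. g \<in> S \<Longrightarrow> a < b \<Longrightarrow> b \<le> top_mark g \<Longrightarrow> mark m \<psi> g a \<noteq> mark m \<psi> g b"
    "\<And>g g' a b c d. g \<in> S \<Longrightarrow> g' \<in> S \<Longrightarrow> seg_half g = seg_half g' \<Longrightarrow> g' \<noteq> g \<Longrightarrow> g' \<noteq> turn g \<Longrightarrow>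
      a \<le> top_mark g \<Longrightarrow> b \<le> top_mark g \<Longrightarrow> c \<le> top_mark g' \<Longrightarrow> d \<le> top_mark g' \<Longrightarrow>
      mark m \<psi> g a \<noteq> mark m \<psi> g' c \<and>
      \<not> crossing (mark m \<psi> g a) (mark m \<psi> g b) (mark m \<psi> g' c) (mark m \<psi> g' d)"
proof -
  define D where "D h = in_half h d\<^sub>1 d\<^sub>2" for h
  have D: "pairs_vertices m (D h)" "deformable m (D h)" "\<And>l. l \<in> D h \<Longrightarrow> line_word l \<in> line_words" for h
    using assms by (cases h; auto simp: D_def blob_diagrams_def loopless_pseudodiagrams_def)+
  define \<Psi> where "\<Psi> h = (SOME \<psi>. drawn m (D h) \<psi>)" for h
  have \<Psi>: "drawn m (D h) (\<Psi> h)" for h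
    unfolding \<Psi>_def using ex_drawn[OF D(1,2)[of h]] by (rule someI_ex)
  define line where "line g = (half_vertex (seg_half g) (seg_from g), seg_word g, half_vertex (seg_half g) (seg_to g))"
    for g :: segment
  define \<psi> where "\<psi> g k = \<Psi> (seg_half g) (line g) k" for g k
  have line: "line g \<in> both_ways (D (seg_half g))" if "g \<in> S" for g
    using that by (cases g) (auto simp: S_def segments_iff line_def D_def)
  have line_inj: "g = g'" if "g \<in> S" "g' \<in> S" "line g = line g'" "seg_half g = seg_half g'" for g g'
    using that by (cases g; cases g') (auto simp: S_def segments_iff line_def)
  have short: "length (seg_word g) \<le> 2" if "g \<in> S" for g
  proof -
    have "seg_word g \<in> line_words \<or> rev (seg_word g) \<in> line_words"
      using line[OF that] D(3) unfolding both_ways_def line_def by force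
    then show ?thesis by (auto simp: line_words_def dest: arg_cong[of _ _ length])
  qed
  have mark_leaf: "mark m \<psi> g k \<in> leaves m (\<Psi> (seg_half g)) (line g)" if "k \<le> top_mark g" for g k
    using that unfolding mark_def leaves_def top_mark_def line_def \<psi>_def by auto
  show thesis
  proof (rule that[of \<psi>])
    show edge: "mark m \<psi> g (Suc k) \<in> blob_edge m (seg_word g ! k)" if "g \<in> S" "k < length (seg_word g)" for g k
    proof -
      have "\<Psi> (seg_half g) (line g) k \<in> blob_edge m (seg_word g ! k)"
        using drawn_edge[OF \<Psi>[of "seg_half g"] line[OF that(1), unfolded line_def] that(2)]
        unfolding line_def .
      then show ?thesis using that(2) by (simp add: mark_def \<psi>_def top_mark_def)
    qed
    show "mark m \<psi> g a \<noteq> mark m \<psi> g b" if "g \<in> S" "a < b" "b \<le> top_mark g" for g a b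
    proof -
      have V: "half_vertex (seg_half g) (seg_from g) \<in> vertices m"
        "half_vertex (seg_half g) (seg_to g) \<in> vertices m"
        "half_vertex (seg_half g) (seg_from g) \<noteq> half_vertex (seg_half g) (seg_to g)"
        using both_ways_vertices[OF D(1), of _ _ _ "seg_half g"] line[OF that(1)] unfolding line_def by blast+
      have "b = top_mark g \<or> b < top_mark g" using that(3) by linarith
      then consider "a = 0" "b = top_mark g" | "a = 0" "b < top_mark g" | "a \<noteq> 0" "b = top_mark g"
        | "a \<noteq> 0" "b < top_mark g" by blast
      then show ?thesis
      proof cases
        case 1
        then show ?thesis using V position_inj[OF V(1,2)] by (auto simp: mark_def top_mark_def)
      next
        case 2
        then have "b - 1 < length (seg_word g)" using that(2) unfolding top_mark_def by linarith
        with 2 show ?thesis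
          using edge[OF that(1), of "b - 1"] position_not_blob_edge[OF V(1)] that(2)
          by (auto simp: mark_def top_mark_def)
      next
        case 3
        have "mark m \<psi> g (Suc (a - 1)) \<in> blob_edge m (seg_word g ! (a - 1))"
          by (rule edge) (use 3 that in \<open>auto simp: top_mark_def\<close>)
        moreover have "mark m \<psi> g b = position m (half_vertex (seg_half g) (seg_to g))"
          using 3 by (simp add: mark_def top_mark_def)
        ultimately show ?thesis
          using 3(1) position_not_blob_edge[OF V(2), of "seg_word g ! (a - 1)"] by auto
      next
        case 4
        have "\<Psi> (seg_half g) (line g) (a - 1) \<noteq> \<Psi> (seg_half g) (line g) (b - 1)"
          using drawn_tree[OF \<Psi>[of "seg_half g"] line[OF that(1), unfolded line_def], of "a - 1" "b - 1"] 4 that(2)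
          unfolding line_def top_mark_def by linarith
        then show ?thesis using 4 that(2) by (auto simp: mark_def \<psi>_def)
      qed
    qed
    show "\<not> crossing (mark m \<psi> g a) (mark m \<psi> g b) (mark m \<psi> g c) (mark m \<psi> g d)"
      if "g \<in> S" "a < b" "b < c" "c < d" "d \<le> top_mark g" for g a b c d
    proof -
      have *: "a = 0" "b = 1" "c = 2" "d = 3" "length (seg_word g) = 2"
        using short[OF that(1)] that(2-) unfolding top_mark_def by linarith+
      have "\<not> crossing (position m (half_vertex (seg_half g) (seg_from g))) (\<Psi> (seg_half g) (line g) 0)
        (\<Psi> (seg_half g) (line g) 1) (position m (half_vertex (seg_half g) (seg_to g)))"
        using drawn_tree[OF \<Psi>[of "seg_half g"] line[OF that(1), unfolded line_def], of 0 1] *(5)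
        unfolding line_def by simp
      then show ?thesis unfolding * by (simp add: mark_def top_mark_def *(5) \<psi>_def)
    qed
    fix g g' a b c d
    assume g: "g \<in> S" "g' \<in> S" "seg_half g = seg_half g'" "g' \<noteq> g" "g' \<noteq> turn g"
      and m: "a \<le> top_mark g" "b \<le> top_mark g" "c \<le> top_mark g'" "d \<le> top_mark g'"
    have "turn g \<in> S"
      using g(1) unfolding S_def by (intro segment_system.turn_closed[OF segments_system[of m]])
        (use assms in \<open>auto simp: blob_diagrams_def loopless_pseudodiagrams_def\<close>)
    then have "line g' \<noteq> line g" "line g' \<noteq> line (turn g)"
      using line_inj[of g' g] line_inj[of g' "turn g"] g by auto
    then have "leaves m (\<Psi> (seg_half g)) (line g) \<inter> leaves m (\<Psi> (seg_half g)) (line g') = {} \<and>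
       (\<forall>x \<in> leaves m (\<Psi> (seg_half g)) (line g). \<forall>y \<in> leaves m (\<Psi> (seg_half g)) (line g).
        \<forall>u \<in> leaves m (\<Psi> (seg_half g)) (line g'). \<forall>v \<in> leaves m (\<Psi> (seg_half g)) (line g'). \<not> crossing x y u v)"
      using drawn_apart[OF \<Psi>[of "seg_half g"] line[OF g(1), unfolded line_def]
          line[OF g(2), folded g(3), unfolded line_def]]
      unfolding line_def g(3)[symmetric] turn_simps by blast
    then show "mark m \<psi> g a \<noteq> mark m \<psi> g' c \<and>
      \<not> crossing (mark m \<psi> g a) (mark m \<psi> g b) (mark m \<psi> g' c) (mark m \<psi> g' d)"
      using mark_leaf[OF m(1)] mark_leaf[OF m(2)] mark_leaf[OF m(3)] mark_leaf[OF m(4)] g(3) by auto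
  qed
qed

lemma crossing_commute:
  assumes "x \<notin> {u, v}" "y \<notin> {u, v}"
  shows "crossing x y u v \<longleftrightarrow> crossing u v x y"
proof -
  have 1: "u \<notin> {x, y}" "v \<notin> {x, y}" using assms by auto
  have "\<not> a < b \<longleftrightarrow> b < a" if "a \<noteq> b" for a b :: real using that by auto
  then have "(x < u) = (\<not> u < x)" "(x < v) = (\<not> v < x)" "(y < u) = (\<not> u < y)" "(y < v) = (\<not> v < y)"
    using assms by auto
  then show ?thesis
    unfolding crossing_iff_separates[OF assms(1,2)] crossing_iff_separates[OF 1] separates_def
    by argo
qed

text \<open>
  The piece of a segment between two of its marks; at an inner mark the curve enters or leaves the
  segment along the arc of the blob.
\<close>

definition chord_of :: "nat \<Rightarrow> (segment \<Rightarrow> nat \<Rightarrow> real) \<Rightarrow> segment \<times> nat \<times> nat \<Rightarrow> chord" where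
  "chord_of m \<psi> = (\<lambda>(g, a, b). (seg_half g, mark m \<psi> g a, mark m \<psi> g b))"

text \<open>
  The part of the sequence \<open>G\<close> of segments from mark \<open>a\<close> of \<open>G t\<close> to mark \<open>b\<close> of \<open>G t'\<close>.
\<close>

fun subpath :: "(nat \<Rightarrow> segment) \<Rightarrow> nat \<times> nat \<Rightarrow> nat \<times> nat \<Rightarrow> (segment \<times> nat \<times> nat) list" where
  "subpath G (t, a) (t', b) =
     (if t = t' then [(G t, a, b)]
      else (G t, a, top_mark (G t)) # map (\<lambda>s. (G s, 0, top_mark (G s))) [Suc t..<t'] @ [(G t', 0, b)])"

lemma subpath_step:
  "t < t' \<Longrightarrow> subpath G (t, a) (t', b) = (G t, a, top_mark (G t)) # subpath G (Suc t, 0) (t', b)"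
  by (cases "Suc t = t'") (simp_all add: upt_conv_Cons)

lemma subpath_not_Nil [simp]: "subpath G (t, a) (t', b) \<noteq> []"
  by simp

lemma hd_subpath: "\<exists>c. hd (subpath G (t, a) (t', b)) = (G t, a, c)"
  by simp

lemma last_subpath: "\<exists>c. last (subpath G (t, a) (t', b)) = (G t', c, b)"
  by simp

lemma subpath_pieces:
  assumes "p \<in> set (subpath G (t, a) (t', b))" "t \<le> t'"
  shows "\<exists>s. t \<le> s \<and> s \<le> t' \<and>
    p = (G s, if s = t then a else 0, if s = t' then b else top_mark (G s))"
proof (cases "t = t'")
  case True
  then show ?thesis using assms by (intro exI[of _ t]) simp
next
  case False
  then consider "p = (G t, a, top_mark (G t))" | "p = (G t', 0, b)"
    | s where "s \<in> {Suc t..<t'}" "p = (G s, 0, top_mark (G s))"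
    using assms(1) unfolding subpath.simps by (auto simp del: subpath.simps)
  then show ?thesis
  proof cases
    case 1
    then show ?thesis using False assms(2) by (intro exI[of _ t]) simp
  next
    case 2
    then show ?thesis using False assms(2) by (intro exI[of _ t']) simp
  next
    case 3
    then show ?thesis using False assms(2) by (intro exI[of _ s]) simp
  qed
qed

text \<open>
  The eastern and the western edge of the whole stack.
\<close>

definition blob_zone :: "nat \<Rightarrow> blob \<Rightarrow> real set" where
  "blob_zone m b = (case b of BR \<Rightarrow> {real m <..< real m + 2} | BL \<Rightarrow> {2 * real m + 1 <..< 2 * real m + 3})"

lemma outer_pos_blob_edge:
  assumes "p \<in> blob_edge m b" "m \<ge> 1"
  shows "outer_point m h p" "outer_pos m h p \<in> blob_zone m b"
  using assms by (cases h; cases b; simp add: blob_zone_def)+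

lemma outer_pos_inj:
  assumes "p \<in> blob_edge m b" "q \<in> blob_edge m b" "outer_pos m h p = outer_pos m h' q" "m \<ge> 1"
  shows "h = h' \<and> p = q"
  using assms by (cases h; cases h'; cases b) (auto split: if_splits)

text \<open>
  The letters of the word of a trail are located by the index of a segment and a mark of this segment,
  in lexicographic order.
\<close>

lemma word_positions:
  "\<exists>loc. \<forall>n < length (trail_word gs).
     fst (loc n) < length gs \<and> 0 < snd (loc n) \<and> snd (loc n) < top_mark (gs ! fst (loc n)) \<and>
     trail_word gs ! n = seg_word (gs ! fst (loc n)) ! (snd (loc n) - 1) \<and>
     (\<forall>n' < n. fst (loc n') < fst (loc n) \<or> fst (loc n') = fst (loc n) \<and> snd (loc n') < snd (loc n))"
proof (induction gs rule: rev_induct)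
  case (snoc g gs)
  then obtain loc where loc: "\<forall>n < length (trail_word gs).
     fst (loc n) < length gs \<and> 0 < snd (loc n) \<and> snd (loc n) < top_mark (gs ! fst (loc n)) \<and>
     trail_word gs ! n = seg_word (gs ! fst (loc n)) ! (snd (loc n) - 1) \<and>
     (\<forall>n' < n. fst (loc n') < fst (loc n) \<or> fst (loc n') = fst (loc n) \<and> snd (loc n') < snd (loc n))"
    by blast
  define L where "L = length (trail_word gs)"
  define loc' where "loc' n = (if n < L then loc n else (length gs, Suc (n - L)))" for n
  show ?case
  proof (intro exI[of _ loc'] allI impI)
    fix n assume n: "n < length (trail_word (gs @ [g]))"
    show "fst (loc' n) < length (gs @ [g]) \<and> 0 < snd (loc' n) \<and>
      snd (loc' n) < top_mark ((gs @ [g]) ! fst (loc' n)) \<and>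
      trail_word (gs @ [g]) ! n = seg_word ((gs @ [g]) ! fst (loc' n)) ! (snd (loc' n) - 1) \<and>
      (\<forall>n' < n. fst (loc' n') < fst (loc' n) \<or> fst (loc' n') = fst (loc' n) \<and> snd (loc' n') < snd (loc' n))"
    proof (cases "n < L")
      case True
      then have old: "loc' n' = loc n'" if "n' \<le> n" for n' using that by (simp add: loc'_def)
      have *: "fst (loc n) < length gs \<and> 0 < snd (loc n) \<and> snd (loc n) < top_mark (gs ! fst (loc n)) \<and>
        trail_word gs ! n = seg_word (gs ! fst (loc n)) ! (snd (loc n) - 1) \<and>
        (\<forall>n' < n. fst (loc n') < fst (loc n) \<or> fst (loc n') = fst (loc n) \<and> snd (loc n') < snd (loc n))"
        using loc True unfolding L_def by blast
      have "trail_word (gs @ [g]) ! n = trail_word gs ! n" "(gs @ [g]) ! fst (loc n) = gs ! fst (loc n)"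
        using True * by (simp_all add: nth_append L_def)
      then show ?thesis using * old by simp
    next
      case False
      then have new: "loc' n = (length gs, Suc (n - L))" by (simp add: loc'_def)
      have "fst (loc' n') < length gs \<or> fst (loc' n') = length gs \<and> snd (loc' n') < Suc (n - L)" if "n' < n" for n'
      proof (cases "n' < L")
        case True
        then show ?thesis using loc by (simp add: loc'_def L_def)
      next
        case False
        then show ?thesis using that by (simp add: loc'_def)
      qed
      moreover have "trail_word (gs @ [g]) ! n = seg_word g ! (n - L)"
        using False by (simp add: nth_append L_def)
      moreover have "n - L < length (seg_word g)" using n False by (simp add: L_def)
      ultimately show ?thesis using new by (simp add: top_mark_def)
    qed
  qed
qed simp

locale stack_system = segment_system S for S +
  fixes m :: nat
  assumes mids: "g \<in> S \<Longrightarrow> seg_from g = Mid k \<Longrightarrow> k \<in> {1..m}"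
    and tops: "g \<in> S \<Longrightarrow> seg_from g = Top k \<Longrightarrow> seg_half g = Upper \<and> k \<in> {1..m}"
    and bots: "g \<in> S \<Longrightarrow> seg_from g = Bot k \<Longrightarrow> seg_half g = Lower \<and> k \<in> {1..m}"

text \<open>
  \<open>tree\<close> keeps apart two consecutive parts of the same segment, \<open>apart\<close> the trees of different
  lines of one half.
\<close>

locale drawn_stack = stack_system S m for S m +
  fixes \<psi> :: "segment \<Rightarrow> nat \<Rightarrow> real"
  assumes m_pos: "m \<ge> 1"
    and edge: "g \<in> S \<Longrightarrow> k < length (seg_word g) \<Longrightarrow> mark m \<psi> g (Suc k) \<in> blob_edge m (seg_word g ! k)"
    and tree: "g \<in> S \<Longrightarrow> a < b \<Longrightarrow> b < c \<Longrightarrow> c < d \<Longrightarrow> d \<le> top_mark g \<Longrightarrow>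
      \<not> crossing (mark m \<psi> g a) (mark m \<psi> g b) (mark m \<psi> g c) (mark m \<psi> g d)"
    and mark_inj: "g \<in> S \<Longrightarrow> a < b \<Longrightarrow> b \<le> top_mark g \<Longrightarrow> mark m \<psi> g a \<noteq> mark m \<psi> g b"
    and apart: "g \<in> S \<Longrightarrow> g' \<in> S \<Longrightarrow> seg_half g = seg_half g' \<Longrightarrow> g' \<noteq> g \<Longrightarrow> g' \<noteq> turn g \<Longrightarrow>
      a \<le> top_mark g \<Longrightarrow> b \<le> top_mark g \<Longrightarrow> c \<le> top_mark g' \<Longrightarrow> d \<le> top_mark g' \<Longrightarrow>
      mark m \<psi> g a \<noteq> mark m \<psi> g' c \<and>
      \<not> crossing (mark m \<psi> g a) (mark m \<psi> g b) (mark m \<psi> g' c) (mark m \<psi> g' d)"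
begin

lemma follows_glued:
  assumes "g \<in> S" "g' \<in> S" "follows g g'"
  shows "glued m (chord_of m \<psi> (g, a, top_mark g)) (chord_of m \<psi> (g', 0, b))"
proof -
  obtain k where "seg_to g = Mid k" using assms(3) unfolding follows_def by blast
  then have k: "seg_to g = Mid k" "seg_from g' = Mid k" "seg_half g' \<noteq> seg_half g"
    using assms(3) unfolding follows_def by simp_all
  have "position m (half_vertex h (Mid k)) = mid_pos m h k" for h by (cases h) auto
  moreover have "k \<in> {1..m}" using mids[OF assms(2) k(2)] .
  ultimately show ?thesis
    unfolding chord_of_def mark_def using k by (auto simp: top_mark_def)
qed

lemma subpath_glued:
  assumes "t \<le> t'" "\<And>s. t \<le> s \<Longrightarrow> s \<le> t' \<Longrightarrow> G s \<in> S"
    and "\<And>s. t \<le> s \<Longrightarrow> s < t' \<Longrightarrow> follows (G s) (G (Suc s))"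
  shows "successively (glued m) (map (chord_of m \<psi>) (subpath G (t, a) (t', b)))"
  using assms
proof (induction "t' - t" arbitrary: t a)
  case 0
  then show ?case by simp
next
  case (Suc n)
  then have "t < t'" by simp
  have IH: "successively (glued m) (map (chord_of m \<psi>) (subpath G (Suc t, 0) (t', b)))"
    by (rule Suc.hyps(1)) (use Suc.hyps(2) Suc.prems \<open>t < t'\<close> in auto)
  obtain c where c: "hd (subpath G (Suc t, 0) (t', b)) = (G (Suc t), 0, c)"
    using hd_subpath by blast
  have "glued m (chord_of m \<psi> (G t, a, top_mark (G t))) (chord_of m \<psi> (G (Suc t), 0, c))"
    using \<open>t < t'\<close> Suc.prems by (intro follows_glued) auto
  then show ?case
    unfolding subpath_step[OF \<open>t < t'\<close>] list.map successively_Cons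
    using IH c by (simp add: hd_map del: subpath.simps)
qed

definition outer_mark :: "segment \<Rightarrow> nat \<Rightarrow> real" where
  "outer_mark g a = outer_pos m (seg_half g) (mark m \<psi> g a)"

definition outer_end :: "segment \<Rightarrow> nat \<Rightarrow> bool" where
  "outer_end g a \<longleftrightarrow> outer_point m (seg_half g) (mark m \<psi> g a)"

text \<open>
  Two parts of curves that use different lines, or the same line one after the other, satisfy the
  hypotheses of \<open>disjoint_curves_do_not_cross\<close>.
\<close>

lemma curves_do_not_cross:
  assumes t: "t1 \<le> t2" "t3 \<le> t4"
    and in_S: "\<And>s. t1 \<le> s \<and> s \<le> t2 \<or> t3 \<le> s \<and> s \<le> t4 \<Longrightarrow> G s \<in> S"
    and fol: "\<And>s. t1 \<le> s \<and> s < t2 \<or> t3 \<le> s \<and> s < t4 \<Longrightarrow> follows (G s) (G (Suc s))"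
    and a: "a1 < top_mark (G t1)" "0 < a2" "a2 \<le> top_mark (G t2)" "t1 = t2 \<Longrightarrow> a1 < a2"
      "a3 < top_mark (G t3)" "0 < a4" "a4 \<le> top_mark (G t4)" "t3 = t4 \<Longrightarrow> a3 < a4"
    and disjoint: "\<And>s s'. t1 \<le> s \<Longrightarrow> s \<le> t2 \<Longrightarrow> t3 \<le> s' \<Longrightarrow> s' \<le> t4 \<Longrightarrow>
      (G s' \<noteq> G s \<and> G s' \<noteq> turn (G s)) \<or>
      (G s' = G s \<and> ((s = t2 \<and> s' = t3 \<and> a2 < a3) \<or> (s = t1 \<and> s' = t4 \<and> a4 < a1)))"
    and outer: "outer_end (G t1) a1" "outer_end (G t2) a2" "outer_end (G t3) a3" "outer_end (G t4) a4"
  shows "separates (outer_mark (G t1) a1) (outer_mark (G t3) a3) (outer_mark (G t4) a4) \<longleftrightarrow>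
    separates (outer_mark (G t2) a2) (outer_mark (G t3) a3) (outer_mark (G t4) a4)"
proof -
  define P where "P = map (chord_of m \<psi>) (subpath G (t1, a1) (t2, a2))"
  define Q where "Q = map (chord_of m \<psi>) (subpath G (t3, a3) (t4, a4))"
  have glued: "successively (glued m) P" "successively (glued m) Q"
    unfolding P_def Q_def by (rule subpath_glued; use t in_S fol in blast)+
  have ne: "P \<noteq> []" "Q \<noteq> []" by (simp_all add: P_def Q_def)
  have hdP: "chord_half (hd P) = seg_half (G t1)" "chord_start (hd P) = mark m \<psi> (G t1) a1"
    and lastP: "chord_half (last P) = seg_half (G t2)" "chord_end (last P) = mark m \<psi> (G t2) a2"
    using hd_subpath[of G t1 a1 t2 a2] last_subpath[of G t1 a1 t2 a2] unfolding P_def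
    by (auto simp: hd_map last_map chord_of_def simp del: subpath.simps)
  have hdQ: "chord_half (hd Q) = seg_half (G t3)" "chord_start (hd Q) = mark m \<psi> (G t3) a3"
    and lastQ: "chord_half (last Q) = seg_half (G t4)" "chord_end (last Q) = mark m \<psi> (G t4) a4"
    using hd_subpath[of G t3 a3 t4 a4] last_subpath[of G t3 a3 t4 a4] unfolding Q_def
    by (auto simp: hd_map last_map chord_of_def simp del: subpath.simps)
  have main: "x \<notin> {u, v} \<and> y \<notin> {u, v} \<and> \<not> crossing x y u v"
    if P: "(h, x, y) \<in> set P" and Q: "(h, u, v) \<in> set Q" for h x y u v
  proof -
    obtain pc where pc: "(h, x, y) = chord_of m \<psi> pc" "pc \<in> set (subpath G (t1, a1) (t2, a2))"
      using P unfolding P_def set_map by (rule imageE)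
    obtain s where s: "t1 \<le> s" "s \<le> t2"
      "(h, x, y) = chord_of m \<psi> (G s, if s = t1 then a1 else 0, if s = t2 then a2 else top_mark (G s))"
      using subpath_pieces[OF pc(2) t(1)] pc(1) by blast
    obtain qc where qc: "(h, u, v) = chord_of m \<psi> qc" "qc \<in> set (subpath G (t3, a3) (t4, a4))"
      using Q unfolding Q_def set_map by (rule imageE)
    obtain s' where s': "t3 \<le> s'" "s' \<le> t4"
      "(h, u, v) = chord_of m \<psi> (G s', if s' = t3 then a3 else 0, if s' = t4 then a4 else top_mark (G s'))"
      using subpath_pieces[OF qc(2) t(2)] qc(1) by blast
    define p q where "p = (if s = t1 then a1 else 0)" and "q = (if s = t2 then a2 else top_mark (G s))"
    define p' q' where "p' = (if s' = t3 then a3 else 0)" and "q' = (if s' = t4 then a4 else top_mark (G s'))"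
    have x: "x = mark m \<psi> (G s) p" "y = mark m \<psi> (G s) q" "h = seg_half (G s)"
      using s(3) by (simp_all add: chord_of_def p_def q_def)
    have u: "u = mark m \<psi> (G s') p'" "v = mark m \<psi> (G s') q'" "h = seg_half (G s')"
      using s'(3) by (simp_all add: chord_of_def p'_def q'_def)
    have pq: "p < q" "q \<le> top_mark (G s)"
      using a(1-4) by (auto simp: p_def q_def top_mark_def)
    have pq': "p' < q'" "q' \<le> top_mark (G s')"
      using a(5-8) by (auto simp: p'_def q'_def top_mark_def)
    have GS: "G s \<in> S" "G s' \<in> S" using in_S s s' by blast+
    from disjoint[OF s(1,2) s'(1,2)]
    consider "G s' \<noteq> G s" "G s' \<noteq> turn (G s)"
      | "G s' = G s" "q < p'" | "G s' = G s" "q' < p"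
      unfolding p_def q_def p'_def q'_def by auto
    then show ?thesis
    proof cases
      case 1
      have h: "seg_half (G s) = seg_half (G s')" using x u by simp
      have "p \<le> top_mark (G s)" "p' \<le> top_mark (G s')" using pq pq' by auto
      then show ?thesis
        using apart[OF GS h 1, of p q p' q'] apart[OF GS h 1, of p q q' p']
          apart[OF GS h 1, of q p p' q'] apart[OF GS h 1, of q p q' p'] pq pq' x u by auto
    next
      case 2
      then show ?thesis
        using mark_inj[OF GS(1), of p p'] mark_inj[OF GS(1), of p q'] mark_inj[OF GS(1), of q p']
          mark_inj[OF GS(1), of q q'] tree[OF GS(1), of p q p' q'] pq pq' x u by auto
    next
      case 3
      have D: "x \<notin> {u, v}" "y \<notin> {u, v}"
        using mark_inj[OF GS(1), of p' p] mark_inj[OF GS(1), of q' p] mark_inj[OF GS(1), of p' q]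
          mark_inj[OF GS(1), of q' q] 3 pq pq' x u
        by auto
      have "\<not> crossing u v x y"
        using tree[OF GS(1), of p' q' p q] 3 pq pq' x u by auto
      then show ?thesis using D crossing_commute[OF D] by blast
    qed
  qed
  have "separates (outer_pos m (chord_half (hd P)) (chord_start (hd P)))
      (outer_pos m (chord_half (hd Q)) (chord_start (hd Q)))
      (outer_pos m (chord_half (last Q)) (chord_end (last Q))) \<longleftrightarrow>
    separates (outer_pos m (chord_half (last P)) (chord_end (last P)))
      (outer_pos m (chord_half (hd Q)) (chord_start (hd Q)))
      (outer_pos m (chord_half (last Q)) (chord_end (last Q)))"
    by (rule disjoint_curves_do_not_cross[OF glued(1) ne(1) glued(2) ne(2) m_pos])
      (use outer main in \<open>auto simp: hdP hdQ lastP lastQ outer_end_def\<close>)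
  then show ?thesis unfolding hdP hdQ lastP lastQ outer_mark_def .
qed

lemma blob_mark:
  assumes "g \<in> S" "0 < a" "a < top_mark g"
  shows "outer_end g a" "outer_mark g a \<in> blob_zone m (seg_word g ! (a - 1))"
    "mark m \<psi> g a \<in> blob_edge m (seg_word g ! (a - 1))"
proof -
  show *: "mark m \<psi> g a \<in> blob_edge m (seg_word g ! (a - 1))"
    using edge[OF assms(1), of "a - 1"] assms(2,3) by (simp add: top_mark_def)
  show "outer_end g a" "outer_mark g a \<in> blob_zone m (seg_word g ! (a - 1))"
    using outer_pos_blob_edge[OF * m_pos] by (simp_all add: outer_end_def outer_mark_def)
qed

end

section \<open>The words of the curves of a stack\<close>

text \<open>
  A closed curve of the stack, cut open at an arbitrary glued vertex and with an arbitrary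
  direction.
\<close>

definition closed_trail :: "segment set \<Rightarrow> segment list \<Rightarrow> bool" where
  "closed_trail S gs \<longleftrightarrow> trail S gs \<and> follows (last gs) (hd gs) \<and> distinct gs"

text \<open>
  Four points on the vertical edges that alternate between east and west: two of them are on each
  edge, and whichever way these are ordered, one of the two ways of pairing neighbours crosses.
\<close>

lemma separates_inj_cases:
  assumes "b \<noteq> b'" "o1 \<in> blob_zone m b" "o2 \<in> blob_zone m b'" "o3 \<in> blob_zone m b" "o4 \<in> blob_zone m b'"
    and "m \<ge> 1" "o1 \<noteq> o3"
    and "separates o1 o3 o4 = separates o2 o3 o4" "separates o2 o4 o1 = separates o3 o4 o1"
  shows False
proof -
  have zones: "x < y" if "x \<in> blob_zone m BR" "y \<in> blob_zone m BL" for x y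
    using that \<open>m \<ge> 1\<close> by (auto simp: blob_zone_def)
  consider "b = BL" "b' = BR" | "b = BR" "b' = BL" using \<open>b \<noteq> b'\<close> by (cases b; cases b') auto
  then show False
  proof cases
    case 1
    have "o2 < o1" "o4 < o1" "o2 < o3" "o4 < o3" using zones assms(2-5) 1 by auto
    then have "o1 < o3 \<longleftrightarrow> o3 < o1" using assms(8,9) unfolding separates_def by auto
    then show False using \<open>o1 \<noteq> o3\<close> by linarith
  next
    case 2
    have "o1 < o2" "o1 < o4" "o3 < o2" "o3 < o4" using zones assms(2-5) 2 by auto
    then have "o1 < o3 \<longleftrightarrow> o3 < o1" using assms(8,9) unfolding separates_def by auto
    then show False using \<open>o1 \<noteq> o3\<close> by linarith
  qed
qed

context drawn_stack
begin

lemma trail_in_S: "trail S gs \<Longrightarrow> n < length gs \<Longrightarrow> gs ! n \<in> S"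
  by (auto simp: trail_def)

lemma trail_not_turn:
  assumes "trail S gs" "i < length gs" "j < length gs"
  shows "gs ! i \<noteq> turn (gs ! j)"
proof (cases "i \<le> j")
  case True
  then show ?thesis using trail_no_return[OF assms(1) True assms(3)] by simp
next
  case False
  then have "gs ! j \<noteq> turn (gs ! i)" using trail_no_return[OF assms(1), of j i] assms(2) by simp
  then show ?thesis by auto
qed

text \<open>
  The part of the line from its start to the blob \<open>n\<close> is disjoint from the part from the blob \<open>n'\<close>
  to its end; both parts have their ends on the outer boundary.
\<close>

lemma line_blobs_do_not_cross:
  assumes tr: "trail S gs" and start: "stuck S (turn (hd gs))"
    and outer: "outer_end (hd gs) 0" "outer_end (last gs) (top_mark (last gs))"
    and n: "n < n'" "n' < length (trail_word gs)"
  shows "\<exists>z \<in> blob_zone m (trail_word gs ! n). \<exists>z' \<in> blob_zone m (trail_word gs ! n').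
    separates (outer_mark (hd gs) 0) z' (outer_mark (last gs) (top_mark (last gs))) \<longleftrightarrow>
    separates z z' (outer_mark (last gs) (top_mark (last gs)))"
proof -
  obtain loc where loc: "\<And>n. n < length (trail_word gs) \<Longrightarrow>
     fst (loc n) < length gs \<and> 0 < snd (loc n) \<and> snd (loc n) < top_mark (gs ! fst (loc n)) \<and>
     trail_word gs ! n = seg_word (gs ! fst (loc n)) ! (snd (loc n) - 1) \<and>
     (\<forall>n' < n. fst (loc n') < fst (loc n) \<or> fst (loc n') = fst (loc n) \<and> snd (loc n') < snd (loc n))"
    using word_positions[of gs] by blast
  define t a t' a' where ta: "t = fst (loc n)" "a = snd (loc n)" "t' = fst (loc n')" "a' = snd (loc n')"
  have A: "t < length gs" "0 < a" "a < top_mark (gs ! t)" "trail_word gs ! n = seg_word (gs ! t) ! (a - 1)"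
    using loc[of n] n by (simp_all add: ta)
  have A': "t' < length gs" "0 < a'" "a' < top_mark (gs ! t')"
    "trail_word gs ! n' = seg_word (gs ! t') ! (a' - 1)"
    using loc[of n'] n by (simp_all add: ta)
  have lex: "t < t' \<or> t = t' \<and> a < a'"
    using loc[of n'] n by (simp add: ta)
  have ne: "gs \<noteq> []" using tr by (simp add: trail_def)
  define N where "N = length gs - 1"
  have N: "hd gs = gs ! 0" "last gs = gs ! N" "N < length gs"
    using ne by (simp_all add: hd_conv_nth last_conv_nth N_def)
  have "separates (outer_mark (gs ! 0) 0) (outer_mark (gs ! t') a') (outer_mark (gs ! N) (top_mark (gs ! N))) \<longleftrightarrow>
    separates (outer_mark (gs ! t) a) (outer_mark (gs ! t') a') (outer_mark (gs ! N) (top_mark (gs ! N)))"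
  proof (rule curves_do_not_cross)
    show "0 \<le> t" "t' \<le> N" using A' by (simp_all add: N_def)
    show "gs ! s \<in> S" if "0 \<le> s \<and> s \<le> t \<or> t' \<le> s \<and> s \<le> N" for s
      using that A(1) N(3) by (intro trail_in_S[OF tr]) auto
    show "follows (gs ! s) (gs ! Suc s)" if "0 \<le> s \<and> s < t \<or> t' \<le> s \<and> s < N" for s
      using that A(1) N(3) by (intro trail_nth_follows[OF tr]) auto
    show "(gs ! s' \<noteq> gs ! s \<and> gs ! s' \<noteq> turn (gs ! s)) \<or>
      (gs ! s' = gs ! s \<and> (s = t \<and> s' = t' \<and> a < a' \<or> s = 0 \<and> s' = N \<and> top_mark (gs ! N) < 0))"
      if "0 \<le> s" "s \<le> t" "t' \<le> s'" "s' \<le> N" for s s'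
    proof (cases "s = s'")
      case True
      then show ?thesis using that lex by auto
    next
      case False
      then have "s < s'" using that lex by auto
      then have "gs ! s' \<noteq> gs ! s"
        using trail_no_repeat[OF tr start, of s s'] that N(3) by auto
      moreover have "gs ! s' \<noteq> turn (gs ! s)"
        using that A(1) N(3) by (intro trail_not_turn[OF tr]) auto
      ultimately show ?thesis by blast
    qed
    show "outer_end (gs ! t) a" "outer_end (gs ! t') a'"
      using A A' by (auto intro!: blob_mark trail_in_S[OF tr])
    show "outer_end (gs ! 0) 0" "outer_end (gs ! N) (top_mark (gs ! N))"
      using outer N by simp_all
  qed (use A A' in \<open>auto simp: top_mark_def\<close>)
  moreover have "outer_mark (gs ! t) a \<in> blob_zone m (trail_word gs ! n)"
    unfolding A(4) using A by (intro blob_mark trail_in_S[OF tr]) auto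
  moreover have "outer_mark (gs ! t') a' \<in> blob_zone m (trail_word gs ! n')"
    unfolding A'(4) using A' by (intro blob_mark trail_in_S[OF tr]) auto
  ultimately show ?thesis unfolding N(1,2) by blast
qed

text \<open>
  Four blobs with the cyclic word \<open>x y x y\<close> cut the loop into four parts, and opposite parts are
  disjoint. Neither pair of opposite parts crosses, which is impossible for four points that alternate
  between the eastern and the western edge.
\<close>

lemma loop_blobs_not_interleaved:
  assumes "closed_trail S gs"
    and n: "n1 < n2" "n2 < n3" "n3 < n4" "n4 < length (trail_word gs)"
    and letters: "trail_word gs ! n3 = trail_word gs ! n1" "trail_word gs ! n4 = trail_word gs ! n2"
  shows "trail_word gs ! n1 = trail_word gs ! n2"
proof (rule ccontr)
  assume neq: "trail_word gs ! n1 \<noteq> trail_word gs ! n2"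
  have tr: "trail S gs" and cl: "follows (last gs) (hd gs)" and dist: "distinct gs"
    using assms(1) by (simp_all add: closed_trail_def)
  obtain loc where loc: "\<And>n. n < length (trail_word gs) \<Longrightarrow>
     fst (loc n) < length gs \<and> 0 < snd (loc n) \<and> snd (loc n) < top_mark (gs ! fst (loc n)) \<and>
     trail_word gs ! n = seg_word (gs ! fst (loc n)) ! (snd (loc n) - 1) \<and>
     (\<forall>n' < n. fst (loc n') < fst (loc n) \<or> fst (loc n') = fst (loc n) \<and> snd (loc n') < snd (loc n))"
    using word_positions[of gs] by blast
  define t1 a1 t2 a2 t3 a3 t4 a4 where ta: "t1 = fst (loc n1)" "a1 = snd (loc n1)" "t2 = fst (loc n2)" "a2 = snd (loc n2)"
    "t3 = fst (loc n3)" "a3 = snd (loc n3)" "t4 = fst (loc n4)" "a4 = snd (loc n4)"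
  define N where "N = length gs"
  define G where "G s = gs ! (s mod N)" for s
  have "N > 0" using tr by (simp add: trail_def N_def)
  have G: "G s = gs ! s" if "s < N" for s using that by (simp add: G_def)
  have G': "G (s + N) = G s" for s by (simp add: G_def)
  have in_S: "G s \<in> S" for s
    using \<open>N > 0\<close> unfolding G_def by (intro trail_in_S[OF tr]) (simp add: N_def)
  have fol: "follows (G s) (G (Suc s))" for s
  proof (cases "Suc (s mod N) < N")
    case True
    then have "Suc s mod N = Suc (s mod N)" by (simp add: mod_Suc)
    then show ?thesis using trail_nth_follows[OF tr, of "s mod N"] True by (simp add: G_def N_def)
  next
    case False
    then have "Suc (s mod N) = N" using \<open>N > 0\<close> by (meson Suc_lessI mod_less_divisor)
    then have "Suc s mod N = 0" "s mod N = length gs - 1" by (simp_all add: mod_Suc N_def)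
    then show ?thesis using cl \<open>N > 0\<close> by (simp add: G_def N_def hd_conv_nth last_conv_nth)
  qed
  have G_eq: "G s = G s' \<longleftrightarrow> s mod N = s' mod N" for s s'
    using dist \<open>N > 0\<close> by (simp add: G_def N_def nth_eq_iff_index_eq)
  have G_turn: "G s \<noteq> turn (G s')" for s s'
    using \<open>N > 0\<close> unfolding G_def by (intro trail_not_turn[OF tr]) (simp_all add: N_def)
  have t: "t1 < N" "t2 < N" "t3 < N" "t4 < N"
    and a: "0 < a1" "0 < a2" "0 < a3" "0 < a4"
      "a1 < top_mark (G t1)" "a2 < top_mark (G t2)" "a3 < top_mark (G t3)" "a4 < top_mark (G t4)"
    and w: "trail_word gs ! n1 = seg_word (G t1) ! (a1 - 1)" "trail_word gs ! n2 = seg_word (G t2) ! (a2 - 1)"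
      "trail_word gs ! n3 = seg_word (G t3) ! (a3 - 1)" "trail_word gs ! n4 = seg_word (G t4) ! (a4 - 1)"
    using loc[of n1] loc[of n2] loc[of n3] loc[of n4] n G by (simp_all add: ta N_def)
  have lex: "t1 < t2 \<or> t1 = t2 \<and> a1 < a2" "t2 < t3 \<or> t2 = t3 \<and> a2 < a3" "t3 < t4 \<or> t3 = t4 \<and> a3 < a4"
    "t1 < t3 \<or> t1 = t3 \<and> a1 < a3"
    using loc[of n2] loc[of n3] loc[of n4] n by (simp_all add: ta)
  have ends: "outer_end (G t1) a1" "outer_end (G t2) a2" "outer_end (G t3) a3" "outer_end (G t4) a4"
    using blob_mark(1)[OF in_S] a by simp_all
  have 1: "separates (outer_mark (G t1) a1) (outer_mark (G t3) a3) (outer_mark (G t4) a4) \<longleftrightarrow>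
    separates (outer_mark (G t2) a2) (outer_mark (G t3) a3) (outer_mark (G t4) a4)"
  proof (rule curves_do_not_cross)
    show "t1 \<le> t2" "t3 \<le> t4" using lex by auto
    show "G s' \<noteq> G s \<and> G s' \<noteq> turn (G s) \<or>
      G s' = G s \<and> (s = t2 \<and> s' = t3 \<and> a2 < a3 \<or> s = t1 \<and> s' = t4 \<and> a4 < a1)"
      if "t1 \<le> s" "s \<le> t2" "t3 \<le> s'" "s' \<le> t4" for s s'
    proof (cases "s = s'")
      case True
      then show ?thesis using that lex by auto
    next
      case False
      have "s < N" "s' < N" using that t by auto
      then have "G s' \<noteq> G s" using False by (simp add: G_eq)
      then show ?thesis using G_turn by blast
    qed
  qed (use in_S fol ends a lex in auto)
  \<comment> \<open>\<open>G\<close> goes around the loop periodically, and \<open>t1 + N\<close> is the second visit to the first blob\<close>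
  have 2: "separates (outer_mark (G t2) a2) (outer_mark (G t4) a4) (outer_mark (G (t1 + N)) a1) \<longleftrightarrow>
    separates (outer_mark (G t3) a3) (outer_mark (G t4) a4) (outer_mark (G (t1 + N)) a1)"
  proof (rule curves_do_not_cross)
    show "t2 \<le> t3" "t4 \<le> t1 + N" using lex t by auto
    show "G s' \<noteq> G s \<and> G s' \<noteq> turn (G s) \<or>
      G s' = G s \<and> (s = t3 \<and> s' = t4 \<and> a3 < a4 \<or> s = t2 \<and> s' = t1 + N \<and> a1 < a2)"
      if s: "t2 \<le> s" "s \<le> t3" "t4 \<le> s'" "s' \<le> t1 + N" for s s'
    proof (cases "s' < N")
      case True
      show ?thesis
      proof (cases "s = s'")
        case True
        then show ?thesis using s lex by auto
      next
        case False
        have "s < N" using s t by auto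
        then have "G s' \<noteq> G s" using False \<open>s' < N\<close> by (simp add: G_eq)
        then show ?thesis using G_turn by blast
      qed
    next
      case False
      define r where "r = s' - N"
      have r: "s' = r + N" "r \<le> t1" using False s by (auto simp: r_def)
      show ?thesis
      proof (cases "s = r")
        case True
        then have "s = t2" "r = t1" "t1 = t2" using r s lex by auto
        then show ?thesis using r lex G' by auto
      next
        case False
        have "s < N" "r < N" using s t r by auto
        then have "G s' \<noteq> G s" using False r by (simp add: G_eq)
        then show ?thesis using G_turn by blast
      qed
    qed
    show "t2 = t3 \<Longrightarrow> a2 < a3" "t4 = t1 + N \<Longrightarrow> a4 < a1" using lex t by auto
    show "outer_end (G (t1 + N)) a1" using ends G' by simp
    show "a1 \<le> top_mark (G (t1 + N))" using a G' by simp
  qed (use in_S fol ends a in auto)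
  have zones: "outer_mark (G t1) a1 \<in> blob_zone m (trail_word gs ! n1)"
    "outer_mark (G t2) a2 \<in> blob_zone m (trail_word gs ! n2)"
    "outer_mark (G t3) a3 \<in> blob_zone m (trail_word gs ! n1)"
    "outer_mark (G t4) a4 \<in> blob_zone m (trail_word gs ! n2)"
    using blob_mark(2)[OF in_S] a letters w by metis+
  have "outer_mark (G t1) a1 \<noteq> outer_mark (G t3) a3"
  proof
    assume eq: "outer_mark (G t1) a1 = outer_mark (G t3) a3"
    have "mark m \<psi> (G t1) a1 \<in> blob_edge m (trail_word gs ! n1)"
      "mark m \<psi> (G t3) a3 \<in> blob_edge m (trail_word gs ! n1)"
      using blob_mark(3)[OF in_S] a letters w by metis+
    from outer_pos_inj[OF this eq[unfolded outer_mark_def] m_pos]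
    have h: "seg_half (G t1) = seg_half (G t3)" "mark m \<psi> (G t1) a1 = mark m \<psi> (G t3) a3" by auto
    show False
    proof (cases "t1 = t3")
      case True
      then show False using h lex mark_inj[OF in_S, of a1 a3 t1] a by auto
    next
      case False
      then have "G t3 \<noteq> G t1" using t by (simp add: G_eq)
      then show False
        using apart[OF in_S in_S h(1) _ G_turn, of a1 a1 a3 a3] a h(2) by auto
    qed
  qed
  from separates_inj_cases[OF neq zones m_pos this 1 2[unfolded G']] show False .
qed

end

lemma constant_word: "(\<And>x. x \<in> set w \<Longrightarrow> x = b) \<Longrightarrow> w = replicate (length w) b"
  using replicate_length_same[of w b] by metis

lemma other_blob: "x \<noteq> y \<Longrightarrow> z \<noteq> y \<Longrightarrow> z = (x :: blob)"
  by (cases x; cases y; cases z) auto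

definition precede_in :: "blob \<Rightarrow> blob \<Rightarrow> blob list \<Rightarrow> bool" where
  "precede_in x y w \<longleftrightarrow> (\<exists>n n'. n < n' \<and> n' < length w \<and> w ! n = x \<and> w ! n' = y)"

lemma precede_in_append: "x \<in> set u \<Longrightarrow> y \<in> set v \<Longrightarrow> precede_in x y (u @ v)"
proof -
  assume "x \<in> set u" "y \<in> set v"
  then obtain n n' where "n < length u" "u ! n = x" "n' < length v" "v ! n' = y"
    by (auto simp: in_set_conv_nth)
  then show ?thesis
    unfolding precede_in_def
    by (intro exI[of _ n] exI[of _ "length u + n'"]) (auto simp: nth_append)
qed

lemma precede_in_extend: "precede_in x y v \<Longrightarrow> precede_in x y (u @ v @ t)"
proof -
  assume "precede_in x y v"
  then obtain n n' where "n < n'" "n' < length v" "v ! n = x" "v ! n' = y"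
    by (auto simp: precede_in_def)
  then show ?thesis
    unfolding precede_in_def
    by (intro exI[of _ "length u + n"] exI[of _ "length u + n'"]) (auto simp: nth_append)
qed

lemma sorted_word:
  assumes "\<not> precede_in y x w" "x \<noteq> y"
  shows "\<exists>p q. w = replicate p x @ replicate q y"
  using assms(1)
proof (induction w)
  case (Cons z w)
  have "\<not> precede_in y x w" using Cons.prems precede_in_extend[of y x w "[z]" "[]"] by auto
  then obtain p q where w: "w = replicate p x @ replicate q y" using Cons.IH by blast
  show ?case
  proof (cases "z = x")
    case True
    then have "z # w = replicate (Suc p) x @ replicate q y" using w by simp
    then show ?thesis by blast
  next
    case False
    then have "z = y" using other_blob[of y x z] assms(2) by simp
    then have "x \<notin> set w" using Cons.prems precede_in_append[of y "[z]" x w] by auto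
    then have "p = 0" using w by auto
    then have "z # w = replicate 0 x @ replicate (Suc q) y" using w \<open>z = y\<close> by simp
    then show ?thesis by blast
  qed
qed (intro exI[of _ 0], simp)

lemma sorted_word_around:
  assumes "\<not> precede_in BR BL (u @ [BL, BR] @ v)"
  shows "u = replicate (length u) BL" "v = replicate (length v) BR"
proof -
  have "BR \<notin> set u" using precede_in_append[of BR u BL "[BL, BR] @ v"] assms by auto
  then show "u = replicate (length u) BL" by (intro constant_word) (metis other_blob blob.distinct(1))
  have "BL \<notin> set v" using precede_in_append[of BR "u @ [BL, BR]" BL v] assms by auto
  then show "v = replicate (length v) BR" by (intro constant_word) (metis other_blob blob.distinct(1))
qed

definition interleaved :: "blob list \<Rightarrow> bool" where
  "interleaved w \<longleftrightarrow> (\<exists>n1 n2 n3 n4. n1 < n2 \<and> n2 < n3 \<and> n3 < n4 \<and> n4 < length w \<and>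
     w ! n3 = w ! n1 \<and> w ! n4 = w ! n2 \<and> w ! n1 \<noteq> w ! n2)"

lemma interleaved_append:
  assumes "precede_in x y u" "precede_in x y v" "x \<noteq> y"
  shows "interleaved (u @ v)"
proof -
  obtain n n' where "n < n'" "n' < length u" "u ! n = x" "u ! n' = y"
    using assms(1) by (auto simp: precede_in_def)
  moreover obtain k k' where "k < k'" "k' < length v" "v ! k = x" "v ! k' = y"
    using assms(2) by (auto simp: precede_in_def)
  ultimately show ?thesis
    unfolding interleaved_def using assms(3)
    by (intro exI[of _ n] exI[of _ n'] exI[of _ "length u + k"] exI[of _ "length u + k'"])
      (auto simp: nth_append)
qed

text \<open>
  Split off the first two runs. If the second letter occurred again after them, then four letters
  \<open>x y x y\<close> could be found. So there are at most three runs, and a rotation joins the third one to the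
  first one.
\<close>

lemma not_interleaved_word:
  assumes "\<not> interleaved w"
  shows "\<exists>n p q. w = rotate n (replicate p BL @ replicate q BR)"
proof (cases w)
  case Nil
  then show ?thesis by (intro exI[of _ 0]) simp
next
  case (Cons x w')
  define y where "y = (if x = BL then BR else BL)"
  have xy: "x \<noteq> y" by (simp add: y_def)
  define u r where "u = takeWhile (\<lambda>z. z = x) w" and "r = dropWhile (\<lambda>z. z = x) w"
  define v t where "v = takeWhile (\<lambda>z. z = y) r" and "t = dropWhile (\<lambda>z. z = y) r"
  have w: "w = u @ v @ t" by (simp add: u_def r_def v_def t_def)
  have u: "u = replicate (length u) x" and v: "v = replicate (length v) y"
    by (intro constant_word; auto simp: u_def v_def dest: set_takeWhileD)+
  have "y \<notin> set t"
  proof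
    assume y: "y \<in> set t"
    then have "t \<noteq> []" by auto
    then have "hd t = x"
      using hd_dropWhile[of "\<lambda>z. z = y" r] other_blob[of x y] xy by (simp add: t_def)
    then obtain t' where t': "t = [x] @ t'" using \<open>t \<noteq> []\<close> by (cases t) auto
    then have "y \<in> set t'" using y xy by auto
    then have 1: "precede_in x y t" unfolding t' by (intro precede_in_append) auto
    have "r \<noteq> []" using \<open>t \<noteq> []\<close> by (auto simp: t_def)
    then have "hd r = y"
      using hd_dropWhile[of "\<lambda>z. z = x" w] other_blob[of y x] xy by (simp add: r_def)
    then have "y \<in> set v" using \<open>r \<noteq> []\<close> by (cases r) (auto simp: v_def)
    moreover have "x \<in> set u" using Cons by (simp add: u_def)
    ultimately have "precede_in x y (u @ v)" by (intro precede_in_append)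
    from interleaved_append[OF this 1 xy] show False using assms w by simp
  qed
  then have t: "t = replicate (length t) x"
    using other_blob[of x y] xy by (intro constant_word) metis
  define a b c where "a = length u" and "b = length v" and "c = length t"
  have w: "w = replicate a x @ replicate b y @ replicate c x"
    using w u v t unfolding a_def b_def c_def by simp
  show ?thesis
  proof (cases "x = BL")
    case True
    then have "w = rotate c (replicate (c + a) BL @ replicate b BR)"
      using rotate_append[of "replicate c BL" "replicate a BL @ replicate b BR"] w
      by (simp add: replicate_add y_def)
    then show ?thesis by blast
  next
    case False
    then have "x = BR" "y = BL" by (cases x; simp add: y_def)+
    then have "w = rotate (b + c) (replicate b BL @ replicate (c + a) BR)"
      using rotate_append[of "replicate b BL @ replicate c BR" "replicate a BR"] w
      by (simp add: replicate_add)
    then show ?thesis by blast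
  qed
qed

context blob_parameters
begin

lemma normal_form_left: "normal_form (replicate (Suc p) BL) = (\<delta>L [^] p, [BL])"
  by (induction p) (simp_all add: m_comm)

lemma normal_form_right: "normal_form (replicate (Suc q) BR) = (\<delta>R [^] q, [BR])"
  by (induction q) (simp_all add: m_comm)

lemma normal_form_left_right:
  "normal_form (replicate (Suc p) BL @ replicate (Suc q) BR) = (\<delta>L [^] p \<otimes> \<delta>R [^] q, [BL, BR])"
proof (induction p)
  case 0
  have "replicate (Suc 0) BL @ w = BL # w" for w by simp
  then show ?case by (simp only: normal_form.simps normal_form_right) simp
next
  case (Suc p)
  then show ?case by (simp add: m_ac)
qed

end

context stack_system
begin

definition curve :: "vertex \<Rightarrow> segment list \<Rightarrow> vertex \<Rightarrow> bool" where
  "curve a gs b \<longleftrightarrow> trail S gs \<and> seg_from (hd gs) = outer_spot a \<and> seg_to (last gs) = outer_spot b"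

lemma lines_of_eq: "lines_of S = {(a, w, b). precedes a b \<and> (\<exists>gs. curve a gs b \<and> trail_word gs = w)}"
  unfolding lines_of_def curve_def by simp

lemma outer_not_mid [simp]: "outer_spot a \<noteq> Mid k" "Mid k \<noteq> outer_spot a"
  by (cases a; simp)+

lemma outer_spot_eq [simp]: "outer_spot a = outer_spot b \<longleftrightarrow> a = b"
  by (cases a; cases b) auto

lemma stuck_outer: "seg_to g = outer_spot b \<Longrightarrow> stuck S g"
  by (auto simp: stuck_def follows_def)

lemma curve_stuck: "curve a gs b \<Longrightarrow> stuck S (last gs) \<and> stuck S (turn (hd gs))"
  using stuck_outer by (simp add: curve_def)

lemma start_unique:
  assumes "g \<in> S" "g' \<in> S" "seg_from g = outer_spot a" "seg_from g' = outer_spot a"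
  shows "g = g'"
  using assms tops[of g] tops[of g'] bots[of g] bots[of g'] by (intro unique) (cases a; simp)+

lemma curve_unique:
  assumes "curve a gs b" "curve a gs' b'"
  shows "gs = gs' \<and> b = b'"
proof -
  have "hd gs \<in> S" "hd gs' \<in> S" using assms by (auto simp: curve_def trail_def)
  then have "hd gs = hd gs'" using assms start_unique by (auto simp: curve_def)
  then have "gs = gs'"
    using assms curve_stuck trail_unique[of gs gs'] unfolding curve_def by blast
  then show ?thesis using assms by (auto simp: curve_def)
qed

lemma curve_backwards: "curve a gs b \<Longrightarrow> curve b (backwards gs) a"
  unfolding curve_def using trail_backwards[of gs] by (auto simp: trail_def)

lemma curve_through:
  assumes "curve a gs b" "curve a' gs' b'" "g \<in> set gs" "g \<in> set gs'"
  shows "gs = gs'"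
  using trail_unique_through[of gs gs' g] assms curve_stuck unfolding curve_def by blast

lemma curve_ends_neq:
  assumes "curve a gs b"
  shows "a \<noteq> b"
proof
  assume "a = b"
  then have "gs = backwards gs" using curve_unique[OF assms] curve_backwards[OF assms] by blast
  have "gs \<noteq> []" "trail S gs" using assms by (auto simp: curve_def trail_def)
  then have "hd gs = turn (last gs)" using backwards_simps(7) \<open>gs = backwards gs\<close> by metis
  moreover have "gs ! 0 \<noteq> turn (gs ! (length gs - 1))"
    using trail_no_return[OF \<open>trail S gs\<close>, of 0 "length gs - 1"] \<open>gs \<noteq> []\<close> by simp
  ultimately show False using \<open>gs \<noteq> []\<close> by (simp add: hd_conv_nth last_conv_nth)
qed

lemma finite_lines:
  assumes "finite S"
  shows "finite (lines_of S)"
proof -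
  have "inj_on fst (lines_of S)"
  proof (rule inj_onI)
    fix l l' assume "l \<in> lines_of S" "l' \<in> lines_of S" "fst l = fst l'"
    then obtain a w b w' b' gs gs' where "l = (a, w, b)" "l' = (a, w', b')"
      "curve a gs b" "trail_word gs = w" "curve a gs' b'" "trail_word gs' = w'"
      unfolding lines_of_eq by auto
    then show "l = l'" using curve_unique[of a gs b gs' b'] by simp
  qed
  moreover have "outer_spot ` fst ` lines_of S \<subseteq> seg_from ` S"
  proof
    fix x assume "x \<in> outer_spot ` fst ` lines_of S"
    then obtain a gs b where "x = outer_spot a" "curve a gs b" by (auto simp: lines_of_eq)
    then have "x = seg_from (hd gs)" "hd gs \<in> S" by (auto simp: curve_def trail_def)
    then show "x \<in> seg_from ` S" by blast
  qed
  then have "finite (outer_spot ` fst ` lines_of S)"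
    using assms by (meson finite_imageI finite_subset)
  then have "finite (fst ` lines_of S)"
    by (rule finite_imageD) (simp add: inj_on_def)
  ultimately show ?thesis by (simp add: finite_image_iff)
qed

lemma loop_at_unique:
  assumes "loop_at S i gs" "loop_at S i hs"
  shows "gs = hs"
proof -
  have tr: "trail S gs" "trail S hs" using assms by (auto simp: loop_at_def)
  then have "hd gs \<in> S" "hd hs \<in> S" by (auto simp: trail_def)
  then have hd: "hd gs = hd hs" using assms by (intro unique) (auto simp: loop_at_def)
  have le: "length hs \<le> length gs" if "loop_at S i gs" "loop_at S i hs" "hd gs = hd hs" for gs hs
  proof (rule ccontr)
    assume "\<not> length hs \<le> length gs"
    then have less: "length gs < length hs" by simp
    have t: "trail S gs" "trail S hs" using that by (auto simp: loop_at_def)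
    then have ne: "gs \<noteq> []" by (simp add: trail_def)
    define n where "n = length gs - 1"
    have n: "Suc n = length gs" using ne by (simp add: n_def)
    have "gs ! n = hs ! n" using trail_prefix[OF t that(3), of n] n less by simp
    then have "follows (last gs) (hs ! Suc n)"
      using trail_nth_follows[OF t(2), of n] n less ne by (simp add: last_conv_nth n_def)
    moreover have "hs ! Suc n \<in> S" using t(2) n less by (auto simp: trail_def)
    moreover have "hd gs \<in> S" using t(1) by (auto simp: trail_def)
    ultimately have "hs ! Suc n = hd gs"
      using that(1) follows_unique by (auto simp: loop_at_def)
    then have "seg_from (tl hs ! n) = Mid i" using that(1) less n by (simp add: nth_tl loop_at_def)
    moreover have "tl hs ! n \<in> set (tl hs)" using less n by (intro nth_mem) simp
    ultimately show False using that(2) by (auto simp: loop_at_def)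
  qed
  have "length gs = length hs" using le[of gs hs] le[of hs gs] assms hd by simp
  then show ?thesis using trail_prefix[OF tr hd] by (intro nth_equalityI) auto
qed

lemma loop_at_closed:
  assumes "loop_at S i gs"
  shows "closed_trail S gs"
proof -
  have tr: "trail S gs" and cl: "follows (last gs) (hd gs)" and st: "seg_from (hd gs) = Mid i"
    and later: "\<And>g. g \<in> set (tl gs) \<Longrightarrow> seg_from g \<noteq> Mid i"
    using assms by (auto simp: loop_at_def)
  have in_S: "gs ! n \<in> S" if "n < length gs" for n using tr that by (auto simp: trail_def)
  have "gs ! k \<noteq> gs ! n" if "k < n" "n < length gs" for k n
    using that
  proof (induction k arbitrary: n)
    case 0
    then have "tl gs ! (n - 1) \<in> set (tl gs)" by (intro nth_mem) auto
    moreover have "tl gs ! (n - 1) = gs ! n" using 0 by (simp add: nth_tl)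
    moreover have "gs ! 0 = hd gs" using 0 by (simp add: hd_conv_nth flip: length_greater_0_conv)
    ultimately have "seg_from (gs ! n) \<noteq> Mid i" "seg_from (gs ! 0) = Mid i" using later st by auto
    then show ?case by auto
  next
    case (Suc k)
    show ?case
    proof
      assume eq: "gs ! Suc k = gs ! n"
      have n: "Suc (n - 1) = n" "k < n - 1" "n - 1 < length gs" "Suc k < length gs" using Suc.prems by auto
      have "follows (gs ! k) (gs ! Suc k)" using trail_nth_follows[OF tr n(4)] .
      moreover have "follows (gs ! (n - 1)) (gs ! Suc k)"
        using trail_nth_follows[OF tr, of "n - 1"] n(1) Suc.prems eq by simp
      ultimately have "gs ! k = gs ! (n - 1)"
        using in_S[of k] in_S[of "n - 1"] n by (intro follows_unique_back) auto
      then show False using Suc.IH[OF n(2,3)] by simp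
    qed
  qed
  then have "distinct gs"
    unfolding distinct_conv_nth using nat_neq_iff by metis
  then show ?thesis using tr cl by (simp add: closed_trail_def)
qed

lemma finite_loops: "finite (loops_of S)"
proof -
  have "inj_on fst (loops_of S)"
    using loop_at_unique by (auto simp: inj_on_def loops_of_def)
  moreover have "fst ` loops_of S \<subseteq> {1..m}"
  proof clarify
    fix i w assume "(i, w) \<in> loops_of S"
    then obtain gs where "loop_at S i gs" by (auto simp: loops_of_def)
    then have "hd gs \<in> S" "seg_from (hd gs) = Mid i" by (auto simp: loop_at_def trail_def)
    then show "fst (i, w) \<in> {1..m}" using mids by simp
  qed
  then have "finite (fst ` loops_of S)" by (rule finite_subset) simp
  ultimately show ?thesis by (simp add: finite_image_iff)
qed

end

lemma stack_system_segments:
  assumes "pairs_vertices m d\<^sub>1" "pairs_vertices m d\<^sub>2"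
  shows "stack_system (segments d\<^sub>1 d\<^sub>2) m"
proof -
  interpret segment_system "segments d\<^sub>1 d\<^sub>2" by (rule segments_system[OF assms])
  have pv: "pairs_vertices m (in_half h d\<^sub>1 d\<^sub>2)" for h using assms by (cases h) auto
  have start: "\<exists>a \<in> vertices m. seg_from g = half_spot (seg_half g) a" if in_segs: "g \<in> segments d\<^sub>1 d\<^sub>2" for g
  proof -
    obtain h x w y where g: "g = (h, x, w, y)" by (cases g)
    then obtain a b where "x = half_spot h a" "(a, w, b) \<in> both_ways (in_half h d\<^sub>1 d\<^sub>2)"
      using in_segs by (auto simp: segments_iff)
    then show ?thesis using both_ways_vertices[OF pv] g by auto
  qed
  show ?thesis
  proof
    fix g k assume g: "g \<in> segments d\<^sub>1 d\<^sub>2"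
    obtain a where a: "a \<in> vertices m" "seg_from g = half_spot (seg_half g) a" using start[OF g] by blast
    have V: "k \<in> {1..m}" if "a = North k \<or> a = South k" using a(1) that by (auto simp: vertices_def)
    show "k \<in> {1..m}" if "seg_from g = Mid k"
      using a(2) that by (intro V) (cases "seg_half g"; cases a; simp)
    show "seg_half g = Upper \<and> k \<in> {1..m}" if "seg_from g = Top k"
      using a(2) that V by (cases "seg_half g"; cases a; simp)
    show "seg_half g = Lower \<and> k \<in> {1..m}" if "seg_from g = Bot k"
      using a(2) that V by (cases "seg_half g"; cases a; simp)
  qed
qed

lemma blob_diagram_pairs: "d \<in> blob_diagrams m \<Longrightarrow> pairs_vertices m d"
  by (simp add: blob_diagrams_def loopless_pseudodiagrams_def)

lemma ex_drawn_stack: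
  assumes "d\<^sub>1 \<in> blob_diagrams m" "d\<^sub>2 \<in> blob_diagrams m" "m \<ge> 1"
  shows "\<exists>\<psi>. drawn_stack (segments d\<^sub>1 d\<^sub>2) m \<psi>"
proof (rule segment_marks[OF assms(1,2)])
  interpret stack_system "segments d\<^sub>1 d\<^sub>2" m
    by (intro stack_system_segments blob_diagram_pairs assms)
  fix \<psi> :: "segment \<Rightarrow> nat \<Rightarrow> real"
  assume "\<And>g k. g \<in> segments d\<^sub>1 d\<^sub>2 \<Longrightarrow> k < length (seg_word g) \<Longrightarrow>
      mark m \<psi> g (Suc k) \<in> blob_edge m (seg_word g ! k)"
    and "\<And>g a b c d. g \<in> segments d\<^sub>1 d\<^sub>2 \<Longrightarrow> a < b \<Longrightarrow> b < c \<Longrightarrow> c < d \<Longrightarrow> d \<le> top_mark g \<Longrightarrow>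
      \<not> crossing (mark m \<psi> g a) (mark m \<psi> g b) (mark m \<psi> g c) (mark m \<psi> g d)"
    and "\<And>g a b. g \<in> segments d\<^sub>1 d\<^sub>2 \<Longrightarrow> a < b \<Longrightarrow> b \<le> top_mark g \<Longrightarrow> mark m \<psi> g a \<noteq> mark m \<psi> g b"
    and "\<And>g g' a b c d. g \<in> segments d\<^sub>1 d\<^sub>2 \<Longrightarrow> g' \<in> segments d\<^sub>1 d\<^sub>2 \<Longrightarrow> seg_half g = seg_half g' \<Longrightarrow>
      g' \<noteq> g \<Longrightarrow> g' \<noteq> turn g \<Longrightarrow>
      a \<le> top_mark g \<Longrightarrow> b \<le> top_mark g \<Longrightarrow> c \<le> top_mark g' \<Longrightarrow> d \<le> top_mark g' \<Longrightarrow>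
      mark m \<psi> g a \<noteq> mark m \<psi> g' c \<and>
      \<not> crossing (mark m \<psi> g a) (mark m \<psi> g b) (mark m \<psi> g' c) (mark m \<psi> g' d)"
  then have "drawn_stack (segments d\<^sub>1 d\<^sub>2) m \<psi>"
    using assms(3) by unfold_locales assumption+
  then show ?thesis by blast
qed

context drawn_stack
begin

lemma closed_trail_not_interleaved: "closed_trail S gs \<Longrightarrow> \<not> interleaved (trail_word gs)"
  unfolding interleaved_def using loop_blobs_not_interleaved by blast

lemma outer_end_curve:
  assumes "curve a gs b"
  shows "outer_end (hd gs) 0 \<and> outer_end (last gs) (top_mark (last gs)) \<and>
    outer_mark (hd gs) 0 = (case a of North k \<Rightarrow> real k | South k \<Rightarrow> 2 * real m + 2 - real k) \<and>
    outer_mark (last gs) (top_mark (last gs)) = (case b of North k \<Rightarrow> real k | South k \<Rightarrow> 2 * real m + 2 - real k) \<and>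
    (\<forall>k. a = North k \<or> a = South k \<or> b = North k \<or> b = South k \<longrightarrow> k \<in> {1..m})"
proof -
  have start: "outer_point m (seg_half g) (position m (half_vertex (seg_half g) (outer_spot c))) \<and>
    outer_pos m (seg_half g) (position m (half_vertex (seg_half g) (outer_spot c))) =
      (case c of North k \<Rightarrow> real k | South k \<Rightarrow> 2 * real m + 2 - real k) \<and>
    (\<forall>k. c = North k \<or> c = South k \<longrightarrow> k \<in> {1..m})"
    if "g \<in> S" "seg_from g = outer_spot c" for g c
    using tops[OF that(1)] bots[OF that(1)] that(2) by (cases c) auto
  have "hd gs \<in> S" "last gs \<in> S" using assms by (auto simp: curve_def trail_def)
  then show ?thesis
    using start[of "hd gs" a] start[of "turn (last gs)" b] assms
    by (auto simp: curve_def outer_end_def outer_mark_def mark_def top_mark_def)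
qed

text \<open>
  The line turns back, so that both of its ends are on the northern or both on the southern edge. Its
  right blobs have to reach the eastern edge on the side of the larger end.
\<close>

lemma curve_word_ordered:
  assumes "curve a gs b" "a = North p \<and> b = North q \<or> a = South p \<and> b = South q"
  shows "precede_in BR BL (trail_word gs) \<Longrightarrow> q < p" "precede_in BL BR (trail_word gs) \<Longrightarrow> p < q"
proof -
  have tr: "trail S gs" using assms(1) by (simp add: curve_def)
  have start: "stuck S (turn (hd gs))" using curve_stuck[OF assms(1)] by simp
  note ends = outer_end_curve[OF assms(1)]
  have "p \<noteq> q" using curve_ends_neq[OF assms(1)] assms(2) by auto
  have pq: "p \<in> {1..m}" "q \<in> {1..m}" using ends assms(2) by blast+
  note cross = line_blobs_do_not_cross[OF tr start]
  {
    assume "precede_in BR BL (trail_word gs)"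
    then obtain n n' where n: "n < n'" "n' < length (trail_word gs)" "trail_word gs ! n = BR"
      "trail_word gs ! n' = BL" by (auto simp: precede_in_def)
    obtain z z' where z: "z \<in> blob_zone m BR" "z' \<in> blob_zone m BL"
      "separates (outer_mark (hd gs) 0) z' (outer_mark (last gs) (top_mark (last gs))) \<longleftrightarrow>
       separates z z' (outer_mark (last gs) (top_mark (last gs)))"
      using cross[OF _ _ n(1,2)] ends unfolding n(3,4) by blast
    then have "\<not> p < q"
      using ends assms(2) pq m_pos unfolding separates_def blob_zone_def by auto
    then show "q < p" using \<open>p \<noteq> q\<close> by linarith
  next
    assume "precede_in BL BR (trail_word gs)"
    then obtain n n' where n: "n < n'" "n' < length (trail_word gs)" "trail_word gs ! n = BL"
      "trail_word gs ! n' = BR" by (auto simp: precede_in_def)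
    obtain z z' where z: "z \<in> blob_zone m BL" "z' \<in> blob_zone m BR"
      "separates (outer_mark (hd gs) 0) z' (outer_mark (last gs) (top_mark (last gs))) \<longleftrightarrow>
       separates z z' (outer_mark (last gs) (top_mark (last gs)))"
      using cross[OF _ _ n(1,2)] ends unfolding n(3,4) by blast
    then have "\<not> q < p"
      using ends assms(2) pq m_pos unfolding separates_def blob_zone_def by auto
    then show "p < q" using \<open>p \<noteq> q\<close> by linarith
  }
qed

end

section \<open>Closed curves of a stack\<close>

fun vertex_half :: "vertex \<Rightarrow> half" where
  "vertex_half (North k) = Upper"
| "vertex_half (South k) = Lower"

lemma follows_irrefl: "\<not> follows g g"
  by (simp add: follows_def)

lemma closed_trail_pred:
  assumes "closed_trail S gs" "g \<in> set gs"
  shows "\<exists>p \<in> set gs. follows p g"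
proof -
  obtain n where n: "n < length gs" "gs ! n = g" using assms(2) by (auto simp: in_set_conv_nth)
  show ?thesis
  proof (cases n)
    case 0
    then have "hd gs = g" using n by (metis hd_conv_nth length_0_conv less_nat_zero_code)
    moreover have "last gs \<in> set gs" using n by (intro last_in_set) auto
    ultimately show ?thesis using assms(1) unfolding closed_trail_def by blast
  next
    case (Suc k)
    then have "follows (gs ! k) g" "gs ! k \<in> set gs"
      using trail_nth_follows[of S gs k] assms(1) n unfolding closed_trail_def by auto
    then show ?thesis by blast
  qed
qed

lemma closed_trail_succ:
  assumes "closed_trail S gs" "g \<in> set gs"
  shows "\<exists>s \<in> set gs. follows g s"
proof -
  obtain n where n: "n < length gs" "gs ! n = g" using assms(2) by (auto simp: in_set_conv_nth)
  show ?thesis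
  proof (cases "Suc n < length gs")
    case True
    then have "follows g (gs ! Suc n)" "gs ! Suc n \<in> set gs"
      using trail_nth_follows[of S gs n] assms(1) n unfolding closed_trail_def by auto
    then show ?thesis by blast
  next
    case False
    then have "n = length gs - 1" using n by simp
    then have "last gs = g" using n by (metis last_conv_nth length_0_conv less_nat_zero_code)
    moreover have "hd gs \<in> set gs" using n by (intro hd_in_set) auto
    ultimately show ?thesis using assms(1) unfolding closed_trail_def by blast
  qed
qed

lemma closed_trail_mids: "closed_trail S gs \<Longrightarrow> g \<in> set gs \<Longrightarrow> \<exists>k k'. seg_from g = Mid k \<and> seg_to g = Mid k'"
  using closed_trail_pred[of S gs g] closed_trail_succ[of S gs g] unfolding follows_def by force

lemma closed_trail_rotate:
  assumes "closed_trail S (xs @ g # ys)"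
  shows "closed_trail S (g # ys @ xs)"
proof (cases "xs = []")
  case True
  then show ?thesis using assms by simp
next
  case False
  have "trail S xs" "trail S (g # ys)" "follows (last xs) g" "follows (last (g # ys)) (hd xs)"
    using assms trail_append[OF False, of "g # ys" S] False unfolding closed_trail_def by auto
  then have "trail S ((g # ys) @ xs)" "follows (last ((g # ys) @ xs)) (hd ((g # ys) @ xs))"
    using trail_append[of "g # ys" xs S] False by auto
  then show ?thesis using assms unfolding closed_trail_def by auto
qed

context stack_system
begin

lemma closed_trail_backwards: "closed_trail S gs \<Longrightarrow> closed_trail S (backwards gs)"
proof -
  assume cl: "closed_trail S gs"
  then have ne: "gs \<noteq> []" by (auto simp: closed_trail_def trail_def)
  have "distinct (backwards gs)"
    using cl unfolding closed_trail_def backwards_def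
    by (simp add: distinct_map inj_on_def turn_eq_iff)
  then show ?thesis
    using cl ne trail_backwards[of gs] unfolding closed_trail_def by simp
qed

lemma closed_trail_successor:
  assumes "closed_trail S cs" "g \<in> set cs" "g' \<in> S" "follows g g'"
  shows "g' \<in> set cs"
proof -
  obtain s where "s \<in> set cs" "follows g s" using closed_trail_succ[OF assms(1,2)] by blast
  then show ?thesis
    using follows_unique[of s g' g] assms by (auto simp: closed_trail_def trail_def)
qed

lemma trail_within_closed:
  assumes "closed_trail S cs" "trail S gs" "hd gs \<in> set cs"
  shows "set gs \<subseteq> set cs"
proof -
  have all: "gs ! n \<in> set cs" if "n < length gs" for n
    using that
  proof (induction n)
    case 0
    then show ?case using assms(3) by (simp add: hd_conv_nth flip: length_greater_0_conv)
  next
    case (Suc n)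
    have "gs ! Suc n \<in> S" using assms(2) Suc.prems by (auto simp: trail_def)
    then show ?case
      using closed_trail_successor[OF assms(1)] Suc trail_nth_follows[OF assms(2)] by simp
  qed
  show ?thesis
  proof
    fix g assume "g \<in> set gs"
    then obtain n where "n < length gs" "gs ! n = g" unfolding in_set_conv_nth by blast
    then show "g \<in> set cs" using all[of n] by simp
  qed
qed

lemma curve_avoids_closed:
  assumes "curve a gs b" "closed_trail S cs" "g \<in> set gs"
  shows "g \<notin> set cs"
proof
  assume g: "g \<in> set cs"
  obtain xs ys where gs: "gs = xs @ g # ys" using assms(3) by (auto simp: in_set_conv_decomp)
  have "trail S (g # ys)"
    using assms(1) trail_append[of xs "g # ys" S] unfolding gs curve_def by (cases "xs = []") auto
  then have "set (g # ys) \<subseteq> set cs" by (rule trail_within_closed[OF assms(2)]) (simp add: g)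
  then have "last gs \<in> set cs" unfolding gs using last_in_set[of "g # ys"] by auto
  then show False
    using closed_trail_mids[OF assms(2), of "last gs"] assms(1) unfolding curve_def by auto
qed

lemma closed_trails_same_set:
  assumes "closed_trail S gs" "closed_trail S cs" "g \<in> set gs" "g \<in> set cs"
  shows "set gs = set cs"
proof -
  have sub: "set gs \<subseteq> set cs" if *: "closed_trail S gs" "closed_trail S cs" "g \<in> set gs" "g \<in> set cs" for gs cs
  proof -
    obtain xs ys where gs: "gs = xs @ g # ys" using *(3) by (auto simp: in_set_conv_decomp)
    have "trail S (g # ys @ xs)"
      using closed_trail_rotate[of S xs g ys] *(1) unfolding gs closed_trail_def by blast
    then have "set (g # ys @ xs) \<subseteq> set cs" by (rule trail_within_closed[OF *(2)]) (simp add: *(4))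
    then show ?thesis unfolding gs by auto
  qed
  show ?thesis using sub[of gs cs] sub[of cs gs] assms by auto
qed

lemma closed_trail_from_to:
  assumes "closed_trail S gs"
  shows "seg_from ` set (backwards gs) = seg_from ` set gs"
proof -
  have "seg_to ` set gs = seg_from ` set gs"
  proof (intro equalityI subsetI)
    fix x assume "x \<in> seg_to ` set gs"
    then obtain g where "g \<in> set gs" "x = seg_to g" by blast
    moreover from closed_trail_succ[OF assms this(1)] obtain s where "s \<in> set gs" "follows g s" by blast
    ultimately show "x \<in> seg_from ` set gs" by (auto simp: follows_def)
  next
    fix x assume "x \<in> seg_from ` set gs"
    then obtain g where "g \<in> set gs" "x = seg_from g" by blast
    moreover from closed_trail_pred[OF assms this(1)] obtain s where "s \<in> set gs" "follows s g" by blast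
    ultimately show "x \<in> seg_to ` set gs" by (auto simp: follows_def image_iff intro!: bexI[of _ s])
  qed
  then show ?thesis by (simp add: image_image)
qed

lemma closed_trail_not_both:
  assumes "closed_trail S cs" "g \<in> set cs"
  shows "turn g \<notin> set cs"
proof
  assume "turn g \<in> set cs"
  then obtain p q where pq: "p < length cs" "cs ! p = g" "q < length cs" "cs ! q = turn g"
    using assms(2) unfolding in_set_conv_nth by blast
  have tr: "trail S cs" using assms(1) by (simp add: closed_trail_def)
  show False
  proof (cases "p \<le> q")
    case True
    then show False using trail_no_return[OF tr True pq(3)] pq by simp
  next
    case False
    then show False using trail_no_return[OF tr _ pq(1), of q] pq by simp
  qed
qed

text \<open>
  The closed trail is rotated so that it starts at its smallest glued vertex. It does not come back
  there, since the vertex has only one segment in each half; hence the strict inequality in \<open>loop_at\<close>.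
\<close>

lemma closed_trail_cut:
  assumes cl: "closed_trail S cs" and g: "g \<in> set cs" "seg_half g = Upper" "seg_from g = Mid k"
    and least: "\<And>g' k'. g' \<in> set cs \<Longrightarrow> seg_from g' = Mid k' \<Longrightarrow> k \<le> k'"
  shows "\<exists>gs. loop_at S k gs \<and> set gs = set cs"
proof -
  obtain xs ys where cs: "cs = xs @ g # ys" using g(1) by (auto simp: in_set_conv_decomp)
  have rot: "closed_trail S (g # ys @ xs)" using closed_trail_rotate cl unfolding cs .
  have in_S: "set cs \<subseteq> S" using cl by (simp add: closed_trail_def trail_def)
  have "k < k'" if g': "g' \<in> set (ys @ xs)" "seg_from g' = Mid k'" for g' k'
  proof -
    have cs': "g' \<in> set cs" using g' unfolding cs by auto
    have neq: "g' \<noteq> g" using g' rot unfolding closed_trail_def by auto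
    have "k \<noteq> k'"
    proof
      assume "k = k'"
      then have same: "seg_from g' = seg_from g" using g' g by simp
      then have half: "seg_half g' \<noteq> seg_half g" using unique[of g' g] neq cs' g(1) in_S by blast
      obtain p where p: "p \<in> set cs" "follows p g'" using closed_trail_pred[OF cl cs'] by blast
      have "seg_half p = seg_half g"
        using p(2) half half_eqI[of "seg_half p" "seg_half g'" "seg_half g"] by (auto simp: follows_def)
      moreover have "seg_to p = seg_from g" using p(2) same by (simp add: follows_def)
      ultimately have "turn p = g" using p(1) g(1) in_S by (intro unique) auto
      then show False using closed_trail_not_both[OF cl p(1)] g(1) by simp
    qed
    then show ?thesis using least[OF cs' g'(2)] by simp
  qed
  then have "loop_at S k (g # ys @ xs)"
    using rot g unfolding loop_at_def closed_trail_def by auto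
  then show ?thesis using cs by (intro exI[of _ "g # ys @ xs"]) auto
qed

text \<open>
  At its smallest glued vertex a closed curve has one segment in either half, so that one of its two
  directions leaves through the upper half.
\<close>

lemma ex_loop_of_closed_trail:
  assumes cl: "closed_trail S cs"
  shows "\<exists>k gs. loop_at S k gs \<and> (set gs = set cs \<or> set gs = set (backwards cs))"
proof -
  define I where "I = {k. Mid k \<in> seg_from ` set cs}"
  have "cs \<noteq> []" using cl by (auto simp: closed_trail_def trail_def)
  then obtain g0 where "g0 \<in> set cs" by (cases cs) auto
  then obtain k0 where "seg_from g0 = Mid k0" using closed_trail_mids[OF cl] by blast
  with \<open>g0 \<in> set cs\<close> have "k0 \<in> I" unfolding I_def by (auto simp: image_iff intro!: bexI[of _ g0])
  define k where "k = (LEAST k. k \<in> I)"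
  have k: "k \<in> I" "\<And>k'. k' \<in> I \<Longrightarrow> k \<le> k'"
    unfolding k_def using \<open>k0 \<in> I\<close> by (auto intro: LeastI Least_le)
  then obtain g where g: "g \<in> set cs" "seg_from g = Mid k" by (auto simp: I_def)
  show ?thesis
  proof (cases "seg_half g")
    case Upper
    have "\<exists>gs. loop_at S k gs \<and> set gs = set cs"
    proof (rule closed_trail_cut[OF cl g(1) Upper g(2)])
      fix g' k' assume "g' \<in> set cs" "seg_from g' = Mid k'"
      then have "Mid k' \<in> seg_from ` set cs" by (intro image_eqI[of _ _ g']) auto
      then show "k \<le> k'" using k(2) by (simp add: I_def)
    qed
    then show ?thesis by blast
  next
    case Lower
    obtain p where p: "p \<in> set cs" "follows p g" using closed_trail_pred[OF cl g(1)] by blast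
    have cl': "closed_trail S (backwards cs)" by (rule closed_trail_backwards[OF cl])
    have "\<exists>gs. loop_at S k gs \<and> set gs = set (backwards cs)"
    proof (rule closed_trail_cut[OF cl'])
      show "turn p \<in> set (backwards cs)" using p by simp
      show "seg_half (turn p) = Upper"
        using p(2) Lower by (cases "seg_half p") (auto simp: follows_def)
      show "seg_from (turn p) = Mid k" using p(2) g(2) by (simp add: follows_def)
      show "k \<le> k'" if "g' \<in> set (backwards cs)" "seg_from g' = Mid k'" for g' k'
      proof -
        have "Mid k' \<in> seg_from ` set (backwards cs)" using that by (intro image_eqI[of _ _ g']) auto
        then show ?thesis using closed_trail_from_to[OF cl] k(2) by (simp add: I_def)
      qed
    qed
    then show ?thesis by blast
  qed
qed

lemma curve_through_either:
  assumes "curve a gs b" "curve a' gs' b'" "g \<in> set gs" "g \<in> set gs' \<or> turn g \<in> set gs'"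
  shows "gs = gs' \<or> gs = backwards gs'"
  using assms(4)
proof
  assume "g \<in> set gs'"
  then show ?thesis using curve_through assms by blast
next
  assume "turn g \<in> set gs'"
  then have "g \<in> set (backwards gs')" by (metis backwards_simps(6) image_eqI turn_turn)
  then show ?thesis using curve_through[OF assms(1) curve_backwards[OF assms(2)] assms(3)] by blast
qed

text \<open>
  The curves of \<open>S\<close> that are not made of segments of \<open>T\<close> are listed by \<open>C\<close>, one direction each.
\<close>

lemma lines_split:
  assumes "T \<subseteq> S"
    and cover: "\<And>a gs b. curve a gs b \<Longrightarrow> \<not> set gs \<subseteq> T \<Longrightarrow>
      \<exists>(a', gs', b') \<in> C. gs = gs' \<or> gs = backwards gs'"
    and C: "\<And>a gs b. (a, gs, b) \<in> C \<Longrightarrow> curve a gs b \<and> precedes a b"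
  shows "lines_of S = lines_of T \<union> (\<lambda>(a, gs, b). (a, trail_word gs, b)) ` C"
proof (intro equalityI subsetI)
  fix l assume "l \<in> lines_of S"
  then obtain a gs b where l: "l = (a, trail_word gs, b)" "precedes a b" "curve a gs b"
    unfolding lines_of_eq by auto
  show "l \<in> lines_of T \<union> (\<lambda>(a, gs, b). (a, trail_word gs, b)) ` C"
  proof (cases "set gs \<subseteq> T")
    case True
    then have "trail T gs" using l(3) by (simp add: curve_def trail_def)
    then show ?thesis using l unfolding lines_of_def curve_def by auto
  next
    case False
    obtain a' gs' b' where c: "(a', gs', b') \<in> C" "gs = gs' \<or> gs = backwards gs'"
      using cover[OF l(3) False] by auto
    have c': "curve a' gs' b'" "precedes a' b'" using C[OF c(1)] by auto
    have "gs = gs'"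
    proof (rule ccontr)
      assume "gs \<noteq> gs'"
      then have "gs = backwards gs'" using c(2) by simp
      then have "a = b' \<and> b = a'"
        using curve_backwards[OF c'(1)] l(3) by (simp add: curve_def)
      then show False using l(2) c'(2) precedes_antisym by blast
    qed
    then have "a = a' \<and> b = b'" using c'(1) l(3) by (simp add: curve_def)
    then show ?thesis using c(1) l(1) \<open>gs = gs'\<close> by force
  qed
next
  fix l assume "l \<in> lines_of T \<union> (\<lambda>(a, gs, b). (a, trail_word gs, b)) ` C"
  then show "l \<in> lines_of S"
  proof
    assume "l \<in> lines_of T"
    then show ?thesis unfolding lines_of_def using trail_mono[OF _ assms(1)] by blast
  next
    assume "l \<in> (\<lambda>(a, gs, b). (a, trail_word gs, b)) ` C"
    then show ?thesis using C unfolding lines_of_eq by auto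
  qed
qed

lemma line_ends_avoid:
  assumes "curve a gs b" "\<not> set gs \<subseteq> T" "T \<subseteq> S" "l \<in> lines_of T" "\<And>g. g \<in> T \<Longrightarrow> turn g \<in> T"
  shows "line_ends l \<inter> {a, b} = {}"
proof -
  obtain c hs d where l: "l = (c, trail_word hs, d)" "trail T hs" "seg_from (hd hs) = outer_spot c"
    "seg_to (last hs) = outer_spot d"
    using assms(4) unfolding lines_of_def by auto
  have hs: "curve c hs d" using l trail_mono[OF l(2) assms(3)] by (simp add: curve_def)
  have sub: "set hs \<subseteq> T" "set (backwards hs) \<subseteq> T" using l(2) assms(5) by (auto simp: trail_def)
  have "set gs \<subseteq> T" if "set (backwards gs) \<subseteq> T"
  proof
    fix g assume "g \<in> set gs"
    then have "turn g \<in> T" using that by auto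
    then show "g \<in> T" using assms(5)[of "turn g"] by simp
  qed
  then have "\<not> set (backwards gs) \<subseteq> T" using assms(2) by blast
  note bw = curve_backwards[OF hs] curve_backwards[OF assms(1)]
  have "c \<noteq> a" using curve_unique[of a gs b hs d] assms(1,2) hs sub by auto
  moreover have "d \<noteq> a" 
  proof
    assume "d = a"
    then have "gs = backwards hs" using curve_unique[of a gs b "backwards hs" c] assms(1) bw(1) by blast
    then show False using assms(2) sub(2) by blast
  qed
  moreover have "c \<noteq> b" 
  proof
    assume "c = b"
    then have "backwards gs = hs" using curve_unique[of b "backwards gs" a hs d] bw hs by blast
    then show False using sub(1) \<open>\<not> set (backwards gs) \<subseteq> T\<close> by blast
  qed
  moreover have "d \<noteq> b"
  proof
    assume "d = b"
    then have "backwards gs = backwards hs"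
      using curve_unique[of b "backwards gs" a "backwards hs" c] bw by blast
    then have "set (backwards gs) = set (backwards hs)" by (rule arg_cong)
    then show False using sub(2) \<open>\<not> set (backwards gs) \<subseteq> T\<close> by blast
  qed
  ultimately show ?thesis using l(1) by auto
qed

lemma vertex_half_from:
  "g \<in> S \<Longrightarrow> seg_from g = outer_spot v \<Longrightarrow> seg_half g = vertex_half v"
  using tops[of g] bots[of g] by (cases v) auto

lemma vertex_half_to:
  "g \<in> S \<Longrightarrow> seg_to g = outer_spot v \<Longrightarrow> seg_half g = vertex_half v"
  using vertex_half_from[of "turn g" v] by simp

end

section \<open>Reconnecting two doubly decorated segments of a stack\<close>

lemma turn_follows_iff: "follows (turn g) g' \<longleftrightarrow> follows (turn g') g"
  using follows_turn[of g "turn g'"] by simp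

lemma stack_system_subset:
  assumes "stack_system S m" "T \<subseteq> S" "\<And>g. g \<in> T \<Longrightarrow> turn g \<in> T"
  shows "stack_system T m"
proof -
  interpret stack_system S m by fact
  show ?thesis
  proof
    fix g g' k
    show "turn g \<in> T" if "g \<in> T" using that assms(3) by blast
    show "g = g'" if "g \<in> T" "g' \<in> T" "seg_half g = seg_half g'" "seg_from g = seg_from g'"
      using that assms(2) unique by blast
    show "seg_from g \<noteq> seg_to g" if "g \<in> T" using that assms(2) proper by blast
    show "k \<in> {1..m}" if "g \<in> T" "seg_from g = Mid k" using that assms(2) mids by blast
    show "seg_half g = Upper \<and> k \<in> {1..m}" if "g \<in> T" "seg_from g = Top k" using that assms(2) tops by blast
    show "seg_half g = Lower \<and> k \<in> {1..m}" if "g \<in> T" "seg_from g = Bot k" using that assms(2) bots by blast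
  qed
qed

text \<open>
  The representative of a line that is stored in a diagram.
\<close>

definition ordered_line :: "vertex \<Rightarrow> blob list \<Rightarrow> vertex \<Rightarrow> line" where
  "ordered_line a w b = (if precedes a b then (a, w, b) else (b, rev w, a))"

text \<open>
  The stack \<open>S\<close> contains the doubly decorated segments \<open>l0\<close>, with both ends on the gluing line, and
  \<open>l1\<close>, with both ends on the outer edge of the same half \<open>h\<close>. In \<open>S'\<close> they are replaced by \<open>k0\<close> and
  \<open>k1\<close>, which run from the gluing line to the outer edge; \<open>T\<close> is what the two stacks share. By
  \<open>no_through\<close> the curves of \<open>T\<close> that leave the gluing line through \<open>h\<close> return to it.
\<close>

locale surgery = old: stack_system S m + new: stack_system S' m + common: stack_system T m
  for S S' T :: "segment set" and m :: nat +
  fixes h :: half and i j :: nat and x y :: vertex and l0 l1 k0 k1 :: segment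
  assumes l0: "l0 = (h, Mid i, [BL, BR], Mid j)"
    and l1: "l1 = (h, outer_spot x, [BL, BR], outer_spot y)"
    and k0: "k0 = (h, Mid i, [BL], outer_spot x)"
    and k1: "k1 = (h, Mid j, [BR], outer_spot y)"
    and S_eq: "S = T \<union> {l0, turn l0, l1, turn l1}"
    and S'_eq: "S' = T \<union> {k0, turn k0, k1, turn k1}"
    and fresh: "l0 \<notin> T" "l1 \<notin> T" "k0 \<notin> T" "k1 \<notin> T"
    and xy: "precedes x y"
    and finite_S: "finite S"
    and continues: "g \<in> S \<Longrightarrow> seg_to g = Mid k \<Longrightarrow> \<exists>g' \<in> S. follows g g'"
    and no_through: "g \<in> T \<Longrightarrow> seg_half g = h \<Longrightarrow> seg_from g = Mid k \<Longrightarrow> \<exists>k'. seg_to g = Mid k'"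
    and drawable: "\<exists>\<psi>. drawn_stack S m \<psi>"
begin

lemma T_sub: "T \<subseteq> S" "T \<subseteq> S'"
  using S_eq S'_eq by auto

lemma fresh_turn: "turn l0 \<notin> T" "turn l1 \<notin> T" "turn k0 \<notin> T" "turn k1 \<notin> T"
  using fresh by simp_all

lemma l_in: "l0 \<in> S" "turn l0 \<in> S" "l1 \<in> S" "turn l1 \<in> S" and k_in: "k0 \<in> S'" "turn k0 \<in> S'" "k1 \<in> S'" "turn k1 \<in> S'"
  using S_eq S'_eq by auto

lemma half_x: "vertex_half x = h" and half_y: "vertex_half y = h"
  using old.vertex_half_from[OF l_in(3), of x] old.vertex_half_to[OF l_in(3), of y] l1 by simp_all

lemma trail_old: "trail T W \<Longrightarrow> trail S W" and trail_new: "trail T W \<Longrightarrow> trail S' W"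
  using trail_mono T_sub by blast+

lemma after_mid:
  assumes "e \<in> {l0, turn l0}" "g \<in> S" "follows e g"
  shows "g \<in> T" "stuck T (turn g)"
proof -
  have e: "e \<in> S" "e \<notin> T" "turn e \<in> S" "turn e \<notin> T" using assms(1) l_in fresh by auto
  have "seg_half g \<noteq> h" using assms(1,3) l0 by (auto simp: follows_def)
  then show "g \<in> T" using assms(2) S_eq l0 l1 by auto
  show "stuck T (turn g)"
    unfolding stuck_def
  proof (intro ballI notI)
    fix g' assume g': "g' \<in> T" "follows (turn g) g'"
    have "follows (turn g) (turn e)" using assms(3) by simp
    then have "g' = turn e" using old.follows_unique[of g' "turn e" "turn g"] g' e T_sub by blast
    then show False using g' e by simp
  qed
qed

lemma maximal_from_mid:
  assumes "e \<in> {l0, turn l0}"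
  shows "\<exists>W. trail T W \<and> follows e (hd W) \<and> stuck T (last W)"
proof -
  obtain k where k: "seg_to e = Mid k" using assms l0 by auto
  have "e \<in> S" using assms l_in by auto
  then obtain g where g: "g \<in> S" "follows e g" using continues k by blast
  have "finite T" using finite_S T_sub finite_subset by blast
  then obtain W where "trail T W" "hd W = g" "stuck T (last W)"
    using common.ex_maximal_trail after_mid[OF assms g] by blast
  then show ?thesis using g by blast
qed

text \<open>
  From an end of \<open>l0\<close> the curve can be followed through \<open>T\<close> until it meets the outer boundary or returns
  to \<open>l0\<close>. It cannot return to the end from which it started, as it would then have to turn back.
\<close>

lemma maximal_end:
  assumes "e \<in> {l0, turn l0}" "trail T W" "follows e (hd W)" "stuck T (last W)"
  shows "(\<exists>a. seg_to (last W) = outer_spot a) \<or> follows (last W) e"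
proof (cases "seg_to (last W)")
  case (Top k)
  then show ?thesis using outer_spot.simps(1)[of k] by metis
next
  case (Bot k)
  then show ?thesis using outer_spot.simps(2)[of k] by metis
next
  case (Mid k)
  have W: "hd W \<in> S" "last W \<in> S" "W \<noteq> []" using trail_old[OF assms(2)] by (auto simp: trail_def)
  obtain g where g: "g \<in> S" "follows (last W) g" using continues[OF W(2) Mid] by blast
  then have "g \<notin> T" using assms(4) by (auto simp: stuck_def)
  then have "g \<in> {l0, turn l0, l1, turn l1}" using g(1) S_eq by blast
  moreover have "g \<noteq> l1" "g \<noteq> turn l1" using g(2) l1 Mid by (auto simp: follows_def)
  ultimately have "g = e \<or> g = turn e" using assms(1) by auto
  moreover have "g \<noteq> turn e"
  proof
    assume "g = turn e"
    then have "follows e (turn (last W))" using g(2) follows_turn[of "turn e" "last W"] by simp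
    then have "hd W = turn (last W)" using old.follows_unique[OF W(1) _ assms(3)] W(2) by simp
    moreover have "W ! 0 \<noteq> turn (W ! (length W - 1))"
      using common.trail_no_return[OF assms(2), of 0 "length W - 1"] W(3) by simp
    ultimately show False using W(3) by (simp add: hd_conv_nth last_conv_nth)
  qed
  ultimately show ?thesis using g(2) by blast
qed

text \<open>
  The two ends of \<open>l0\<close> are joined by \<open>W\<close>, which runs from \<open>i\<close> to \<open>j\<close>.
\<close>

definition loop_case :: "segment list \<Rightarrow> bool" where
  "loop_case W \<longleftrightarrow> trail T W \<and> follows (turn l0) (hd W) \<and> follows (last W) (turn l0)"

text \<open>
  \<open>U\<close> and \<open>V\<close> continue the curve beyond the ends \<open>i\<close> and \<open>j\<close> of \<open>l0\<close>.
\<close>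

definition line_case :: "vertex \<Rightarrow> segment list \<Rightarrow> segment list \<Rightarrow> vertex \<Rightarrow> bool" where
  "line_case a U V b \<longleftrightarrow> trail T U \<and> follows (turn l0) (hd U) \<and> seg_to (last U) = outer_spot a \<and>
     trail T V \<and> follows l0 (hd V) \<and> seg_to (last V) = outer_spot b"

lemma loop_or_line: "(\<exists>W. loop_case W) \<or> (\<exists>a U V b. line_case a U V b)"
proof (rule ccontr)
  assume none: "\<not> ?thesis"
  obtain U where U: "trail T U" "follows (turn l0) (hd U)" "stuck T (last U)"
    using maximal_from_mid[of "turn l0"] by auto
  obtain V where V: "trail T V" "follows l0 (hd V)" "stuck T (last V)"
    using maximal_from_mid[of l0] by auto
  have "\<not> follows (last U) (turn l0)" using none U unfolding loop_case_def by blast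
  then obtain a where a: "seg_to (last U) = outer_spot a"
    using maximal_end[OF _ U] by auto
  then have "\<nexists>b. seg_to (last V) = outer_spot b" using none U V unfolding line_case_def by blast
  then have close: "follows (last V) l0" using maximal_end[OF _ V] by auto
  have "V \<noteq> []" "U \<noteq> []" using U V by (auto simp: trail_def)
  have "trail T (backwards V)" using common.trail_backwards V by blast
  moreover have "follows (turn l0) (turn (last V))" using close by simp
  ultimately have "loop_case (backwards V)"
    using V(2) \<open>V \<noteq> []\<close> unfolding loop_case_def by simp
  then show False using none by blast
qed

lemma lines_S:
  assumes cover: "\<And>a gs b. old.curve a gs b \<Longrightarrow> l0 \<in> set gs \<or> turn l0 \<in> set gs \<Longrightarrow>
      \<exists>(a', gs', b') \<in> C. gs = gs' \<or> gs = backwards gs'"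
    and C: "\<And>a gs b. (a, gs, b) \<in> C \<Longrightarrow> old.curve a gs b \<and> precedes a b"
  shows "lines_of S = lines_of T \<union> (\<lambda>(a, gs, b). (a, trail_word gs, b)) ` insert (x, [l1], y) C"
proof (rule old.lines_split[OF T_sub(1)])
  have outer: "old.curve x [l1] y" using l_in(3) l1 by (simp add: old.curve_def)
  show "old.curve a gs b \<and> precedes a b" if "(a, gs, b) \<in> insert (x, [l1], y) C" for a gs b
    using that outer xy C by auto
  fix a gs b assume gs: "old.curve a gs b" "\<not> set gs \<subseteq> T"
  then obtain g where g: "g \<in> set gs" "g \<in> {l0, turn l0, l1, turn l1}"
    using S_eq unfolding old.curve_def trail_def by blast
  show "\<exists>(a', gs', b') \<in> insert (x, [l1], y) C. gs = gs' \<or> gs = backwards gs'"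
  proof (cases "g \<in> {l0, turn l0}")
    case True
    then show ?thesis using cover[OF gs(1)] g(1) by blast
  next
    case False
    then have "g \<in> set [l1] \<or> turn g \<in> set [l1]" using g(2) by auto
    then show ?thesis using old.curve_through_either[OF gs(1) outer g(1)] by blast
  qed
qed

lemma lines_S':
  assumes C: "\<And>a gs b. (a, gs, b) \<in> C \<Longrightarrow> new.curve a gs b \<and> precedes a b"
    and k: "\<exists>a gs b. (a, gs, b) \<in> C \<and> (k0 \<in> set gs \<or> turn k0 \<in> set gs)"
      "\<exists>a gs b. (a, gs, b) \<in> C \<and> (k1 \<in> set gs \<or> turn k1 \<in> set gs)"
  shows "lines_of S' = lines_of T \<union> (\<lambda>(a, gs, b). (a, trail_word gs, b)) ` C"
proof (rule new.lines_split[OF T_sub(2) _ C])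
  fix a gs b assume gs: "new.curve a gs b" "\<not> set gs \<subseteq> T"
  then obtain g where g: "g \<in> set gs" "g \<in> {k0, turn k0, k1, turn k1}"
    using S'_eq unfolding new.curve_def trail_def by blast
  obtain a' gs' b' where "(a', gs', b') \<in> C" "g \<in> set gs' \<or> turn g \<in> set gs'"
    using k g(2) by auto
  then show "\<exists>(a', gs', b') \<in> C. gs = gs' \<or> gs = backwards gs'"
    using new.curve_through_either[OF gs(1) _ g(1), of a' gs' b'] C by blast
qed

lemma closed_in_T:
  assumes "closed_trail S gs" "l0 \<notin> set gs" "turn l0 \<notin> set gs"
  shows "set gs \<subseteq> T"
proof
  fix g assume g: "g \<in> set gs"
  then have "g \<in> S" using assms(1) by (auto simp: closed_trail_def trail_def)
  moreover obtain k k' where "seg_from g = Mid k" "seg_to g = Mid k'"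
    using closed_trail_mids[OF assms(1) g] by blast
  then have "g \<noteq> l1" "g \<noteq> turn l1" using l1 by auto
  ultimately show "g \<in> T" using assms(2,3) g S_eq by auto
qed

text \<open>
  In \<open>S'\<close> both new segments reach the outer boundary, so no loop passes through them.
\<close>

lemma loops_S': "loops_of S' = loops_of T"
proof -
  have "loop_at S' k gs \<longleftrightarrow> loop_at T k gs" for k gs
  proof
    assume loop: "loop_at S' k gs"
    have cl: "closed_trail S' gs" by (rule new.loop_at_closed[OF loop])
    have "set gs \<subseteq> T"
    proof
      fix g assume g: "g \<in> set gs"
      then have "g \<in> S'" using cl by (auto simp: closed_trail_def trail_def)
      moreover obtain k k' where "seg_from g = Mid k" "seg_to g = Mid k'"
        using closed_trail_mids[OF cl g] by blast
      then have "g \<noteq> k0" "g \<noteq> turn k0" "g \<noteq> k1" "g \<noteq> turn k1" using k0 k1 by auto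
      ultimately show "g \<in> T" using S'_eq by auto
    qed
    then show "loop_at T k gs" using loop by (simp add: loop_at_def trail_def)
  next
    assume "loop_at T k gs"
    then show "loop_at S' k gs" unfolding loop_at_def using trail_new by blast
  qed
  then show ?thesis by (simp add: loops_of_def)
qed

lemma loops_T_sub: "loops_of T \<subseteq> loops_of S"
  unfolding loops_of_def loop_at_def using trail_old by blast

text \<open>
  A curve of \<open>T\<close> never leaves \<open>h\<close> by its outer edge once it has come from the gluing line. So its
  ends are either both in \<open>h\<close> or both in the other half.
\<close>

lemma common_lines_not_through:
  assumes "l \<in> lines_of T" "l = (a, w, b)"
  shows "vertex_half a = vertex_half b"
proof -
  have start: "vertex_half b = h" if gs: "common.curve a gs b" "vertex_half a = h" for a b gs
  proof -
    have ne: "gs \<noteq> []" and in_T: "set gs \<subseteq> T" using gs(1) by (auto simp: common.curve_def trail_def)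
    have hd: "hd gs \<in> T" "seg_from (hd gs) = outer_spot a" using gs(1) ne in_T by (auto simp: common.curve_def)
    have half: "seg_half (hd gs) = h" using common.vertex_half_from[OF hd] gs(2) by simp
    have "tl gs = []"
    proof (rule ccontr)
      assume "tl gs \<noteq> []"
      then obtain g2 rest where g2: "gs = hd gs # g2 # rest" using ne by (cases gs; cases "tl gs") auto
      have "successively follows gs" using gs(1) by (simp add: common.curve_def trail_def)
      then have "follows (hd gs) g2" by (subst (asm) g2) simp
      then obtain k where "seg_to (hd gs) = Mid k" unfolding follows_def by blast
      then obtain k' where "seg_from (hd gs) = Mid k'"
        using no_through[of "turn (hd gs)" k] hd(1) half by auto
      then show False using hd(2) by simp
    qed
    then have "last gs = hd gs" using ne by (cases gs) auto
    then have "seg_to (hd gs) = outer_spot b" using gs(1) by (simp add: common.curve_def)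
    then show ?thesis using common.vertex_half_to[OF hd(1)] half by simp
  qed
  obtain gs where gs: "common.curve a gs b" using assms unfolding common.lines_of_eq by auto
  show ?thesis
  proof (cases "vertex_half a = h \<or> vertex_half b = h")
    case True
    then show ?thesis using start[OF gs] start[OF common.curve_backwards[OF gs]] by auto
  next
    case False
    then show ?thesis using half_eqI[of "vertex_half a" h "vertex_half b"] by simp
  qed
qed

lemma far_end_half:
  assumes "trail T W" "follows e (hd W)" "seg_to (last W) = outer_spot a"
  shows "vertex_half a \<noteq> h"
proof
  assume "vertex_half a = h"
  have last: "last W \<in> T" "W \<noteq> []" using assms(1) by (auto simp: trail_def)
  then have half: "seg_half (last W) = h"
    using common.vertex_half_to[OF last(1) assms(3)] \<open>vertex_half a = h\<close> by simp
  have "\<exists>k. seg_from (last W) = Mid k"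
  proof (cases "length W")
    case 0
    then show ?thesis using last(2) by simp
  next
    case (Suc n)
    show ?thesis
    proof (cases n)
      case 0
      then have "last W = hd W" using Suc last(2) by (cases W) auto
      then show ?thesis using assms(2) unfolding follows_def by metis
    next
      case (Suc k)
      then have "last W = W ! Suc k" using \<open>length W = Suc n\<close> last(2) by (simp add: last_conv_nth)
      then show ?thesis
        using trail_nth_follows[OF assms(1), of k] \<open>length W = Suc n\<close> Suc unfolding follows_def
        by (metis lessI)
    qed
  qed
  then show False using no_through[OF last(1) half] assms(3) by auto
qed

end

lemma rotate_to_runs:
  "\<exists>n. [BR, BL] @ replicate p BL @ replicate q BR = rotate n (replicate (Suc p) BL @ replicate (Suc q) BR)"
  "\<exists>n. [BL, BR] @ replicate q BR @ replicate p BL = rotate n (replicate (Suc p) BL @ replicate (Suc q) BR)"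
proof -
  have "rotate (length (replicate (Suc p) BL @ replicate q BR)) ((replicate (Suc p) BL @ replicate q BR) @ [BR]) =
    [BR] @ replicate (Suc p) BL @ replicate q BR"
    by (rule rotate_append)
  moreover have "replicate (Suc q) BR = replicate q BR @ [BR]" by (simp add: replicate_append_same)
  ultimately show "\<exists>n. [BR, BL] @ replicate p BL @ replicate q BR =
      rotate n (replicate (Suc p) BL @ replicate (Suc q) BR)"
    by (metis append.assoc append_Cons append_Nil replicate_Suc)
  have "rotate (length (replicate p BL)) (replicate p BL @ ([BL] @ replicate (Suc q) BR)) =
    ([BL] @ replicate (Suc q) BR) @ replicate p BL"
    by (rule rotate_append)
  moreover have "replicate (Suc p) BL = replicate p BL @ [BL]" by (simp add: replicate_append_same)
  ultimately show "\<exists>n. [BL, BR] @ replicate q BR @ replicate p BL =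
      rotate n (replicate (Suc p) BL @ replicate (Suc q) BR)"
    by (metis append.assoc append_Cons append_Nil replicate_Suc)
qed

context surgery
begin

lemma common_ends_avoid:
  assumes "old.curve a gs b" "l0 \<in> set gs" "l \<in> lines_of T"
  shows "line_ends l \<inter> {a, b} = {}"
  by (rule old.line_ends_avoid[OF assms(1) _ T_sub(1) assms(3)]) (use assms(2) fresh in auto)

lemma common_ends_avoid_xy: "l \<in> lines_of T \<Longrightarrow> line_ends l \<inter> {x, y} = {}"
  by (rule old.line_ends_avoid[of x "[l1]" y T])
    (use T_sub fresh l_in l1 in \<open>auto simp: old.curve_def\<close>)

lemma loop_at_old_iff:
  assumes "l0 \<notin> set gs" "turn l0 \<notin> set gs"
  shows "loop_at S k gs \<longleftrightarrow> loop_at T k gs"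
proof
  assume "loop_at S k gs"
  moreover from this have "set gs \<subseteq> T" using old.loop_at_closed closed_in_T assms by blast
  ultimately show "loop_at T k gs" by (simp add: loop_at_def trail_def)
next
  assume "loop_at T k gs"
  then show "loop_at S k gs" unfolding loop_at_def using trail_old by blast
qed

text \<open>
  The line through \<open>l0\<close> contains \<open>L\<close> before \<open>R\<close> and has both ends on the same edge, hence no \<open>R\<close>
  precedes an \<open>L\<close> by \<open>curve_word_ordered\<close>. So all blobs before those of \<open>l0\<close> are left blobs and all
  blobs after them are right blobs. The new segments carry the two blobs of \<open>l0\<close> to the two lines
  into which it is cut.
\<close>

lemma line_case_result:
  assumes "line_case a U V b"
  shows "\<exists>p q. vertex_half a \<noteq> h \<and> vertex_half b \<noteq> h \<and> precedes a b \<and>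
    lines_of S = lines_of T \<union> {(x, [BL, BR], y), (a, replicate (Suc p) BL @ replicate (Suc q) BR, b)} \<and>
    lines_of S' = lines_of T \<union>
      {ordered_line a (replicate (Suc p) BL) x, ordered_line b (replicate (Suc q) BR) y} \<and>
    loops_of S = loops_of S' \<and> (\<forall>l \<in> lines_of T. line_ends l \<inter> {a, b, x, y} = {})"
proof -
  have U: "trail T U" "follows (turn l0) (hd U)" "seg_to (last U) = outer_spot a" "U \<noteq> []"
    and V: "trail T V" "follows l0 (hd V)" "seg_to (last V) = outer_spot b" "V \<noteq> []"
    using assms unfolding line_case_def trail_def by auto
  \<comment> \<open>the line of \<open>S\<close> through \<open>l0\<close>\<close>
  define C where "C = backwards U @ [l0] @ V"
  have ab: "vertex_half a \<noteq> h" "vertex_half b \<noteq> h" using far_end_half U V by blast+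
  have tU: "trail S (backwards U)" "trail S V" "trail S' (backwards U)" "trail S' (backwards V)"
    using old.trail_backwards trail_old new.trail_backwards trail_new U(1) V(1) by blast+
  have "follows (turn (hd U)) l0" using U(2) turn_follows_iff by blast
  then have "trail S C"
    unfolding C_def using U V tU l_in by (simp add: trail_append trail_Cons)
  then have C: "old.curve a C b"
    using U V by (simp add: old.curve_def C_def hd_append last_append)
  have word: "trail_word C = rev (trail_word U) @ [BL, BR] @ trail_word V"
    by (simp add: C_def trail_word_backwards l0)
  have "precede_in BL BR [BL, BR]" using precede_in_append[of BL "[BL]" BR "[BR]"] by simp
  then have LR: "precede_in BL BR (trail_word C)" unfolding word by (rule precede_in_extend)
  obtain \<psi> where "drawn_stack S m \<psi>" using drawable by blast
  then interpret drawn_stack S m \<psi> .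
  have "vertex_half a = vertex_half b" using half_eqI[OF ab] .
  then obtain s t where st: "a = North s \<and> b = North t \<or> a = South s \<and> b = South t"
    by (cases a; cases b) auto
  then have "s < t" and RL: "\<not> precede_in BR BL (trail_word C)"
    using curve_word_ordered[OF C st] LR by auto
  then have prec: "precedes a b" using st by auto
  define p q where "p = length (trail_word U)" and "q = length (trail_word V)"
  have wU: "rev (trail_word U) = replicate p BL" and wV: "trail_word V = replicate q BR"
    using sorted_word_around[OF RL[unfolded word]] by (simp_all add: p_def q_def)
  have wC: "trail_word C = replicate (Suc p) BL @ replicate (Suc q) BR"
    unfolding word wU wV by (simp add: replicate_append_same flip: append_assoc)
  define K0 K1 where "K0 = backwards U @ [k0]" and "K1 = backwards V @ [k1]"
  have "follows (turn (hd U)) k0" using \<open>follows (turn (hd U)) l0\<close> by (simp add: follows_def l0 k0)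
  then have K0: "new.curve a K0 x"
    using U tU k_in unfolding new.curve_def K0_def by (simp add: trail_append hd_append) (simp add: k0)
  have "follows (turn (hd V)) (turn l0)" using V(2) by simp
  then have "follows (turn (hd V)) k1" by (simp add: follows_def l0 k1)
  then have K1: "new.curve b K1 y"
    using V tU k_in unfolding new.curve_def K1_def by (simp add: trail_append hd_append) (simp add: k1)
  have wK0: "trail_word K0 = replicate (Suc p) BL"
    by (simp add: K0_def trail_word_backwards wU k0 replicate_append_same)
  have wK1: "trail_word K1 = replicate (Suc q) BR"
    by (simp add: K1_def trail_word_backwards wV k1 replicate_append_same)
  have linesS: "lines_of S = lines_of T \<union> (\<lambda>(a, gs, b). (a, trail_word gs, b)) ` insert (x, [l1], y) {(a, C, b)}"
  proof (rule lines_S)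
    show "old.curve a' gs b' \<and> precedes a' b'" if "(a', gs, b') \<in> {(a, C, b)}" for a' gs b'
      using that C prec by simp
    show "\<exists>(a', gs', b') \<in> {(a, C, b)}. gs = gs' \<or> gs = backwards gs'"
      if "old.curve c gs d" "l0 \<in> set gs \<or> turn l0 \<in> set gs" for c gs d
    proof -
      have "l0 \<in> set C" by (simp add: C_def)
      then have "gs = C \<or> gs = backwards C"
        using old.curve_through_either[OF that(1) C, of l0] old.curve_through_either[OF that(1) C, of "turn l0"]
          that(2) by auto
      then show ?thesis by simp
    qed
  qed
  define ordered where "ordered a gs b = (if precedes a b then (a, gs, b) else (b, backwards gs, a))"
    for a b gs
  have ord: "new.curve c gs d \<and> precedes c d" if "(c, gs, d) = ordered c' gs' d'" "new.curve c' gs' d'"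
    for c gs d c' gs' d'
    using that new.curve_backwards[OF that(2)] precedes_total[OF new.curve_ends_neq[OF that(2)]]
    by (auto simp: ordered_def split: if_splits)
  have linesS': "lines_of S' = lines_of T \<union> (\<lambda>(a, gs, b). (a, trail_word gs, b)) ` {ordered a K0 x, ordered b K1 y}"
  proof (rule lines_S')
    show "new.curve c gs d \<and> precedes c d" if "(c, gs, d) \<in> {ordered a K0 x, ordered b K1 y}" for c gs d
      using that ord[OF _ K0] ord[OF _ K1] by blast
    have "k0 \<in> set K0" "k1 \<in> set K1" by (simp_all add: K0_def K1_def)
    then have "k0 \<in> set (fst (snd (ordered a K0 x))) \<or> turn k0 \<in> set (fst (snd (ordered a K0 x)))"
      "k1 \<in> set (fst (snd (ordered b K1 y))) \<or> turn k1 \<in> set (fst (snd (ordered b K1 y)))"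
      by (auto simp: ordered_def)
    then show "\<exists>c gs d. (c, gs, d) \<in> {ordered a K0 x, ordered b K1 y} \<and> (k0 \<in> set gs \<or> turn k0 \<in> set gs)"
      "\<exists>c gs d. (c, gs, d) \<in> {ordered a K0 x, ordered b K1 y} \<and> (k1 \<in> set gs \<or> turn k1 \<in> set gs)"
      by (metis insertI1 insertI2 prod.collapse)+
  qed
  have ordered_word: "(\<lambda>(a, gs, b). (a, trail_word gs, b)) (ordered c gs d) = ordered_line c (trail_word gs) d"
    for c gs d by (simp add: ordered_def ordered_line_def trail_word_backwards)
  have "loop_at S k gs \<longleftrightarrow> loop_at T k gs" for k gs
  proof (cases "l0 \<in> set gs \<or> turn l0 \<in> set gs")
    case True
    have "\<not> closed_trail S gs"
    proof
      assume cl: "closed_trail S gs"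
      have "l0 \<in> set C" by (simp add: C_def)
      then have "l0 \<notin> set gs" "l0 \<notin> set (backwards gs)"
        using old.curve_avoids_closed[OF C] cl old.closed_trail_backwards[OF cl] by blast+
      then show False using True by (auto simp: image_iff)
    qed
    then have "\<not> loop_at S k gs" using old.loop_at_closed by blast
    moreover have "\<not> loop_at T k gs" using True fresh by (auto simp: loop_at_def trail_def)
    ultimately show ?thesis by blast
  next
    case False
    then show ?thesis using loop_at_old_iff by blast
  qed
  then have loops: "loops_of S = loops_of S'" unfolding loops_S' by (simp add: loops_of_def)
  have avoid: "line_ends l \<inter> {a, b, x, y} = {}" if "l \<in> lines_of T" for l
    using common_ends_avoid[OF C _ that] common_ends_avoid_xy[OF that] by (auto simp: C_def)
  have "lines_of S = lines_of T \<union> {(x, [BL, BR], y), (a, replicate (Suc p) BL @ replicate (Suc q) BR, b)}"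
    unfolding linesS using wC by (simp add: l1)
  moreover have "lines_of S' = lines_of T \<union>
      {ordered_line a (replicate (Suc p) BL) x, ordered_line b (replicate (Suc q) BR) y}"
    unfolding linesS' image_insert image_empty ordered_word wK0 wK1 ..
  ultimately show ?thesis using ab prec loops avoid by blast
qed

text \<open>
  Around the loop \<open>l0\<close> reads \<open>R L\<close> after the word of \<open>W\<close>. As the letters of the loop are not
  interleaved, no \<open>R\<close> precedes an \<open>L\<close> in the word of \<open>W\<close>. In \<open>S'\<close> the trail \<open>W\<close> together with \<open>k0\<close> and
  \<open>k1\<close> becomes the line from \<open>x\<close> to \<open>y\<close>.
\<close>

lemma loop_case_result:
  assumes "loop_case W"
  shows "\<exists>p q k v n. lines_of S = lines_of T \<union> {(x, [BL, BR], y)} \<and>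
    lines_of S' = lines_of T \<union> {(x, replicate (Suc p) BL @ replicate (Suc q) BR, y)} \<and>
    loops_of S = insert (k, v) (loops_of S') \<and> (k, v) \<notin> loops_of S' \<and>
    v = rotate n (replicate (Suc p) BL @ replicate (Suc q) BR) \<and>
    (\<forall>l \<in> lines_of T. line_ends l \<inter> {x, y} = {})"
proof -
  have W: "trail T W" "follows (turn l0) (hd W)" "follows (last W) (turn l0)" "W \<noteq> []"
    using assms unfolding loop_case_def trail_def by auto
  \<comment> \<open>the closed curve of \<open>S\<close> through \<open>l0\<close>\<close>
  define cs where "cs = W @ [turn l0]"
  have W_T: "set W \<subseteq> T" using W(1) by (simp add: trail_def)
  have "hd W \<in> S" using W trail_old[OF W(1)] by (auto simp: trail_def)
  then have stuck_start: "stuck T (turn (hd W))" using after_mid(2)[of "turn l0" "hd W"] W(2) by simp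
  have stuck_end: "stuck T g" if "follows g (turn l0)" for g
    using after_mid(2)[of l0 "turn g"] that
    unfolding stuck_def
    using old.follows_unique[of _ "turn l0" g] fresh_turn(1) T_sub(1) l_in(2) by blast
  have "distinct W"
    unfolding distinct_conv_nth
  proof (intro allI impI)
    fix s t assume st: "s < length W" "t < length W" "s \<noteq> t"
    from st(3) consider "s < t" | "t < s" by linarith
    then show "W ! s \<noteq> W ! t"
      using common.trail_no_repeat[OF W(1) stuck_start, of s t]
        common.trail_no_repeat[OF W(1) stuck_start, of t s] st by cases auto
  qed
  moreover have "turn l0 \<notin> set W" using W_T fresh_turn by blast
  moreover have "trail S cs" unfolding cs_def using W trail_old[OF W(1)] l_in by (simp add: trail_append)
  ultimately have cl: "closed_trail S cs"
    using W by (simp add: closed_trail_def cs_def)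
  obtain \<psi> where "drawn_stack S m \<psi>" using drawable by blast
  then interpret drawn_stack S m \<psi> .
  have "\<not> interleaved (trail_word cs)" by (rule closed_trail_not_interleaved[OF cl])
  moreover have "trail_word cs = trail_word W @ [BR, BL]" by (simp add: cs_def l0)
  moreover have "precede_in BR BL [BR, BL]" using precede_in_append[of BR "[BR]" BL "[BL]"] by simp
  ultimately have "\<not> precede_in BR BL (trail_word W)" using interleaved_append[of BR BL] by auto
  then obtain p q where wW: "trail_word W = replicate p BL @ replicate q BR"
    using sorted_word[of BR BL "trail_word W"] by auto
  define K where "K = [turn k0] @ W @ [k1]"
  have "follows (turn k0) (hd W)" using W(2) by (auto simp: follows_def l0 k0 intro!: exI[of _ i])
  moreover have "follows (last W) k1" using W(3) by (simp add: follows_def l0 k1)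
  ultimately have "trail S' K"
    unfolding K_def using W trail_new[OF W(1)] k_in by (simp add: trail_append trail_Cons)
  then have K: "new.curve x K y" by (simp add: new.curve_def K_def) (simp add: k0 k1)
  have wK: "trail_word K = replicate (Suc p) BL @ replicate (Suc q) BR"
    by (simp add: K_def wW k0 k1 replicate_append_same)
  have "lines_of S = lines_of T \<union> (\<lambda>(a, gs, b). (a, trail_word gs, b)) ` insert (x, [l1], y) {}"
  proof (rule lines_S)
    fix a gs b assume gs: "old.curve a gs b" "l0 \<in> set gs \<or> turn l0 \<in> set gs"
    have "turn l0 \<in> set cs" by (simp add: cs_def)
    then have "turn l0 \<notin> set gs" "turn l0 \<notin> set (backwards gs)"
      using old.curve_avoids_closed[OF gs(1) cl] old.curve_avoids_closed[OF old.curve_backwards[OF gs(1)] cl]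
      by blast+
    then have False using gs(2) by auto
    then show "\<exists>(a', gs', b') \<in> {}. gs = gs' \<or> gs = backwards gs'" ..
  qed simp
  then have linesS: "lines_of S = lines_of T \<union> {(x, [BL, BR], y)}" by (simp add: l1)
  have "lines_of S' = lines_of T \<union> (\<lambda>(a, gs, b). (a, trail_word gs, b)) ` {(x, K, y)}"
    by (rule lines_S') (use K xy in \<open>auto simp: K_def\<close>)
  then have linesS': "lines_of S' = lines_of T \<union> {(x, replicate (Suc p) BL @ replicate (Suc q) BR, y)}"
    by (simp only: wK image_insert image_empty prod.case)
  obtain k gs where gs: "loop_at S k gs" "set gs = set cs \<or> set gs = set (backwards cs)"
    using old.ex_loop_of_closed_trail[OF cl] by blast
  have from_cs: "seg_from ` set gs = seg_from ` set cs"
    if "closed_trail S gs" "l0 \<in> set gs \<or> turn l0 \<in> set gs" for gs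
  proof (cases "turn l0 \<in> set gs")
    case True
    then show ?thesis using old.closed_trails_same_set[OF that(1) cl, of "turn l0"] by (simp add: cs_def)
  next
    case False
    then have "turn l0 \<in> set (backwards gs)" using that(2) by simp
    then have "set (backwards gs) = set cs"
      using old.closed_trails_same_set[OF old.closed_trail_backwards[OF that(1)] cl, of "turn l0"]
      by (simp add: cs_def)
    then show ?thesis using old.closed_trail_from_to[OF that(1)] by (simp only:)
  qed
  have meets: "l0 \<in> set gs \<or> turn l0 \<in> set gs"
    using gs(2) by (auto simp: cs_def)
  have unique_loop: "k' = k \<and> gs' = gs" if gs': "loop_at S k' gs'" "l0 \<in> set gs' \<or> turn l0 \<in> set gs'" for k' gs'
  proof -
    have least: "Mid k \<in> seg_from ` set gs \<and> (\<forall>n. Mid n \<in> seg_from ` set gs \<longrightarrow> k \<le> n)"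
      if "loop_at S k gs" for k gs
    proof -
      have "gs \<noteq> []" "seg_from (hd gs) = Mid k"
        "\<And>g n. g \<in> set (tl gs) \<Longrightarrow> seg_from g = Mid n \<Longrightarrow> k < n"
        using that by (auto simp: loop_at_def trail_def)
      then show ?thesis by (cases gs) (force simp: image_iff)+
    qed
    have "seg_from ` set gs' = seg_from ` set gs"
      using from_cs[OF old.loop_at_closed[OF gs(1)] meets] from_cs[OF old.loop_at_closed[OF gs'(1)] gs'(2)]
      by simp
    then have "k' = k" using least[OF gs(1)] least[OF gs'(1)] by (simp add: order_antisym)
    then show ?thesis using old.loop_at_unique gs(1) gs'(1) by blast
  qed
  define v where "v = trail_word gs"
  have "\<exists>n. v = rotate n (replicate (Suc p) BL @ replicate (Suc q) BR)"
  proof -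
    obtain e where e: "e \<in> {l0, turn l0}" "e \<in> set gs" using meets by blast
    obtain xs ys where split: "gs = xs @ e # ys" using e(2) by (auto simp: in_set_conv_decomp)
    have clgs: "closed_trail S gs" by (rule old.loop_at_closed[OF gs(1)])
    then have rot: "closed_trail S (e # ys @ xs)" using closed_trail_rotate unfolding split by blast
    define Z where "Z = ys @ xs"
    have eZ: "trail S (e # Z)" "follows (last (e # Z)) e" "distinct (e # Z)"
      using rot by (simp_all add: closed_trail_def Z_def)
    have Z: "Z \<noteq> []"
    proof
      assume "Z = []"
      then show False using eZ(2) follows_irrefl[of e] by simp
    qed
    have Z': "trail S Z" "follows e (hd Z)" "follows (last Z) e" "e \<notin> set Z"
      using eZ Z trail_Cons[OF Z, of S e] by simp_all
    have "turn e \<notin> set (e # Z)" using old.closed_trail_not_both[OF rot] unfolding Z_def by simp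
    have "set Z \<subseteq> T"
    proof
      fix g assume g: "g \<in> set Z"
      then have "g \<in> S" using Z'(1) by (auto simp: trail_def)
      moreover obtain n n' where "seg_from g = Mid n" "seg_to g = Mid n'"
        using closed_trail_mids[OF rot, of g] g unfolding Z_def by auto
      then have "g \<noteq> l1" "g \<noteq> turn l1" using l1 by auto
      moreover have "g \<noteq> l0" "g \<noteq> turn l0" using g Z'(4) e(1) \<open>turn e \<notin> set (e # Z)\<close> by auto
      ultimately show "g \<in> T" using S_eq by auto
    qed
    then have ZT: "trail T Z" using Z'(1) by (simp add: trail_def)
    have W_unique: "Y = W" if "trail T Y" "follows (turn l0) (hd Y)" "follows (last Y) (turn l0)" for Y
    proof (rule common.trail_unique[OF that(1) W(1)])
      have "hd Y \<in> S" "hd W \<in> S" using trail_old[OF that(1)] trail_old[OF W(1)] by (auto simp: trail_def)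
      then show "hd Y = hd W" using old.follows_unique that(2) W(2) by blast
    qed (use stuck_end that(3) W(3) in blast)+
    have "v = trail_word xs @ seg_word e @ trail_word ys" by (simp add: v_def split)
    also have "\<dots> = rotate (length (seg_word e @ trail_word ys)) (seg_word e @ trail_word Z)"
      using rotate_append[of "seg_word e @ trail_word ys" "trail_word xs"] by (simp add: Z_def)
    finally have v: "v = rotate (length (seg_word e @ trail_word ys)) (seg_word e @ trail_word Z)" .
    have "\<exists>n. seg_word e @ trail_word Z = rotate n (replicate (Suc p) BL @ replicate (Suc q) BR)"
    proof (cases "e = turn l0")
      case True
      then have "Z = W" using W_unique[OF ZT] Z' by blast
      then show ?thesis using rotate_to_runs(1)[of p q] wW True by (simp add: l0)
    next
      case False
      then have "e = l0" using e(1) by blast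
      then have "backwards Z = W"
        using Z' Z by (intro W_unique) (auto intro: common.trail_backwards ZT)
      then have "trail_word Z = rev (trail_word W)" using trail_word_backwards[of Z] by simp
      then show ?thesis using rotate_to_runs(2)[of q p] wW \<open>e = l0\<close> by (simp add: l0)
    qed
    then show ?thesis unfolding v using rotate_rotate by metis
  qed
  then obtain n where v: "v = rotate n (replicate (Suc p) BL @ replicate (Suc q) BR)" by blast
  have "loops_of S = insert (k, v) (loops_of T)"
  proof (intro equalityI subsetI)
    fix c assume "c \<in> loops_of S"
    then obtain k' gs' where c: "c = (k', trail_word gs')" "loop_at S k' gs'" by (auto simp: loops_of_def)
    show "c \<in> insert (k, v) (loops_of T)"
    proof (cases "l0 \<in> set gs' \<or> turn l0 \<in> set gs'")
      case True
      then show ?thesis using unique_loop[OF c(2)] c(1) by (simp add: v_def)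
    next
      case False
      then show ?thesis using loop_at_old_iff[of gs' k'] c by (auto simp: loops_of_def)
    qed
  next
    fix c assume "c \<in> insert (k, v) (loops_of T)"
    then show "c \<in> loops_of S" using loops_T_sub gs(1) by (auto simp: loops_of_def v_def)
  qed
  moreover have "(k, v) \<notin> loops_of T"
  proof
    assume "(k, v) \<in> loops_of T"
    then obtain gs' where gs': "loop_at T k gs'" by (auto simp: loops_of_def)
    then have "loop_at S k gs'" unfolding loop_at_def using trail_old by blast
    then have "gs' = gs" using old.loop_at_unique gs(1) by blast
    then show False using gs' meets fresh by (auto simp: loop_at_def trail_def)
  qed
  ultimately show ?thesis
    unfolding loops_S' using linesS linesS' v common_ends_avoid_xy by blast
qed

end

section \<open>Drawings of a diagram before and after reconnecting\<close>

text \<open>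
  No two points of one set separate two points of the other one. Written with the order of the
  cut-open boundary, this is a linear condition.
\<close>

definition apart_sets :: "real set \<Rightarrow> real set \<Rightarrow> bool" where
  "apart_sets A B \<longleftrightarrow> A \<inter> B = {} \<and>
     (\<forall>x \<in> A. \<forall>y \<in> A. \<forall>u \<in> B. \<forall>v \<in> B. ((x < u) \<noteq> (y < u)) = ((x < v) \<noteq> (y < v)))"

lemma crossing_iff_order:
  assumes "x \<notin> {u, v}" "y \<notin> {u, v}"
  shows "crossing x y u v \<longleftrightarrow> ((x < u) \<noteq> (y < u)) \<noteq> ((x < v) \<noteq> (y < v))"
  unfolding crossing_iff_separates[OF assms] separates_def by argo

lemma apart_sets_iff:
  "apart_sets A B \<longleftrightarrow> A \<inter> B = {} \<and> (\<forall>x \<in> A. \<forall>y \<in> A. \<forall>u \<in> B. \<forall>v \<in> B. \<not> crossing x y u v)"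
proof (cases "A \<inter> B = {}")
  case True
  have "(((x < u) \<noteq> (y < u)) = ((x < v) \<noteq> (y < v))) \<longleftrightarrow> \<not> crossing x y u v"
    if "x \<in> A" "y \<in> A" "u \<in> B" "v \<in> B" for x y u v
  proof -
    have "x \<notin> {u, v}" "y \<notin> {u, v}" using that True by auto
    then show ?thesis by (simp add: crossing_iff_order)
  qed
  then show ?thesis unfolding apart_sets_def using True by simp
next
  case False
  then show ?thesis by (simp add: apart_sets_def)
qed

lemma apart_sets_commute: "apart_sets A B \<longleftrightarrow> apart_sets B A"
proof -
  have "apart_sets B A" if "apart_sets A B" for A B
    unfolding apart_sets_iff
  proof (intro conjI ballI)
    show "B \<inter> A = {}" using that by (auto simp: apart_sets_def)
    fix x y u v assume m: "x \<in> B" "y \<in> B" "u \<in> A" "v \<in> A"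
    have "A \<inter> B = {}" using that by (simp add: apart_sets_def)
    then have "x \<notin> {u, v}" "y \<notin> {u, v}" using m by auto
    then show "\<not> crossing x y u v" using that m by (simp add: crossing_commute apart_sets_iff)
  qed
  then show ?thesis by blast
qed

text \<open>
  It suffices to compare all points of \<open>B\<close> with a single one.
\<close>

lemma apart_setsI:
  assumes "A \<inter> B = {}" "v0 \<in> B"
    and "\<And>x y z. x \<in> A \<Longrightarrow> y \<in> A \<Longrightarrow> z \<in> B \<Longrightarrow> ((x < z) \<noteq> (y < z)) = ((x < v0) \<noteq> (y < v0))"
  shows "apart_sets A B"
  unfolding apart_sets_def
proof (intro conjI ballI)
  fix x y u v assume "x \<in> A" "y \<in> A" "u \<in> B" "v \<in> B"
  then show "((x < u) \<noteq> (y < u)) = ((x < v) \<noteq> (y < v))"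
    using assms(3)[of x y u] assms(3)[of x y v] by simp
qed (rule assms)

text \<open>
  The conditions of \<open>deformable\<close> on \<open>\<phi>\<close>, with injectivity split up: that the arcs of different
  lines have different ends is part of \<open>apart_sets\<close>.
\<close>

definition drawing :: "nat \<Rightarrow> diagram \<Rightarrow> (line \<Rightarrow> nat \<Rightarrow> real) \<Rightarrow> bool" where
  "drawing m d \<phi> \<longleftrightarrow>
     (\<forall>l \<in> d. \<forall>k < length (line_word l). \<phi> l k \<in> blob_edge m (line_word l ! k)) \<and>
     (\<forall>l \<in> d. inj_on (\<phi> l) {..<length (line_word l)}) \<and>
     (\<forall>(a, w, b) \<in> d. \<forall>k k'. k < k' \<and> k' < length w \<longrightarrow>
        \<not> crossing (position m a) (\<phi> (a, w, b) k) (\<phi> (a, w, b) k') (position m b)) \<and>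
     (\<forall>l \<in> d. \<forall>l' \<in> d. l \<noteq> l' \<longrightarrow> apart_sets (leaves m \<phi> l) (leaves m \<phi> l'))"

lemma conj_exchange: "(E \<Longrightarrow> (I \<and> A) = (I' \<and> A')) \<Longrightarrow> (E \<and> I \<and> C \<and> A) = (E \<and> I' \<and> C \<and> A')"
  by blast

lemma deformable_iff_drawing:
  assumes pv: "pairs_vertices m d"
  shows "deformable m d \<longleftrightarrow> (\<exists>\<phi>. drawing m d \<phi>)"
proof -
  have "(inj_on (\<lambda>(l, k). \<phi> l k) (SIGMA l:d. {..<length (line_word l)}) \<and>
      (\<forall>l \<in> d. \<forall>l' \<in> d. l \<noteq> l' \<longrightarrow>
         (\<forall>x \<in> leaves m \<phi> l. \<forall>y \<in> leaves m \<phi> l. \<forall>u \<in> leaves m \<phi> l'. \<forall>v \<in> leaves m \<phi> l'.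
            \<not> crossing x y u v))) \<longleftrightarrow>
    ((\<forall>l \<in> d. inj_on (\<phi> l) {..<length (line_word l)}) \<and>
     (\<forall>l \<in> d. \<forall>l' \<in> d. l \<noteq> l' \<longrightarrow> apart_sets (leaves m \<phi> l) (leaves m \<phi> l')))"
    (is "?L1 \<and> ?L2 \<longleftrightarrow> ?R1 \<and> ?R2")
    if edge: "\<forall>l \<in> d. \<forall>k < length (line_word l). \<phi> l k \<in> blob_edge m (line_word l ! k)" for \<phi>
  proof
    assume L: "?L1 \<and> ?L2"
    have inj0: "inj_on (\<lambda>(l, k). \<phi> l k) (SIGMA l:d. {..<length (line_word l)})" using L by (rule conjunct1)
    have inj: "\<phi> l k \<noteq> \<phi> l' k'" if "l \<in> d" "l' \<in> d" "k < length (line_word l)" "k' < length (line_word l')"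
      "l \<noteq> l' \<or> k \<noteq> k'" for l l' k k'
      using inj_onD[OF inj0, of "(l, k)" "(l', k')"] that by auto
    have "leaves m \<phi> l \<inter> leaves m \<phi> l' = {}" if l: "l \<in> d" "l' \<in> d" "l \<noteq> l'" for l l'
    proof -
      have V: "v \<in> vertices m" if "v \<in> line_ends l" "l \<in> d" for v l
        using line_vertices[OF pv] that by (cases l) auto
      have ends: "v \<noteq> v'" if "v \<in> line_ends l" "v' \<in> line_ends l'" for v v'
        using line_at_vertex_unique[OF pv l(1,2)] that l(3) by blast
      have False if z: "z \<in> leaves m \<phi> l" "z \<in> leaves m \<phi> l'" for z
      proof -
        have 1: "(\<exists>v. v \<in> line_ends l \<and> z = position m v) \<or> (\<exists>k < length (line_word l). z = \<phi> l k)"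
          using z(1) unfolding leaves_def by blast
        have 2: "(\<exists>v. v \<in> line_ends l' \<and> z = position m v) \<or> (\<exists>k < length (line_word l'). z = \<phi> l' k)"
          using z(2) unfolding leaves_def by blast
        from 1 2 show False
        proof (elim disjE exE conjE)
          fix v v' assume *: "v \<in> line_ends l" "z = position m v" "v' \<in> line_ends l'" "z = position m v'"
          then have "v = v'" using position_inj[of v m v'] V[OF *(1) l(1)] V[OF *(3) l(2)] by simp
          then show False using ends * by blast
        next
          fix v k assume *: "v \<in> line_ends l" "z = position m v" "k < length (line_word l')" "z = \<phi> l' k"
          have "\<phi> l' k \<in> blob_edge m (line_word l' ! k)" using edge l(2) *(3) by blast
          then have "z \<in> blob_edge m (line_word l' ! k)" using *(4) by simp
          then show False using position_not_blob_edge[OF V[OF *(1) l(1)]] *(2) by blast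
        next
          fix v k assume *: "v \<in> line_ends l'" "z = position m v" "k < length (line_word l)" "z = \<phi> l k"
          have "\<phi> l k \<in> blob_edge m (line_word l ! k)" using edge l(1) *(3) by blast
          then have "z \<in> blob_edge m (line_word l ! k)" using *(4) by simp
          then show False using position_not_blob_edge[OF V[OF *(1) l(2)]] *(2) by blast
        next
          fix k k' assume "k < length (line_word l)" "z = \<phi> l k" "k' < length (line_word l')" "z = \<phi> l' k'"
          then show False using inj[of l l' k k'] l by simp
        qed
      qed
      then show ?thesis by blast
    qed
    then have ?R2 using L unfolding apart_sets_iff by blast
    moreover have ?R1
    proof (intro ballI inj_onI)
      fix l k k' assume "l \<in> d" "k \<in> {..<length (line_word l)}" "k' \<in> {..<length (line_word l)}" "\<phi> l k = \<phi> l k'"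
      then show "k = k'" using inj[of l l k k'] by blast
    qed
    ultimately show "?R1 \<and> ?R2" by blast
  next
    assume R: "?R1 \<and> ?R2"
    have ?L1
    proof (rule inj_onI, clarify)
      fix l k l' k'
      assume l: "l \<in> d" "l' \<in> d" "k < length (line_word l)" "k' < length (line_word l')" "\<phi> l k = \<phi> l' k'"
      have "\<phi> l k \<in> leaves m \<phi> l" using l(3) unfolding leaves_def by blast
      moreover have "\<phi> l' k' \<in> leaves m \<phi> l'" using l(4) unfolding leaves_def by blast
      ultimately have "leaves m \<phi> l \<inter> leaves m \<phi> l' \<noteq> {}" using l(5) by auto
      then have "l = l'" using R l(1,2) unfolding apart_sets_def by blast
      moreover have "inj_on (\<phi> l) {..<length (line_word l)}" using R l(1) by blast
      ultimately show "l = l' \<and> k = k'" using l inj_onD[of "\<phi> l" "{..<length (line_word l)}" k k'] by simp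
    qed
    moreover have ?L2 using R unfolding apart_sets_iff by blast
    ultimately show "?L1 \<and> ?L2" by blast
  qed
  note equiv = this
  show ?thesis
    unfolding deformable_def drawing_def by (intro iff_exI) (rule conj_exchange[OF equiv])
qed

abbreviation agree :: "real \<Rightarrow> real \<Rightarrow> real \<Rightarrow> bool" where
  "agree t z v \<equiv> (t < z) = (t < v)"

lemma apart_sets_agree:
  assumes "apart_sets A B" "x \<in> A" "y \<in> A" "z \<in> B" "v \<in> B"
  shows "agree x z v = agree y z v"
  using assms unfolding apart_sets_def by (smt (verit, best))

lemma apart_sets_quadI:
  assumes "{a, b, c, e} \<inter> B = {}" "v \<in> B"
    and "\<And>z. z \<in> B \<Longrightarrow> agree a z v = agree b z v \<and> agree b z v = agree c z v \<and> agree c z v = agree e z v"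
  shows "apart_sets {a, b, c, e} B"
proof (rule apart_setsI[OF assms(1,2)])
  fix x y z assume "x \<in> {a, b, c, e}" "y \<in> {a, b, c, e}" "z \<in> B"
  then have "agree x z v = agree a z v" "agree y z v = agree a z v" using assms(3)[of z] by blast+
  then show "((x < z) \<noteq> (y < z)) = ((x < v) \<noteq> (y < v))" by argo
qed

lemma drawing_edge:
  assumes "drawing m d \<phi>" "l \<in> d" "k < length (line_word l)"
  shows "\<phi> l k \<in> blob_edge m (line_word l ! k)"
proof -
  have "\<forall>l \<in> d. \<forall>k < length (line_word l). \<phi> l k \<in> blob_edge m (line_word l ! k)"
    using assms(1) unfolding drawing_def by (elim conjE)
  then show ?thesis using assms(2,3) by blast
qed

lemma drawing_apart:
  assumes "drawing m d \<phi>" "l \<in> d" "l' \<in> d" "l \<noteq> l'"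
  shows "apart_sets (leaves m \<phi> l) (leaves m \<phi> l')"
proof -
  have "\<forall>l \<in> d. \<forall>l' \<in> d. l \<noteq> l' \<longrightarrow> apart_sets (leaves m \<phi> l) (leaves m \<phi> l')"
    using assms(1) unfolding drawing_def by (elim conjE)
  then show ?thesis using assms(2-4) by blast
qed

lemma drawing_subset:
  assumes d: "drawing m d \<phi>" and "R \<subseteq> d"
  shows "drawing m R \<phi>"
proof -
  have sub: "\<And>P. \<forall>l \<in> d. P l \<Longrightarrow> \<forall>l \<in> R. P l" using assms(2) by blast
  note parts = d[unfolded drawing_def]
  show ?thesis
    unfolding drawing_def
  proof (intro conjI sub[OF parts[THEN conjunct1]] sub[OF parts[THEN conjunct2, THEN conjunct1]]
      sub[OF parts[THEN conjunct2, THEN conjunct2, THEN conjunct1]])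
    show "\<forall>l \<in> R. \<forall>l' \<in> R. l \<noteq> l' \<longrightarrow> apart_sets (leaves m \<phi> l) (leaves m \<phi> l')"
    proof (intro ballI impI)
      fix l l' assume "l \<in> R" "l' \<in> R" "l \<noteq> l'"
      then show "apart_sets (leaves m \<phi> l) (leaves m \<phi> l')"
        using drawing_apart[OF d, of l l'] assms(2) by blast
    qed
  qed
qed

lemma drawing_insert:
  assumes d: "drawing m d \<phi>" and new: "(a, w, b) \<notin> d"
    and edge: "\<And>k. k < length w \<Longrightarrow> f k \<in> blob_edge m (w ! k)"
    and inj: "inj_on f {..<length w}"
    and tree: "\<And>k k'. k < k' \<Longrightarrow> k' < length w \<Longrightarrow> \<not> crossing (position m a) (f k) (f k') (position m b)"
    and apart: "\<And>l. l \<in> d \<Longrightarrow>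
      apart_sets ({position m a, position m b} \<union> f ` {..<length w}) (leaves m \<phi> l)"
  shows "drawing m (insert (a, w, b) d) (\<phi>((a, w, b) := f))"
proof -
  let ?\<phi> = "\<phi>((a, w, b) := f)"
  have old: "?\<phi> l = \<phi> l" if "l \<in> d" for l using that new by auto
  have lold: "leaves m ?\<phi> l = leaves m \<phi> l" if "l \<in> d" for l using old[OF that] by (simp add: leaves_def)
  have lnew: "leaves m ?\<phi> (a, w, b) = {position m a, position m b} \<union> f ` {..<length w}"
    by (simp add: leaves_def)
  show ?thesis
    unfolding drawing_def
  proof (intro conjI)
    show "\<forall>l \<in> insert (a, w, b) d. \<forall>k < length (line_word l). ?\<phi> l k \<in> blob_edge m (line_word l ! k)"
      using drawing_edge[OF d] edge old by auto
    have "\<forall>l \<in> d. inj_on (\<phi> l) {..<length (line_word l)}"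
      using d unfolding drawing_def by (elim conjE)
    then show "\<forall>l \<in> insert (a, w, b) d. inj_on (?\<phi> l) {..<length (line_word l)}"
      using inj old by simp
    have t: "\<forall>(a, w, b) \<in> d. \<forall>k k'. k < k' \<and> k' < length w \<longrightarrow>
        \<not> crossing (position m a) (\<phi> (a, w, b) k) (\<phi> (a, w, b) k') (position m b)"
      using d unfolding drawing_def by (elim conjE)
    show "\<forall>(a, w, b) \<in> insert (a, w, b) d. \<forall>k k'. k < k' \<and> k' < length w \<longrightarrow>
        \<not> crossing (position m a) (?\<phi> (a, w, b) k) (?\<phi> (a, w, b) k') (position m b)"
    proof (clarify)
      fix a' w' b' k k'
      assume l: "(a', w', b') \<in> insert (a, w, b) d" and k: "k < k'" "k' < length w'"
        and cr: "crossing (position m a') (?\<phi> (a', w', b') k) (?\<phi> (a', w', b') k') (position m b')"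
      show False
      proof (cases "(a', w', b') = (a, w, b)")
        case True
        then show False using tree[of k k'] k cr by simp
      next
        case False
        then have "(a', w', b') \<in> d" using l by blast
        then show False using t k cr old[of "(a', w', b')"] by auto
      qed
    qed
    show "\<forall>l \<in> insert (a, w, b) d. \<forall>l' \<in> insert (a, w, b) d. l \<noteq> l' \<longrightarrow>
      apart_sets (leaves m ?\<phi> l) (leaves m ?\<phi> l')"
    proof (intro ballI impI)
      fix l l' assume l: "l \<in> insert (a, w, b) d" "l' \<in> insert (a, w, b) d" "l \<noteq> l'"
      consider "l = (a, w, b)" "l' \<in> d" | "l' = (a, w, b)" "l \<in> d" | "l \<in> d" "l' \<in> d" using l by blast
      then show "apart_sets (leaves m ?\<phi> l) (leaves m ?\<phi> l')"
      proof cases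
        case 1
        then show ?thesis using apart[of l'] lold[of l'] lnew by simp
      next
        case 2
        then show ?thesis using apart[of l] lold[of l] lnew apart_sets_commute by simp
      next
        case 3
        then show ?thesis using drawing_apart[OF d, of l l'] l(3) lold by simp
      qed
    qed
  qed
qed

text \<open>
  Which diagram pairs the vertices only depends on the set of ends of the exchanged lines.
\<close>

lemma pairs_vertices_swap:
  assumes pv: "pairs_vertices m (R \<union> {X1, X2})" and fresh: "X1 \<notin> R" "X2 \<notin> R"
    and ends: "line_ends Y1 \<union> line_ends Y2 = line_ends X1 \<union> line_ends X2" "line_ends Y1 \<inter> line_ends Y2 = {}"
    and Y: "\<And>a w b. (a, w, b) \<in> {Y1, Y2} \<Longrightarrow> precedes a b"
  shows "pairs_vertices m (R \<union> {Y1, Y2})"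
proof -
  have V: "v \<in> vertices m" if "l \<in> R \<union> {X1, X2}" "v \<in> line_ends l" for l v
    using line_vertices[OF pv] that by (cases l) auto
  have R_ends: "v \<notin> line_ends X1 \<union> line_ends X2" if l: "l \<in> R" "v \<in> line_ends l" for l v
    using line_at_vertex_unique[OF pv, of l X1 v] line_at_vertex_unique[OF pv, of l X2 v] l fresh by auto
  show ?thesis
    unfolding pairs_vertices_def
  proof (intro conjI ballI)
    fix l assume l: "l \<in> R \<union> {Y1, Y2}"
    obtain a w b where abw: "l = (a, w, b)" by (cases l)
    have "a \<in> vertices m \<and> b \<in> vertices m \<and> precedes a b"
    proof (cases "l \<in> R")
      case True
      then show ?thesis using line_vertices[OF pv, of a w b] abw by blast
    next
      case False
      then have lY: "(a, w, b) \<in> {Y1, Y2}" using l abw by blast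
      have "line_ends (a, w, b) \<subseteq> line_ends X1 \<union> line_ends X2"
        using lY ends(1) by (elim insertE emptyE) (simp only:, blast)+
      then have "v \<in> vertices m" if "v \<in> {a, b}" for v
        using V[of X1 v] V[of X2 v] that by auto
      then show ?thesis using Y[OF lY] by simp
    qed
    then show "case l of (a, w, b) \<Rightarrow> a \<in> vertices m \<and> b \<in> vertices m \<and> precedes a b" using abw by simp
  next
    fix v assume v: "v \<in> vertices m"
    show "\<exists>!l. l \<in> R \<union> {Y1, Y2} \<and> v \<in> line_ends l"
    proof (cases "v \<in> line_ends X1 \<union> line_ends X2")
      case True
      then obtain l where l: "l \<in> {Y1, Y2}" "v \<in> line_ends l" using ends(1) by blast
      show ?thesis
      proof (rule ex1I[of _ l])
        fix l' assume l': "l' \<in> R \<union> {Y1, Y2} \<and> v \<in> line_ends l'"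
        then have "l' \<notin> R" using R_ends True by blast
        then show "l' = l" using l l' ends(2) by blast
      qed (use l in blast)
    next
      case False
      obtain l where l: "l \<in> R \<union> {X1, X2}" "v \<in> line_ends l"
        using pv v unfolding pairs_vertices_def by blast
      then have "l \<in> R" using False by blast
      show ?thesis
      proof (rule ex1I[of _ l])
        fix l' assume l': "l' \<in> R \<union> {Y1, Y2} \<and> v \<in> line_ends l'"
        then have "l' \<in> R" using False ends(1) by blast
        then show "l' = l" using line_at_vertex_unique[OF pv, of l' l v] l l' by blast
      qed (use l \<open>l \<in> R\<close> in blast)
    qed
  qed
qed

lemma leaf_cases:
  assumes "drawing m d \<phi>" "(a, w, b) \<in> d" "z \<in> leaves m \<phi> (a, w, b)"
  shows "z = position m a \<or> z = position m b \<or>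
    real m < z \<and> z < real m + 1 \<or> 2 * real m < z \<and> z < 2 * real m + 1"
proof -
  have "\<phi> (a, w, b) k \<in> blob_edge m (w ! k)" if "k < length w" for k
    using drawing_edge[OF assms(1,2)] that by simp
  then have "real m < \<phi> (a, w, b) k \<and> \<phi> (a, w, b) k < real m + 1 \<or>
      2 * real m < \<phi> (a, w, b) k \<and> \<phi> (a, w, b) k < 2 * real m + 1" if "k < length w" for k
    using that by (cases "w ! k") force+
  then show ?thesis using assms(3) unfolding leaves_def by auto
qed

lemma line_leaf: "position m a \<in> leaves m \<phi> (a, w, b)"
  by (simp add: leaves_def)

lemma blob_diagrams_iff:
  "d \<in> blob_diagrams m \<longleftrightarrow>
    pairs_vertices m d \<and> (\<exists>\<phi>. drawing m d \<phi>) \<and> (\<forall>l \<in> d. line_word l \<in> line_words)"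
  unfolding blob_diagrams_def loopless_pseudodiagrams_def using deformable_iff_drawing by auto

lemma finite_drawing_leaves:
  assumes "finite d"
  shows "finite (\<Union> (leaves m \<phi> ` d))"
proof -
  have "finite (line_ends l)" for l by (cases l) auto
  then show ?thesis using assms by (simp add: leaves_def)
qed

text \<open>
  Finitely many points leave room next to \<open>z\<close>.
\<close>

lemma ex_gap_below:
  fixes z :: real
  assumes "finite F" "lo < z"
  shows "\<exists>y. lo < y \<and> y < z \<and> (\<forall>f \<in> F. \<not> (y \<le> f \<and> f < z))"
proof -
  define M where "M = Max (insert lo {f \<in> F. f < z})"
  have fin: "finite (insert lo {f \<in> F. f < z})" using assms(1) by simp
  then have "M \<in> insert lo {f \<in> F. f < z}" unfolding M_def by (rule Max_in) simp
  then have "M < z" using assms(2) by auto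
  have le: "f \<le> M" if "f \<in> insert lo {f \<in> F. f < z}" for f
    unfolding M_def using fin that by (rule Max_ge)
  have "lo \<le> M" using le by simp
  moreover have "\<not> ((M + z) / 2 \<le> f \<and> f < z)" if "f \<in> F" for f
    using le[of f] that \<open>M < z\<close> by auto
  ultimately show ?thesis using \<open>M < z\<close> by (intro exI[of _ "(M + z) / 2"]) auto
qed

lemma ex_gap_above:
  fixes z :: real
  assumes "finite F" "z < hi"
  shows "\<exists>y. z < y \<and> y < hi \<and> (\<forall>f \<in> F. \<not> (z < f \<and> f \<le> y))"
proof -
  obtain y where y: "- hi < y" "y < - z" "\<forall>f \<in> uminus ` F. \<not> (y \<le> f \<and> f < - z)"
    using ex_gap_below[of "uminus ` F" "- hi" "- z"] assms by auto
  then have "\<not> (z < f \<and> f \<le> - y)" if "f \<in> F" for f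
    using that by force
  then show ?thesis using y by (intro exI[of _ "- y"]) auto
qed

lemma apart_sets_disjoint: "apart_sets A B \<Longrightarrow> A \<inter> B = {}"
  by (simp add: apart_sets_def)

lemma two_legs: "{..<length [BL, BR]} = {0, 1}" "{..<length [BL]} = {0}" "{..<length [BR]} = {0}"
  by (auto simp: lessThan_def)

definition north_double :: "nat \<Rightarrow> nat \<Rightarrow> line" where "north_double i j = (North i, [BL, BR], North j)"
definition south_double :: "nat \<Rightarrow> nat \<Rightarrow> line" where "south_double r s = (South r, [BL, BR], South s)"
definition left_through :: "nat \<Rightarrow> nat \<Rightarrow> line" where "left_through i r = (North i, [BL], South r)"
definition right_through :: "nat \<Rightarrow> nat \<Rightarrow> line" where "right_through j s = (North j, [BR], South s)"

lemma vertex_bounds: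
  "North k \<in> vertices m \<longleftrightarrow> 1 \<le> k \<and> k \<le> m" "South k \<in> vertices m \<longleftrightarrow> 1 \<le> k \<and> k \<le> m"
  by (auto simp: vertices_def)

lemma double_leaves:
  "leaves m \<phi> (a, [BL, BR], b) = {position m a, position m b, \<phi> (a, [BL, BR], b) 0, \<phi> (a, [BL, BR], b) 1}"
  "leaves m \<phi> (a, [BL], b) = {position m a, position m b, \<phi> (a, [BL], b) 0}"
  "leaves m \<phi> (a, [BR], b) = {position m a, position m b, \<phi> (a, [BR], b) 0}"
  unfolding leaves_def by (auto simp: two_legs lessThan_Suc)

lemma double_legs:
  assumes "drawing m d \<phi>" "(a, [BL, BR], b) \<in> d"
  shows "2 * real m < \<phi> (a, [BL, BR], b) 0 \<and> \<phi> (a, [BL, BR], b) 0 < 2 * real m + 1"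
    "real m < \<phi> (a, [BL, BR], b) 1 \<and> \<phi> (a, [BL, BR], b) 1 < real m + 1"
  using drawing_edge[OF assms, of 0] drawing_edge[OF assms, of 1] by auto

text \<open>
  The tree of a doubly decorated line with both ends on the same edge contains a path from the western
  to the eastern edge, which separates the northern from the southern edge.
\<close>

lemma no_through_line_beside_double:
  assumes d: "d \<in> blob_diagrams m" and l: "l \<in> d" "l = (a, [BL, BR], b)" "vertex_half a = vertex_half b"
    and l': "(a', w, b') \<in> d"
  shows "vertex_half a' = vertex_half b'"
proof (cases "(a', w, b') = l")
  case True
  then show ?thesis using l by simp
next
  case False
  have pv: "pairs_vertices m d" using blob_diagram_pairs[OF d] .
  obtain \<phi> where dr: "drawing m d \<phi>" using d unfolding blob_diagrams_iff by blast
  define xL xR where "xL = \<phi> l 0" and "xR = \<phi> l 1"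
  have x: "2 * real m < xL" "real m < xR" "xR < real m + 1"
    using double_legs[OF dr, of a b] l by (simp_all add: xL_def xR_def)
  have ap: "apart_sets (leaves m \<phi> l) (leaves m \<phi> (a', w, b'))"
    by (rule drawing_apart[OF dr l(1) l']) (use False in simp)
  have leaf: "xL \<in> leaves m \<phi> l" "xR \<in> leaves m \<phi> l"
    unfolding l(2) double_leaves by (simp_all add: xL_def xR_def l(2))
  have leaf': "position m a' \<in> leaves m \<phi> (a', w, b')" "position m b' \<in> leaves m \<phi> (a', w, b')"
    by (simp_all add: leaves_def)
  have eq: "agree xL (position m a') (position m b') = agree xR (position m a') (position m b')"
    by (rule apart_sets_agree[OF ap leaf leaf'])
  have V: "a' \<in> vertices m" "b' \<in> vertices m" using line_vertices[OF pv l'] by auto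
  have pos: "position m v \<le> real m \<and> vertex_half v = Upper \<or>
      real m + 1 \<le> position m v \<and> position m v \<le> 2 * real m \<and> vertex_half v = Lower"
    if "v \<in> vertices m" for v
    using that by (cases v) (auto simp: vertices_def)
  from pos[OF V(1)] pos[OF V(2)] show ?thesis
    using eq x by (elim disjE conjE) auto
qed

text \<open>
  The trees of two such lines on the same edge would be on top of each other, and the one that is
  further away from the edge could not reach its vertices.
\<close>

lemma double_line_unique:
  assumes d: "d \<in> blob_diagrams m"
    and l: "l \<in> d" "l = (a, [BL, BR], b)" "vertex_half a = h"
    and l': "l' \<in> d" "l' = (a', [BL, BR], b')" "vertex_half a' = h"
  shows "l = l'"
proof (rule ccontr)
  assume neq: "l \<noteq> l'"
  have pv: "pairs_vertices m d" using blob_diagram_pairs[OF d] .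
  obtain \<phi> where dr: "drawing m d \<phi>" using d unfolding blob_diagrams_iff by blast
  define xL xR yL yR where x_def: "xL = \<phi> l 0" "xR = \<phi> l 1" "yL = \<phi> l' 0" "yR = \<phi> l' 1"
  have x: "2 * real m < xL" "real m < xR" "xR < real m + 1" "2 * real m < yL" "real m < yR" "yR < real m + 1"
    using double_legs[OF dr, of a b] double_legs[OF dr, of a' b'] l l' by (simp_all add: x_def)
  have V: "a \<in> vertices m" "a' \<in> vertices m"
    using line_vertices[OF pv] l l' by auto
  have mem: "xL \<in> leaves m \<phi> l" "xR \<in> leaves m \<phi> l" "position m a \<in> leaves m \<phi> l"
    "yL \<in> leaves m \<phi> l'" "yR \<in> leaves m \<phi> l'" "position m a' \<in> leaves m \<phi> l'"
    unfolding l(2) l'(2) double_leaves by (simp_all add: x_def l(2) l'(2))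
  have ap: "apart_sets (leaves m \<phi> l) (leaves m \<phi> l')" "apart_sets (leaves m \<phi> l') (leaves m \<phi> l)"
    using drawing_apart[OF dr l(1) l'(1) neq] apart_sets_commute by blast+
  have 1: "agree xL yR (position m a') = agree xR yR (position m a')"
    "agree yL xR (position m a) = agree yR xR (position m a)"
    by (rule apart_sets_agree[OF ap(1)] apart_sets_agree[OF ap(2)]; fact mem)+
  have "xR \<noteq> yR" using ap(1) mem unfolding apart_sets_def by auto
  moreover have "position m v \<le> real m \<and> vertex_half v = Upper \<or>
      real m + 1 \<le> position m v \<and> position m v \<le> 2 * real m \<and> vertex_half v = Lower"
    if "v \<in> vertices m" for v
    using that by (cases v) (auto simp: vertices_def)
  from this[OF V(1)] this[OF V(2)] have "position m a \<le> real m \<and> position m a' \<le> real m \<or>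
    real m + 1 \<le> position m a \<and> position m a \<le> 2 * real m \<and>
    real m + 1 \<le> position m a' \<and> position m a' \<le> 2 * real m"
    using l(3) l'(3) by auto
  moreover have "1 \<le> real m" using V(1) by (cases a) (auto simp: vertices_def)
  ultimately show False using 1 x by (elim disjE conjE) auto
qed

lemma reconnect_pairs:
  assumes "i < j" "r < s" "north_double i j \<notin> R" "south_double r s \<notin> R"
    "left_through i r \<notin> R" "right_through j s \<notin> R"
  shows "pairs_vertices m (R \<union> {north_double i j, south_double r s}) \<longleftrightarrow>
    pairs_vertices m (R \<union> {left_through i r, right_through j s})"
proof
  assume "pairs_vertices m (R \<union> {north_double i j, south_double r s})"
  then show "pairs_vertices m (R \<union> {left_through i r, right_through j s})"
    by (rule pairs_vertices_swap)
      (use assms in \<open>auto simp: north_double_def south_double_def left_through_def right_through_def\<close>)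
next
  assume "pairs_vertices m (R \<union> {left_through i r, right_through j s})"
  then show "pairs_vertices m (R \<union> {north_double i j, south_double r s})"
    by (rule pairs_vertices_swap)
      (use assms in \<open>auto simp: north_double_def south_double_def left_through_def right_through_def\<close>)
qed

text \<open>
  The two arcs of the northern line serve for the two new lines. A new line could only cross a line
  of \<open>R\<close> that separates the tree of the northern line from that of the southern one. But between these
  two trees there are only parts of the vertical edges, and a line of \<open>R\<close> has its ends at vertices.
\<close>

lemma drawing_merge:
  assumes ij: "i < j" "r < s" and fresh: "left_through i r \<notin> R" "right_through j s \<notin> R"
    "north_double i j \<notin> R" "south_double r s \<notin> R"
    and pv: "pairs_vertices m (R \<union> {north_double i j, south_double r s})"
    and dr: "drawing m (R \<union> {north_double i j, south_double r s}) \<phi>"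
  shows "\<exists>\<phi>. drawing m (R \<union> {left_through i r, right_through j s}) \<phi>"
proof -
  define xL xR yL yR where x_def: "xL = \<phi> (north_double i j) 0" "xR = \<phi> (north_double i j) 1"
    "yL = \<phi> (south_double r s) 0" "yR = \<phi> (south_double r s) 1"
  have x: "2 * real m < xL" "xL < 2 * real m + 1" "real m < xR" "xR < real m + 1"
    "2 * real m < yL" "yL < 2 * real m + 1" "real m < yR" "yR < real m + 1"
    using double_legs[OF dr, of "North i" "North j"] double_legs[OF dr, of "South r" "South s"]
    by (simp_all add: x_def north_double_def south_double_def)
  have X: "leaves m \<phi> (north_double i j) = {real i, real j, xL, xR}"
    "leaves m \<phi> (south_double r s) = {2 * real m + 1 - real r, 2 * real m + 1 - real s, yL, yR}"
    unfolding north_double_def south_double_def double_leaves x_def by simp_all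
  have V: "North i \<in> vertices m \<and> North j \<in> vertices m" "South r \<in> vertices m \<and> South s \<in> vertices m"
    using line_vertices[OF pv, of "North i" _ "North j"] line_vertices[OF pv, of "South r" _ "South s"]
    by (auto simp: north_double_def south_double_def)
  then have b: "1 \<le> real i" "real i < real j" "real j \<le> real m" "1 \<le> real r" "real r < real s" "real s \<le> real m"
    using ij by (simp_all add: vertex_bounds)
  have XX: "apart_sets {real i, real j, xL, xR} {2 * real m + 1 - real r, 2 * real m + 1 - real s, yL, yR}"
    using drawing_apart[OF dr, of "north_double i j" "south_double r s"] unfolding X
    by (simp add: north_double_def south_double_def)
  have "xR \<noteq> yR" "xL \<noteq> yL" using XX unfolding apart_sets_def by auto
  moreover have "agree xR yR (2 * real m + 1 - real r) = agree xL yR (2 * real m + 1 - real r)"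
    "agree xR yL (2 * real m + 1 - real r) = agree xL yL (2 * real m + 1 - real r)"
    by (rule apart_sets_agree[OF XX]; simp)+
  \<comment> \<open>the arcs of the northern line end north of those of the southern line\<close>
  ultimately have xy: "xR < yR" "yL < xL" using x b by auto
  have R: "drawing m R \<phi>" using drawing_subset[OF dr] by blast
  have key: "{real i, 2 * real m + 1 - real r, xL} \<inter> leaves m \<phi> l = {} \<and>
      {real j, 2 * real m + 1 - real s, xR} \<inter> leaves m \<phi> l = {} \<and>
      apart_sets {real i, 2 * real m + 1 - real r, xL} (leaves m \<phi> l) \<and>
      apart_sets {real j, 2 * real m + 1 - real s, xR} (leaves m \<phi> l)" if l: "l \<in> R" for l
  proof -
    obtain a w c where abc: "l = (a, w, c)" by (cases l)
    define v where "v = position m a"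
    have v: "v \<in> leaves m \<phi> l" unfolding abc v_def by (rule line_leaf)
    have "a \<in> vertices m" using line_vertices[OF pv, of a w c] l abc by blast
    then have vpos: "v \<le> real m \<or> real m + 1 \<le> v \<and> v \<le> 2 * real m"
      unfolding v_def by (cases a) (auto simp: vertices_def)
    have A: "apart_sets {real i, real j, xL, xR} (leaves m \<phi> l)"
      using drawing_apart[OF dr, of "north_double i j" l] fresh l unfolding X by auto
    have B: "apart_sets {2 * real m + 1 - real r, 2 * real m + 1 - real s, yL, yR} (leaves m \<phi> l)"
      using drawing_apart[OF dr, of "south_double r s" l] fresh l unfolding X by auto
    have dis: "{real i, real j, xL, xR} \<inter> leaves m \<phi> l = {}"
      "{2 * real m + 1 - real r, 2 * real m + 1 - real s, yL, yR} \<inter> leaves m \<phi> l = {}"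
      using apart_sets_disjoint[OF A] apart_sets_disjoint[OF B] by blast+
    have all: "agree (real i) z v = agree (real j) z v \<and> agree (real j) z v = agree xL z v \<and>
        agree xL z v = agree xR z v \<and> agree xR z v = agree (2 * real m + 1 - real r) z v \<and>
        agree (2 * real m + 1 - real r) z v = agree (2 * real m + 1 - real s) z v"
      if z: "z \<in> leaves m \<phi> l" for z
    proof -
      have 1: "agree (real i) z v = agree (real j) z v" "agree (real j) z v = agree xL z v"
        "agree xL z v = agree xR z v"
        by (rule apart_sets_agree[OF A _ _ z v]; simp)+
      have 2: "agree (2 * real m + 1 - real r) z v = agree (2 * real m + 1 - real s) z v"
        "agree (2 * real m + 1 - real s) z v = agree yL z v" "agree yL z v = agree yR z v"
        by (rule apart_sets_agree[OF B _ _ z v]; simp)+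
      have zne: "z \<noteq> xL" "z \<noteq> yL" using dis z by auto
      have "agree xR z v = agree (2 * real m + 1 - real r) z v"
        using 1 2 x b xy vpos zne by (smt (verit, best))
      then show ?thesis using 1 2 by blast
    qed
    have Y1: "apart_sets {real i, 2 * real m + 1 - real r, xL, xL} (leaves m \<phi> l)"
      by (rule apart_sets_quadI[OF _ v]) (use dis all in blast)+
    have Y2: "apart_sets {real j, 2 * real m + 1 - real s, xR, xR} (leaves m \<phi> l)"
      by (rule apart_sets_quadI[OF _ v]) (use dis all in blast)+
    show ?thesis using dis Y1 Y2 by auto
  qed
  have D1: "drawing m (insert (left_through i r) R) (\<phi>(left_through i r := \<lambda>k. xL))"
    unfolding left_through_def
  proof (rule drawing_insert[OF R])
    show "apart_sets ({position m (North i), position m (South r)} \<union> (\<lambda>k. xL) ` {..<length [BL]}) (leaves m \<phi> l)"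
      if "l \<in> R" for l
    proof -
      have "{position m (North i), position m (South r)} \<union> (\<lambda>k. xL) ` {..<length [BL]} =
          {real i, 2 * real m + 1 - real r, xL}" unfolding two_legs by auto
      then show ?thesis using key[OF that] by simp
    qed
  qed (use x fresh in \<open>auto simp: left_through_def inj_on_def\<close>)
  let ?\<phi> = "\<phi>(left_through i r := \<lambda>k. xL)"
  have "drawing m (insert (right_through j s) (insert (left_through i r) R)) (?\<phi>(right_through j s := \<lambda>k. xR))"
    unfolding right_through_def
  proof (rule drawing_insert[OF D1])
    show "apart_sets ({position m (North j), position m (South s)} \<union> (\<lambda>k. xR) ` {..<length [BR]}) (leaves m ?\<phi> l)"
      if l: "l \<in> insert (left_through i r) R" for l
    proof -
      have e: "{position m (North j), position m (South s)} \<union> (\<lambda>k. xR) ` {..<length [BR]} =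
          {real j, 2 * real m + 1 - real s, xR}" unfolding two_legs by auto
      show ?thesis
      proof (cases "l \<in> R")
        case True
        then have "l \<noteq> left_through i r" using fresh by auto
        then have "leaves m ?\<phi> l = leaves m \<phi> l" by (simp add: leaves_def)
        then show ?thesis using key[OF True] e by simp
      next
        case False
        then have "leaves m ?\<phi> l = {real i, 2 * real m + 1 - real r, xL}"
          using l by (simp add: left_through_def double_leaves)
        moreover have "apart_sets {real j, 2 * real m + 1 - real s, xR, xR} {real i, 2 * real m + 1 - real r, xL}"
          by (rule apart_sets_quadI[of _ _ _ _ _ "real i"]) (use b x in auto)
        ultimately show ?thesis using e by simp
      qed
    qed
  qed (use x fresh in \<open>auto simp: right_through_def left_through_def inj_on_def\<close>)
  moreover have "insert (right_through j s) (insert (left_through i r) R) =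
      R \<union> {left_through i r, right_through j s}" by auto
  ultimately show ?thesis by (simp only:) blast
qed

text \<open>
  The arcs of the two lines serve for the southern line. The arcs for the northern line end right
  next to them, on their northern side, so that they meet the same gaps between the lines of \<open>R\<close>.
  No line of \<open>R\<close> separates the trees of the two lines, because it would have to run from the northern to
  the southern edge between them.
\<close>

lemma drawing_split:
  assumes ij: "i < j" "r < s" and fresh: "left_through i r \<notin> R" "right_through j s \<notin> R"
    "north_double i j \<notin> R" "south_double r s \<notin> R"
    and pv: "pairs_vertices m (R \<union> {left_through i r, right_through j s})"
    and dr: "drawing m (R \<union> {left_through i r, right_through j s}) \<phi>"
    and turn_back: "\<And>a w b. (a, w, b) \<in> R \<Longrightarrow> vertex_half a = vertex_half b"
  shows "\<exists>\<phi>. drawing m (R \<union> {north_double i j, south_double r s}) \<phi>"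
proof -
  let ?d = "R \<union> {left_through i r, right_through j s}"
  define x e where x_def: "x = \<phi> (left_through i r) 0" "e = \<phi> (right_through j s) 0"
  have x: "2 * real m < x" "x < 2 * real m + 1" "real m < e" "e < real m + 1"
    using drawing_edge[OF dr, of "left_through i r" 0] drawing_edge[OF dr, of "right_through j s" 0]
    by (simp_all add: x_def left_through_def right_through_def)
  have X: "leaves m \<phi> (left_through i r) = {real i, 2 * real m + 1 - real r, x}"
    "leaves m \<phi> (right_through j s) = {real j, 2 * real m + 1 - real s, e}"
    unfolding left_through_def right_through_def double_leaves x_def by simp_all
  have V: "North i \<in> vertices m \<and> South r \<in> vertices m" "North j \<in> vertices m \<and> South s \<in> vertices m"
    using line_vertices[OF pv, of "North i" _ "South r"] line_vertices[OF pv, of "North j" _ "South s"]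
    by (auto simp: left_through_def right_through_def)
  then have b: "1 \<le> real i" "real i < real j" "real j \<le> real m" "1 \<le> real r" "real r < real s" "real s \<le> real m"
    using ij by (simp_all add: vertex_bounds)
  define F where "F = \<Union> (leaves m \<phi> ` ?d)"
  have "finite F" unfolding F_def by (rule finite_drawing_leaves[OF finite_diagram[OF pv]])
  \<comment> \<open>displaced ends for the arcs of the northern line, with no leaf in between\<close>
  obtain e1 where e1: "real m < e1" "e1 < e" "\<forall>f \<in> F. \<not> (e1 \<le> f \<and> f < e)"
    using ex_gap_below[OF \<open>finite F\<close> x(3)] by blast
  obtain x1 where x1: "x < x1" "x1 < 2 * real m + 1" "\<forall>f \<in> F. \<not> (x < f \<and> f \<le> x1)"
    using ex_gap_above[OF \<open>finite F\<close> x(2)] by blast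
  have R: "drawing m R \<phi>" using drawing_subset[OF dr] by blast
  have key: "apart_sets {real i, real j, e1, x1} (leaves m \<phi> l) \<and>
      apart_sets {2 * real m + 1 - real r, 2 * real m + 1 - real s, e, x} (leaves m \<phi> l)" if l: "l \<in> R" for l
  proof -
    obtain a w c where abc: "l = (a, w, c)" by (cases l)
    define v where "v = position m a"
    have v: "v \<in> leaves m \<phi> l" unfolding abc v_def by (rule line_leaf)
    have ac: "a \<in> vertices m" "c \<in> vertices m" "vertex_half a = vertex_half c"
      using line_vertices[OF pv, of a w c] turn_back[of a w c] l abc by auto
    have vpos: "v \<le> real m \<or> real m + 1 \<le> v \<and> v \<le> 2 * real m"
      using ac(1) unfolding v_def by (cases a) (auto simp: vertices_def)
    have A: "apart_sets {real i, 2 * real m + 1 - real r, x} (leaves m \<phi> l)"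
      using drawing_apart[OF dr, of "left_through i r" l] fresh l unfolding X by auto
    have B: "apart_sets {real j, 2 * real m + 1 - real s, e} (leaves m \<phi> l)"
      using drawing_apart[OF dr, of "right_through j s" l] fresh l unfolding X by auto
    have dis: "{real i, 2 * real m + 1 - real r, x} \<inter> leaves m \<phi> l = {}"
      "{real j, 2 * real m + 1 - real s, e} \<inter> leaves m \<phi> l = {}"
      using apart_sets_disjoint[OF A] apart_sets_disjoint[OF B] by blast+
    have gap: "\<not> (e1 \<le> z \<and> z < e)" "\<not> (x < z \<and> z \<le> x1)" if "z \<in> leaves m \<phi> l" for z
      using e1(3) x1(3) that l unfolding F_def by blast+
    then have dis': "e1 \<notin> leaves m \<phi> l" "x1 \<notin> leaves m \<phi> l" using e1(2) x1(1) by auto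
    have all: "agree (real i) z v = agree (real j) z v \<and> agree (real j) z v = agree e1 z v \<and>
        agree e1 z v = agree x1 z v \<and> agree x1 z v = agree (2 * real m + 1 - real r) z v \<and>
        agree (2 * real m + 1 - real r) z v = agree (2 * real m + 1 - real s) z v \<and>
        agree (2 * real m + 1 - real s) z v = agree e z v \<and> agree e z v = agree x z v"
      if z: "z \<in> leaves m \<phi> l" for z
    proof -
      have 1: "agree (real i) z v = agree (2 * real m + 1 - real r) z v"
        "agree (2 * real m + 1 - real r) z v = agree x z v"
        by (rule apart_sets_agree[OF A _ _ z v]; simp)+
      have 2: "agree (real j) z v = agree (2 * real m + 1 - real s) z v"
        "agree (2 * real m + 1 - real s) z v = agree e z v"
        by (rule apart_sets_agree[OF B _ _ z v]; simp)+
      have pos: "position m u \<le> real m \<and> vertex_half u = Upper \<or>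
          real m + 1 \<le> position m u \<and> position m u \<le> 2 * real m \<and> vertex_half u = Lower"
        if "u \<in> vertices m" for u
        using that by (cases u) (auto simp: vertices_def)
      have zpos: "z \<le> real m \<and> v \<le> real m \<or> real m + 1 \<le> z \<and> z \<le> 2 * real m \<and> real m + 1 \<le> v \<or>
          real m < z \<and> z < real m + 1 \<or> 2 * real m < z"
        using leaf_cases[OF R, of a w c z] z l abc pos[OF ac(1)] pos[OF ac(2)] ac(3) unfolding v_def by auto
      have ne: "z \<noteq> e" "z \<noteq> x" "v \<noteq> e" "v \<noteq> x" using dis z v by auto
      have 3: "agree e1 z v = agree e z v" "agree x1 z v = agree x z v"
        using gap[OF z] gap[OF v] ne e1(2) x1(1) by (smt (verit, best))+
      have "agree x z v = agree e z v"
        using 1 2 x b vpos zpos ne by (smt (verit, best))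
      then show ?thesis using 1 2 3 by (simp only:)
    qed
    have Y1: "apart_sets {real i, real j, e1, x1} (leaves m \<phi> l)"
      by (rule apart_sets_quadI[OF _ v]) (use dis dis' all in blast)+
    have Y2: "apart_sets {2 * real m + 1 - real r, 2 * real m + 1 - real s, e, x} (leaves m \<phi> l)"
      by (rule apart_sets_quadI[OF _ v]) (use dis all in blast)+
    show ?thesis using Y1 Y2 by blast
  qed
  define f where "f = (\<lambda>k :: nat. if k = 0 then x1 else e1)"
  define g where "g = (\<lambda>k :: nat. if k = 0 then x else e)"
  have f: "f ` {..<length [BL, BR]} = {e1, x1}" and g: "g ` {..<length [BL, BR]} = {e, x}"
    unfolding two_legs by (auto simp: f_def g_def)
  have D1: "drawing m (insert (north_double i j) R) (\<phi>(north_double i j := f))"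
    unfolding north_double_def
  proof (rule drawing_insert[OF R])
    show "apart_sets ({position m (North i), position m (North j)} \<union> f ` {..<length [BL, BR]}) (leaves m \<phi> l)"
      if "l \<in> R" for l
    proof -
      have "{position m (North i), position m (North j)} \<union> f ` {..<length [BL, BR]} =
          {real i, real j, e1, x1}" unfolding f by auto
      then show ?thesis using key[OF that] by simp
    qed
    show "f k \<in> blob_edge m ([BL, BR] ! k)" if "k < length [BL, BR]" for k
      using that x x1(1,2) e1(1,2) by (auto simp: f_def less_Suc_eq)
    show "inj_on f {..<length [BL, BR]}"
      unfolding two_legs using x b x1(1,2) e1(1,2) by (auto simp: f_def inj_on_def)
    show "\<not> crossing (position m (North i)) (f k) (f k') (position m (North j))"
      if "k < k'" "k' < length [BL, BR]" for k k'
    proof -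
      have "k = 0" "k' = 1" using that by auto
      then show ?thesis using x x1(1,2) e1(1,2) b by (auto simp: f_def crossing_def min_def max_def)
    qed
  qed (use fresh in \<open>auto simp: north_double_def\<close>)
  let ?\<phi> = "\<phi>(north_double i j := f)"
  have "drawing m (insert (south_double r s) (insert (north_double i j) R)) (?\<phi>(south_double r s := g))"
    unfolding south_double_def
  proof (rule drawing_insert[OF D1])
    show "apart_sets ({position m (South r), position m (South s)} \<union> g ` {..<length [BL, BR]}) (leaves m ?\<phi> l)"
      if l: "l \<in> insert (north_double i j) R" for l
    proof -
      have e: "{position m (South r), position m (South s)} \<union> g ` {..<length [BL, BR]} =
          {2 * real m + 1 - real r, 2 * real m + 1 - real s, e, x}" unfolding g by auto
      show ?thesis
      proof (cases "l \<in> R")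
        case True
        then have "l \<noteq> north_double i j" using fresh by auto
        then have "leaves m ?\<phi> l = leaves m \<phi> l" by (simp add: leaves_def)
        then show ?thesis using key[OF True] e by simp
      next
        case False
        then have "leaves m ?\<phi> l = {real i, real j, x1, e1}"
          using l by (simp add: north_double_def double_leaves f_def)
        moreover have "apart_sets {2 * real m + 1 - real r, 2 * real m + 1 - real s, e, x} {real i, real j, x1, e1}"
          by (rule apart_sets_quadI[of _ _ _ _ _ "real i"]) (use b x x1(1,2) e1(1,2) in auto)
        ultimately show ?thesis using e by simp
      qed
    qed
    show "g k \<in> blob_edge m ([BL, BR] ! k)" if "k < length [BL, BR]" for k
      using that x by (auto simp: g_def less_Suc_eq)
    show "inj_on g {..<length [BL, BR]}"
      unfolding two_legs using x b by (auto simp: g_def inj_on_def)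
    show "\<not> crossing (position m (South r)) (g k) (g k') (position m (South s))"
      if "k < k'" "k' < length [BL, BR]" for k k'
    proof -
      have "k = 0" "k' = 1" using that by auto
      then show ?thesis using x b by (auto simp: g_def crossing_def min_def max_def)
    qed
  qed (use fresh in \<open>auto simp: north_double_def south_double_def\<close>)
  moreover have "insert (south_double r s) (insert (north_double i j) R) =
      R \<union> {north_double i j, south_double r s}" by auto
  ultimately show ?thesis by (simp only:) blast
qed

theorem reconnect_blob_diagram_iff:
  assumes "i < j" "r < s" and fresh: "north_double i j \<notin> R" "south_double r s \<notin> R"
    "left_through i r \<notin> R" "right_through j s \<notin> R"
    and "\<And>a w b. (a, w, b) \<in> R \<Longrightarrow> vertex_half a = vertex_half b"
  shows "R \<union> {north_double i j, south_double r s} \<in> blob_diagrams m \<longleftrightarrow>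
    R \<union> {left_through i r, right_through j s} \<in> blob_diagrams m"
proof -
  note pairs = reconnect_pairs[OF assms(1,2) fresh, of m]
  have words: "line_word (north_double i j) \<in> line_words" "line_word (south_double r s) \<in> line_words"
    "line_word (left_through i r) \<in> line_words" "line_word (right_through j s) \<in> line_words"
    by (simp_all add: north_double_def south_double_def left_through_def right_through_def line_words_def)
  have draw: "(\<exists>\<phi>. drawing m (R \<union> {north_double i j, south_double r s}) \<phi>) \<longleftrightarrow>
    (\<exists>\<phi>. drawing m (R \<union> {left_through i r, right_through j s}) \<phi>)"
    if "pairs_vertices m (R \<union> {north_double i j, south_double r s})"
  proof
    assume "\<exists>\<phi>. drawing m (R \<union> {north_double i j, south_double r s}) \<phi>"
    then show "\<exists>\<phi>. drawing m (R \<union> {left_through i r, right_through j s}) \<phi>"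
      using drawing_merge[OF assms(1,2) fresh(3,4,1,2) that] by blast
  next
    assume "\<exists>\<phi>. drawing m (R \<union> {left_through i r, right_through j s}) \<phi>"
    then obtain \<phi> where "drawing m (R \<union> {left_through i r, right_through j s}) \<phi>" by blast
    then show "\<exists>\<phi>. drawing m (R \<union> {north_double i j, south_double r s}) \<phi>"
      by (rule drawing_split[OF assms(1,2) fresh(3,4,1,2) pairs[THEN iffD1, OF that]]) (rule assms(7))
  qed
  have "(\<forall>l \<in> R \<union> {north_double i j, south_double r s}. line_word l \<in> line_words) \<longleftrightarrow>
    (\<forall>l \<in> R \<union> {left_through i r, right_through j s}. line_word l \<in> line_words)"
    by (simp only: ball_Un ball_simps words simp_thms)
  then show ?thesis
    unfolding blob_diagrams_iff pairs[symmetric]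
    by (cases "pairs_vertices m (R \<union> {north_double i j, south_double r s})") (simp_all only: draw simp_thms)
qed

section \<open>Products with a reconnected diagram\<close>

definition half_segments :: "half \<Rightarrow> diagram \<Rightarrow> segment set" where
  "half_segments h d = {(h, half_spot h a, w, half_spot h b) | a w b. (a, w, b) \<in> both_ways d}"

lemma segments_eq: "segments d\<^sub>1 d\<^sub>2 = half_segments Upper d\<^sub>1 \<union> half_segments Lower d\<^sub>2"
proof (intro equalityI subsetI)
  fix g assume g: "g \<in> segments d\<^sub>1 d\<^sub>2"
  obtain h x w y where g': "g = (h, x, w, y)" by (cases g)
  then show "g \<in> half_segments Upper d\<^sub>1 \<union> half_segments Lower d\<^sub>2"
    using g unfolding g' segments_iff half_segments_def by (cases h) auto
next
  fix g assume g: "g \<in> half_segments Upper d\<^sub>1 \<union> half_segments Lower d\<^sub>2"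
  obtain h x w y where g': "g = (h, x, w, y)" by (cases g)
  then show "g \<in> segments d\<^sub>1 d\<^sub>2"
    using g unfolding g' segments_iff half_segments_def by (cases h) auto
qed

lemma half_segments_Un: "half_segments h (d \<union> d') = half_segments h d \<union> half_segments h d'"
  unfolding half_segments_def both_ways_def by blast

lemma half_segments_insert: "half_segments h {l, l'} = half_segments h {l} \<union> half_segments h {l'}"
  using half_segments_Un[of h "{l}" "{l'}"] by (simp only: Un_insert_left Un_empty_left)

lemma half_segments_single:
  "half_segments h {(a, w, b)} = {(h, half_spot h a, w, half_spot h b), turn (h, half_spot h a, w, half_spot h b)}"
  unfolding half_segments_def both_ways_def turn_def by force

lemma half_segment_iff: "(h, half_spot h a, w, half_spot h b) \<in> half_segments h d \<longleftrightarrow> (a, w, b) \<in> both_ways d"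
  unfolding half_segments_def by auto

lemma half_segments_half: "g \<in> half_segments h d \<Longrightarrow> seg_half g = h"
  unfolding half_segments_def by auto

lemma half_segments_turn:
  assumes "g \<in> half_segments h d"
  shows "turn g \<in> half_segments h d"
proof -
  obtain a w b where g: "g = (h, half_spot h a, w, half_spot h b)" "(a, w, b) \<in> both_ways d"
    using assms unfolding half_segments_def by blast
  then have "turn g = (h, half_spot h b, rev w, half_spot h a)" by (simp add: turn_def)
  then show ?thesis using both_ways_reverse[OF g(2)] by (simp only: half_segment_iff)
qed

lemma fresh_both_ways:
  assumes "pairs_vertices m d" "(a, w, b) \<in> d" "(a, w, b) \<notin> R" "R \<subseteq> d"
  shows "(a, w, b) \<notin> both_ways R"
  using assms line_vertices[OF assms(1), of a w b] line_vertices[OF assms(1), of b "rev w" a] precedes_antisym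
  unfolding both_ways_def by blast

lemma segments_continue:
  assumes pv: "pairs_vertices m d\<^sub>1" "pairs_vertices m d\<^sub>2"
    and g: "g \<in> segments d\<^sub>1 d\<^sub>2" "seg_to g = Mid k"
  shows "\<exists>g' \<in> segments d\<^sub>1 d\<^sub>2. follows g g'"
proof -
  interpret stack_system "segments d\<^sub>1 d\<^sub>2" m by (rule stack_system_segments[OF pv])
  have k: "k \<in> {1..m}" using mids[of "turn g" k] g by simp
  define h where "h = (if seg_half g = Upper then Lower else Upper)"
  have h: "h \<noteq> seg_half g" by (simp add: h_def)
  define v where "v = half_vertex h (Mid k)"
  have v: "v \<in> vertices m" "half_spot h v = Mid k"
    using k by (cases h; simp add: v_def vertices_def)+
  have "pairs_vertices m (in_half h d\<^sub>1 d\<^sub>2)" using pv by (cases h) auto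
  then obtain w b where "(v, w, b) \<in> both_ways (in_half h d\<^sub>1 d\<^sub>2)" using both_ways_ex v(1) by blast
  then have "(h, Mid k, w, half_spot h b) \<in> segments d\<^sub>1 d\<^sub>2"
    using v(2) segments_iff by metis
  then show ?thesis using h g(2) by (intro bexI[of _ "(h, Mid k, w, half_spot h b)"]) (simp_all add: follows_def)
qed

text \<open>
  The two sides on which \<open>e\<close> can be multiplied are treated at once: the half \<open>h\<close> holds the diagram
  that is reconnected, and \<open>(a0, b0)\<close> are the ends of the line on the glued edge.
\<close>

lemma surgery_segments:
  fixes h :: half and e R :: diagram
  defines "stack \<equiv> \<lambda>D. if h = Lower then segments e D else segments D e"
  assumes e: "e \<in> blob_diagrams m" and d: "R \<union> {X0, X1} \<in> blob_diagrams m"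
    and d': "R \<union> {Y0, Y1} \<in> blob_diagrams m" and m: "m \<ge> 1"
    and fresh: "X0 \<notin> R" "X1 \<notin> R" "Y0 \<notin> R" "Y1 \<notin> R"
    and turn_back: "\<And>a w b. (a, w, b) \<in> R \<Longrightarrow> vertex_half a = vertex_half b"
    and X: "X0 = (a0, [BL, BR], b0)" "X1 = (a1, [BL, BR], b1)"
    and Y: "Y0 = (a0, [BL], a1) \<or> Y0 = (a1, [BL], a0)" "Y1 = (b0, [BR], b1) \<or> Y1 = (b1, [BR], b0)"
    and spots: "half_spot h a0 = Mid i" "half_spot h b0 = Mid j"
      "half_spot h a1 = outer_spot a1" "half_spot h b1 = outer_spot b1"
  shows "surgery (stack (R \<union> {X0, X1})) (stack (R \<union> {Y0, Y1})) (stack R) m h i j a1 b1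
    (h, Mid i, [BL, BR], Mid j) (h, outer_spot a1, [BL, BR], outer_spot b1)
    (h, Mid i, [BL], outer_spot a1) (h, Mid j, [BR], outer_spot b1)"
proof -
  let ?d = "R \<union> {X0, X1}" and ?d' = "R \<union> {Y0, Y1}"
  have pe: "pairs_vertices m e" and pd: "pairs_vertices m ?d" and pd': "pairs_vertices m ?d'"
    using e d d' blob_diagram_pairs by blast+
  define E where "E = half_segments (if h = Lower then Upper else Lower) e"
  have stack: "stack D = E \<union> half_segments h D" for D
    unfolding stack_def segments_eq E_def by (cases h) auto
  have E_half: "seg_half g \<noteq> h" if "g \<in> E" for g
    using half_segments_half that unfolding E_def by (cases h) auto
  have systems: "stack_system (stack D) m" if "pairs_vertices m D" for D
    unfolding stack_def using stack_system_segments pe that by (cases h) auto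
  have turn_E: "turn g \<in> E" if "g \<in> E" for g
    using that half_segments_turn unfolding E_def by blast
  have turn_R: "turn g \<in> half_segments h R" if "g \<in> half_segments h R" for g
    using that half_segments_turn by blast
  interpret old: stack_system "stack ?d" m by (rule systems[OF pd])
  interpret new: stack_system "stack ?d'" m by (rule systems[OF pd'])
  have sub: "stack R \<subseteq> stack ?d" unfolding stack half_segments_Un by blast
  interpret common: stack_system "stack R" m
    by (rule stack_system_subset[OF systems[OF pd] sub]) (use turn_E turn_R stack in auto)
  have segY: "half_segments h {Y0, Y1} = {(h, Mid i, [BL], outer_spot a1), turn (h, Mid i, [BL], outer_spot a1),
      (h, Mid j, [BR], outer_spot b1), turn (h, Mid j, [BR], outer_spot b1)}"
  proof -
    have "half_segments h {Y0} = {(h, Mid i, [BL], outer_spot a1), turn (h, Mid i, [BL], outer_spot a1)}"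
      using Y(1) by (elim disjE) (auto simp: half_segments_single spots turn_def)
    moreover have "half_segments h {Y1} = {(h, Mid j, [BR], outer_spot b1), turn (h, Mid j, [BR], outer_spot b1)}"
      using Y(2) by (elim disjE) (auto simp: half_segments_single spots turn_def)
    ultimately show ?thesis by (simp only: half_segments_insert Un_insert_left Un_empty_left)
  qed
  have segX: "half_segments h {X0, X1} = {(h, Mid i, [BL, BR], Mid j), turn (h, Mid i, [BL, BR], Mid j),
      (h, outer_spot a1, [BL, BR], outer_spot b1), turn (h, outer_spot a1, [BL, BR], outer_spot b1)}"
    unfolding half_segments_insert X half_segments_single spots
    by (simp only: Un_insert_left Un_empty_left)
  have not_in: "(h, half_spot h a, w, half_spot h b) \<notin> stack R"
    if "(a, w, b) \<in> D" "(a, w, b) \<notin> R" "pairs_vertices m D" "R \<subseteq> D" for a w b D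
  proof -
    have "(a, w, b) \<notin> both_ways R" using fresh_both_ways that by blast
    moreover have "(h, half_spot h a, w, half_spot h b) \<notin> E"
      using E_half[of "(h, half_spot h a, w, half_spot h b)"] by auto
    ultimately show ?thesis unfolding stack by (simp add: half_segment_iff)
  qed
  have not_in_X: "(h, Mid i, [BL, BR], Mid j) \<notin> stack R" "(h, outer_spot a1, [BL, BR], outer_spot b1) \<notin> stack R"
    using not_in[of a0 "[BL, BR]" b0 ?d] not_in[of a1 "[BL, BR]" b1 ?d] pd fresh by (auto simp: X spots)
  have not_in_Y: "(h, Mid i, [BL], outer_spot a1) \<notin> stack R"
    using Y(1)
  proof
    assume "Y0 = (a0, [BL], a1)"
    then show ?thesis using not_in[of a0 "[BL]" a1 ?d'] pd' fresh by (auto simp: spots)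
  next
    assume "Y0 = (a1, [BL], a0)"
    then have "turn (h, Mid i, [BL], outer_spot a1) \<notin> stack R"
      using not_in[of a1 "[BL]" a0 ?d'] pd' fresh by (auto simp: spots turn_def)
    then show ?thesis by simp
  qed
  have not_in_Y': "(h, Mid j, [BR], outer_spot b1) \<notin> stack R"
    using Y(2)
  proof
    assume "Y1 = (b0, [BR], b1)"
    then show ?thesis using not_in[of b0 "[BR]" b1 ?d'] pd' fresh by (auto simp: spots)
  next
    assume "Y1 = (b1, [BR], b0)"
    then have "turn (h, Mid j, [BR], outer_spot b1) \<notin> stack R"
      using not_in[of b1 "[BR]" b0 ?d'] pd' fresh by (auto simp: spots turn_def)
    then show ?thesis by simp
  qed
  show ?thesis
  proof
    show "stack ?d = stack R \<union> {(h, Mid i, [BL, BR], Mid j), turn (h, Mid i, [BL, BR], Mid j),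
        (h, outer_spot a1, [BL, BR], outer_spot b1), turn (h, outer_spot a1, [BL, BR], outer_spot b1)}"
      unfolding stack half_segments_Un segX by blast
    show "stack ?d' = stack R \<union> {(h, Mid i, [BL], outer_spot a1), turn (h, Mid i, [BL], outer_spot a1),
      (h, Mid j, [BR], outer_spot b1), turn (h, Mid j, [BR], outer_spot b1)}"
      unfolding stack half_segments_Un segY by blast
    show "precedes a1 b1" using line_vertices[OF pd, of a1 "[BL, BR]" b1] X by blast
    show "finite (stack ?d)" unfolding stack_def using finite_segments pe pd by (cases h) auto
    show "\<exists>g' \<in> stack ?d. follows g g'" if "g \<in> stack ?d" "seg_to g = Mid k" for g k
      using segments_continue[OF pe pd, of g k] segments_continue[OF pd pe, of g k] that
      unfolding stack_def by (cases h) auto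
    show "\<exists>k'. seg_to g = Mid k'" if g: "g \<in> stack R" "seg_half g = h" "seg_from g = Mid k" for g k
    proof -
      have "g \<in> half_segments h R" using g E_half stack by blast
      then obtain a w b where abw: "g = (h, half_spot h a, w, half_spot h b)" "(a, w, b) \<in> both_ways R"
        unfolding half_segments_def by blast
      have "vertex_half a = vertex_half b"
        using abw(2) turn_back[of a w b] turn_back[of b "rev w" a] unfolding both_ways_def by auto
      moreover have "half_spot h a = Mid k" using g(3) abw(1) by simp
      ultimately have "\<exists>k'. half_spot h b = Mid k'" by (cases h; cases a; cases b) auto
      then show ?thesis using abw(1) by simp
    qed
    show "\<exists>\<psi>. drawn_stack (stack ?d) m \<psi>"
      using ex_drawn_stack[OF e d m] ex_drawn_stack[OF d e m] unfolding stack_def by (cases h) auto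
  qed (fact not_in_X not_in_Y not_in_Y' refl)+
qed

context blob_parameters
begin

definition reduce_line :: "line \<Rightarrow> line" where
  "reduce_line = (\<lambda>(a, w, b). (a, snd (normal_form w), b))"

text \<open>
  The two parts of \<open>product_factor\<close>, as functions of the lines and of the loops of a stack.
\<close>

definition lines_factor :: "line set \<Rightarrow> 'a" where
  "lines_factor L = (\<Otimes>l\<in>L. fst (normal_form (line_word l)))"

definition loops_factor :: "(nat \<times> blob list) set \<Rightarrow> 'a" where
  "loops_factor L = (\<Otimes>l\<in>L. loop_factor (snd l))"

lemma product_diagram_eq: "product_diagram d\<^sub>1 d\<^sub>2 = reduce_line ` lines_of (segments d\<^sub>1 d\<^sub>2)"
  unfolding product_diagram_def reduce_line_def stack_lines_eq reduced_word_eq ..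

lemma product_factor_eq:
  "product_factor d\<^sub>1 d\<^sub>2 = lines_factor (lines_of (segments d\<^sub>1 d\<^sub>2)) \<otimes> loops_factor (loops_of (segments d\<^sub>1 d\<^sub>2))"
  unfolding product_factor_def lines_factor_def loops_factor_def stack_lines_eq stack_loops_eq reduced_word_eq ..

lemma lines_factor_closed: "lines_factor L \<in> carrier K"
  unfolding lines_factor_def by (intro finprod_closed) (simp add: normal_form_closed)

lemma lines_factor_insert:
  assumes "finite L" "l \<notin> L"
  shows "lines_factor (insert l L) = fst (normal_form (line_word l)) \<otimes> lines_factor L"
  unfolding lines_factor_def using assms by (intro finprod_insert) (simp_all add: normal_form_closed)

lemma loop_factor_runs:
  "loop_factor (rotate n (replicate p BL @ replicate q BR)) \<in> carrier K"
  unfolding loop_factor_eq by (simp add: loop_base_def)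

text \<open>
  A loop reduces to a scalar because its letters are not interleaved.
\<close>

lemma loop_factor_closed:
  assumes "drawn_stack S m \<psi>" "l \<in> loops_of S"
  shows "loop_factor (snd l) \<in> carrier K"
proof -
  interpret drawn_stack S m \<psi> by fact
  obtain k gs where "l = (k, trail_word gs)" "loop_at S k gs" using assms(2) by (auto simp: loops_of_def)
  then have "\<not> interleaved (snd l)" using loop_at_closed closed_trail_not_interleaved by simp
  then obtain n p q where "snd l = rotate n (replicate p BL @ replicate q BR)"
    using not_interleaved_word by blast
  then show ?thesis using loop_factor_runs by simp
qed

lemma loops_factor_closed:
  assumes "drawn_stack S m \<psi>" "L \<subseteq> loops_of S"
  shows "loops_factor L \<in> carrier K"
  unfolding loops_factor_def using loop_factor_closed[OF assms(1)] assms(2)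
  by (intro finprod_closed) blast

lemma product_factor_closed:
  assumes "d\<^sub>1 \<in> blob_diagrams m" "d\<^sub>2 \<in> blob_diagrams m" "m \<ge> 1"
  shows "product_factor d\<^sub>1 d\<^sub>2 \<in> carrier K"
proof -
  obtain \<psi> where "drawn_stack (segments d\<^sub>1 d\<^sub>2) m \<psi>" using ex_drawn_stack assms by blast
  then show ?thesis
    unfolding product_factor_eq using lines_factor_closed loops_factor_closed by simp
qed

lemma surgery_loop_case:
  assumes sur: "surgery S S' T m h i j x y l0 l1 k0 k1"
    and W: "surgery.loop_case T l0 W"
  shows "reduce_line ` lines_of S = reduce_line ` lines_of S'"
    "lines_factor (lines_of S) \<otimes> loops_factor (loops_of S) =
      \<kappa>LR \<otimes> (lines_factor (lines_of S') \<otimes> loops_factor (loops_of S'))"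
proof -
  interpret surgery S S' T m h i j x y l0 l1 k0 k1 by (rule sur)
  obtain p q k v n where
    lines: "lines_of S = lines_of T \<union> {(x, [BL, BR], y)}"
      "lines_of S' = lines_of T \<union> {(x, replicate (Suc p) BL @ replicate (Suc q) BR, y)}"
    and loops: "loops_of S = insert (k, v) (loops_of S')" "(k, v) \<notin> loops_of S'"
    and v: "v = rotate n (replicate (Suc p) BL @ replicate (Suc q) BR)"
    and avoid: "\<forall>l \<in> lines_of T. line_ends l \<inter> {x, y} = {}"
    using loop_case_result[OF W] by (elim exE conjE) (rule that)
  show "reduce_line ` lines_of S = reduce_line ` lines_of S'"
    unfolding lines image_Un image_insert image_empty reduce_line_def prod.case normal_form_left_right
    by simp
  have fin: "finite (lines_of T)"
    using common.finite_lines finite_S T_sub(1) finite_subset by blast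
  have "(x, w, y) \<notin> lines_of T" for w using avoid by force
  then have LS: "lines_factor (lines_of S) = \<one> \<otimes> lines_factor (lines_of T)"
    and LS': "lines_factor (lines_of S') = (\<delta>L [^] p \<otimes> \<delta>R [^] q) \<otimes> lines_factor (lines_of T)"
    unfolding lines using fin normal_form_left_right[of p q]
    by (simp_all add: lines_factor_insert del: replicate_Suc normal_form.simps)
      (simp add: lines_factor_insert)
  obtain \<psi> where \<psi>: "drawn_stack S m \<psi>" using drawable by blast
  have closed: "loop_factor (snd l) \<in> carrier K" if "l \<in> loops_of S" for l
    using loop_factor_closed[OF \<psi> that] .
  have fv: "loop_factor v = \<delta>L [^] p \<otimes> \<delta>R [^] q \<otimes> \<kappa>LR"
    unfolding v loop_factor_eq by (simp add: loop_base_def)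
  have QS: "loops_factor (loops_of S) = loop_factor v \<otimes> loops_factor (loops_of S')"
    unfolding loops(1) loops_factor_def using new.finite_loops loops closed closed[of "(k, v)"]
    by (subst finprod_insert) auto
  have Q: "loops_factor (loops_of S') \<in> carrier K"
    by (rule loops_factor_closed[OF \<psi>]) (use loops in blast)
  show "lines_factor (lines_of S) \<otimes> loops_factor (loops_of S) =
      \<kappa>LR \<otimes> (lines_factor (lines_of S') \<otimes> loops_factor (loops_of S'))"
    unfolding LS LS' QS fv using Q lines_factor_closed by (simp add: m_ac)
qed

lemma surgery_line_case:
  assumes sur: "surgery S S' T m h i j x y l0 l1 k0 k1"
    and ab: "surgery.line_case T l0 a U V b"
  shows "vertex_half a \<noteq> h \<and> vertex_half b \<noteq> h \<and> precedes a b \<and>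
    reduce_line ` lines_of S = reduce_line ` lines_of T \<union> {(x, [BL, BR], y), (a, [BL, BR], b)} \<and>
    reduce_line ` lines_of S' = reduce_line ` lines_of T \<union> {ordered_line a [BL] x, ordered_line b [BR] y} \<and>
    (\<forall>l \<in> reduce_line ` lines_of T. line_ends l \<inter> {a, b, x, y} = {}) \<and>
    (\<forall>(c, w, d) \<in> reduce_line ` lines_of T. vertex_half c = vertex_half d) \<and>
    lines_factor (lines_of S) \<otimes> loops_factor (loops_of S) =
      lines_factor (lines_of S') \<otimes> loops_factor (loops_of S')"
proof -
  interpret surgery S S' T m h i j x y l0 l1 k0 k1 by (rule sur)
  obtain p q where near: "vertex_half a \<noteq> h" "vertex_half b \<noteq> h" "precedes a b"
    and lines: "lines_of S = lines_of T \<union>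
        {(x, [BL, BR], y), (a, replicate (Suc p) BL @ replicate (Suc q) BR, b)}"
      "lines_of S' = lines_of T \<union>
        {ordered_line a (replicate (Suc p) BL) x, ordered_line b (replicate (Suc q) BR) y}"
    and loops: "loops_of S = loops_of S'"
    and avoid: "\<forall>l \<in> lines_of T. line_ends l \<inter> {a, b, x, y} = {}"
    using line_case_result[OF ab] by (elim exE conjE) (rule that)
  have rev_rep: "rev (replicate n c) = replicate n c" for n and c :: blob by simp
  have ordered: "reduce_line (ordered_line c w d) = ordered_line c w' d"
    "fst (normal_form (line_word (ordered_line c w d))) = t"
    if "normal_form w = (t, w')" "rev w = w" "rev w' = w'" for c d w w' t
    using that by (simp_all add: ordered_line_def reduce_line_def)
  have reduced: "reduce_line (ordered_line a (replicate (Suc p) BL) x) = ordered_line a [BL] x"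
    "fst (normal_form (line_word (ordered_line a (replicate (Suc p) BL) x))) = \<delta>L [^] p"
    "reduce_line (ordered_line b (replicate (Suc q) BR) y) = ordered_line b [BR] y"
    "fst (normal_form (line_word (ordered_line b (replicate (Suc q) BR) y))) = \<delta>R [^] q"
    by (rule ordered[OF normal_form_left rev_rep] ordered[OF normal_form_right rev_rep], simp)+
  have ends: "line_ends (ordered_line c w d) = {c, d}" for c w d
    by (auto simp: ordered_line_def)
  have fin: "finite (lines_of T)"
    using common.finite_lines finite_S T_sub(1) finite_subset by blast
  have xab: "x \<noteq> a" "x \<noteq> b" "b \<noteq> a" using near half_x precedes_antisym by auto
  have yab: "y \<noteq> a" "y \<noteq> b" using near half_y by auto
  have notin: "l \<notin> lines_of T" if "line_ends l \<inter> {a, b, x, y} \<noteq> {}" for l using avoid that by blast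
  have "lines_factor (insert (x, [BL, BR], y)
      (insert (a, replicate (Suc p) BL @ replicate (Suc q) BR, b) (lines_of T))) =
    \<one> \<otimes> (\<delta>L [^] p \<otimes> \<delta>R [^] q \<otimes> lines_factor (lines_of T))"
  proof -
    have "(x, [BL, BR], y) \<notin> insert (a, replicate (Suc p) BL @ replicate (Suc q) BR, b) (lines_of T)"
      using notin[of "(x, [BL, BR], y)"] xab by auto
    moreover have "(a, replicate (Suc p) BL @ replicate (Suc q) BR, b) \<notin> lines_of T"
      by (rule notin) simp
    moreover have "fst (normal_form (line_word (x, [BL, BR], y))) = \<one>" by simp
    moreover have "fst (normal_form (line_word (a, replicate (Suc p) BL @ replicate (Suc q) BR, b))) =
        \<delta>L [^] p \<otimes> \<delta>R [^] q"
      unfolding line_word.simps normal_form_left_right fst_conv ..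
    ultimately show ?thesis
      using lines_factor_insert[of "lines_of T"] lines_factor_insert[of "insert _ (lines_of T)"] fin
      by (simp only: finite_insert simp_thms)
  qed
  moreover have "lines_of S = insert (x, [BL, BR], y)
      (insert (a, replicate (Suc p) BL @ replicate (Suc q) BR, b) (lines_of T))"
    unfolding lines by blast
  ultimately have LS: "lines_factor (lines_of S) = \<delta>L [^] p \<otimes> \<delta>R [^] q \<otimes> lines_factor (lines_of T)"
    using lines_factor_closed by simp
  have "lines_factor (insert (ordered_line a (replicate (Suc p) BL) x)
      (insert (ordered_line b (replicate (Suc q) BR) y) (lines_of T))) =
    \<delta>L [^] p \<otimes> (\<delta>R [^] q \<otimes> lines_factor (lines_of T))"
  proof -
    have "ordered_line a (replicate (Suc p) BL) x \<noteq> ordered_line b (replicate (Suc q) BR) y"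
      using ends[of a "replicate (Suc p) BL" x] ends[of b "replicate (Suc q) BR" y] xab yab by auto
    moreover have "ordered_line a (replicate (Suc p) BL) x \<notin> lines_of T"
      "ordered_line b (replicate (Suc q) BR) y \<notin> lines_of T"
      by (rule notin; simp only: ends; blast)+
    ultimately have "ordered_line a (replicate (Suc p) BL) x \<notin>
        insert (ordered_line b (replicate (Suc q) BR) y) (lines_of T)"
      "ordered_line b (replicate (Suc q) BR) y \<notin> lines_of T" by blast+
    then show ?thesis
      using lines_factor_insert[of "lines_of T"] lines_factor_insert[of "insert _ (lines_of T)"] fin
      by (simp only: finite_insert simp_thms reduced)
  qed
  moreover have "lines_of S' = insert (ordered_line a (replicate (Suc p) BL) x)
      (insert (ordered_line b (replicate (Suc q) BR) y) (lines_of T))"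
    unfolding lines by blast
  ultimately have LS': "lines_factor (lines_of S') = \<delta>L [^] p \<otimes> (\<delta>R [^] q \<otimes> lines_factor (lines_of T))"
    by simp
  have "lines_factor (lines_of S) = lines_factor (lines_of S')"
    unfolding LS LS' using lines_factor_closed by (simp add: m_assoc)
  then have factors: "lines_factor (lines_of S) \<otimes> loops_factor (loops_of S) =
      lines_factor (lines_of S') \<otimes> loops_factor (loops_of S')"
    unfolding loops by simp
  have redS: "reduce_line (x, [BL, BR], y) = (x, [BL, BR], y)"
    "reduce_line (a, replicate (Suc p) BL @ replicate (Suc q) BR, b) = (a, [BL, BR], b)"
    unfolding reduce_line_def prod.case normal_form_left_right by simp_all
  have RS: "reduce_line ` lines_of S = reduce_line ` lines_of T \<union> {(x, [BL, BR], y), (a, [BL, BR], b)}"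
    unfolding lines image_Un image_insert image_empty redS ..
  have RS': "reduce_line ` lines_of S' = reduce_line ` lines_of T \<union> {ordered_line a [BL] x, ordered_line b [BR] y}"
    unfolding lines image_Un image_insert image_empty reduced ..
  have avoid': "line_ends (reduce_line l) = line_ends l" for l
    by (cases l) (simp add: reduce_line_def)
  have "line_ends l \<inter> {a, b, x, y} = {}" if "l \<in> reduce_line ` lines_of T" for l
    using that avoid avoid' by auto
  moreover have "vertex_half c = vertex_half d" if l: "(c, w, d) \<in> reduce_line ` lines_of T" for c w d
  proof -
    obtain w' where "(c, w', d) \<in> lines_of T" using l by (auto simp: reduce_line_def)
    then show ?thesis using common_lines_not_through by blast
  qed
  ultimately show ?thesis using near RS RS' factors by blast
qed

text \<open>
  The two ways in which \<open>c\<close> times \<open>P\<close> and \<open>\<kappa>LR \<otimes> c'\<close> times \<open>P'\<close> agree in the quotient: they are equal,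
  or \<open>P'\<close> is \<open>P\<close> after reconnecting and \<open>c = c'\<close>.
\<close>

definition topologically_related :: "diagram \<Rightarrow> 'a \<Rightarrow> diagram \<Rightarrow> 'a \<Rightarrow> bool" where
  "topologically_related P c P' c' \<longleftrightarrow> P = P' \<and> c = \<kappa>LR \<otimes> c' \<or>
     c = c' \<and> (\<exists>R i j r s. i < j \<and> r < s \<and>
       P = R \<union> {north_double i j, south_double r s} \<and> P' = R \<union> {left_through i r, right_through j s} \<and>
       north_double i j \<notin> R \<and> south_double r s \<notin> R \<and> left_through i r \<notin> R \<and> right_through j s \<notin> R \<and>
       (\<forall>(a, w, b) \<in> R. vertex_half a = vertex_half b))"

text \<open>
  The two stacks differ by a surgery in the lower half. If the curve through the northern line closes
  up, then the two products have the same diagram; otherwise they are again related by reconnecting,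
  where \<open>R\<close> is replaced by the reduced lines that avoid the surgery.
\<close>

lemma product_reconnect_right:
  assumes e: "e \<in> blob_diagrams m" and ij: "i < j" "r < s"
    and d: "R \<union> {north_double i j, south_double r s} \<in> blob_diagrams m"
    and d': "R \<union> {left_through i r, right_through j s} \<in> blob_diagrams m"
    and fresh: "north_double i j \<notin> R" "south_double r s \<notin> R" "left_through i r \<notin> R" "right_through j s \<notin> R"
    and turn_back: "\<And>a w b. (a, w, b) \<in> R \<Longrightarrow> vertex_half a = vertex_half b" and m: "m \<ge> 1"
  shows "topologically_related
      (product_diagram e (R \<union> {north_double i j, south_double r s}))
      (product_factor e (R \<union> {north_double i j, south_double r s}))
      (product_diagram e (R \<union> {left_through i r, right_through j s}))
      (product_factor e (R \<union> {left_through i r, right_through j s}))"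
proof -
  have sur: "surgery (segments e (R \<union> {north_double i j, south_double r s}))
    (segments e (R \<union> {left_through i r, right_through j s})) (segments e R) m Lower i j (South r) (South s)
    (Lower, Mid i, [BL, BR], Mid j) (Lower, outer_spot (South r), [BL, BR], outer_spot (South s))
    (Lower, Mid i, [BL], outer_spot (South r)) (Lower, Mid j, [BR], outer_spot (South s))"
    using surgery_segments[OF e d d' m fresh turn_back north_double_def south_double_def, where h = Lower and i = i and j = j]
    by (simp add: left_through_def right_through_def)
  from surgery.loop_or_line[OF sur] show ?thesis
  proof (elim disjE exE)
    fix W assume "surgery.loop_case (segments e R) (Lower, Mid i, [BL, BR], Mid j) W"
    from surgery_loop_case[OF sur this] show ?thesis
      unfolding topologically_related_def product_diagram_eq product_factor_eq by blast
  next
    fix a U V b assume "surgery.line_case (segments e R) (Lower, Mid i, [BL, BR], Mid j) a U V b"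
    note res = surgery_line_case[OF sur this]
    obtain i' j' where ab: "a = North i'" "b = North j'" "i' < j'"
      using res by (cases a; cases b) auto
    define C where "C = reduce_line ` lines_of (segments e R)"
    have avoid: "line_ends l \<inter> {a, b, South r, South s} = {}" if "l \<in> C" for l using res that C_def by blast
    have "north_double i' j' \<notin> C" "south_double r s \<notin> C" "left_through i' r \<notin> C" "right_through j' s \<notin> C"
      using avoid[of "north_double i' j'"] avoid[of "south_double r s"] avoid[of "left_through i' r"]
        avoid[of "right_through j' s"]
      by (auto simp: ab north_double_def south_double_def left_through_def right_through_def)
    moreover have "ordered_line a [BL] (South r) = left_through i' r"
      "ordered_line b [BR] (South s) = right_through j' s"
      by (simp_all add: ordered_line_def left_through_def right_through_def ab)
    moreover have "{(South r, [BL, BR], South s), (a, [BL, BR], b)} = {north_double i' j', south_double r s}"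
      by (auto simp: north_double_def south_double_def ab)
    ultimately show ?thesis
      using res ab(3) ij(2) unfolding topologically_related_def product_diagram_eq product_factor_eq C_def[symmetric]
      by (intro disjI2 conjI exI[of _ C] exI[of _ i'] exI[of _ j'] exI[of _ r] exI[of _ s]) simp_all
  qed
qed

text \<open>
  The mirror image: the surgery takes place in the upper half, where the southern line is the one
  with its ends on the gluing line.
\<close>

lemma product_reconnect_left:
  assumes e: "e \<in> blob_diagrams m" and ij: "i < j" "r < s"
    and d: "R \<union> {north_double i j, south_double r s} \<in> blob_diagrams m"
    and d': "R \<union> {left_through i r, right_through j s} \<in> blob_diagrams m"
    and fresh: "north_double i j \<notin> R" "south_double r s \<notin> R" "left_through i r \<notin> R" "right_through j s \<notin> R"
    and turn_back: "\<And>a w b. (a, w, b) \<in> R \<Longrightarrow> vertex_half a = vertex_half b" and m: "m \<ge> 1"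
  shows "topologically_related
      (product_diagram (R \<union> {north_double i j, south_double r s}) e)
      (product_factor (R \<union> {north_double i j, south_double r s}) e)
      (product_diagram (R \<union> {left_through i r, right_through j s}) e)
      (product_factor (R \<union> {left_through i r, right_through j s}) e)"
proof -
  have "R \<union> {south_double r s, north_double i j} \<in> blob_diagrams m" using d by (simp add: insert_commute)
  from surgery_segments[OF e this d' m fresh(2,1,3,4) turn_back south_double_def north_double_def,
      where h = Upper and i = r and j = s]
  have sur: "surgery (segments (R \<union> {north_double i j, south_double r s}) e)
    (segments (R \<union> {left_through i r, right_through j s}) e) (segments R e) m Upper r s (North i) (North j)
    (Upper, Mid r, [BL, BR], Mid s) (Upper, outer_spot (North i), [BL, BR], outer_spot (North j))
    (Upper, Mid r, [BL], outer_spot (North i)) (Upper, Mid s, [BR], outer_spot (North j))"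
    by (simp add: left_through_def right_through_def insert_commute)
  from surgery.loop_or_line[OF sur] show ?thesis
  proof (elim disjE exE)
    fix W assume "surgery.loop_case (segments R e) (Upper, Mid r, [BL, BR], Mid s) W"
    from surgery_loop_case[OF sur this] show ?thesis
      unfolding topologically_related_def product_diagram_eq product_factor_eq by blast
  next
    fix a U V b assume "surgery.line_case (segments R e) (Upper, Mid r, [BL, BR], Mid s) a U V b"
    note res = surgery_line_case[OF sur this]
    obtain r' s' where ab: "a = South r'" "b = South s'" "r' < s'"
      using res by (cases a; cases b) auto
    define C where "C = reduce_line ` lines_of (segments R e)"
    have avoid: "line_ends l \<inter> {a, b, North i, North j} = {}" if "l \<in> C" for l using res that C_def by blast
    have "north_double i j \<notin> C" "south_double r' s' \<notin> C" "left_through i r' \<notin> C" "right_through j s' \<notin> C"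
      using avoid[of "north_double i j"] avoid[of "south_double r' s'"] avoid[of "left_through i r'"]
        avoid[of "right_through j s'"]
      by (auto simp: ab north_double_def south_double_def left_through_def right_through_def)
    moreover have "ordered_line a [BL] (North i) = left_through i r'"
      "ordered_line b [BR] (North j) = right_through j s'"
      by (simp_all add: ordered_line_def left_through_def right_through_def ab)
    moreover have "{(North i, [BL, BR], North j), (a, [BL, BR], b)} = {north_double i j, south_double r' s'}"
      by (auto simp: north_double_def south_double_def ab)
    ultimately show ?thesis
      using res ab(3) ij(1) unfolding topologically_related_def product_diagram_eq product_factor_eq C_def[symmetric]
      by (intro disjI2 conjI exI[of _ C] exI[of _ i] exI[of _ j] exI[of _ r'] exI[of _ s']) simp_all
  qed
qed

end

section \<open>Bases of quotients by submodules\<close>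

context module
begin

context
  fixes I assumes I: "submodule I R M"
begin

interpretation I: submodule I R M by (rule I)

lemma submodule_abelian_subgroup: "abelian_subgroup I M"
  by (intro abelian_subgroupI3 additive_subgroup.intro I.subgroup_axioms M.abelian_group_axioms)

interpretation Q: abelian_subgroup I M by (rule submodule_abelian_subgroup)

lemma quotient_simps:
  "carrier (quotient_algebra M I) = a_rcosets\<^bsub>M\<^esub> I"
  "\<zero>\<^bsub>quotient_algebra M I\<^esub> = I"
  "X \<oplus>\<^bsub>quotient_algebra M I\<^esub> Y = X <+>\<^bsub>M\<^esub> Y"
  "k \<odot>\<^bsub>quotient_algebra M I\<^esub> X = (\<Union>x\<in>X. I +>\<^bsub>M\<^esub> (k \<odot>\<^bsub>M\<^esub> x))"
  by (simp_all add: quotient_algebra_def ring.defs module.defs FactRing_def)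

lemma quotient_abelian_monoid: "abelian_monoid (quotient_algebra M I)"
proof -
  interpret G: comm_group "M A_Mod I" by (rule Q.a_factorgroup_is_comm_group)
  have simps: "carrier (M A_Mod I) = a_rcosets\<^bsub>M\<^esub> I" "\<one>\<^bsub>M A_Mod I\<^esub> = I"
    by (simp_all add: A_FactGroup_def FactGroup_def A_RCOSETS_def)
  show ?thesis
    using G.m_closed G.one_closed G.m_assoc G.l_one G.m_comm unfolding simps add_A_FactGroup
    by (intro abelian_monoidI; unfold quotient_simps)
qed

lemma coset_eq_iff:
  assumes "x \<in> carrier M" "y \<in> carrier M"
  shows "I +>\<^bsub>M\<^esub> x = I +>\<^bsub>M\<^esub> y \<longleftrightarrow> x \<ominus>\<^bsub>M\<^esub> y \<in> I"
proof
  assume "I +>\<^bsub>M\<^esub> x = I +>\<^bsub>M\<^esub> y"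
  then have "x \<in> I +>\<^bsub>M\<^esub> y" using Q.a_rcos_self[OF assms(1)] by simp
  then show "x \<ominus>\<^bsub>M\<^esub> y \<in> I" using Q.a_rcos_module_imp[OF assms(2)] by (simp add: a_minus_def)
next
  assume "x \<ominus>\<^bsub>M\<^esub> y \<in> I"
  then have "x \<in> I +>\<^bsub>M\<^esub> y" using Q.a_rcos_module_rev[OF assms(2,1)] by (simp add: a_minus_def)
  then show "I +>\<^bsub>M\<^esub> x = I +>\<^bsub>M\<^esub> y" using Q.a_repr_independence'[OF _ assms(2)] by simp
qed

lemma coset_in_quotient: "x \<in> carrier M \<Longrightarrow> I +>\<^bsub>M\<^esub> x \<in> carrier (quotient_algebra M I)"
  unfolding quotient_simps A_RCOSETS_def' by blast

lemma quotient_smult: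
  assumes "k \<in> carrier R" "x \<in> carrier M"
  shows "k \<odot>\<^bsub>quotient_algebra M I\<^esub> (I +>\<^bsub>M\<^esub> x) = I +>\<^bsub>M\<^esub> (k \<odot>\<^bsub>M\<^esub> x)"
proof -
  have "I +>\<^bsub>M\<^esub> (k \<odot>\<^bsub>M\<^esub> y) = I +>\<^bsub>M\<^esub> (k \<odot>\<^bsub>M\<^esub> x)" if y: "y \<in> I +>\<^bsub>M\<^esub> x" for y
  proof -
    have yc: "y \<in> carrier M" using Q.a_elemrcos_carrier[OF assms(2) y] .
    have "y \<ominus>\<^bsub>M\<^esub> x \<in> I" using Q.a_rcos_module_imp[OF assms(2) y] by (simp add: a_minus_def)
    then have "k \<odot>\<^bsub>M\<^esub> (y \<ominus>\<^bsub>M\<^esub> x) \<in> I" using assms(1) by simp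
    moreover have "k \<odot>\<^bsub>M\<^esub> (y \<ominus>\<^bsub>M\<^esub> x) = k \<odot>\<^bsub>M\<^esub> y \<ominus>\<^bsub>M\<^esub> k \<odot>\<^bsub>M\<^esub> x"
      using assms yc by (simp add: a_minus_def smult_r_distr smult_r_minus)
    ultimately show ?thesis using assms yc by (simp add: coset_eq_iff)
  qed
  moreover have "x \<in> I +>\<^bsub>M\<^esub> x" using Q.a_rcos_self[OF assms(2)] .
  ultimately show ?thesis unfolding quotient_simps by blast
qed

lemma quotient_finsum:
  assumes "finite F" "c \<in> F \<rightarrow> carrier R" "v \<in> F \<rightarrow> carrier M"
  shows "(\<Oplus>\<^bsub>quotient_algebra M I\<^esub>s\<in>F. c s \<odot>\<^bsub>quotient_algebra M I\<^esub> (I +>\<^bsub>M\<^esub> v s)) =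
    I +>\<^bsub>M\<^esub> (\<Oplus>\<^bsub>M\<^esub>s\<in>F. c s \<odot>\<^bsub>M\<^esub> v s)"
  using assms
proof (induction F rule: finite_induct)
  interpret QM: abelian_monoid "quotient_algebra M I" by (rule quotient_abelian_monoid)
  case empty
  then show ?case using Q.a_rcos_const[of "\<zero>\<^bsub>M\<^esub>"] by (simp add: QM.finsum_empty quotient_simps)
next
  interpret QM: abelian_monoid "quotient_algebra M I" by (rule quotient_abelian_monoid)
  case (insert s F)
  have c: "c s \<in> carrier R" "c \<in> F \<rightarrow> carrier R" and v: "v s \<in> carrier M" "v \<in> F \<rightarrow> carrier M"
    using insert.prems by auto
  have summand: "c t \<odot>\<^bsub>quotient_algebra M I\<^esub> (I +>\<^bsub>M\<^esub> v t) = I +>\<^bsub>M\<^esub> (c t \<odot>\<^bsub>M\<^esub> v t)" if "t \<in> insert s F" for t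
    using that insert.prems by (intro quotient_smult) auto
  have "(\<Oplus>\<^bsub>quotient_algebra M I\<^esub>t\<in>insert s F. c t \<odot>\<^bsub>quotient_algebra M I\<^esub> (I +>\<^bsub>M\<^esub> v t)) =
    c s \<odot>\<^bsub>quotient_algebra M I\<^esub> (I +>\<^bsub>M\<^esub> v s) \<oplus>\<^bsub>quotient_algebra M I\<^esub>
    (\<Oplus>\<^bsub>quotient_algebra M I\<^esub>t\<in>F. c t \<odot>\<^bsub>quotient_algebra M I\<^esub> (I +>\<^bsub>M\<^esub> v t))"
  proof (rule QM.finsum_insert[OF insert.hyps])
    have "I +>\<^bsub>M\<^esub> (c t \<odot>\<^bsub>M\<^esub> v t) \<in> carrier (quotient_algebra M I)" if "t \<in> insert s F" for t
      using that insert.prems by (intro coset_in_quotient smult_closed) auto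
    then show "(\<lambda>t. c t \<odot>\<^bsub>quotient_algebra M I\<^esub> (I +>\<^bsub>M\<^esub> v t)) \<in> F \<rightarrow> carrier (quotient_algebra M I)"
      "c s \<odot>\<^bsub>quotient_algebra M I\<^esub> (I +>\<^bsub>M\<^esub> v s) \<in> carrier (quotient_algebra M I)"
      using summand by auto
  qed
  also have "\<dots> = (I +>\<^bsub>M\<^esub> (c s \<odot>\<^bsub>M\<^esub> v s)) <+>\<^bsub>M\<^esub> (I +>\<^bsub>M\<^esub> (\<Oplus>\<^bsub>M\<^esub>t\<in>F. c t \<odot>\<^bsub>M\<^esub> v t))"
    using insert.IH[OF c(2) v(2)] summand[of s] by (simp add: quotient_simps(3))
  also have "\<dots> = I +>\<^bsub>M\<^esub> (c s \<odot>\<^bsub>M\<^esub> v s \<oplus>\<^bsub>M\<^esub> (\<Oplus>\<^bsub>M\<^esub>t\<in>F. c t \<odot>\<^bsub>M\<^esub> v t))"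
    using c v by (intro Q.a_rcos_sum M.finsum_closed) auto
  also have "c s \<odot>\<^bsub>M\<^esub> v s \<oplus>\<^bsub>M\<^esub> (\<Oplus>\<^bsub>M\<^esub>t\<in>F. c t \<odot>\<^bsub>M\<^esub> v t) = (\<Oplus>\<^bsub>M\<^esub>t\<in>insert s F. c t \<odot>\<^bsub>M\<^esub> v t)"
    using c v insert.hyps by (subst M.finsum_insert) auto
  finally show ?case .
qed

text \<open>
  Induction on \<open>F\<close>, replacing one vector \<open>v d\<close> at a time by a multiple of some \<open>v t\<close>.
\<close>

lemma combination_mod_submodule:
  assumes "finite T" "v \<in> B \<rightarrow> carrier M" "T \<subseteq> B"
    and reduce: "\<And>d. d \<in> B \<Longrightarrow> \<exists>t \<in> T. \<exists>k \<in> carrier R. v d \<ominus>\<^bsub>M\<^esub> k \<odot>\<^bsub>M\<^esub> v t \<in> I"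
    and F: "finite F" "F \<subseteq> B" "c \<in> F \<rightarrow> carrier R"
  shows "\<exists>e \<in> T \<rightarrow> carrier R. (\<Oplus>\<^bsub>M\<^esub>d\<in>F. c d \<odot>\<^bsub>M\<^esub> v d) \<ominus>\<^bsub>M\<^esub> (\<Oplus>\<^bsub>M\<^esub>t\<in>T. e t \<odot>\<^bsub>M\<^esub> v t) \<in> I"
  using F
proof (induction F rule: finite_induct)
  case empty
  have "v t \<in> carrier M" if "t \<in> T" for t using that assms(2,3) by auto
  then have "(\<Oplus>\<^bsub>M\<^esub>t\<in>T. \<zero> \<odot>\<^bsub>M\<^esub> v t) = (\<Oplus>\<^bsub>M\<^esub>t\<in>T. \<zero>\<^bsub>M\<^esub>)"
    by (intro M.finsum_cong') auto
  then have "(\<Oplus>\<^bsub>M\<^esub>t\<in>T. \<zero> \<odot>\<^bsub>M\<^esub> v t) = \<zero>\<^bsub>M\<^esub>" by simp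
  then show ?case by (intro bexI[of _ "\<lambda>_. \<zero>"]) (simp_all add: a_minus_def)
next
  case (insert d F)
  then obtain e where e: "e \<in> T \<rightarrow> carrier R"
    "(\<Oplus>\<^bsub>M\<^esub>d\<in>F. c d \<odot>\<^bsub>M\<^esub> v d) \<ominus>\<^bsub>M\<^esub> (\<Oplus>\<^bsub>M\<^esub>t\<in>T. e t \<odot>\<^bsub>M\<^esub> v t) \<in> I" by auto
  have d: "d \<in> B" "c d \<in> carrier R" "v d \<in> carrier M" using insert.prems assms(2) by auto
  obtain t k where t: "t \<in> T" "k \<in> carrier R" "v d \<ominus>\<^bsub>M\<^esub> k \<odot>\<^bsub>M\<^esub> v t \<in> I" using reduce d(1) by blast
  have vt: "v t \<in> carrier M" using t(1) assms(2,3) by auto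
  define g where "g s = (if t = s then c d \<otimes> k else \<zero>)" for s
  have g: "g \<in> T \<rightarrow> carrier R" using d t by (auto simp: g_def)
  have vT: "v s \<in> carrier M" if "s \<in> T" for s using that assms(2,3) by auto
  define X Y Z where "X = (\<Oplus>\<^bsub>M\<^esub>d\<in>F. c d \<odot>\<^bsub>M\<^esub> v d)" and "Y = (\<Oplus>\<^bsub>M\<^esub>t\<in>T. e t \<odot>\<^bsub>M\<^esub> v t)"
    and "Z = (c d \<otimes> k) \<odot>\<^bsub>M\<^esub> v t"
  have XYZ: "X \<in> carrier M" "Y \<in> carrier M" "Z \<in> carrier M"
    unfolding X_def Y_def Z_def using insert.prems assms(2) e(1) vT d t vt
    by (auto intro!: M.finsum_closed)
  have "(\<Oplus>\<^bsub>M\<^esub>s\<in>T. g s \<odot>\<^bsub>M\<^esub> v s) = (\<Oplus>\<^bsub>M\<^esub>s\<in>T. if t = s then (c d \<otimes> k) \<odot>\<^bsub>M\<^esub> v s else \<zero>\<^bsub>M\<^esub>)"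
    using vT d t by (intro M.finsum_cong') (auto simp: g_def)
  also have "\<dots> = Z"
    unfolding Z_def using vT d t assms(1) by (intro M.finsum_singleton) auto
  finally have gZ: "(\<Oplus>\<^bsub>M\<^esub>s\<in>T. g s \<odot>\<^bsub>M\<^esub> v s) = Z" .
  have "(\<Oplus>\<^bsub>M\<^esub>s\<in>T. (e s \<oplus> g s) \<odot>\<^bsub>M\<^esub> v s) = (\<Oplus>\<^bsub>M\<^esub>s\<in>T. e s \<odot>\<^bsub>M\<^esub> v s \<oplus>\<^bsub>M\<^esub> g s \<odot>\<^bsub>M\<^esub> v s)"
    using e(1) g vT by (intro M.finsum_cong') (auto simp: smult_l_distr Pi_def)
  also have "\<dots> = Y \<oplus>\<^bsub>M\<^esub> Z"
    unfolding gZ[symmetric] Y_def using e(1) g vT by (intro M.finsum_addf) auto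
  finally have new: "(\<Oplus>\<^bsub>M\<^esub>s\<in>T. (e s \<oplus> g s) \<odot>\<^bsub>M\<^esub> v s) = Y \<oplus>\<^bsub>M\<^esub> Z" .
  have "c d \<odot>\<^bsub>M\<^esub> (v d \<ominus>\<^bsub>M\<^esub> k \<odot>\<^bsub>M\<^esub> v t) \<in> I" using t(3) d(2) by simp
  moreover have "c d \<odot>\<^bsub>M\<^esub> (v d \<ominus>\<^bsub>M\<^esub> k \<odot>\<^bsub>M\<^esub> v t) = c d \<odot>\<^bsub>M\<^esub> v d \<ominus>\<^bsub>M\<^esub> Z"
    unfolding Z_def using d t vt by (simp add: a_minus_def smult_r_distr smult_r_minus smult_assoc1)
  ultimately have "(c d \<odot>\<^bsub>M\<^esub> v d \<ominus>\<^bsub>M\<^esub> Z) \<oplus>\<^bsub>M\<^esub> (X \<ominus>\<^bsub>M\<^esub> Y) \<in> I"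
    using e(2) unfolding X_def Y_def by simp
  moreover have "(c d \<odot>\<^bsub>M\<^esub> v d \<ominus>\<^bsub>M\<^esub> Z) \<oplus>\<^bsub>M\<^esub> (X \<ominus>\<^bsub>M\<^esub> Y) = (c d \<odot>\<^bsub>M\<^esub> v d \<oplus>\<^bsub>M\<^esub> X) \<ominus>\<^bsub>M\<^esub> (Y \<oplus>\<^bsub>M\<^esub> Z)"
    using XYZ d by (simp add: a_minus_def M.minus_add M.a_ac)
  moreover have "(\<Oplus>\<^bsub>M\<^esub>s\<in>insert d F. c s \<odot>\<^bsub>M\<^esub> v s) = c d \<odot>\<^bsub>M\<^esub> v d \<oplus>\<^bsub>M\<^esub> X"
    unfolding X_def using insert.prems insert.hyps assms(2) d by (intro M.finsum_insert) auto
  ultimately show ?case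
    using new e(1) g by (intro bexI[of _ "\<lambda>s. e s \<oplus> g s"]) auto
qed

text \<open>
  The classes span since every vector is congruent to a combination of the \<open>v t\<close>, and a relation
  between them is a combination of the \<open>v t\<close> that lies in the submodule.
\<close>

theorem quotient_module_basis:
  assumes "finite B" "T \<subseteq> B" "v \<in> B \<rightarrow> carrier M"
    and span: "\<And>x. x \<in> carrier M \<Longrightarrow> \<exists>c \<in> B \<rightarrow> carrier R. x = (\<Oplus>\<^bsub>M\<^esub>d\<in>B. c d \<odot>\<^bsub>M\<^esub> v d)"
    and reduce: "\<And>d. d \<in> B \<Longrightarrow> \<exists>t \<in> T. \<exists>k \<in> carrier R. v d \<ominus>\<^bsub>M\<^esub> k \<odot>\<^bsub>M\<^esub> v t \<in> I"
    and indep: "\<And>c. c \<in> T \<rightarrow> carrier R \<Longrightarrow> (\<Oplus>\<^bsub>M\<^esub>t\<in>T. c t \<odot>\<^bsub>M\<^esub> v t) \<in> I \<Longrightarrow> \<forall>t \<in> T. c t = \<zero>"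
  shows "module_basis R (quotient_algebra M I) T (\<lambda>t. I +>\<^bsub>M\<^esub> v t)"
  unfolding module_basis_def
proof (intro conjI ballI allI impI)
  have T: "finite T" using assms(1,2) finite_subset by blast
  have vT: "v s \<in> carrier M" if "s \<in> T" for s using that assms(2,3) by auto
  show "(\<lambda>t. I +>\<^bsub>M\<^esub> v t) \<in> T \<rightarrow> carrier (quotient_algebra M I)"
    using vT coset_in_quotient by auto
  fix X assume "X \<in> carrier (quotient_algebra M I)"
  then obtain x where x: "x \<in> carrier M" "X = I +>\<^bsub>M\<^esub> x"
    unfolding quotient_simps A_RCOSETS_def' by blast
  obtain c where c: "c \<in> B \<rightarrow> carrier R" "x = (\<Oplus>\<^bsub>M\<^esub>d\<in>B. c d \<odot>\<^bsub>M\<^esub> v d)" using span[OF x(1)] by blast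
  obtain e where e: "e \<in> T \<rightarrow> carrier R" "x \<ominus>\<^bsub>M\<^esub> (\<Oplus>\<^bsub>M\<^esub>t\<in>T. e t \<odot>\<^bsub>M\<^esub> v t) \<in> I"
    using combination_mod_submodule[OF T assms(3,2) reduce assms(1) subset_refl c(1)] c(2) by blast
  have "(\<Oplus>\<^bsub>M\<^esub>t\<in>T. e t \<odot>\<^bsub>M\<^esub> v t) \<in> carrier M" using e(1) vT by (intro M.finsum_closed) auto
  then have "X = I +>\<^bsub>M\<^esub> (\<Oplus>\<^bsub>M\<^esub>t\<in>T. e t \<odot>\<^bsub>M\<^esub> v t)" using e(2) x by (simp add: coset_eq_iff)
  then have "X = (\<Oplus>\<^bsub>quotient_algebra M I\<^esub>s\<in>T. e s \<odot>\<^bsub>quotient_algebra M I\<^esub> (I +>\<^bsub>M\<^esub> v s))"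
    using quotient_finsum[OF T e(1)] vT by auto
  then show "\<exists>F c. finite F \<and> F \<subseteq> T \<and> c \<in> F \<rightarrow> carrier R \<and>
      X = (\<Oplus>\<^bsub>quotient_algebra M I\<^esub>s\<in>F. c s \<odot>\<^bsub>quotient_algebra M I\<^esub> (I +>\<^bsub>M\<^esub> v s))"
    using T e(1) by blast
next
  have T: "finite T" using assms(1,2) finite_subset by blast
  have vT: "v s \<in> carrier M" if "s \<in> T" for s using that assms(2,3) by auto
  fix F c s
  assume F: "finite F \<and> F \<subseteq> T \<and> c \<in> F \<rightarrow> carrier R \<and>
      (\<Oplus>\<^bsub>quotient_algebra M I\<^esub>s\<in>F. c s \<odot>\<^bsub>quotient_algebra M I\<^esub> (I +>\<^bsub>M\<^esub> v s)) = \<zero>\<^bsub>quotient_algebra M I\<^esub>"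
    and s: "s \<in> F"
  have cF: "c t \<odot>\<^bsub>M\<^esub> v t \<in> carrier M" if "t \<in> F" for t
    using that F vT by (intro smult_closed) auto
  define e where "e t = (if t \<in> F then c t else \<zero>)" for t
  have e: "e \<in> T \<rightarrow> carrier R" using F by (auto simp: e_def)
  have sum: "(\<Oplus>\<^bsub>M\<^esub>t\<in>T. e t \<odot>\<^bsub>M\<^esub> v t) = (\<Oplus>\<^bsub>M\<^esub>t\<in>F. c t \<odot>\<^bsub>M\<^esub> v t)"
    by (rule M.add.finprod_mono_neutral_cong_right) (use F T vT cF in \<open>auto simp: e_def\<close>)
  have closed: "(\<Oplus>\<^bsub>M\<^esub>t\<in>F. c t \<odot>\<^bsub>M\<^esub> v t) \<in> carrier M"
    using cF by (intro M.finsum_closed) auto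
  have "I +>\<^bsub>M\<^esub> (\<Oplus>\<^bsub>M\<^esub>t\<in>F. c t \<odot>\<^bsub>M\<^esub> v t) = I"
    using quotient_finsum[of F c v] F vT by (auto simp: quotient_simps(2))
  then have "(\<Oplus>\<^bsub>M\<^esub>t\<in>F. c t \<odot>\<^bsub>M\<^esub> v t) \<in> I" using Q.a_rcos_self[OF closed] by simp
  then have "e s = \<zero>" using indep[OF e] sum F s by auto
  then show "c s = \<zero>" using s by (simp add: e_def)
qed

end

end

section \<open>Diagrams modulo the topological relations\<close>

lemma (in abelian_monoid) finsum_swap:
  assumes "finite A" "finite B" "\<And>a b. a \<in> A \<Longrightarrow> b \<in> B \<Longrightarrow> g a b \<in> carrier G"
  shows "(\<Oplus>a\<in>A. \<Oplus>b\<in>B. g a b) = (\<Oplus>b\<in>B. \<Oplus>a\<in>A. g a b)"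
  using assms(1,3)
proof (induction A rule: finite_induct)
  case (insert a A)
  have inner: "(\<lambda>a. \<Oplus>b\<in>B. g a b) \<in> A \<rightarrow> carrier G" "(\<Oplus>b\<in>B. g a b) \<in> carrier G"
    "(\<lambda>b. g a b) \<in> B \<rightarrow> carrier G" "(\<lambda>b. \<Oplus>a\<in>A. g a b) \<in> B \<rightarrow> carrier G"
    using insert.prems by (auto intro!: finsum_closed)
  have "(\<Oplus>b\<in>B. \<Oplus>a\<in>insert a A. g a b) = (\<Oplus>b\<in>B. g a b \<oplus> (\<Oplus>a\<in>A. g a b))"
  proof (rule finsum_cong')
    show "(\<Oplus>a\<in>insert a A. g a b) = g a b \<oplus> (\<Oplus>a\<in>A. g a b)" if "b \<in> B" for b
      using that insert.prems insert.hyps by (intro finsum_insert) auto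
  qed (use inner in auto)
  also have "\<dots> = (\<Oplus>b\<in>B. g a b) \<oplus> (\<Oplus>b\<in>B. \<Oplus>a\<in>A. g a b)"
    using inner by (intro finsum_addf)
  also have "(\<Oplus>b\<in>B. \<Oplus>a\<in>A. g a b) = (\<Oplus>a\<in>A. \<Oplus>b\<in>B. g a b)"
    using insert by simp
  finally show ?case using insert.hyps inner by simp
qed simp

lemma (in abelian_monoid) finsum_Times:
  assumes "finite A" "finite B" "\<And>a b. a \<in> A \<Longrightarrow> b \<in> B \<Longrightarrow> g (a, b) \<in> carrier G"
  shows "(\<Oplus>p\<in>A \<times> B. g p) = (\<Oplus>a\<in>A. \<Oplus>b\<in>B. g (a, b))"
  using assms(1,3)
proof (induction A rule: finite_induct)
  case (insert a A)
  have row: "(\<Oplus>p\<in>{a} \<times> B. g p) = (\<Oplus>b\<in>B. g (a, b))"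
  proof -
    have "{a} \<times> B = Pair a ` B" by auto
    then show ?thesis using insert.prems by (simp only:) (rule finsum_reindex; auto simp: inj_on_def)
  qed
  have "(\<Oplus>p\<in>insert a A \<times> B. g p) = (\<Oplus>p\<in>{a} \<times> B \<union> A \<times> B. g p)"
    by (rule arg_cong[of _ _ "\<lambda>X. finsum G g X"]) auto
  also have "\<dots> = (\<Oplus>p\<in>{a} \<times> B. g p) \<oplus> (\<Oplus>p\<in>A \<times> B. g p)"
    using insert.hyps insert.prems assms(2) by (intro finsum_Un_disjoint) auto
  also have "\<dots> = (\<Oplus>b\<in>B. g (a, b)) \<oplus> (\<Oplus>a\<in>A. \<Oplus>b\<in>B. g (a, b))"
    using row insert by simp
  also have "\<dots> = (\<Oplus>a\<in>insert a A. \<Oplus>b\<in>B. g (a, b))"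
    using insert.hyps insert.prems by (subst finsum_insert) (auto intro!: finsum_closed)
  finally show ?case .
qed simp

lemma finite_blob_diagrams: "finite (blob_diagrams m)"
proof (rule finite_subset)
  show "blob_diagrams m \<subseteq> Pow (vertices m \<times> line_words \<times> vertices m)"
  proof (intro subsetI PowI)
    fix d l assume d: "d \<in> blob_diagrams m" and l: "l \<in> d"
    obtain a w b where abw: "l = (a, w, b)" by (cases l)
    have "a \<in> vertices m \<and> b \<in> vertices m"
      using line_vertices[OF blob_diagram_pairs[OF d], of a w b] l abw by blast
    moreover have "w \<in> line_words" using d l abw unfolding blob_diagrams_def by force
    ultimately show "l \<in> vertices m \<times> line_words \<times> vertices m" using abw by blast
  qed
  show "finite (Pow (vertices m \<times> line_words \<times> vertices m))"
    by (simp add: vertices_def line_words_def)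
qed

lemma has_double_pair_iff:
  "has_double_pair d i j r s \<longleftrightarrow> i < j \<and> r < s \<and> north_double i j \<in> d \<and> south_double r s \<in> d"
  by (simp add: has_double_pair_def north_double_def south_double_def)

lemma reconnect_eq:
  "reconnect d i j r s = (d - {north_double i j, south_double r s}) \<union> {left_through i r, right_through j s}"
  by (simp add: reconnect_def north_double_def south_double_def left_through_def right_through_def)

lemma double_pair_turns_back:
  assumes "d \<in> blob_diagrams m" "has_double_pair d i j r s" "(a, w, b) \<in> d"
  shows "vertex_half a = vertex_half b"
  by (rule no_through_line_beside_double[OF assms(1) _ north_double_def[of i j] _ assms(3)])
    (use assms(2) in \<open>simp_all add: has_double_pair_iff\<close>)

text \<open>
  A line from north to south would cross the two doubly decorated lines.
\<close>

lemma double_pair_fresh: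
  assumes "d \<in> blob_diagrams m" "has_double_pair d i j r s"
  shows "left_through k l \<notin> d" "right_through k l \<notin> d"
  using double_pair_turns_back[OF assms, of "North k" "[BL]" "South l"]
    double_pair_turns_back[OF assms, of "North k" "[BR]" "South l"]
  by (auto simp: left_through_def right_through_def)

lemma double_pair_split:
  assumes "has_double_pair d i j r s"
  shows "(d - {north_double i j, south_double r s}) \<union> {north_double i j, south_double r s} = d"
  using assms by (auto simp: has_double_pair_iff)

lemma reconnect_blob_diagram:
  assumes "d \<in> blob_diagrams m" "has_double_pair d i j r s"
  shows "reconnect d i j r s \<in> symplectic_blob_diagrams m"
proof -
  let ?R = "d - {north_double i j, south_double r s}"
  have ij: "i < j" "r < s" using assms(2) by (simp_all add: has_double_pair_iff)
  have iff: "?R \<union> {north_double i j, south_double r s} \<in> blob_diagrams m \<longleftrightarrow>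
    ?R \<union> {left_through i r, right_through j s} \<in> blob_diagrams m"
  proof (rule reconnect_blob_diagram_iff[OF ij])
    show "left_through i r \<notin> ?R" "right_through j s \<notin> ?R" using double_pair_fresh[OF assms] by blast+
    show "vertex_half a = vertex_half b" if "(a, w, b) \<in> ?R" for a w b
      using double_pair_turns_back[OF assms] that by blast
  qed auto
  have in_B: "reconnect d i j r s \<in> blob_diagrams m"
    using iff assms(1) unfolding double_pair_split[OF assms(2)] reconnect_eq by blast
  moreover have "\<not> has_double_pair (reconnect d i j r s) i' j' r' s'" for i' j' r' s'
  proof
    assume "has_double_pair (reconnect d i j r s) i' j' r' s'"
    then have "left_through i r \<notin> reconnect d i j r s" by (rule double_pair_fresh[OF in_B])
    then show False by (simp add: reconnect_eq)
  qed
  ultimately show ?thesis by (simp add: symplectic_blob_diagrams_def)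
qed

lemma double_pair_unique:
  assumes d: "d \<in> blob_diagrams m" and p: "has_double_pair d i j r s" and p': "has_double_pair d i' j' r' s'"
  shows "i = i' \<and> j = j' \<and> r = r' \<and> s = s'"
proof -
  have "north_double i j = north_double i' j'"
    by (rule double_line_unique[OF d, of _ "North i" "North j" Upper _ "North i'" "North j'"])
      (use p p' in \<open>auto simp: has_double_pair_iff north_double_def\<close>)
  moreover have "south_double r s = south_double r' s'"
    by (rule double_line_unique[OF d, of _ "South r" "South s" Lower _ "South r'" "South s'"])
      (use p p' in \<open>auto simp: has_double_pair_iff south_double_def\<close>)
  ultimately show ?thesis by (simp add: north_double_def south_double_def)
qed

text \<open>
  The diagram $\bar d$ if a topological relation applies to \<open>d\<close>, and \<open>d\<close> itself otherwise; the
  reconnected pair is unique.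
\<close>

definition untangle :: "diagram \<Rightarrow> diagram" where
  "untangle d = (if \<exists>i j r s. has_double_pair d i j r s
     then THE d'. \<exists>i j r s. has_double_pair d i j r s \<and> d' = reconnect d i j r s else d)"

lemma untangle_double:
  assumes "d \<in> blob_diagrams m" "has_double_pair d i j r s"
  shows "untangle d = reconnect d i j r s"
proof -
  have "(THE d'. \<exists>i j r s. has_double_pair d i j r s \<and> d' = reconnect d i j r s) = reconnect d i j r s"
  proof (rule the_equality)
    show "\<exists>i' j' r' s'. has_double_pair d i' j' r' s' \<and> reconnect d i j r s = reconnect d i' j' r' s'"
      using assms(2) by blast
    fix d' assume "\<exists>i j r s. has_double_pair d i j r s \<and> d' = reconnect d i j r s"
    then obtain i' j' r' s' where "has_double_pair d i' j' r' s'" "d' = reconnect d i' j' r' s'" by blast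
    then show "d' = reconnect d i j r s" using double_pair_unique[OF assms(1,2)] by blast
  qed
  then show ?thesis using assms(2) unfolding untangle_def by auto
qed

lemma untangle_symplectic: "d \<in> symplectic_blob_diagrams m \<Longrightarrow> untangle d = d"
  by (simp add: symplectic_blob_diagrams_def untangle_def)

lemma untangle_in: "d \<in> blob_diagrams m \<Longrightarrow> untangle d \<in> symplectic_blob_diagrams m"
proof (cases "\<exists>i j r s. has_double_pair d i j r s")
  case True
  assume d: "d \<in> blob_diagrams m"
  obtain i j r s where "has_double_pair d i j r s" using True by blast
  then show ?thesis using untangle_double[OF d] reconnect_blob_diagram[OF d] by simp
next
  case False
  assume "d \<in> blob_diagrams m"
  then show ?thesis using False by (simp add: untangle_def symplectic_blob_diagrams_def)
qed

lemma symplectic_sub: "symplectic_blob_diagrams m \<subseteq> blob_diagrams m"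
  by (auto simp: symplectic_blob_diagrams_def)

context blob_parameters
begin

definition untangle_factor :: "diagram \<Rightarrow> 'a" where
  "untangle_factor d = (if \<exists>i j r s. has_double_pair d i j r s then \<kappa>LR else \<one>)"

text \<open>
  The coefficient at \<open>t\<close> of the class of \<open>d\<close>, expressed by diagrams of $B^x_m$.
\<close>

definition weight :: "diagram \<Rightarrow> diagram \<Rightarrow> 'a" where
  "weight t d = (if untangle d = t then untangle_factor d else \<zero>)"

lemma untangle_factor_closed [simp]: "untangle_factor d \<in> carrier K"
  by (simp add: untangle_factor_def)

lemma weight_closed [simp]: "weight t d \<in> carrier K"
  by (simp add: weight_def)

lemma weight_symplectic: "d \<in> symplectic_blob_diagrams m \<Longrightarrow> weight t d = (if d = t then \<one> else \<zero>)"
  by (auto simp: weight_def untangle_symplectic untangle_factor_def symplectic_blob_diagrams_def)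

lemma weight_untangle: "d \<in> blob_diagrams m \<Longrightarrow> weight t d = untangle_factor d \<otimes> weight t (untangle d)"
  using weight_symplectic[OF untangle_in, of d m t] by (simp add: weight_def)

text \<open>
  The coefficient at \<open>t\<close> of a product of two diagrams. The product in \<open>blob_algebra\<close> collects only those
  products that lie in $B^{x'}_m$.
\<close>

definition product_weight :: "nat \<Rightarrow> diagram \<Rightarrow> diagram \<Rightarrow> diagram \<Rightarrow> 'a" where
  "product_weight m t d\<^sub>1 d\<^sub>2 =
     (if product_diagram d\<^sub>1 d\<^sub>2 \<in> blob_diagrams m
      then weight t (product_diagram d\<^sub>1 d\<^sub>2) \<otimes> product_factor d\<^sub>1 d\<^sub>2 else \<zero>)"

lemma product_weight_closed:
  "d\<^sub>1 \<in> blob_diagrams m \<Longrightarrow> d\<^sub>2 \<in> blob_diagrams m \<Longrightarrow> m \<ge> 1 \<Longrightarrow> product_weight m t d\<^sub>1 d\<^sub>2 \<in> carrier K"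
  by (simp add: product_weight_def product_factor_closed)

text \<open>
  In the second case of \<open>topologically_related\<close> both diagrams are in $B^{x'}_m$ or neither of them is,
  by \<open>reconnect_blob_diagram_iff\<close>.
\<close>

lemma related_weight:
  assumes rel: "topologically_related P c P' c'" and c: "c \<in> carrier K" "c' \<in> carrier K"
  shows "(if P \<in> blob_diagrams m then weight t P \<otimes> c else \<zero>) =
    \<kappa>LR \<otimes> (if P' \<in> blob_diagrams m then weight t P' \<otimes> c' else \<zero>)"
  using rel unfolding topologically_related_def
proof (elim disjE conjE exE)
  assume "P = P'" "c = \<kappa>LR \<otimes> c'"
  then show ?thesis using c by (simp add: m_ac)
next
  fix R i j r s
  assume "c = c'" and ij: "i < j" "r < s" and P: "P = R \<union> {north_double i j, south_double r s}"
    and P': "P' = R \<union> {left_through i r, right_through j s}"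
    and fresh: "north_double i j \<notin> R" "south_double r s \<notin> R" "left_through i r \<notin> R" "right_through j s \<notin> R"
    and turn_back: "\<forall>(a, w, b) \<in> R. vertex_half a = vertex_half b"
  have iff: "P \<in> blob_diagrams m \<longleftrightarrow> P' \<in> blob_diagrams m"
    unfolding P P' by (rule reconnect_blob_diagram_iff[OF ij fresh]) (use turn_back in blast)
  show ?thesis
  proof (cases "P \<in> blob_diagrams m")
    case True
    have pair: "has_double_pair P i j r s" using ij by (simp add: has_double_pair_iff P)
    have rec: "reconnect P i j r s = P'" unfolding reconnect_eq P P' using fresh by blast
    have "weight t P = \<kappa>LR \<otimes> weight t P'"
      using weight_untangle[OF True, of t] untangle_double[OF True pair] pair rec
      by (auto simp: untangle_factor_def)
    then show ?thesis using True iff c \<open>c = c'\<close> by (simp add: m_assoc)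
  next
    case False
    then show ?thesis using iff by simp
  qed
qed

text \<open>
  This is what makes the common kernel of the coordinates an ideal. The geometry is in
  \<open>product_reconnect_right\<close> and \<open>product_reconnect_left\<close>.
\<close>

lemma product_weight_untangle:
  assumes e: "e \<in> blob_diagrams m" and d: "d \<in> blob_diagrams m" and m: "m \<ge> 1"
  shows "product_weight m t e d = untangle_factor d \<otimes> product_weight m t e (untangle d)"
    "product_weight m t d e = untangle_factor d \<otimes> product_weight m t (untangle d) e"
proof -
  have "product_weight m t e d = untangle_factor d \<otimes> product_weight m t e (untangle d) \<and>
    product_weight m t d e = untangle_factor d \<otimes> product_weight m t (untangle d) e"
  proof (cases "\<exists>i j r s. has_double_pair d i j r s")
    case False
    then show ?thesis using product_weight_closed e d m by (simp add: untangle_def untangle_factor_def)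
  next
    case True
    then obtain i j r s where pair: "has_double_pair d i j r s" by blast
    let ?R = "d - {north_double i j, south_double r s}"
    have u: "untangle d = ?R \<union> {left_through i r, right_through j s}"
      using untangle_double[OF d pair] by (simp only: reconnect_eq)
    have ud: "untangle d \<in> blob_diagrams m" using untangle_in[OF d] symplectic_sub by blast
    have ij: "i < j" "r < s" using pair by (simp_all add: has_double_pair_iff)
    have fresh: "north_double i j \<notin> ?R" "south_double r s \<notin> ?R"
      "left_through i r \<notin> ?R" "right_through j s \<notin> ?R"
      using double_pair_fresh[OF d pair] by auto
    have turn_back: "vertex_half a = vertex_half b" if "(a, w, b) \<in> ?R" for a w b
      using double_pair_turns_back[OF d pair] that by blast
    note split = double_pair_split[OF pair]
    have factor: "untangle_factor d = \<kappa>LR" using True by (simp add: untangle_factor_def)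
    have "topologically_related (product_diagram e d) (product_factor e d)
        (product_diagram e (untangle d)) (product_factor e (untangle d))"
      using product_reconnect_right[OF e ij _ _ fresh _ m] turn_back d ud unfolding u split by presburger
    moreover have "topologically_related (product_diagram d e) (product_factor d e)
        (product_diagram (untangle d) e) (product_factor (untangle d) e)"
      using product_reconnect_left[OF e ij _ _ fresh _ m] turn_back d ud unfolding u split by presburger
    ultimately show ?thesis
      unfolding product_weight_def factor
      using related_weight product_factor_closed e d ud m by blast
  qed
  then show "product_weight m t e d = untangle_factor d \<otimes> product_weight m t e (untangle d)"
    "product_weight m t d e = untangle_factor d \<otimes> product_weight m t (untangle d) e" by blast+
qed

lemma blob_algebra_simps:
  "carrier (blob_algebra m) = blob_diagrams m \<rightarrow>\<^sub>E carrier K"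
  "\<zero>\<^bsub>blob_algebra m\<^esub> = (\<lambda>d \<in> blob_diagrams m. \<zero>)"
  "f \<oplus>\<^bsub>blob_algebra m\<^esub> g = (\<lambda>d \<in> blob_diagrams m. f d \<oplus> g d)"
  "k \<odot>\<^bsub>blob_algebra m\<^esub> f = (\<lambda>d \<in> blob_diagrams m. k \<otimes> f d)"
  "f \<otimes>\<^bsub>blob_algebra m\<^esub> g = (\<lambda>d \<in> blob_diagrams m.
        \<Oplus>p\<in>{(d\<^sub>1, d\<^sub>2) \<in> blob_diagrams m \<times> blob_diagrams m. product_diagram d\<^sub>1 d\<^sub>2 = d}.
          f (fst p) \<otimes> g (snd p) \<otimes> product_factor (fst p) (snd p))"
  by (simp_all add: blob_algebra_def)

lemma blob_algebra_coeff [simp]: "f \<in> carrier (blob_algebra m) \<Longrightarrow> d \<in> blob_diagrams m \<Longrightarrow> f d \<in> carrier K"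
  by (auto simp: blob_algebra_simps)

lemma blob_algebra_ext:
  "f \<in> carrier (blob_algebra m) \<Longrightarrow> g \<in> carrier (blob_algebra m) \<Longrightarrow>
    (\<And>d. d \<in> blob_diagrams m \<Longrightarrow> f d = g d) \<Longrightarrow> f = g"
  unfolding blob_algebra_simps by (rule PiE_ext)

lemma blob_algebra_module: "module K (blob_algebra m)"
proof (rule moduleI)
  show "cring K" by (rule is_cring)
  show "abelian_group (blob_algebra m)"
  proof (rule abelian_groupI)
    fix f assume f: "f \<in> carrier (blob_algebra m)"
    show "\<exists>g \<in> carrier (blob_algebra m). g \<oplus>\<^bsub>blob_algebra m\<^esub> f = \<zero>\<^bsub>blob_algebra m\<^esub>"
      using f by (intro bexI[of _ "\<lambda>d \<in> blob_diagrams m. \<ominus> f d"])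
        (auto simp: blob_algebra_simps l_neg intro!: restrict_ext)
    show "\<zero>\<^bsub>blob_algebra m\<^esub> \<oplus>\<^bsub>blob_algebra m\<^esub> f = f"
      using f by (intro blob_algebra_ext[OF _ f]) (auto simp: blob_algebra_simps)
  qed (auto simp: blob_algebra_simps a_ac PiE_iff intro!: restrict_ext)
  fix f assume f: "f \<in> carrier (blob_algebra m)"
  show "\<one> \<odot>\<^bsub>blob_algebra m\<^esub> f = f"
    using f by (intro blob_algebra_ext[OF _ f]) (auto simp: blob_algebra_simps)
qed (auto simp: blob_algebra_simps PiE_iff l_distr r_distr m_assoc intro!: restrict_ext)

end

section \<open>The coordinates of the quotient\<close>

context blob_parameters
begin

text \<open>
  The linear functional with the values \<open>W\<close> on the diagrams.
\<close>

definition extension :: "nat \<Rightarrow> (diagram \<Rightarrow> 'a) \<Rightarrow> (diagram \<Rightarrow> 'a) \<Rightarrow> 'a" where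
  "extension m W f = (\<Oplus>d\<in>blob_diagrams m. W d \<otimes> f d)"

lemma extension_closed:
  "W \<in> blob_diagrams m \<rightarrow> carrier K \<Longrightarrow> f \<in> carrier (blob_algebra m) \<Longrightarrow> extension m W f \<in> carrier K"
  unfolding extension_def by (intro finsum_closed) (auto simp: Pi_iff)

lemma extension_zero: "W \<in> blob_diagrams m \<rightarrow> carrier K \<Longrightarrow> extension m W \<zero>\<^bsub>blob_algebra m\<^esub> = \<zero>"
  unfolding extension_def blob_algebra_simps
  by (subst finsum_cong'[of _ _ "\<lambda>_. \<zero>"]) (auto simp: Pi_iff)

lemma extension_add:
  assumes "W \<in> blob_diagrams m \<rightarrow> carrier K" "f \<in> carrier (blob_algebra m)" "g \<in> carrier (blob_algebra m)"
  shows "extension m W (f \<oplus>\<^bsub>blob_algebra m\<^esub> g) = extension m W f \<oplus> extension m W g"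
proof -
  have W: "W d \<in> carrier K" if "d \<in> blob_diagrams m" for d using that assms(1) by blast
  have "extension m W (f \<oplus>\<^bsub>blob_algebra m\<^esub> g) = (\<Oplus>d\<in>blob_diagrams m. W d \<otimes> f d \<oplus> W d \<otimes> g d)"
    unfolding extension_def blob_algebra_simps using W assms(2,3)
    by (intro finsum_cong') (auto simp: r_distr)
  also have "\<dots> = extension m W f \<oplus> extension m W g"
    unfolding extension_def using W assms(2,3) by (intro finsum_addf) auto
  finally show ?thesis .
qed

lemma extension_smult:
  assumes "W \<in> blob_diagrams m \<rightarrow> carrier K" "f \<in> carrier (blob_algebra m)" "k \<in> carrier K"
  shows "extension m W (k \<odot>\<^bsub>blob_algebra m\<^esub> f) = k \<otimes> extension m W f"
proof -
  have W: "W d \<in> carrier K" if "d \<in> blob_diagrams m" for d using that assms(1) by blast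
  have "extension m W (k \<odot>\<^bsub>blob_algebra m\<^esub> f) = (\<Oplus>d\<in>blob_diagrams m. k \<otimes> (W d \<otimes> f d))"
    unfolding extension_def blob_algebra_simps using W assms(2,3)
    by (intro finsum_cong') (auto simp: m_lcomm)
  also have "\<dots> = k \<otimes> extension m W f"
    unfolding extension_def using W assms(2,3) finite_blob_diagrams
    by (intro finsum_rdistr[symmetric]) auto
  finally show ?thesis .
qed

lemma extension_finsum:
  assumes "finite F" "W \<in> blob_diagrams m \<rightarrow> carrier K" "\<phi> \<in> F \<rightarrow> carrier (blob_algebra m)"
  shows "extension m W (\<Oplus>\<^bsub>blob_algebra m\<^esub>s\<in>F. \<phi> s) = (\<Oplus>s\<in>F. extension m W (\<phi> s))"
proof -
  interpret A: module K "blob_algebra m" by (rule blob_algebra_module)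
  show ?thesis using assms(1,3)
  proof (induction F rule: finite_induct)
    case empty
    then show ?case using extension_zero[OF assms(2)] by simp
  next
    case (insert s F)
    have \<phi>: "\<phi> s \<in> carrier (blob_algebra m)" "\<phi> \<in> F \<rightarrow> carrier (blob_algebra m)"
      using insert.prems by auto
    have "extension m W (\<Oplus>\<^bsub>blob_algebra m\<^esub>s\<in>insert s F. \<phi> s) =
      extension m W (\<phi> s) \<oplus> extension m W (\<Oplus>\<^bsub>blob_algebra m\<^esub>s\<in>F. \<phi> s)"
      using insert.hyps \<phi> by (simp add: extension_add[OF assms(2)])
    then show ?case
      using insert.IH[OF \<phi>(2)] insert.hyps insert.prems
      by (subst finsum_insert) (auto intro!: extension_closed[OF assms(2)])
  qed
qed

lemma diagram_vector_closed: "diagram_vector m d \<in> carrier (blob_algebra m)"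
  by (auto simp: diagram_vector_def blob_algebra_simps)

lemma extension_diagram_vector:
  assumes "W \<in> blob_diagrams m \<rightarrow> carrier K" "d \<in> blob_diagrams m"
  shows "extension m W (diagram_vector m d) = W d"
proof -
  have "extension m W (diagram_vector m d) = (\<Oplus>e\<in>blob_diagrams m. if d = e then W e else \<zero>)"
    unfolding extension_def using assms by (intro finsum_cong') (auto simp: diagram_vector_def Pi_iff)
  also have "\<dots> = W d" using assms finite_blob_diagrams by (intro finsum_singleton) auto
  finally show ?thesis .
qed

lemma extension_combination:
  assumes "T \<subseteq> blob_diagrams m" "c \<in> T \<rightarrow> carrier K" "W \<in> blob_diagrams m \<rightarrow> carrier K"
  shows "extension m W (\<Oplus>\<^bsub>blob_algebra m\<^esub>t\<in>T. c t \<odot>\<^bsub>blob_algebra m\<^esub> diagram_vector m t) = (\<Oplus>t\<in>T. c t \<otimes> W t)"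
proof -
  interpret A: module K "blob_algebra m" by (rule blob_algebra_module)
  have cW: "c t \<in> carrier K \<and> W t \<in> carrier K" if "t \<in> T" for t using that assms by blast
  have "finite T" using assms(1) finite_blob_diagrams finite_subset by blast
  then have "extension m W (\<Oplus>\<^bsub>blob_algebra m\<^esub>t\<in>T. c t \<odot>\<^bsub>blob_algebra m\<^esub> diagram_vector m t) =
    (\<Oplus>t\<in>T. extension m W (c t \<odot>\<^bsub>blob_algebra m\<^esub> diagram_vector m t))"
    using assms(2,3) diagram_vector_closed by (intro extension_finsum) auto
  also have "\<dots> = (\<Oplus>t\<in>T. c t \<otimes> W t)"
  proof (rule finsum_cong')
    fix t assume "t \<in> T"
    then show "extension m W (c t \<odot>\<^bsub>blob_algebra m\<^esub> diagram_vector m t) = c t \<otimes> W t"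
      using extension_smult[OF assms(3) diagram_vector_closed, of "c t" t]
        extension_diagram_vector[OF assms(3), of t] cW[of t] assms(1) by auto
  qed (use cW in auto)
  finally show ?thesis .
qed

lemma diagram_vectors_span:
  assumes f: "f \<in> carrier (blob_algebra m)"
  shows "f = (\<Oplus>\<^bsub>blob_algebra m\<^esub>d\<in>blob_diagrams m. f d \<odot>\<^bsub>blob_algebra m\<^esub> diagram_vector m d)"
    (is "f = ?g")
proof -
  interpret A: module K "blob_algebra m" by (rule blob_algebra_module)
  have g: "?g \<in> carrier (blob_algebra m)"
    using f diagram_vector_closed by (intro A.M.finsum_closed) auto
  have entry: "extension m (\<lambda>d. if e = d then \<one> else \<zero>) h = h e"
    if "h \<in> carrier (blob_algebra m)" "e \<in> blob_diagrams m" for h e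
  proof -
    have "extension m (\<lambda>d. if e = d then \<one> else \<zero>) h = (\<Oplus>d\<in>blob_diagrams m. if e = d then h d else \<zero>)"
      unfolding extension_def using that by (intro finsum_cong') auto
    also have "\<dots> = h e" using that finite_blob_diagrams by (intro finsum_singleton) auto
    finally show ?thesis .
  qed
  show ?thesis
  proof (rule blob_algebra_ext[OF f g])
    fix e assume e: "e \<in> blob_diagrams m"
    have "?g e = (\<Oplus>d\<in>blob_diagrams m. f d \<otimes> (if e = d then \<one> else \<zero>))"
      unfolding entry[OF g e, symmetric] using f
      by (intro extension_combination) auto
    also have "\<dots> = (\<Oplus>d\<in>blob_diagrams m. if e = d then f d else \<zero>)"
      using f by (intro finsum_cong') auto
    also have "\<dots> = f e" using f e finite_blob_diagrams by (intro finsum_singleton) auto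
    finally show "f e = ?g e" by simp
  qed
qed

lemma blob_product_closed:
  assumes "f \<in> carrier (blob_algebra m)" "g \<in> carrier (blob_algebra m)" "m \<ge> 1"
  shows "f \<otimes>\<^bsub>blob_algebra m\<^esub> g \<in> carrier (blob_algebra m)"
  unfolding blob_algebra_simps(1,5) using assms product_factor_closed
  by (auto intro!: finsum_closed)

lemma extension_product:
  assumes f: "f \<in> carrier (blob_algebra m)" and g: "g \<in> carrier (blob_algebra m)" and m: "m \<ge> 1"
  shows "extension m (weight t) (f \<otimes>\<^bsub>blob_algebra m\<^esub> g) =
    (\<Oplus>d\<^sub>1\<in>blob_diagrams m. \<Oplus>d\<^sub>2\<in>blob_diagrams m. (f d\<^sub>1 \<otimes> g d\<^sub>2) \<otimes> product_weight m t d\<^sub>1 d\<^sub>2)"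
proof -
  let ?B = "blob_diagrams m"
  define P where "P p = product_diagram (fst p) (snd p)" for p
  define h where "h p = f (fst p) \<otimes> g (snd p) \<otimes> product_factor (fst p) (snd p)" for p
  have h: "h p \<in> carrier K" if "p \<in> ?B \<times> ?B" for p
    using that f g product_factor_closed[OF _ _ m] by (auto simp: h_def)
  have fin: "finite ?B" "finite (?B \<times> ?B)" using finite_blob_diagrams by auto
  have fibre: "{(d\<^sub>1, d\<^sub>2) \<in> ?B \<times> ?B. product_diagram d\<^sub>1 d\<^sub>2 = d} = {p \<in> ?B \<times> ?B. P p = d}" for d
    by (auto simp: P_def)
  have "extension m (weight t) (f \<otimes>\<^bsub>blob_algebra m\<^esub> g) =
    (\<Oplus>d\<in>?B. \<Oplus>p\<in>?B \<times> ?B. if P p = d then weight t d \<otimes> h p else \<zero>)"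
    unfolding extension_def
  proof (rule finsum_cong')
    fix d assume d: "d \<in> ?B"
    have "(f \<otimes>\<^bsub>blob_algebra m\<^esub> g) d = (\<Oplus>p\<in>{p \<in> ?B \<times> ?B. P p = d}. h p)"
      using d by (simp only: blob_algebra_simps restrict_apply' fibre h_def)
    then have "weight t d \<otimes> (f \<otimes>\<^bsub>blob_algebra m\<^esub> g) d = (\<Oplus>p\<in>{p \<in> ?B \<times> ?B. P p = d}. weight t d \<otimes> h p)"
      using fin h by (simp only:) (intro finsum_rdistr; auto)
    also have "\<dots> = (\<Oplus>p\<in>?B \<times> ?B. if P p = d then weight t d \<otimes> h p else \<zero>)"
      by (rule add.finprod_mono_neutral_cong_left) (use fin h in auto)
    finally show "weight t d \<otimes> (f \<otimes>\<^bsub>blob_algebra m\<^esub> g) d = \<dots>" .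
  qed (use h in \<open>auto intro!: finsum_closed\<close>)
  also have "\<dots> = (\<Oplus>p\<in>?B \<times> ?B. \<Oplus>d\<in>?B. if P p = d then weight t d \<otimes> h p else \<zero>)"
    using fin h by (intro finsum_swap) auto
  also have "\<dots> = (\<Oplus>p\<in>?B \<times> ?B. (f (fst p) \<otimes> g (snd p)) \<otimes> product_weight m t (fst p) (snd p))"
  proof (rule finsum_cong')
    fix p assume p: "p \<in> ?B \<times> ?B"
    have closed: "f (fst p) \<in> carrier K" "g (snd p) \<in> carrier K" "product_factor (fst p) (snd p) \<in> carrier K"
      using p f g product_factor_closed[OF _ _ m] by auto
    show "(\<Oplus>d\<in>?B. if P p = d then weight t d \<otimes> h p else \<zero>) =
      (f (fst p) \<otimes> g (snd p)) \<otimes> product_weight m t (fst p) (snd p)"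
    proof (cases "P p \<in> ?B")
      case True
      have "(\<Oplus>d\<in>?B. if P p = d then weight t d \<otimes> h p else \<zero>) = weight t (P p) \<otimes> h p"
        using True fin h[OF p] by (intro finsum_singleton) auto
      then show ?thesis using True closed by (simp add: product_weight_def h_def P_def m_ac)
    next
      case False
      have "(\<Oplus>d\<in>?B. if P p = d then weight t d \<otimes> h p else \<zero>) = (\<Oplus>d\<in>?B. \<zero>)"
        using False by (intro finsum_cong') auto
      then show ?thesis using False closed by (simp add: product_weight_def P_def)
    qed
  qed (use f g product_weight_closed[OF _ _ m] in auto)
  also have "\<dots> = (\<Oplus>d\<^sub>1\<in>?B. \<Oplus>d\<^sub>2\<in>?B. (f d\<^sub>1 \<otimes> g d\<^sub>2) \<otimes> product_weight m t d\<^sub>1 d\<^sub>2)"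
    using fin f g product_weight_closed[OF _ _ m] by (subst finsum_Times) auto
  finally show ?thesis .
qed

text \<open>
  The coordinate functionals are \<open>extension m (weight t)\<close> for \<open>t\<close> in $B^x_m$.
\<close>

definition coordinate_kernel :: "nat \<Rightarrow> (diagram \<Rightarrow> 'a) set" where
  "coordinate_kernel m = {f \<in> carrier (blob_algebra m).
     \<forall>t \<in> symplectic_blob_diagrams m. extension m (weight t) f = \<zero>}"

text \<open>
  A functional that respects the topological relations is a combination of the coordinate functionals,
  with the coefficients \<open>W t\<close>.
\<close>

lemma extension_coordinate_kernel:
  assumes g: "g \<in> coordinate_kernel m" and W: "W \<in> blob_diagrams m \<rightarrow> carrier K"
    and untangle: "\<And>d. d \<in> blob_diagrams m \<Longrightarrow> W d = untangle_factor d \<otimes> W (untangle d)"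
  shows "extension m W g = \<zero>"
proof -
  let ?B = "blob_diagrams m" and ?T = "symplectic_blob_diagrams m"
  have T: "finite ?T" using finite_blob_diagrams symplectic_sub finite_subset by blast
  have Wc: "W d \<in> carrier K" if "d \<in> ?B" for d using that W by blast
  have WT: "W t \<in> carrier K" if "t \<in> ?T" for t using that Wc symplectic_sub by blast
  have gc: "g d \<in> carrier K" if "d \<in> ?B" for d using that g blob_algebra_coeff[of g m d] by (simp add: coordinate_kernel_def)
  have "extension m W g = (\<Oplus>d\<in>?B. \<Oplus>t\<in>?T. W t \<otimes> (weight t d \<otimes> g d))"
    unfolding extension_def
  proof (rule finsum_cong')
    fix d assume d: "d \<in> ?B"
    have "(\<Oplus>t\<in>?T. W t \<otimes> (weight t d \<otimes> g d)) =
      (\<Oplus>t\<in>?T. if untangle d = t then W t \<otimes> (untangle_factor d \<otimes> g d) else \<zero>)"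
      using WT gc[OF d] by (intro finsum_cong') (auto simp: weight_def)
    also have "\<dots> = W (untangle d) \<otimes> (untangle_factor d \<otimes> g d)"
      using WT gc[OF d] T untangle_in[OF d] by (intro finsum_singleton) auto
    also have "\<dots> = untangle_factor d \<otimes> W (untangle d) \<otimes> g d"
      using WT[OF untangle_in[OF d]] gc[OF d] by (simp add: m_ac)
    finally show "W d \<otimes> g d = (\<Oplus>t\<in>?T. W t \<otimes> (weight t d \<otimes> g d))"
      using untangle[OF d] by simp
  qed (use WT gc in \<open>auto intro!: finsum_closed\<close>)
  also have "\<dots> = (\<Oplus>t\<in>?T. \<Oplus>d\<in>?B. W t \<otimes> (weight t d \<otimes> g d))"
    using WT gc T finite_blob_diagrams by (intro finsum_swap) auto
  also have "\<dots> = (\<Oplus>t\<in>?T. \<zero>)"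
  proof (rule finsum_cong')
    fix t assume t: "t \<in> ?T"
    have "(\<Oplus>d\<in>?B. W t \<otimes> (weight t d \<otimes> g d)) = W t \<otimes> extension m (weight t) g"
      unfolding extension_def using WT[OF t] gc finite_blob_diagrams
      by (intro finsum_rdistr[symmetric]) auto
    then show "(\<Oplus>d\<in>?B. W t \<otimes> (weight t d \<otimes> g d)) = \<zero>"
      using g t WT[OF t] by (simp add: coordinate_kernel_def)
  qed auto
  finally show ?thesis by simp
qed

text \<open>
  For fixed \<open>d\<^sub>1\<close> the coefficient of a product \<open>d\<^sub>1 d\<^sub>2\<close> respects the topological relations as a function
  of \<open>d\<^sub>2\<close>, so the functional that it defines vanishes on \<open>g\<close>; the same holds with the factors exchanged.
\<close>

lemma coordinate_kernel_absorbs: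
  assumes f: "f \<in> carrier (blob_algebra m)" and g: "g \<in> coordinate_kernel m" and m: "m \<ge> 1"
  shows "f \<otimes>\<^bsub>blob_algebra m\<^esub> g \<in> coordinate_kernel m" "g \<otimes>\<^bsub>blob_algebra m\<^esub> f \<in> coordinate_kernel m"
proof -
  let ?B = "blob_diagrams m"
  have gA: "g \<in> carrier (blob_algebra m)" using g by (simp add: coordinate_kernel_def)
  note pw = product_weight_closed[OF _ _ m] and B = finite_blob_diagrams[of m]
  have "extension m (weight t) (f \<otimes>\<^bsub>blob_algebra m\<^esub> g) = \<zero>" for t
  proof -
    have "(\<Oplus>d\<^sub>2\<in>?B. (f d\<^sub>1 \<otimes> g d\<^sub>2) \<otimes> product_weight m t d\<^sub>1 d\<^sub>2) = \<zero>" if d1: "d\<^sub>1 \<in> ?B" for d\<^sub>1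
    proof -
      have "(\<Oplus>d\<^sub>2\<in>?B. (f d\<^sub>1 \<otimes> g d\<^sub>2) \<otimes> product_weight m t d\<^sub>1 d\<^sub>2) =
        (\<Oplus>d\<^sub>2\<in>?B. f d\<^sub>1 \<otimes> (product_weight m t d\<^sub>1 d\<^sub>2 \<otimes> g d\<^sub>2))"
        using f gA pw d1 by (intro finsum_cong') (auto simp: m_ac)
      also have "\<dots> = f d\<^sub>1 \<otimes> extension m (product_weight m t d\<^sub>1) g"
        unfolding extension_def using f gA pw d1 B by (intro finsum_rdistr[symmetric]) auto
      also have "extension m (product_weight m t d\<^sub>1) g = \<zero>"
        using extension_coordinate_kernel[OF g] pw[OF d1] product_weight_untangle(1)[OF d1 _ m] by blast
      finally show ?thesis using f d1 by simp
    qed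
    then have "(\<Oplus>d\<^sub>1\<in>?B. \<Oplus>d\<^sub>2\<in>?B. (f d\<^sub>1 \<otimes> g d\<^sub>2) \<otimes> product_weight m t d\<^sub>1 d\<^sub>2) = (\<Oplus>d\<^sub>1\<in>?B. \<zero>)"
      by (intro finsum_cong') auto
    then show ?thesis using extension_product[OF f gA m] by simp
  qed
  then show "f \<otimes>\<^bsub>blob_algebra m\<^esub> g \<in> coordinate_kernel m"
    using blob_product_closed[OF f gA m] by (simp add: coordinate_kernel_def)
  have "extension m (weight t) (g \<otimes>\<^bsub>blob_algebra m\<^esub> f) = \<zero>" for t
  proof -
    have "(\<Oplus>d\<^sub>1\<in>?B. (g d\<^sub>1 \<otimes> f d\<^sub>2) \<otimes> product_weight m t d\<^sub>1 d\<^sub>2) = \<zero>" if d2: "d\<^sub>2 \<in> ?B" for d\<^sub>2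
    proof -
      have "(\<Oplus>d\<^sub>1\<in>?B. (g d\<^sub>1 \<otimes> f d\<^sub>2) \<otimes> product_weight m t d\<^sub>1 d\<^sub>2) =
        (\<Oplus>d\<^sub>1\<in>?B. f d\<^sub>2 \<otimes> (product_weight m t d\<^sub>1 d\<^sub>2 \<otimes> g d\<^sub>1))"
        using f gA pw d2 by (intro finsum_cong') (auto simp: m_ac)
      also have "\<dots> = f d\<^sub>2 \<otimes> extension m (\<lambda>d\<^sub>1. product_weight m t d\<^sub>1 d\<^sub>2) g"
        unfolding extension_def using f gA pw d2 B by (intro finsum_rdistr[symmetric]) auto
      also have "extension m (\<lambda>d\<^sub>1. product_weight m t d\<^sub>1 d\<^sub>2) g = \<zero>"
        by (rule extension_coordinate_kernel[OF g _ product_weight_untangle(2)[OF d2 _ m]])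
          (use pw d2 in auto)
      finally show ?thesis using f d2 by simp
    qed
    then have "(\<Oplus>d\<^sub>2\<in>?B. \<Oplus>d\<^sub>1\<in>?B. (g d\<^sub>1 \<otimes> f d\<^sub>2) \<otimes> product_weight m t d\<^sub>1 d\<^sub>2) = (\<Oplus>d\<^sub>2\<in>?B. \<zero>)"
      by (intro finsum_cong') auto
    moreover have "(\<Oplus>d\<^sub>1\<in>?B. \<Oplus>d\<^sub>2\<in>?B. (g d\<^sub>1 \<otimes> f d\<^sub>2) \<otimes> product_weight m t d\<^sub>1 d\<^sub>2) =
      (\<Oplus>d\<^sub>2\<in>?B. \<Oplus>d\<^sub>1\<in>?B. (g d\<^sub>1 \<otimes> f d\<^sub>2) \<otimes> product_weight m t d\<^sub>1 d\<^sub>2)"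
      using f gA pw B by (intro finsum_swap) auto
    ultimately show ?thesis using extension_product[OF gA f m] by simp
  qed
  then show "g \<otimes>\<^bsub>blob_algebra m\<^esub> f \<in> coordinate_kernel m"
    using blob_product_closed[OF gA f m] by (simp add: coordinate_kernel_def)
qed

lemma coordinate_kernel_submodule: "submodule (coordinate_kernel m) K (blob_algebra m)"
proof -
  interpret A: module K "blob_algebra m" by (rule blob_algebra_module)
  have W: "weight t \<in> blob_diagrams m \<rightarrow> carrier K" for t by simp
  have smult: "k \<odot>\<^bsub>blob_algebra m\<^esub> f \<in> coordinate_kernel m"
    if "k \<in> carrier K" "f \<in> coordinate_kernel m" for k f
    using that extension_smult[OF W, of f k] by (simp add: coordinate_kernel_def)
  show ?thesis
  proof (rule A.submoduleI)
    show "coordinate_kernel m \<subseteq> carrier (blob_algebra m)" by (auto simp: coordinate_kernel_def)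
    show "\<zero>\<^bsub>blob_algebra m\<^esub> \<in> coordinate_kernel m" by (simp add: coordinate_kernel_def extension_zero)
    show "f \<oplus>\<^bsub>blob_algebra m\<^esub> g \<in> coordinate_kernel m"
      if "f \<in> coordinate_kernel m" "g \<in> coordinate_kernel m" for f g
      using that by (simp add: coordinate_kernel_def extension_add)
    fix f assume f: "f \<in> coordinate_kernel m"
    then have "\<ominus>\<^bsub>blob_algebra m\<^esub> f = (\<ominus> \<one>) \<odot>\<^bsub>blob_algebra m\<^esub> f"
      by (simp add: coordinate_kernel_def A.smult_l_minus)
    then show "\<ominus>\<^bsub>blob_algebra m\<^esub> f \<in> coordinate_kernel m" using smult[OF _ f] by simp
  qed (rule smult)
qed

lemma relators_in_coordinate_kernel: "topological_relators m \<subseteq> coordinate_kernel m"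
proof
  interpret A: module K "blob_algebra m" by (rule blob_algebra_module)
  have W: "weight t \<in> blob_diagrams m \<rightarrow> carrier K" for t by simp
  fix x assume "x \<in> topological_relators m"
  then obtain d i j r s where d: "d \<in> blob_diagrams m" and pair: "has_double_pair d i j r s"
    and x: "x = diagram_vector m d \<ominus>\<^bsub>blob_algebra m\<^esub>
        (\<kappa>LR \<odot>\<^bsub>blob_algebra m\<^esub> diagram_vector m (reconnect d i j r s))"
    unfolding topological_relators_def by blast
  let ?u = "untangle d"
  have u: "reconnect d i j r s = ?u" and factor: "untangle_factor d = \<kappa>LR"
    using untangle_double[OF d pair] pair by (auto simp: untangle_factor_def)
  have uB: "?u \<in> blob_diagrams m" using untangle_in[OF d] symplectic_sub by blast
  have x': "x = diagram_vector m d \<oplus>\<^bsub>blob_algebra m\<^esub>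
        ((\<ominus> \<kappa>LR) \<odot>\<^bsub>blob_algebra m\<^esub> diagram_vector m ?u)"
    unfolding x u using diagram_vector_closed by (simp add: a_minus_def A.smult_l_minus)
  have "extension m (weight t) x = weight t d \<oplus> (\<ominus> \<kappa>LR) \<otimes> weight t ?u" for t
    unfolding x' using diagram_vector_closed
    by (simp add: extension_add[OF W] extension_smult[OF W] extension_diagram_vector[OF W] d uB)
  then have "extension m (weight t) x = \<zero>" for t
    using weight_untangle[OF d, of t] factor by (simp add: l_minus r_neg)
  moreover have "x \<in> carrier (blob_algebra m)" unfolding x' using diagram_vector_closed by simp
  ultimately show "x \<in> coordinate_kernel m" by (simp add: coordinate_kernel_def)
qed

text \<open>
  The kernel is one of the ideals of which \<open>topological_ideal\<close> is the intersection.
\<close>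

lemma topological_ideal_le_kernel: "m \<ge> 1 \<Longrightarrow> topological_ideal m \<subseteq> coordinate_kernel m"
  unfolding topological_ideal_def algebra_ideal_def
  using coordinate_kernel_submodule relators_in_coordinate_kernel coordinate_kernel_absorbs
  by (intro Inter_lower) blast

theorem symplectic_diagrams_basis:
  assumes m: "m \<ge> 1"
  shows "module_basis K (symplectic_blob_algebra m) (symplectic_blob_diagrams m) (diagram_class m)"
proof -
  interpret A: module K "blob_algebra m" by (rule blob_algebra_module)
  let ?B = "blob_diagrams m" and ?T = "symplectic_blob_diagrams m" and ?I = "topological_ideal m"
  have zero: "\<zero>\<^bsub>blob_algebra m\<^esub> \<in> H" if "submodule H K (blob_algebra m)" for H
    using subgroup.one_closed[OF submodule.axioms(1)[OF that]] by simp
  have I: "submodule ?I K (blob_algebra m)"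
    unfolding topological_ideal_def algebra_ideal_def
  proof (rule A.submoduleI, goal_cases)
    case 1
    show ?case
      using topological_ideal_le_kernel[OF m]
      by (auto simp: topological_ideal_def algebra_ideal_def coordinate_kernel_def)
  next
    case 2
    show ?case by (intro InterI) (auto dest: zero)
  qed (auto dest: A.submoduleE(3,5) intro: submodule.smult_closed)
  have relators: "topological_relators m \<subseteq> ?I"
    unfolding topological_ideal_def algebra_ideal_def by blast
  have "module_basis K (quotient_algebra (blob_algebra m) ?I) ?T (\<lambda>t. ?I +>\<^bsub>blob_algebra m\<^esub> diagram_vector m t)"
  proof (rule A.quotient_module_basis[OF I finite_blob_diagrams symplectic_sub])
    show "diagram_vector m \<in> ?B \<rightarrow> carrier (blob_algebra m)" using diagram_vector_closed by blast
    show "\<exists>c \<in> ?B \<rightarrow> carrier K. f = (\<Oplus>\<^bsub>blob_algebra m\<^esub>d\<in>?B. c d \<odot>\<^bsub>blob_algebra m\<^esub> diagram_vector m d)"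
      if "f \<in> carrier (blob_algebra m)" for f
      using diagram_vectors_span[OF that] blob_algebra_coeff[OF that] by blast
    show "\<exists>t \<in> ?T. \<exists>k \<in> carrier K. diagram_vector m d \<ominus>\<^bsub>blob_algebra m\<^esub> k \<odot>\<^bsub>blob_algebra m\<^esub> diagram_vector m t \<in> ?I"
      if d: "d \<in> ?B" for d
    proof (intro bexI)
      show "diagram_vector m d \<ominus>\<^bsub>blob_algebra m\<^esub> untangle_factor d \<odot>\<^bsub>blob_algebra m\<^esub> diagram_vector m (untangle d) \<in> ?I"
      proof (cases "\<exists>i j r s. has_double_pair d i j r s")
        case True
        then obtain i j r s where pair: "has_double_pair d i j r s" by blast
        have "diagram_vector m d \<ominus>\<^bsub>blob_algebra m\<^esub> \<kappa>LR \<odot>\<^bsub>blob_algebra m\<^esub> diagram_vector m (reconnect d i j r s)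
            \<in> topological_relators m"
          unfolding topological_relators_def using d pair by blast
        then show ?thesis
          using relators untangle_double[OF d pair] True by (simp add: untangle_factor_def subset_iff)
      next
        case False
        then have "untangle d = d" "untangle_factor d = \<one>" by (simp_all add: untangle_def untangle_factor_def)
        then show ?thesis
          using diagram_vector_closed zero[OF I] by (simp add: a_minus_def A.M.r_neg)
      qed
    qed (use untangle_in[OF d] in simp_all)
    show "\<forall>t \<in> ?T. c t = \<zero>"
      if c: "c \<in> ?T \<rightarrow> carrier K"
        and sum: "(\<Oplus>\<^bsub>blob_algebra m\<^esub>t\<in>?T. c t \<odot>\<^bsub>blob_algebra m\<^esub> diagram_vector m t) \<in> ?I" for c
    proof
      fix s assume s: "s \<in> ?T"
      have "\<zero> = extension m (weight s) (\<Oplus>\<^bsub>blob_algebra m\<^esub>t\<in>?T. c t \<odot>\<^bsub>blob_algebra m\<^esub> diagram_vector m t)"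
        using topological_ideal_le_kernel[OF m] sum s by (auto simp: coordinate_kernel_def)
      also have "\<dots> = (\<Oplus>t\<in>?T. c t \<otimes> weight s t)"
        using c symplectic_sub by (intro extension_combination) auto
      also have "\<dots> = (\<Oplus>t\<in>?T. if s = t then c t else \<zero>)"
        using c by (intro finsum_cong') (auto simp: weight_symplectic Pi_iff)
      also have "\<dots> = c s"
        using c s finite_subset[OF symplectic_sub finite_blob_diagrams] by (intro finsum_singleton) auto
      finally show "c s = \<zero>" by simp
    qed
  qed
  then show ?thesis by (simp add: symplectic_blob_algebra_def diagram_class_def[abs_def])
qed

end

section \<open>The basis theorem\<close>

theorem proposition6p5p3:
  fixes K :: "('k, 'b) ring_scheme" (structure)
    and \<delta> \<delta>L \<delta>R \<kappa>L \<kappa>R \<kappa>LR :: 'k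
    and m :: nat
  assumes "cring K"
    and "\<delta> \<in> carrier K" and "\<delta>L \<in> carrier K" and "\<delta>R \<in> carrier K"
    and "\<kappa>L \<in> carrier K" and "\<kappa>R \<in> carrier K" and "\<kappa>LR \<in> carrier K"
    and "m \<ge> 1"
  shows "module_basis K
    (blob_parameters.symplectic_blob_algebra K \<delta> \<delta>L \<delta>R \<kappa>L \<kappa>R \<kappa>LR m)
    (symplectic_blob_diagrams m)
    (blob_parameters.diagram_class K \<delta> \<delta>L \<delta>R \<kappa>L \<kappa>R \<kappa>LR m)"
proof -
  interpret blob_parameters K \<delta> \<delta>L \<delta>R \<kappa>L \<kappa>R \<kappa>LR
    using assms by (intro blob_parameters.intro blob_parameters_axioms.intro)
  show ?thesis using symplectic_diagrams_basis[OF \<open>m \<ge> 1\<close>] .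
qed

end
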